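(* Let $(H,r)$ be a coquasitriangular Hopf algebra over a field $\Bbbk$, let $G$ be an abelian group, let $\pi:H\to\Bbbk G$ be a surjective cocentral Hopf algebra map, and let $(\gamma,\lambda,\omega,t)$ be a braided $G$-zesting datum for $(H,r)$. Then the coquasi-Hopf algebra $H^\lambda$ determined by $(\gamma,\lambda,\omega)$ is also braided coquasitriangular. Its universal $r$-form $r^\lambda$ is obtained by twisting $r$ with the cochain $t$; explicitly, $$r^\lambda(x,y)=t(g_1,g_2)\,r(x,y)\qquad\text{for }x\in H^\lambda_{g_1},\ y\in H^\lambda_{g_2}.$$ Consequently, the category of left $H^\lambda$-comodules, with the braiding induced by $r^\lambda$, is braided tensor equivalent to the (braided) zested category obtained from ${}^H\mathcal M$.
   Context: Sweedler notation is used; $G(C)$ denotes the set of group-like elements of $C$; ${}^H\mathcal M$ is the category of left $H$-comodules, with coaction $x\mapsto x_{(-1)}\otimes x_{(0)}$. **Gradings.** A Hopf algebra map $\pi:H\to\Bbbk G$ is cocentral if $h_{(1)}\otimes\pi(h_{(2)})=h_{(2)}\otimes\pi(h_{(1)})$ for all $h$. Put $H_s=\{h\in H:(\pi\otimes\mathrm{id})\Delta(h)=s\otimes h\}$, so $H=\bigoplus_{s\in G}H_s$; $H^{\mathrm{co}\,\pi}=H_e$; $H^\lambda_s$ is $H_s$ viewed in $H^\lambda$. A comodule $X$ has degree $s$ if $\pi(x_{(-1)})\otimes x_{(0)}=s\otimes x$ for all $x\in X$; every comodule is the direct sum of its homogeneous components. **Coquasi-bialgebra.** A coalgebra with coalgebra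 maps $m:H\otimes H\to H$ and $u:\Bbbk\to H$ and a convolution invertible $\Omega\in(H^{\otimes3})^*$ such that: $(h_{(1)}k_{(1)})l_{(1)}\Omega(h_{(2)},k_{(2)},l_{(2)})=\Omega(h_{(1)},k_{(1)},l_{(1)})h_{(2)}(k_{(2)}l_{(2)})$; $1h=h1=h$; $\Omega(h_{(1)}k_{(1)},l_{(1)},t_{(1)})\Omega(h_{(2)},k_{(2)},l_{(2)}t_{(2)})=\Omega(h_{(1)},k_{(1)},l_{(1)})\Omega(h_{(2)},k_{(2)}l_{(2)},t_{(1)})\Omega(k_{(3)},l_{(3)},t_{(2)})$; $\Omega(h,1,k)=\varepsilon(h)\varepsilon(k)$. It is a coquasi-Hopf algebra if there are a linear map $S:H\to H$ and $\alpha,\beta\in H^*$ with $S(h_{(1)})\alpha(h_{(2)})h_{(3)}=\alpha(h)1$, $h_{(1)}\beta(h_{(2)})S(h_{(3)})=\beta(h)1$, and $\Omega(h_{(1)}\beta(h_{(2)}),S(h_{(3)}),\alpha(h_{(4)})h_{(5)})=\Omega^{-1}(S(h_{(1)}),\alpha(h_{(2)})h_{(3)}\beta(h_{(4)}),S(h_{(5)}))=\varepsilon(h)$. Its left comodules form a monoidal category with coaction $x\otimes y\mapsto x_{(-1)}y_{(-1)}\otimes x_{(0)}\otimes y_{(0)}$ and associator $x\otimes y\otimes z\mapsto\Omega(x_{(-1)},y_{(-1)},z_{(-1)})x_{(0)}\otimes y_{(0)}\otimes z_{(0)}$. **Coquasitriangular coquasi-bialgebra.** A coquasi-bialgebra with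 a convolution invertible $r:H\otimes H\to\Bbbk$ (an $r$-form) such that, for all $h,k,l$: (i) $r(h_{(1)},k_{(1)})h_{(2)}k_{(2)}=k_{(1)}h_{(1)}r(h_{(2)},k_{(2)})$; (ii) $r(h_{(1)},k_{(1)}l_{(1)})\Omega^{-1}(h_{(2)},k_{(2)},l_{(2)})=\Omega(k_{(1)},l_{(1)},h_{(1)})r(h_{(2)},l_{(2)})\Omega^{-1}(k_{(2)},h_{(3)},l_{(3)})r(h_{(4)},k_{(3)})$; (iii) $r(h_{(1)}k_{(1)},l_{(1)})\Omega(h_{(2)},k_{(2)},l_{(2)})=\Omega^{-1}(l_{(1)},k_{(1)},h_{(1)})r(h_{(2)},l_{(2)})\Omega(h_{(3)},l_{(3)},k_{(2)})r(k_{(3)},l_{(4)})$. The braiding induced by $r$ on left comodules is $c_{X,Y}(x\otimes y)=r(x_{(-1)},y_{(-1)})\,y_{(0)}\otimes x_{(0)}$. **Coquasitriangular Hopf algebra.** For a Hopf algebra $H$, being coquasitriangular means that ${}^H\mathcal M$ is braided. The paper describes this as the existence of a convolution-invertible universal $r$-form $r:H\otimes H\to\Bbbk$ or, equivalently, of a Hopf algebra map $f:H\to(H^\circ)^{\mathrm{cop}}$ ($H^\circ$ the finite dual, cop the co-opposite coproduct) with $\langle f(k_{(1)}),h_{(1)}\rangle\,k_{(2)}h_{(2)}=h_{(1)}k_{(1)}\langle f(k_{(2)}),h_{(2)}\rangle$ for all $h,k\in H$; the two are related by $r(h,k)=\langle f(k),h\rangle$. The braiding on ${}^H\mathcal M$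 is $c_{X,Y}(x\otimes y)=r(x_{(-1)},y_{(-1)})\,y_{(0)}\otimes x_{(0)}$. Write $r^{-1}$ for the convolution inverse of $r$, and $f':H\to(H^\circ)^{\mathrm{cop}}$ for the map with $\langle f'(k),h\rangle=r^{-1}(k,h)$. **Character-inducing.** $g\in G(H)$ is $\pi$-character-inducing if there is a group character $\chi_g:G\to\Bbbk^*$ such that $r(x_{(1)},g)r(g,x_{(2)})=\chi_g(s)\varepsilon(x)$ for all $s\in G$ and $x\in H_s$. **Associative $G$-zesting datum.** Let $\Gamma_0\le G(H^{\mathrm{co}\,\pi})$ be a subgroup, and let $\mathrm{Alg}(H,\Bbbk)$ be the group of algebra maps $H\to\Bbbk$ under convolution. The datum $(\gamma,\lambda,\omega)$ consists of a group homomorphism $\gamma:\Gamma_0\to\mathrm{Alg}(H,\Bbbk)$ with $\langle\gamma(g),h_{(1)}\rangle\,g h_{(2)}g^{-1}=h_{(1)}\langle\gamma(g),h_{(2)}\rangle$ for all $g\in\Gamma_0$, $h\in H$; a normalized 2-cocycle $\lambda:G\times G\to\Gamma_0$ (trivial action); and a normalized 3-cochain $\omega:G^3\to\Bbbk^*$ (value $1$ if some argument is $e$) with $\langle\gamma(\lambda(g_1,g_2)),\lambda(g_3,g_4)\rangle=\frac{\omega(g_1,g_2,g_3)\omega(g_1,g_2g_3,g_4)\omega(g_2,g_3,g_4)}{\omega(g_1g_2,g_3,g_4)\omega(g_1,g_2,g_3g_4)}$ for all $g_1,\dots,g_4\in G$. The coquasi-Hopf algebra $H^\lambda$ is the coalgebra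 $H$ with unit $1_H$, multiplication $h\otimes k\mapsto hk\,\lambda(g_1,g_2)$ and associator $\Omega(h,k,l)=\varepsilon(hk)\omega(g_1,g_2,g_3)\langle\gamma(\lambda(g_1,g_2)),l\rangle$ for $h\in H_{g_1}$, $k\in H_{g_2}$, $l\in H_{g_3}$. **Braided $G$-zesting datum** ($G$ abelian): $(\gamma,\lambda,\omega,t)$, where $(\gamma,\lambda,\omega)$ is an associative $G$-zesting datum with $f'|_{G(H^{\mathrm{co}\,\pi})}=\gamma$, every $\lambda(g_1,g_2)$ is $\pi$-character-inducing, $\lambda(g_1,g_2)=\lambda(g_2,g_1)$ for all $g_1,g_2\in G$, and $t:G\times G\to\Bbbk^*$ is a 2-cochain such that for all $g_1,g_2,g_3\in G$ $$\frac{\omega(g_1,g_2,g_3)\omega(g_2,g_3,g_1)}{\omega(g_2,g_1,g_3)}=\frac{t(g_1,g_2)t(g_1,g_3)}{t(g_1,g_2g_3)},$$ $$r(\lambda(g_1,g_2),g_3)\,r(g_3,\lambda(g_1,g_2))=\frac{\omega(g_1,g_2,g_3)\omega(g_3,g_1,g_2)}{\omega(g_1,g_3,g_2)}\cdot\frac{t(g_1,g_3)t(g_2,g_3)}{t(g_1g_2,g_3)},$$ where the left side of the last equation denotes the scalar $\chi_{\lambda(g_1,g_2)}(g_3)$ given by the character-inducing property. **Braided zested category.** ${}^H\mathcal M$ with, for $X,Y,Z$ of degrees $g_1,g_2,g_3$, tensor product $X\otimes^\lambda Y=X\otimes Y\otimes\Bbbk\lambda(g_1,g_2)$, where $\Bbbk\lambda(g_1,g_2)$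 is the one-dimensional comodule of the group-like $\lambda(g_1,g_2)$. The associator first moves $\Bbbk\lambda(g_1,g_2)$ past $Z$ by the half-braiding $\lambda(g_1,g_2)\otimes z\mapsto\langle\gamma(\lambda(g_1,g_2)),z_{(-1)}\rangle z_{(0)}\otimes\lambda(g_1,g_2)$ and then applies the isomorphism $\Bbbk\lambda(g_1,g_2)\otimes\Bbbk\lambda(g_1g_2,g_3)\to\Bbbk\lambda(g_2,g_3)\otimes\Bbbk\lambda(g_1,g_2g_3)$ sending basis element to $\omega(g_1,g_2,g_3)$ times basis element. The braiding is $c_{X,Y}\otimes t(g_1,g_2):X\otimes^\lambda Y\to Y\otimes^\lambda X$.
   Formalization: Conventions made consistent for left comodules: r-form axioms (i)-(iii) are the hexagons of c=r(x,y)y⊗x; γ satisfies <γ(g),h2>gh1g^{-1}=<γ(g),h1>h2; γ(g)=r^{-1}(-,g) instead of r^{-1}(g,-); Ω and Ω^{-1} are exchanged in the antipode identities. *)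

theory Defs
  imports Complex_Main "HOL-Library.Poly_Mapping" "HOL-Library.Function_Algebras"
begin

section \<open>Tensor products over a field\<close>

text \<open>
  A vector space over \<open>'k\<close> is a type with an explicit scalar multiplication, as in
  \<^theory>\<open>HOL.Vector_Spaces\<close>. The tensor \<open>a \<otimes> b\<close> is the functional
  \<open>\<beta> \<mapsto> \<beta> a b\<close> on bilinear forms, and \<open>A \<otimes> B\<close> is the span of these
  functionals for \<open>a \<in> A\<close>, \<open>b \<in> B\<close>. Over a field this is a tensor product: see
  \<open>tensor_universal\<close> and \<open>sweedler_eq\<close>; and for subspaces \<open>A\<close>, \<open>B\<close> the map
  \<open>A \<otimes> B \<rightarrow> V \<otimes> W\<close> is injective.
\<close>

type_synonym ('a, 'b, 'k) tensor = "('a \<Rightarrow> 'b \<Rightarrow> 'k) \<Rightarrow> 'k"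

definition tscale :: "'k::field \<Rightarrow> ('x \<Rightarrow> 'k) \<Rightarrow> 'x \<Rightarrow> 'k"
  where "tscale c f = (\<lambda>x. c * f x)"

definition bilin ::
  "('k::field \<Rightarrow> 'a::ab_group_add \<Rightarrow> 'a) \<Rightarrow> ('k \<Rightarrow> 'b::ab_group_add \<Rightarrow> 'b) \<Rightarrow>
   ('k \<Rightarrow> 'c::ab_group_add \<Rightarrow> 'c) \<Rightarrow> ('a \<Rightarrow> 'b \<Rightarrow> 'c) \<Rightarrow> bool"
  where "bilin s1 s2 s3 F \<longleftrightarrow>
    (\<forall>a. Vector_Spaces.linear s2 s3 (F a)) \<and> (\<forall>b. Vector_Spaces.linear s1 s3 (\<lambda>a. F a b))"

definition tens ::
  "('k::field \<Rightarrow> 'a::ab_group_add \<Rightarrow> 'a) \<Rightarrow> ('k \<Rightarrow> 'b::ab_group_add \<Rightarrow> 'b) \<Rightarrow>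
   'a \<Rightarrow> 'b \<Rightarrow> ('a, 'b, 'k) tensor"
  where "tens s1 s2 a b = (\<lambda>\<beta>. if bilin s1 s2 (*) \<beta> then \<beta> a b else 0)"

definition tspace ::
  "('k::field \<Rightarrow> 'a::ab_group_add \<Rightarrow> 'a) \<Rightarrow> ('k \<Rightarrow> 'b::ab_group_add \<Rightarrow> 'b) \<Rightarrow>
   'a set \<Rightarrow> 'b set \<Rightarrow> ('a, 'b, 'k) tensor set"
  where "tspace s1 s2 A B = module.span tscale {tens s1 s2 a b | a b. a \<in> A \<and> b \<in> B}"

text \<open>
  \<open>sweedler s1 s2 A B T F\<close> is \<open>\<Sum> F(T\<^sub>1, T\<^sub>2)\<close> where \<open>T = \<Sum> T\<^sub>1 \<otimes> T\<^sub>2\<close> with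
  \<open>T\<^sub>1 \<in> A\<close> and \<open>T\<^sub>2 \<in> B\<close>. It is independent of the chosen representation whenever
  \<open>F\<close> is bilinear on \<open>A \<times> B\<close>, which is the case in all uses below.
\<close>

definition sweedler ::
  "('k::field \<Rightarrow> 'a::ab_group_add \<Rightarrow> 'a) \<Rightarrow> ('k \<Rightarrow> 'b::ab_group_add \<Rightarrow> 'b) \<Rightarrow>
   'a set \<Rightarrow> 'b set \<Rightarrow> ('a, 'b, 'k) tensor \<Rightarrow> ('a \<Rightarrow> 'b \<Rightarrow> 'u::ab_group_add) \<Rightarrow> 'u"
  where "sweedler s1 s2 A B T F =
    (\<Sum>(a, b) \<leftarrow> (SOME L. set L \<subseteq> A \<times> B \<and> T = (\<Sum>(a, b) \<leftarrow> L. tens s1 s2 a b)). F a b)"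

lemma sum_list_fun_apply:
  "(\<Sum>x\<leftarrow>L. f x) y = (\<Sum>x\<leftarrow>L. f x y)" for f :: "'x \<Rightarrow> 'y \<Rightarrow> 'k::ab_group_add"
  by (induction L) auto

lemma linear_sum_list:
  assumes "Vector_Spaces.linear s1 s2 f"
  shows "f (\<Sum>x\<leftarrow>L. g x) = (\<Sum>x\<leftarrow>L. f (g x))"
proof -
  interpret Vector_Spaces.linear s1 s2 f by fact
  show ?thesis by (induction L) (auto simp: add zero)
qed

lemma tensor_universal:
  assumes F: "bilin s1 s2 s3 F"
    and eq: "(\<Sum>(a, b)\<leftarrow>L. tens s1 s2 a b) = (\<Sum>(a, b)\<leftarrow>L'. tens s1 s2 a b)"
  shows "(\<Sum>(a, b)\<leftarrow>L. F a b) = (\<Sum>(a, b)\<leftarrow>L'. F a b)"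
proof (rule ccontr)
  let ?S = "\<lambda>L. \<Sum>(a, b)\<leftarrow>L. F a b"
  assume ne: "?S L \<noteq> ?S L'"
  have vs3: "vector_space s3"
    using F by (auto simp: bilin_def Vector_Spaces.linear_def)
  have vsk: "vector_space ((*) :: 'a \<Rightarrow> 'a \<Rightarrow> 'a)"
    by unfold_locales (auto simp: algebra_simps)
  interpret V: vector_space_pair s3 "(*) :: 'a \<Rightarrow> 'a \<Rightarrow> 'a"
    using vs3 vsk by (simp add: vector_space_pair_def)
  have "\<not> V.vs1.dependent {?S L - ?S L'}"
    using ne by (simp add: V.vs1.dependent_single)
  then obtain \<phi> where lin: "Vector_Spaces.linear s3 (*) \<phi>" and one: "\<phi> (?S L - ?S L') = 1"
    using V.linear_independent_extend[of "{?S L - ?S L'}" "\<lambda>_. 1"] by auto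
  have b: "bilin s1 s2 (*) (\<lambda>a b. \<phi> (F a b))"
  proof -
    have "Vector_Spaces.linear s2 (*) (\<lambda>b. \<phi> (F a b))" for a
      using Vector_Spaces.linear_compose[of s2 s3 "F a" "(*)" \<phi>] F lin
      by (simp add: bilin_def o_def)
    moreover have "Vector_Spaces.linear s1 (*) (\<lambda>a. \<phi> (F a b))" for b
      using Vector_Spaces.linear_compose[of s1 s3 "\<lambda>a. F a b" "(*)" \<phi>] F lin
      by (simp add: bilin_def o_def)
    ultimately show ?thesis by (simp add: bilin_def)
  qed
  have *: "\<phi> (?S M) = (\<Sum>(a, b)\<leftarrow>M. tens s1 s2 a b) (\<lambda>a b. \<phi> (F a b))" for M
    using b by (simp add: linear_sum_list[OF lin] sum_list_fun_apply tens_def case_prod_unfold)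
  have "\<phi> (?S L) = \<phi> (?S L')"
    unfolding * eq by simp
  moreover have "\<phi> (?S L - ?S L') = \<phi> (?S L) - \<phi> (?S L')"
  proof -
    interpret p: Vector_Spaces.linear s3 "(*)" \<phi> by fact
    show ?thesis by (rule p.diff)
  qed
  ultimately show False using one by simp
qed

lemma sweedler_eq:
  assumes "bilin s1 s2 s3 F" and "set L \<subseteq> A \<times> B"
  shows "sweedler s1 s2 A B (\<Sum>(a, b)\<leftarrow>L. tens s1 s2 a b) F = (\<Sum>(a, b)\<leftarrow>L. F a b)"
proof -
  let ?P = "\<lambda>M. set M \<subseteq> A \<times> B \<and> (\<Sum>(a, b)\<leftarrow>L. tens s1 s2 a b) = (\<Sum>(a, b)\<leftarrow>M. tens s1 s2 a b)"
  have "?P L" using assms(2) by simp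
  then have "?P (SOME M. ?P M)" by (rule someI)
  then show ?thesis
    unfolding sweedler_def by (intro tensor_universal[OF assms(1), symmetric]) blast
qed

text \<open>
  Linear maps on a subspace \<open>V\<close> are extended by \<open>0\<close> outside \<open>V\<close>.
  \<open>the_lin s1 s2 V P\<close> is the linear map on \<open>V\<close> with property \<open>P\<close>; below, \<open>P\<close> always
  prescribes the values on a spanning set.
\<close>

definition lin_on ::
  "('k::field \<Rightarrow> 'a::ab_group_add \<Rightarrow> 'a) \<Rightarrow> ('k \<Rightarrow> 'b::ab_group_add \<Rightarrow> 'b) \<Rightarrow>
   'a set \<Rightarrow> ('a \<Rightarrow> 'b) \<Rightarrow> bool"
  where "lin_on s1 s2 V f \<longleftrightarrow>
    (\<forall>x\<in>V. \<forall>y\<in>V. f (x + y) = f x + f y) \<and>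
    (\<forall>c. \<forall>x\<in>V. f (s1 c x) = s2 c (f x)) \<and>
    (\<forall>x. x \<notin> V \<longrightarrow> f x = 0)"

definition the_lin ::
  "('k::field \<Rightarrow> 'a::ab_group_add \<Rightarrow> 'a) \<Rightarrow> ('k \<Rightarrow> 'b::ab_group_add \<Rightarrow> 'b) \<Rightarrow>
   'a set \<Rightarrow> (('a \<Rightarrow> 'b) \<Rightarrow> bool) \<Rightarrow> 'a \<Rightarrow> 'b"
  where "the_lin s1 s2 V P = (THE f. lin_on s1 s2 V f \<and> P f)"

definition pscale :: "'k::field \<Rightarrow> ('i \<Rightarrow>\<^sub>0 'k) \<Rightarrow> ('i \<Rightarrow>\<^sub>0 'k)"
  where "pscale c p = Poly_Mapping.map ((*) c) p"


section \<open>Coalgebras and Hopf algebras\<close>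

record ('k, 'h) coalg =
  scal :: "'k \<Rightarrow> 'h \<Rightarrow> 'h"
  comul :: "'h \<Rightarrow> ('h, 'h, 'k) tensor"
  cou :: "'h \<Rightarrow> 'k"

text \<open>\<open>sw2 H h F\<close> is \<open>F(h\<^sub>(\<^sub>1\<^sub>), h\<^sub>(\<^sub>2\<^sub>))\<close>, and similarly for \<open>sw3\<close>, \<open>sw4\<close>, \<open>sw5\<close>.\<close>

definition sw2 :: "('k::field, 'h::ab_group_add) coalg \<Rightarrow> 'h \<Rightarrow> ('h \<Rightarrow> 'h \<Rightarrow> 'u::ab_group_add) \<Rightarrow> 'u"
  where "sw2 H h F = sweedler (scal H) (scal H) UNIV UNIV (comul H h) F"

definition sw3 :: "('k::field, 'h::ab_group_add) coalg \<Rightarrow> 'h \<Rightarrow>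
    ('h \<Rightarrow> 'h \<Rightarrow> 'h \<Rightarrow> 'u::ab_group_add) \<Rightarrow> 'u"
  where "sw3 H h F = sw2 H h (\<lambda>a h'. sw2 H h' (\<lambda>b c. F a b c))"

definition sw4 :: "('k::field, 'h::ab_group_add) coalg \<Rightarrow> 'h \<Rightarrow>
    ('h \<Rightarrow> 'h \<Rightarrow> 'h \<Rightarrow> 'h \<Rightarrow> 'u::ab_group_add) \<Rightarrow> 'u"
  where "sw4 H h F = sw2 H h (\<lambda>a h'. sw3 H h' (\<lambda>b c d. F a b c d))"

definition sw5 :: "('k::field, 'h::ab_group_add) coalg \<Rightarrow> 'h \<Rightarrow>
    ('h \<Rightarrow> 'h \<Rightarrow> 'h \<Rightarrow> 'h \<Rightarrow> 'h \<Rightarrow> 'u::ab_group_add) \<Rightarrow> 'u"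
  where "sw5 H h F = sw2 H h (\<lambda>a h'. sw4 H h' (\<lambda>b c d e. F a b c d e))"

definition tens2 :: "('k::field, 'h::ab_group_add) coalg \<Rightarrow> 'h \<Rightarrow> 'h \<Rightarrow> ('h, 'h, 'k) tensor"
  where "tens2 H a b = tens (scal H) (scal H) a b"

definition tens3 :: "('k::field, 'h::ab_group_add) coalg \<Rightarrow> 'h \<Rightarrow> 'h \<Rightarrow> 'h \<Rightarrow>
    ('h, ('h, 'h, 'k) tensor, 'k) tensor"
  where "tens3 H a b c = tens (scal H) tscale a (tens2 H b c)"

definition coalgebra :: "('k::field, 'h::ab_group_add) coalg \<Rightarrow> bool"
  where "coalgebra H \<longleftrightarrow>
    vector_space (scal H) \<and>
    Vector_Spaces.linear (scal H) tscale (comul H) \<and>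
    (\<forall>h. comul H h \<in> tspace (scal H) (scal H) UNIV UNIV) \<and>
    Vector_Spaces.linear (scal H) (*) (cou H) \<and>
    (\<forall>h. sw2 H h (\<lambda>a b. sw2 H a (\<lambda>a1 a2. tens3 H a1 a2 b)) =
         sw2 H h (\<lambda>a b. sw2 H b (\<lambda>b1 b2. tens3 H a b1 b2))) \<and>
    (\<forall>h. sw2 H h (\<lambda>a b. scal H (cou H a) b) = h) \<and>
    (\<forall>h. sw2 H h (\<lambda>a b. scal H (cou H b) a) = h)"

definition grouplike :: "('k::field, 'h::ab_group_add) coalg \<Rightarrow> 'h \<Rightarrow> bool"
  where "grouplike H g \<longleftrightarrow> comul H g = tens2 H g g \<and> cou H g = 1"

definition mult_coalg_map :: "('k::field, 'h::ab_group_add) coalg \<Rightarrow> ('h \<Rightarrow> 'h \<Rightarrow> 'h) \<Rightarrow> bool"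
  where "mult_coalg_map H m \<longleftrightarrow>
    bilin (scal H) (scal H) (scal H) m \<and>
    (\<forall>h k. comul H (m h k) =
       sw2 H h (\<lambda>h1 h2. sw2 H k (\<lambda>k1 k2. tens2 H (m h1 k1) (m h2 k2)))) \<and>
    (\<forall>h k. cou H (m h k) = cou H h * cou H k)"

definition hopf_algebra :: "('k::field, 'h::ring_1) coalg \<Rightarrow> ('h \<Rightarrow> 'h) \<Rightarrow> bool"
  where "hopf_algebra H S \<longleftrightarrow>
    coalgebra H \<and> mult_coalg_map H (*) \<and> grouplike H 1 \<and>
    Vector_Spaces.linear (scal H) (scal H) S \<and>
    (\<forall>h. sw2 H h (\<lambda>h1 h2. S h1 * h2) = scal H (cou H h) 1) \<and>
    (\<forall>h. sw2 H h (\<lambda>h1 h2. h1 * S h2) = scal H (cou H h) 1)"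


section \<open>Convolution in the duals of \<open>H \<otimes> H\<close> and \<open>H \<otimes> H \<otimes> H\<close>\<close>

definition trilin_form :: "('k::field, 'h::ab_group_add) coalg \<Rightarrow> ('h \<Rightarrow> 'h \<Rightarrow> 'h \<Rightarrow> 'k) \<Rightarrow> bool"
  where "trilin_form H \<Omega> \<longleftrightarrow>
    (\<forall>a b. Vector_Spaces.linear (scal H) (*) (\<lambda>x. \<Omega> x a b)) \<and>
    (\<forall>a b. Vector_Spaces.linear (scal H) (*) (\<lambda>x. \<Omega> a x b)) \<and>
    (\<forall>a b. Vector_Spaces.linear (scal H) (*) (\<lambda>x. \<Omega> a b x))"

definition conv2 :: "('k::field, 'h::ab_group_add) coalg \<Rightarrow>
    ('h \<Rightarrow> 'h \<Rightarrow> 'k) \<Rightarrow> ('h \<Rightarrow> 'h \<Rightarrow> 'k) \<Rightarrow> 'h \<Rightarrow> 'h \<Rightarrow> 'k"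
  where "conv2 H p q h k = sw2 H h (\<lambda>h1 h2. sw2 H k (\<lambda>k1 k2. p h1 k1 * q h2 k2))"

definition conv3 :: "('k::field, 'h::ab_group_add) coalg \<Rightarrow>
    ('h \<Rightarrow> 'h \<Rightarrow> 'h \<Rightarrow> 'k) \<Rightarrow> ('h \<Rightarrow> 'h \<Rightarrow> 'h \<Rightarrow> 'k) \<Rightarrow> 'h \<Rightarrow> 'h \<Rightarrow> 'h \<Rightarrow> 'k"
  where "conv3 H p q h k l =
    sw2 H h (\<lambda>h1 h2. sw2 H k (\<lambda>k1 k2. sw2 H l (\<lambda>l1 l2. p h1 k1 l1 * q h2 k2 l2)))"

definition is_cinv2 :: "('k::field, 'h::ab_group_add) coalg \<Rightarrow>
    ('h \<Rightarrow> 'h \<Rightarrow> 'k) \<Rightarrow> ('h \<Rightarrow> 'h \<Rightarrow> 'k) \<Rightarrow> bool"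
  where "is_cinv2 H p q \<longleftrightarrow> bilin (scal H) (scal H) (*) q \<and>
    conv2 H p q = (\<lambda>h k. cou H h * cou H k) \<and> conv2 H q p = (\<lambda>h k. cou H h * cou H k)"

definition is_cinv3 :: "('k::field, 'h::ab_group_add) coalg \<Rightarrow>
    ('h \<Rightarrow> 'h \<Rightarrow> 'h \<Rightarrow> 'k) \<Rightarrow> ('h \<Rightarrow> 'h \<Rightarrow> 'h \<Rightarrow> 'k) \<Rightarrow> bool"
  where "is_cinv3 H p q \<longleftrightarrow> trilin_form H q \<and>
    conv3 H p q = (\<lambda>h k l. cou H h * cou H k * cou H l) \<and>
    conv3 H q p = (\<lambda>h k l. cou H h * cou H k * cou H l)"

definition cinv2 :: "('k::field, 'h::ab_group_add) coalg \<Rightarrow> ('h \<Rightarrow> 'h \<Rightarrow> 'k) \<Rightarrow> 'h \<Rightarrow> 'h \<Rightarrow> 'k"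
  where "cinv2 H p = (THE q. is_cinv2 H p q)"

definition cinv3 :: "('k::field, 'h::ab_group_add) coalg \<Rightarrow>
    ('h \<Rightarrow> 'h \<Rightarrow> 'h \<Rightarrow> 'k) \<Rightarrow> 'h \<Rightarrow> 'h \<Rightarrow> 'h \<Rightarrow> 'k"
  where "cinv3 H p = (THE q. is_cinv3 H p q)"


section \<open>Coquasi-Hopf algebras and \<open>r\<close>-forms\<close>

text \<open>
  The multiplication \<open>m\<close> and the unit element \<open>e\<close> are explicit, since a Hopf algebra and its
  zesting share the same underlying coalgebra.
\<close>

definition coquasi_bialgebra :: "('k::field, 'h::ab_group_add) coalg \<Rightarrow>
    ('h \<Rightarrow> 'h \<Rightarrow> 'h) \<Rightarrow> 'h \<Rightarrow> ('h \<Rightarrow> 'h \<Rightarrow> 'h \<Rightarrow> 'k) \<Rightarrow> bool"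
  where "coquasi_bialgebra H m e \<Omega> \<longleftrightarrow>
    coalgebra H \<and> mult_coalg_map H m \<and> grouplike H e \<and>
    trilin_form H \<Omega> \<and> (\<exists>\<Omega>'. is_cinv3 H \<Omega> \<Omega>') \<and>
    (\<forall>h k l.
       sw2 H h (\<lambda>h1 h2. sw2 H k (\<lambda>k1 k2. sw2 H l (\<lambda>l1 l2.
         scal H (\<Omega> h2 k2 l2) (m (m h1 k1) l1)))) =
       sw2 H h (\<lambda>h1 h2. sw2 H k (\<lambda>k1 k2. sw2 H l (\<lambda>l1 l2.
         scal H (\<Omega> h1 k1 l1) (m h2 (m k2 l2)))))) \<and>
    (\<forall>h. m e h = h \<and> m h e = h) \<and>
    (\<forall>h k l t.
       sw2 H h (\<lambda>h1 h2. sw2 H k (\<lambda>k1 k2. sw2 H l (\<lambda>l1 l2. sw2 H t (\<lambda>t1 t2.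
         \<Omega> (m h1 k1) l1 t1 * \<Omega> h2 k2 (m l2 t2))))) =
       sw2 H h (\<lambda>h1 h2. sw3 H k (\<lambda>k1 k2 k3. sw3 H l (\<lambda>l1 l2 l3. sw2 H t (\<lambda>t1 t2.
         \<Omega> h1 k1 l1 * \<Omega> h2 (m k2 l2) t1 * \<Omega> k3 l3 t2))))) \<and>
    (\<forall>h k. \<Omega> h e k = cou H h * cou H k)"

text \<open>
  In the last two conditions \<open>\<Omega>\<^sup>-\<^sup>1\<close> comes first: these are the two zig-zag identities for
  the associator \<open>\<Omega> : (X \<otimes> Y) \<otimes> Z \<rightarrow> X \<otimes> (Y \<otimes> Z)\<close> of left comodules.
\<close>

definition coquasi_hopf_algebra :: "('k::field, 'h::ab_group_add) coalg \<Rightarrow>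
    ('h \<Rightarrow> 'h \<Rightarrow> 'h) \<Rightarrow> 'h \<Rightarrow> ('h \<Rightarrow> 'h \<Rightarrow> 'h \<Rightarrow> 'k) \<Rightarrow> bool"
  where "coquasi_hopf_algebra H m e \<Omega> \<longleftrightarrow> coquasi_bialgebra H m e \<Omega> \<and>
    (\<exists>S \<alpha> \<beta>.
      Vector_Spaces.linear (scal H) (scal H) S \<and>
      Vector_Spaces.linear (scal H) (*) \<alpha> \<and> Vector_Spaces.linear (scal H) (*) \<beta> \<and>
      (\<forall>h. sw3 H h (\<lambda>h1 h2 h3. scal H (\<alpha> h2) (m (S h1) h3)) = scal H (\<alpha> h) e) \<and>
      (\<forall>h. sw3 H h (\<lambda>h1 h2 h3. scal H (\<beta> h2) (m h1 (S h3))) = scal H (\<beta> h) e) \<and>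
      (\<forall>h. sw5 H h (\<lambda>h1 h2 h3 h4 h5. \<beta> h2 * \<alpha> h4 * cinv3 H \<Omega> h1 (S h3) h5) = cou H h) \<and>
      (\<forall>h. sw5 H h (\<lambda>h1 h2 h3 h4 h5. \<alpha> h2 * \<beta> h4 * \<Omega> (S h1) h3 (S h5)) = cou H h))"

text \<open>
  The axioms of an \<open>r\<close>-form are those which make
  \<open>x \<otimes> y \<mapsto> r(x\<^sub>(\<^sub>-\<^sub>1\<^sub>), y\<^sub>(\<^sub>-\<^sub>1\<^sub>)) y\<^sub>(\<^sub>0\<^sub>) \<otimes> x\<^sub>(\<^sub>0\<^sub>)\<close> a braiding of \<^emph>\<open>left\<close> comodules:
  colinearity and the two hexagons. For right comodules the convolution factors
  would appear in the opposite order.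
\<close>

definition coquasitriangular :: "('k::field, 'h::ab_group_add) coalg \<Rightarrow>
    ('h \<Rightarrow> 'h \<Rightarrow> 'h) \<Rightarrow> 'h \<Rightarrow> ('h \<Rightarrow> 'h \<Rightarrow> 'h \<Rightarrow> 'k) \<Rightarrow> ('h \<Rightarrow> 'h \<Rightarrow> 'k) \<Rightarrow> bool"
  where "coquasitriangular H m e \<Omega> r \<longleftrightarrow> coquasi_bialgebra H m e \<Omega> \<and>
    bilin (scal H) (scal H) (*) r \<and> (\<exists>r'. is_cinv2 H r r') \<and>
    (\<forall>h k.
       sw2 H h (\<lambda>h1 h2. sw2 H k (\<lambda>k1 k2. scal H (r h1 k1) (m k2 h2))) =
       sw2 H h (\<lambda>h1 h2. sw2 H k (\<lambda>k1 k2. scal H (r h2 k2) (m h1 k1)))) \<and>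
    (\<forall>h k l.
       sw2 H h (\<lambda>h1 h2. sw2 H k (\<lambda>k1 k2. sw2 H l (\<lambda>l1 l2.
         r h1 (m k1 l1) * \<Omega> k2 l2 h2))) =
       sw4 H h (\<lambda>h1 h2 h3 h4. sw3 H k (\<lambda>k1 k2 k3. sw3 H l (\<lambda>l1 l2 l3.
         cinv3 H \<Omega> h1 k1 l1 * r h2 k2 * \<Omega> k3 h3 l2 * r h4 l3)))) \<and>
    (\<forall>h k l.
       sw2 H h (\<lambda>h1 h2. sw2 H k (\<lambda>k1 k2. sw2 H l (\<lambda>l1 l2.
         r (m h1 k1) l1 * cinv3 H \<Omega> l2 h2 k2))) =
       sw3 H h (\<lambda>h1 h2 h3. sw3 H k (\<lambda>k1 k2 k3. sw4 H l (\<lambda>l1 l2 l3 l4.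
         \<Omega> h1 k1 l1 * r k2 l2 * cinv3 H \<Omega> h2 l3 k3 * r h3 l4))))"

text \<open>
  With \<open>r(h, k) = \<langle>f(k), h\<rangle>\<close> the last four conditions say that
  \<open>f : H \<rightarrow> (H\<^sup>\<circ>)\<^sup>c\<^sup>o\<^sup>p\<close> is a bialgebra (hence Hopf algebra) map; the fourth of them forces
  \<open>f(k)\<close> to lie in the finite dual. These are the axioms of
  \<open>coquasitriangular\<close> for trivial \<open>\<Omega>\<close>.
\<close>

definition coquasitriangular_hopf :: "('k::field, 'h::ring_1) coalg \<Rightarrow> ('h \<Rightarrow> 'h) \<Rightarrow>
    ('h \<Rightarrow> 'h \<Rightarrow> 'k) \<Rightarrow> bool"
  where "coquasitriangular_hopf H S r \<longleftrightarrow> hopf_algebra H S \<and>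
    bilin (scal H) (scal H) (*) r \<and> (\<exists>r'. is_cinv2 H r r') \<and>
    (\<forall>h k.
       sw2 H h (\<lambda>h1 h2. sw2 H k (\<lambda>k1 k2. scal H (r h1 k1) (k2 * h2))) =
       sw2 H h (\<lambda>h1 h2. sw2 H k (\<lambda>k1 k2. scal H (r h2 k2) (h1 * k1)))) \<and>
    (\<forall>h k l. r h (k * l) = sw2 H h (\<lambda>h1 h2. r h1 k * r h2 l)) \<and>
    (\<forall>h. r h 1 = cou H h) \<and>
    (\<forall>l. r 1 l = cou H l) \<and>
    (\<forall>h k l. r (h * k) l = sw2 H l (\<lambda>l1 l2. r h l2 * r k l1))"


section \<open>Cocentral gradings and zesting data\<close>

text \<open>
  The abelian group \<open>G\<close> is the type \<open>'g\<close>, written additively. The group algebra \<open>\<Bbbk>G\<close> is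
  \<open>'g \<Rightarrow>\<^sub>0 'k\<close> with the convolution product of \<^theory>\<open>HOL-Library.Poly_Mapping\<close>; the group
  element \<open>s\<close> is \<open>Poly_Mapping.single s 1\<close>.
\<close>

definition gbas :: "'g \<Rightarrow> ('g \<Rightarrow>\<^sub>0 'k::field)"
  where "gbas s = Poly_Mapping.single s 1"

definition galg :: "('k::field, 'g \<Rightarrow>\<^sub>0 'k) coalg"
  where "galg = \<lparr>scal = pscale,
    comul = (\<lambda>p. \<Sum>s\<in>Poly_Mapping.keys p.
      tscale (Poly_Mapping.lookup p s) (tens pscale pscale (gbas s) (gbas s))),
    cou = (\<lambda>p. \<Sum>s\<in>Poly_Mapping.keys p. Poly_Mapping.lookup p s)\<rparr>"

definition hopf_map_to_galg :: "('k::field, 'h::ring_1) coalg \<Rightarrow>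
    ('h \<Rightarrow> ('g::ab_group_add \<Rightarrow>\<^sub>0 'k)) \<Rightarrow> bool"
  where "hopf_map_to_galg H \<pi> \<longleftrightarrow>
    Vector_Spaces.linear (scal H) pscale \<pi> \<and>
    (\<forall>h k. \<pi> (h * k) = \<pi> h * \<pi> k) \<and> \<pi> 1 = 1 \<and>
    (\<forall>h. comul galg (\<pi> h) = sw2 H h (\<lambda>h1 h2. tens2 galg (\<pi> h1) (\<pi> h2))) \<and>
    (\<forall>h. cou galg (\<pi> h) = cou H h)"

definition cocentral :: "('k::field, 'h::ring_1) coalg \<Rightarrow> ('h \<Rightarrow> ('g::ab_group_add \<Rightarrow>\<^sub>0 'k)) \<Rightarrow> bool"
  where "cocentral H \<pi> \<longleftrightarrow>
    (\<forall>h. sw2 H h (\<lambda>h1 h2. tens (scal H) pscale h1 (\<pi> h2)) =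
         sw2 H h (\<lambda>h1 h2. tens (scal H) pscale h2 (\<pi> h1)))"

definition hdeg :: "('k::field, 'h::ring_1) coalg \<Rightarrow> ('h \<Rightarrow> ('g::ab_group_add \<Rightarrow>\<^sub>0 'k)) \<Rightarrow> 'g \<Rightarrow> 'h set"
  where "hdeg H \<pi> s =
    {h. sw2 H h (\<lambda>h1 h2. tens pscale (scal H) (\<pi> h1) h2) = tens pscale (scal H) (gbas s) h}"

definition alg_map :: "('k::field, 'h::ring_1) coalg \<Rightarrow> ('h \<Rightarrow> 'k) \<Rightarrow> bool"
  where "alg_map H \<phi> \<longleftrightarrow> Vector_Spaces.linear (scal H) (*) \<phi> \<and>
    (\<forall>h k. \<phi> (h * k) = \<phi> h * \<phi> k) \<and> \<phi> 1 = 1"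

text \<open>
  The inverse of a group-like element \<open>g\<close> is \<open>S g\<close>. The compatibility of \<open>\<gamma>\<close> with conjugation
  is the condition that the half-braiding
  \<open>g \<otimes> z \<mapsto> \<langle>\<gamma>(g), z\<^sub>(\<^sub>-\<^sub>1\<^sub>)\<rangle> z\<^sub>(\<^sub>0\<^sub>) \<otimes> g\<close>, out of which the associator of \<open>H\<^sup>\<lambda>\<close> is built, is
  colinear.
\<close>

definition assoc_zesting_datum :: "('k::field, 'h::ring_1) coalg \<Rightarrow> ('h \<Rightarrow> 'h) \<Rightarrow>
    ('h \<Rightarrow> ('g::ab_group_add \<Rightarrow>\<^sub>0 'k)) \<Rightarrow> 'h set \<Rightarrow>
    ('h \<Rightarrow> 'h \<Rightarrow> 'k) \<Rightarrow> ('g \<Rightarrow> 'g \<Rightarrow> 'h) \<Rightarrow> ('g \<Rightarrow> 'g \<Rightarrow> 'g \<Rightarrow> 'k) \<Rightarrow> bool"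
  where "assoc_zesting_datum H S \<pi> \<Gamma>0 \<gamma> lam \<omega> \<longleftrightarrow>
    \<Gamma>0 \<subseteq> {g \<in> hdeg H \<pi> 0. grouplike H g} \<and>
    1 \<in> \<Gamma>0 \<and> (\<forall>g\<in>\<Gamma>0. \<forall>g'\<in>\<Gamma>0. g * g' \<in> \<Gamma>0) \<and> (\<forall>g\<in>\<Gamma>0. S g \<in> \<Gamma>0) \<and>
    (\<forall>g\<in>\<Gamma>0. alg_map H (\<gamma> g)) \<and>
    (\<forall>g\<in>\<Gamma>0. \<forall>g'\<in>\<Gamma>0. \<forall>h. \<gamma> (g * g') h = sw2 H h (\<lambda>h1 h2. \<gamma> g h1 * \<gamma> g' h2)) \<and>
    (\<forall>g\<in>\<Gamma>0. \<forall>h. sw2 H h (\<lambda>h1 h2. scal H (\<gamma> g h2) (g * h1 * S g)) =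
                   sw2 H h (\<lambda>h1 h2. scal H (\<gamma> g h1) h2)) \<and>
    (\<forall>a b. lam a b \<in> \<Gamma>0) \<and>
    (\<forall>a. lam 0 a = 1 \<and> lam a 0 = 1) \<and>
    (\<forall>a b c. lam a b * lam (a + b) c = lam b c * lam a (b + c)) \<and>
    (\<forall>a b c. \<omega> a b c \<noteq> 0) \<and>
    (\<forall>a b. \<omega> 0 a b = 1 \<and> \<omega> a 0 b = 1 \<and> \<omega> a b 0 = 1) \<and>
    (\<forall>a b c d. \<gamma> (lam a b) (lam c d) =
       (\<omega> a b c * \<omega> a (b + c) d * \<omega> b c d) / (\<omega> (a + b) c d * \<omega> a b (c + d)))"

definition induces_character :: "('k::field, 'h::ring_1) coalg \<Rightarrow> ('h \<Rightarrow> 'h \<Rightarrow> 'k) \<Rightarrow>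
    ('h \<Rightarrow> ('g::ab_group_add \<Rightarrow>\<^sub>0 'k)) \<Rightarrow> 'h \<Rightarrow> ('g \<Rightarrow> 'k) \<Rightarrow> bool"
  where "induces_character H r \<pi> g \<chi> \<longleftrightarrow>
    (\<forall>s s'. \<chi> (s + s') = \<chi> s * \<chi> s') \<and> (\<forall>s. \<chi> s \<noteq> 0) \<and>
    (\<forall>s. \<forall>x\<in>hdeg H \<pi> s. sw2 H x (\<lambda>x1 x2. r x1 g * r g x2) = \<chi> s * cou H x)"

text \<open>
  \<open>\<gamma>(g) = r\<^sup>-\<^sup>1(-, g)\<close> says that the half-braiding of \<open>\<Bbbk>g\<close> with \<open>Z\<close> given by \<open>\<gamma>\<close> is the inverse of
  the braiding \<open>c\<^bsub>Z, \<Bbbk>g\<^esub>\<close>. Since \<open>\<pi>\<close> is surjective, the character \<open>\<chi>\<close> induced by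
  \<open>lam a b\<close> is unique.
\<close>

definition braided_zesting_datum :: "('k::field, 'h::ring_1) coalg \<Rightarrow> ('h \<Rightarrow> 'h) \<Rightarrow>
    ('h \<Rightarrow> 'h \<Rightarrow> 'k) \<Rightarrow> ('h \<Rightarrow> ('g::ab_group_add \<Rightarrow>\<^sub>0 'k)) \<Rightarrow> 'h set \<Rightarrow>
    ('h \<Rightarrow> 'h \<Rightarrow> 'k) \<Rightarrow> ('g \<Rightarrow> 'g \<Rightarrow> 'h) \<Rightarrow> ('g \<Rightarrow> 'g \<Rightarrow> 'g \<Rightarrow> 'k) \<Rightarrow> ('g \<Rightarrow> 'g \<Rightarrow> 'k) \<Rightarrow> bool"
  where "braided_zesting_datum H S r \<pi> \<Gamma>0 \<gamma> lam \<omega> t \<longleftrightarrow>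
    assoc_zesting_datum H S \<pi> \<Gamma>0 \<gamma> lam \<omega> \<and>
    (\<forall>g\<in>\<Gamma>0. \<forall>h. \<gamma> g h = cinv2 H r h g) \<and>
    (\<forall>a b. \<exists>\<chi>. induces_character H r \<pi> (lam a b) \<chi>) \<and>
    (\<forall>a b. lam a b = lam b a) \<and>
    (\<forall>a b. t a b \<noteq> 0) \<and>
    (\<forall>a b c. \<omega> a b c * \<omega> b c a / \<omega> b a c = t a b * t a c / t a (b + c)) \<and>
    (\<forall>a b c \<chi>. induces_character H r \<pi> (lam a b) \<chi> \<longrightarrow>
       \<chi> c = (\<omega> a b c * \<omega> c a b / \<omega> a c b) * (t a c * t b c / t (a + b) c))"

text \<open>The structure maps of \<open>H\<^sup>\<lambda>\<close>, given on homogeneous elements and extended (multi)linearly.\<close>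

definition zest_mult :: "('k::field, 'h::ring_1) coalg \<Rightarrow> ('h \<Rightarrow> ('g::ab_group_add \<Rightarrow>\<^sub>0 'k)) \<Rightarrow>
    ('g \<Rightarrow> 'g \<Rightarrow> 'h) \<Rightarrow> 'h \<Rightarrow> 'h \<Rightarrow> 'h"
  where "zest_mult H \<pi> lam = (THE m. bilin (scal H) (scal H) (scal H) m \<and>
    (\<forall>a b. \<forall>h\<in>hdeg H \<pi> a. \<forall>k\<in>hdeg H \<pi> b. m h k = h * k * lam a b))"

definition zest_assoc :: "('k::field, 'h::ring_1) coalg \<Rightarrow> ('h \<Rightarrow> ('g::ab_group_add \<Rightarrow>\<^sub>0 'k)) \<Rightarrow>
    ('h \<Rightarrow> 'h \<Rightarrow> 'k) \<Rightarrow> ('g \<Rightarrow> 'g \<Rightarrow> 'h) \<Rightarrow> ('g \<Rightarrow> 'g \<Rightarrow> 'g \<Rightarrow> 'k) \<Rightarrow> 'h \<Rightarrow> 'h \<Rightarrow> 'h \<Rightarrow> 'k"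
  where "zest_assoc H \<pi> \<gamma> lam \<omega> = (THE \<Omega>. trilin_form H \<Omega> \<and>
    (\<forall>a b c. \<forall>h\<in>hdeg H \<pi> a. \<forall>k\<in>hdeg H \<pi> b. \<forall>l\<in>hdeg H \<pi> c.
       \<Omega> h k l = cou H (h * k) * \<omega> a b c * \<gamma> (lam a b) l))"

definition zest_rform :: "('k::field, 'h::ring_1) coalg \<Rightarrow> ('h \<Rightarrow> ('g::ab_group_add \<Rightarrow>\<^sub>0 'k)) \<Rightarrow>
    ('h \<Rightarrow> 'h \<Rightarrow> 'k) \<Rightarrow> ('g \<Rightarrow> 'g \<Rightarrow> 'k) \<Rightarrow> 'h \<Rightarrow> 'h \<Rightarrow> 'k"
  where "zest_rform H \<pi> r t = (THE r'. bilin (scal H) (scal H) (*) r' \<and>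
    (\<forall>a b. \<forall>x\<in>hdeg H \<pi> a. \<forall>y\<in>hdeg H \<pi> b. r' x y = t a b * r x y))"


section \<open>Braided monoidal categories\<close>

record ('o, 'm, 'k) bmcat =
  Obj :: "'o set"
  Hom :: "'o \<Rightarrow> 'o \<Rightarrow> 'm set"
  Idt :: "'o \<Rightarrow> 'm"
  Cmp :: "'m \<Rightarrow> 'm \<Rightarrow> 'm"  \<comment> \<open>\<open>Cmp g f\<close> is \<open>g \<circ> f\<close>\<close>
  Add :: "'m \<Rightarrow> 'm \<Rightarrow> 'm"
  Smul :: "'k \<Rightarrow> 'm \<Rightarrow> 'm"
  Unt :: "'o"
  Tob :: "'o \<Rightarrow> 'o \<Rightarrow> 'o"
  Tar :: "'m \<Rightarrow> 'm \<Rightarrow> 'm"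
  Asc :: "'o \<Rightarrow> 'o \<Rightarrow> 'o \<Rightarrow> 'm"  \<comment> \<open>\<open>(X \<otimes> Y) \<otimes> Z \<rightarrow> X \<otimes> (Y \<otimes> Z)\<close>\<close>
  Lun :: "'o \<Rightarrow> 'm"
  Run :: "'o \<Rightarrow> 'm"
  Brd :: "'o \<Rightarrow> 'o \<Rightarrow> 'm"

definition iso_in :: "('o, 'm, 'k) bmcat \<Rightarrow> 'o \<Rightarrow> 'o \<Rightarrow> 'm \<Rightarrow> bool"
  where "iso_in C X Y f \<longleftrightarrow> f \<in> Hom C X Y \<and>
    (\<exists>g\<in>Hom C Y X. Cmp C g f = Idt C X \<and> Cmp C f g = Idt C Y)"

definition linear_category :: "('o, 'm, 'k::field) bmcat \<Rightarrow> bool"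
  where "linear_category C \<longleftrightarrow>
    (\<forall>X\<in>Obj C. Idt C X \<in> Hom C X X) \<and>
    (\<forall>X\<in>Obj C. \<forall>Y\<in>Obj C. \<forall>Z\<in>Obj C. \<forall>f\<in>Hom C X Y. \<forall>g\<in>Hom C Y Z. Cmp C g f \<in> Hom C X Z) \<and>
    (\<forall>X\<in>Obj C. \<forall>Y\<in>Obj C. \<forall>f\<in>Hom C X Y. Cmp C f (Idt C X) = f \<and> Cmp C (Idt C Y) f = f) \<and>
    (\<forall>X\<in>Obj C. \<forall>Y\<in>Obj C. \<forall>Z\<in>Obj C. \<forall>W\<in>Obj C.
       \<forall>f\<in>Hom C X Y. \<forall>g\<in>Hom C Y Z. \<forall>h\<in>Hom C Z W. Cmp C h (Cmp C g f) = Cmp C (Cmp C h g) f) \<and>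
    (\<forall>X\<in>Obj C. \<forall>Y\<in>Obj C.
       (\<forall>f\<in>Hom C X Y. \<forall>g\<in>Hom C X Y. Add C f g \<in> Hom C X Y \<and> Add C f g = Add C g f) \<and>
       (\<forall>f\<in>Hom C X Y. \<forall>g\<in>Hom C X Y. \<forall>h\<in>Hom C X Y.
          Add C (Add C f g) h = Add C f (Add C g h)) \<and>
       (\<exists>z\<in>Hom C X Y. \<forall>f\<in>Hom C X Y. Add C z f = f \<and> Add C f (Smul C (-1) f) = z) \<and>
       (\<forall>c. \<forall>f\<in>Hom C X Y. Smul C c f \<in> Hom C X Y) \<and>
       (\<forall>f\<in>Hom C X Y. Smul C 1 f = f) \<and>
       (\<forall>c d. \<forall>f\<in>Hom C X Y. Smul C (c * d) f = Smul C c (Smul C d f) \<and>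
          Smul C (c + d) f = Add C (Smul C c f) (Smul C d f)) \<and>
       (\<forall>c. \<forall>f\<in>Hom C X Y. \<forall>g\<in>Hom C X Y.
          Smul C c (Add C f g) = Add C (Smul C c f) (Smul C c g))) \<and>
    (\<forall>X\<in>Obj C. \<forall>Y\<in>Obj C. \<forall>Z\<in>Obj C. \<forall>f\<in>Hom C X Y. \<forall>f'\<in>Hom C X Y. \<forall>g\<in>Hom C Y Z. \<forall>g'\<in>Hom C Y Z.
       Cmp C (Add C g g') f = Add C (Cmp C g f) (Cmp C g' f) \<and>
       Cmp C g (Add C f f') = Add C (Cmp C g f) (Cmp C g f') \<and>
       (\<forall>c. Cmp C (Smul C c g) f = Smul C c (Cmp C g f) \<and>
            Cmp C g (Smul C c f) = Smul C c (Cmp C g f)))"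

definition monoidal_category :: "('o, 'm, 'k::field) bmcat \<Rightarrow> bool"
  where "monoidal_category C \<longleftrightarrow> linear_category C \<and>
    Unt C \<in> Obj C \<and> (\<forall>X\<in>Obj C. \<forall>Y\<in>Obj C. Tob C X Y \<in> Obj C) \<and>
    (\<forall>X\<in>Obj C. \<forall>X'\<in>Obj C. \<forall>Y\<in>Obj C. \<forall>Y'\<in>Obj C. \<forall>f\<in>Hom C X X'. \<forall>g\<in>Hom C Y Y'.
       Tar C f g \<in> Hom C (Tob C X Y) (Tob C X' Y') \<and>
       (\<forall>f'\<in>Hom C X X'. Tar C (Add C f f') g = Add C (Tar C f g) (Tar C f' g)) \<and>
       (\<forall>g'\<in>Hom C Y Y'. Tar C f (Add C g g') = Add C (Tar C f g) (Tar C f g')) \<and>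
       (\<forall>c. Tar C (Smul C c f) g = Smul C c (Tar C f g) \<and>
            Tar C f (Smul C c g) = Smul C c (Tar C f g))) \<and>
    (\<forall>X\<in>Obj C. \<forall>Y\<in>Obj C. Tar C (Idt C X) (Idt C Y) = Idt C (Tob C X Y)) \<and>
    (\<forall>X\<in>Obj C. \<forall>X'\<in>Obj C. \<forall>X''\<in>Obj C. \<forall>Y\<in>Obj C. \<forall>Y'\<in>Obj C. \<forall>Y''\<in>Obj C.
       \<forall>f\<in>Hom C X X'. \<forall>f'\<in>Hom C X' X''. \<forall>g\<in>Hom C Y Y'. \<forall>g'\<in>Hom C Y' Y''.
         Tar C (Cmp C f' f) (Cmp C g' g) = Cmp C (Tar C f' g') (Tar C f g)) \<and>
    (\<forall>X\<in>Obj C. \<forall>Y\<in>Obj C. \<forall>Z\<in>Obj C.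
       iso_in C (Tob C (Tob C X Y) Z) (Tob C X (Tob C Y Z)) (Asc C X Y Z)) \<and>
    (\<forall>X\<in>Obj C. \<forall>X'\<in>Obj C. \<forall>Y\<in>Obj C. \<forall>Y'\<in>Obj C. \<forall>Z\<in>Obj C. \<forall>Z'\<in>Obj C.
       \<forall>f\<in>Hom C X X'. \<forall>g\<in>Hom C Y Y'. \<forall>h\<in>Hom C Z Z'.
         Cmp C (Asc C X' Y' Z') (Tar C (Tar C f g) h) =
         Cmp C (Tar C f (Tar C g h)) (Asc C X Y Z)) \<and>
    (\<forall>X\<in>Obj C. iso_in C (Tob C (Unt C) X) X (Lun C X) \<and> iso_in C (Tob C X (Unt C)) X (Run C X)) \<and>
    (\<forall>X\<in>Obj C. \<forall>Y\<in>Obj C. \<forall>f\<in>Hom C X Y.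
       Cmp C (Lun C Y) (Tar C (Idt C (Unt C)) f) = Cmp C f (Lun C X) \<and>
       Cmp C (Run C Y) (Tar C f (Idt C (Unt C))) = Cmp C f (Run C X)) \<and>
    (\<forall>X\<in>Obj C. \<forall>Y\<in>Obj C. \<forall>Z\<in>Obj C. \<forall>W\<in>Obj C.
       Cmp C (Asc C X Y (Tob C Z W)) (Asc C (Tob C X Y) Z W) =
       Cmp C (Tar C (Idt C X) (Asc C Y Z W))
         (Cmp C (Asc C X (Tob C Y Z) W) (Tar C (Asc C X Y Z) (Idt C W)))) \<and>
    (\<forall>X\<in>Obj C. \<forall>Y\<in>Obj C.
       Cmp C (Tar C (Idt C X) (Lun C Y)) (Asc C X (Unt C) Y) = Tar C (Run C X) (Idt C Y))"

definition inv_arrow :: "('o, 'm, 'k) bmcat \<Rightarrow> 'o \<Rightarrow> 'o \<Rightarrow> 'm \<Rightarrow> 'm"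
  where "inv_arrow C X Y f = (THE g. g \<in> Hom C Y X \<and> Cmp C g f = Idt C X \<and> Cmp C f g = Idt C Y)"

definition inv_Asc :: "('o, 'm, 'k) bmcat \<Rightarrow> 'o \<Rightarrow> 'o \<Rightarrow> 'o \<Rightarrow> 'm"
  where "inv_Asc C X Y Z = inv_arrow C (Tob C (Tob C X Y) Z) (Tob C X (Tob C Y Z)) (Asc C X Y Z)"

definition braided_monoidal_category :: "('o, 'm, 'k::field) bmcat \<Rightarrow> bool"
  where "braided_monoidal_category C \<longleftrightarrow> monoidal_category C \<and>
    (\<forall>X\<in>Obj C. \<forall>Y\<in>Obj C. iso_in C (Tob C X Y) (Tob C Y X) (Brd C X Y)) \<and>
    (\<forall>X\<in>Obj C. \<forall>X'\<in>Obj C. \<forall>Y\<in>Obj C. \<forall>Y'\<in>Obj C. \<forall>f\<in>Hom C X X'. \<forall>g\<in>Hom C Y Y'.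
       Cmp C (Brd C X' Y') (Tar C f g) = Cmp C (Tar C g f) (Brd C X Y)) \<and>
    (\<forall>X\<in>Obj C. \<forall>Y\<in>Obj C. \<forall>Z\<in>Obj C.
       Cmp C (Asc C Y Z X) (Cmp C (Brd C X (Tob C Y Z)) (Asc C X Y Z)) =
       Cmp C (Tar C (Idt C Y) (Brd C X Z))
         (Cmp C (Asc C Y X Z) (Tar C (Brd C X Y) (Idt C Z)))) \<and>
    (\<forall>X\<in>Obj C. \<forall>Y\<in>Obj C. \<forall>Z\<in>Obj C.
       Cmp C (inv_Asc C Z X Y) (Cmp C (Brd C (Tob C X Y) Z) (inv_Asc C X Y Z)) =
       Cmp C (Tar C (Brd C X Z) (Idt C Y))
         (Cmp C (inv_Asc C X Z Y) (Tar C (Idt C X) (Brd C Y Z))))"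

definition linear_functor :: "('o, 'm, 'k::field) bmcat \<Rightarrow> ('p, 'n, 'k) bmcat \<Rightarrow>
    ('o \<Rightarrow> 'p) \<Rightarrow> ('o \<Rightarrow> 'o \<Rightarrow> 'm \<Rightarrow> 'n) \<Rightarrow> bool"
  where "linear_functor C D Fo Fa \<longleftrightarrow>
    (\<forall>X\<in>Obj C. Fo X \<in> Obj D \<and> Fa X X (Idt C X) = Idt D (Fo X)) \<and>
    (\<forall>X\<in>Obj C. \<forall>Y\<in>Obj C. \<forall>f\<in>Hom C X Y. Fa X Y f \<in> Hom D (Fo X) (Fo Y) \<and>
       (\<forall>g\<in>Hom C X Y. Fa X Y (Add C f g) = Add D (Fa X Y f) (Fa X Y g)) \<and>
       (\<forall>c. Fa X Y (Smul C c f) = Smul D c (Fa X Y f))) \<and>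
    (\<forall>X\<in>Obj C. \<forall>Y\<in>Obj C. \<forall>Z\<in>Obj C. \<forall>f\<in>Hom C X Y. \<forall>g\<in>Hom C Y Z.
       Fa X Z (Cmp C g f) = Cmp D (Fa Y Z g) (Fa X Y f))"

definition natural_iso :: "('o, 'm, 'k::field) bmcat \<Rightarrow> ('p, 'n, 'k) bmcat \<Rightarrow>
    ('o \<Rightarrow> 'p) \<Rightarrow> ('o \<Rightarrow> 'o \<Rightarrow> 'm \<Rightarrow> 'n) \<Rightarrow> ('o \<Rightarrow> 'p) \<Rightarrow> ('o \<Rightarrow> 'o \<Rightarrow> 'm \<Rightarrow> 'n) \<Rightarrow> ('o \<Rightarrow> 'n) \<Rightarrow> bool"
  where "natural_iso C D Fo Fa Go Ga \<eta> \<longleftrightarrow>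
    (\<forall>X\<in>Obj C. iso_in D (Fo X) (Go X) (\<eta> X)) \<and>
    (\<forall>X\<in>Obj C. \<forall>Y\<in>Obj C. \<forall>f\<in>Hom C X Y. Cmp D (\<eta> Y) (Fa X Y f) = Cmp D (Ga X Y f) (\<eta> X))"

definition equivalence_functor :: "('o, 'm, 'k::field) bmcat \<Rightarrow> ('p, 'n, 'k) bmcat \<Rightarrow>
    ('o \<Rightarrow> 'p) \<Rightarrow> ('o \<Rightarrow> 'o \<Rightarrow> 'm \<Rightarrow> 'n) \<Rightarrow> bool"
  where "equivalence_functor C D Fo Fa \<longleftrightarrow> linear_functor C D Fo Fa \<and>
    (\<exists>Go Ga \<eta> \<epsilon>. linear_functor D C Go Ga \<and>
      natural_iso C C (\<lambda>X. X) (\<lambda>X Y f. f)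
        (\<lambda>X. Go (Fo X)) (\<lambda>X Y f. Ga (Fo X) (Fo Y) (Fa X Y f)) \<eta> \<and>
      natural_iso D D (\<lambda>X. Fo (Go X)) (\<lambda>X Y f. Fa (Go X) (Go Y) (Ga X Y f))
        (\<lambda>X. X) (\<lambda>X Y f. f) \<epsilon>)"

definition braided_monoidal_functor :: "('o, 'm, 'k::field) bmcat \<Rightarrow> ('p, 'n, 'k) bmcat \<Rightarrow>
    ('o \<Rightarrow> 'p) \<Rightarrow> ('o \<Rightarrow> 'o \<Rightarrow> 'm \<Rightarrow> 'n) \<Rightarrow> ('o \<Rightarrow> 'o \<Rightarrow> 'n) \<Rightarrow> 'n \<Rightarrow> bool"
  where "braided_monoidal_functor C D Fo Fa J \<phi> \<longleftrightarrow> linear_functor C D Fo Fa \<and>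
    iso_in D (Unt D) (Fo (Unt C)) \<phi> \<and>
    (\<forall>X\<in>Obj C. \<forall>Y\<in>Obj C. iso_in D (Tob D (Fo X) (Fo Y)) (Fo (Tob C X Y)) (J X Y)) \<and>
    (\<forall>X\<in>Obj C. \<forall>X'\<in>Obj C. \<forall>Y\<in>Obj C. \<forall>Y'\<in>Obj C. \<forall>f\<in>Hom C X X'. \<forall>g\<in>Hom C Y Y'.
       Cmp D (J X' Y') (Tar D (Fa X X' f) (Fa Y Y' g)) =
       Cmp D (Fa (Tob C X Y) (Tob C X' Y') (Tar C f g)) (J X Y)) \<and>
    (\<forall>X\<in>Obj C. \<forall>Y\<in>Obj C. \<forall>Z\<in>Obj C.
       Cmp D (Fa (Tob C (Tob C X Y) Z) (Tob C X (Tob C Y Z)) (Asc C X Y Z))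
         (Cmp D (J (Tob C X Y) Z) (Tar D (J X Y) (Idt D (Fo Z)))) =
       Cmp D (J X (Tob C Y Z))
         (Cmp D (Tar D (Idt D (Fo X)) (J Y Z)) (Asc D (Fo X) (Fo Y) (Fo Z)))) \<and>
    (\<forall>X\<in>Obj C.
       Cmp D (Fa (Tob C (Unt C) X) X (Lun C X)) (Cmp D (J (Unt C) X) (Tar D \<phi> (Idt D (Fo X)))) =
         Lun D (Fo X) \<and>
       Cmp D (Fa (Tob C X (Unt C)) X (Run C X)) (Cmp D (J X (Unt C)) (Tar D (Idt D (Fo X)) \<phi>)) =
         Run D (Fo X)) \<and>
    (\<forall>X\<in>Obj C. \<forall>Y\<in>Obj C.
       Cmp D (Fa (Tob C X Y) (Tob C Y X) (Brd C X Y)) (J X Y) =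
       Cmp D (J Y X) (Brd D (Fo X) (Fo Y)))"

definition braided_tensor_equivalent :: "('o, 'm, 'k::field) bmcat \<Rightarrow> ('p, 'n, 'k) bmcat \<Rightarrow> bool"
  where "braided_tensor_equivalent C D \<longleftrightarrow>
    braided_monoidal_category C \<and> braided_monoidal_category D \<and>
    (\<exists>Fo Fa J \<phi>. braided_monoidal_functor C D Fo Fa J \<phi> \<and> equivalence_functor C D Fo Fa)"


section \<open>Left comodules\<close>

text \<open>
  Comodules live on subspaces of the vector space with basis the type \<open>'u vindex\<close>, for an
  arbitrary type \<open>'u\<close>; every comodule of dimension at most \<open>\<bar>'u vindex\<bar>\<close> is isomorphic to one of
  these. Since \<open>Node\<close> is injective, \<open>x \<otimes> y \<mapsto> x \<otimes>\<^sub>v y\<close> embeds the tensor product of two such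
  subspaces into the same space. The field itself is the line spanned by \<open>evec\<close>.
\<close>

datatype 'u vindex = Atom 'u | Dot | Node "'u vindex" "'u vindex"

type_synonym ('k, 'u) vec = "'u vindex \<Rightarrow>\<^sub>0 'k"

definition vten :: "('k::field, 'u) vec \<Rightarrow> ('k, 'u) vec \<Rightarrow> ('k, 'u) vec" (infixr "\<otimes>\<^sub>v" 75)
  where "x \<otimes>\<^sub>v y = (\<Sum>i\<in>Poly_Mapping.keys x. \<Sum>j\<in>Poly_Mapping.keys y.
    Poly_Mapping.single (Node i j) (Poly_Mapping.lookup x i * Poly_Mapping.lookup y j))"

definition evec :: "('k::field, 'u) vec"
  where "evec = Poly_Mapping.single Dot 1"

definition vspan :: "('k::field, 'u) vec set \<Rightarrow> ('k, 'u) vec set"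
  where "vspan = module.span pscale"

record (overloaded) ('k, 'h, 'u) comod =
  carr :: "('k, 'u) vec set"
  coact :: "('k, 'u) vec \<Rightarrow> ('h, ('k, 'u) vec, 'k) tensor"

definition htens :: "('k::field, 'h::ab_group_add) coalg \<Rightarrow> 'h \<Rightarrow> ('k, 'u) vec \<Rightarrow>
    ('h, ('k, 'u) vec, 'k) tensor"
  where "htens H h x = tens (scal H) pscale h x"

text \<open>\<open>csw H X x F\<close> is \<open>F(x\<^sub>(\<^sub>-\<^sub>1\<^sub>), x\<^sub>(\<^sub>0\<^sub>))\<close>.\<close>

definition csw :: "('k::field, 'h::ab_group_add) coalg \<Rightarrow> ('k, 'h, 'u) comod \<Rightarrow> ('k, 'u) vec \<Rightarrow>
    ('h \<Rightarrow> ('k, 'u) vec \<Rightarrow> 'v::ab_group_add) \<Rightarrow> 'v"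
  where "csw H X x F = sweedler (scal H) pscale UNIV (carr X) (coact X x) F"

definition left_comodule :: "('k::field, 'h::ab_group_add) coalg \<Rightarrow> ('k, 'h, 'u) comod \<Rightarrow> bool"
  where "left_comodule H X \<longleftrightarrow>
    module.subspace pscale (carr X) \<and>
    lin_on pscale tscale (carr X) (coact X) \<and>
    (\<forall>x\<in>carr X. coact X x \<in> tspace (scal H) pscale UNIV (carr X)) \<and>
    (\<forall>x\<in>carr X.
       csw H X x (\<lambda>h y. sw2 H h (\<lambda>h1 h2. tens (scal H) tscale h1 (htens H h2 y))) =
       csw H X x (\<lambda>h y. csw H X y (\<lambda>k z. tens (scal H) tscale h (htens H k z)))) \<and>
    (\<forall>x\<in>carr X. csw H X x (\<lambda>h y. pscale (cou H h) y) = x)"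

text \<open>Arrows carry their source and target.\<close>

type_synonym ('k, 'h, 'u) carrow =
  "('k, 'h, 'u) comod \<times> (('k, 'u) vec \<Rightarrow> ('k, 'u) vec) \<times> ('k, 'h, 'u) comod"

definition chom :: "('k::field, 'h::ab_group_add) coalg \<Rightarrow> ('k, 'h, 'u) comod \<Rightarrow>
    ('k, 'h, 'u) comod \<Rightarrow> ('k, 'h, 'u) carrow set"
  where "chom H X Y = {(X, f, Y) | f. lin_on pscale pscale (carr X) f \<and> f ` carr X \<subseteq> carr Y \<and>
    (\<forall>x\<in>carr X. coact Y (f x) = csw H X x (\<lambda>h y. htens H h (f y)))}"

definition cid :: "('k::field, 'h, 'u) comod \<Rightarrow> ('k, 'h, 'u) carrow"
  where "cid X = (X, \<lambda>x. if x \<in> carr X then x else 0, X)"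

definition ccomp :: "('k::field, 'h, 'u) carrow \<Rightarrow> ('k, 'h, 'u) carrow \<Rightarrow> ('k, 'h, 'u) carrow"
  where "ccomp b a = (case (b, a) of ((_, g, Z), (X, f, _)) \<Rightarrow> (X, g \<circ> f, Z))"

definition cadd :: "('k::field, 'h, 'u) carrow \<Rightarrow> ('k, 'h, 'u) carrow \<Rightarrow> ('k, 'h, 'u) carrow"
  where "cadd a b = (case (a, b) of ((X, f, Y), (_, g, _)) \<Rightarrow> (X, \<lambda>x. f x + g x, Y))"

definition csmul :: "'k::field \<Rightarrow> ('k, 'h, 'u) carrow \<Rightarrow> ('k, 'h, 'u) carrow"
  where "csmul c a = (case a of (X, f, Y) \<Rightarrow> (X, \<lambda>x. pscale c (f x), Y))"

definition kline :: "('k::field, 'h::ab_group_add) coalg \<Rightarrow> 'h \<Rightarrow> ('k, 'h, 'u) comod"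
  where "kline H g = \<lparr>carr = vspan {evec},
    coact = the_lin pscale tscale (vspan {evec}) (\<lambda>f. f evec = htens H g evec)\<rparr>"

definition ctens_carr :: "('k::field, 'h, 'u) comod \<Rightarrow> ('k, 'h, 'u) comod \<Rightarrow> ('k, 'u) vec set"
  where "ctens_carr X Y = vspan {x \<otimes>\<^sub>v y | x y. x \<in> carr X \<and> y \<in> carr Y}"

definition ctens :: "('k::field, 'h::ab_group_add) coalg \<Rightarrow> ('h \<Rightarrow> 'h \<Rightarrow> 'h) \<Rightarrow>
    ('k, 'h, 'u) comod \<Rightarrow> ('k, 'h, 'u) comod \<Rightarrow> ('k, 'h, 'u) comod"
  where "ctens H m X Y = \<lparr>carr = ctens_carr X Y,
    coact = the_lin pscale tscale (ctens_carr X Y) (\<lambda>f. \<forall>x\<in>carr X. \<forall>y\<in>carr Y.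
      f (x \<otimes>\<^sub>v y) = csw H X x (\<lambda>h x0. csw H Y y (\<lambda>k y0. htens H (m h k) (x0 \<otimes>\<^sub>v y0))))\<rparr>"

definition ctens_arr :: "('k::field, 'h::ab_group_add) coalg \<Rightarrow> ('h \<Rightarrow> 'h \<Rightarrow> 'h) \<Rightarrow>
    ('k, 'h, 'u) carrow \<Rightarrow> ('k, 'h, 'u) carrow \<Rightarrow> ('k, 'h, 'u) carrow"
  where "ctens_arr H m a b = (case (a, b) of ((X, f, X'), (Y, g, Y')) \<Rightarrow>
    (ctens H m X Y,
     the_lin pscale pscale (ctens_carr X Y) (\<lambda>p. \<forall>x\<in>carr X. \<forall>y\<in>carr Y. p (x \<otimes>\<^sub>v y) = f x \<otimes>\<^sub>v g y),
     ctens H m X' Y'))"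

definition cbraid_map :: "('k::field, 'h::ab_group_add) coalg \<Rightarrow> ('h \<Rightarrow> 'h \<Rightarrow> 'k) \<Rightarrow>
    ('k, 'h, 'u) comod \<Rightarrow> ('k, 'h, 'u) comod \<Rightarrow> ('k, 'u) vec \<Rightarrow> ('k, 'u) vec"
  where "cbraid_map H r X Y = the_lin pscale pscale (ctens_carr X Y) (\<lambda>f. \<forall>x\<in>carr X. \<forall>y\<in>carr Y.
    f (x \<otimes>\<^sub>v y) = csw H X x (\<lambda>h x0. csw H Y y (\<lambda>k y0. pscale (r h k) (y0 \<otimes>\<^sub>v x0))))"

definition comod_category :: "('k::field, 'h::ab_group_add) coalg \<Rightarrow> ('h \<Rightarrow> 'h \<Rightarrow> 'h) \<Rightarrow> 'h \<Rightarrow>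
    ('h \<Rightarrow> 'h \<Rightarrow> 'h \<Rightarrow> 'k) \<Rightarrow> ('h \<Rightarrow> 'h \<Rightarrow> 'k) \<Rightarrow>
    (('k, 'h, 'u) comod, ('k, 'h, 'u) carrow, 'k) bmcat"
  where "comod_category H m e \<Omega> r = \<lparr>
    Obj = {X. left_comodule H X},
    Hom = chom H, Idt = cid, Cmp = ccomp, Add = cadd, Smul = csmul,
    Unt = kline H e,
    Tob = ctens H m,
    Tar = ctens_arr H m,
    Asc = (\<lambda>X Y Z. (ctens H m (ctens H m X Y) Z,
      the_lin pscale pscale (ctens_carr (ctens H m X Y) Z)
        (\<lambda>f. \<forall>x\<in>carr X. \<forall>y\<in>carr Y. \<forall>z\<in>carr Z.
          f ((x \<otimes>\<^sub>v y) \<otimes>\<^sub>v z) =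
          csw H X x (\<lambda>h x0. csw H Y y (\<lambda>k y0. csw H Z z (\<lambda>l z0.
            pscale (\<Omega> h k l) (x0 \<otimes>\<^sub>v (y0 \<otimes>\<^sub>v z0)))))),
      ctens H m X (ctens H m Y Z))),
    Lun = (\<lambda>X. (ctens H m (kline H e) X,
      the_lin pscale pscale (ctens_carr (kline H e) X) (\<lambda>f. \<forall>x\<in>carr X. f (evec \<otimes>\<^sub>v x) = x), X)),
    Run = (\<lambda>X. (ctens H m X (kline H e),
      the_lin pscale pscale (ctens_carr X (kline H e)) (\<lambda>f. \<forall>x\<in>carr X. f (x \<otimes>\<^sub>v evec) = x), X)),
    Brd = (\<lambda>X Y. (ctens H m X Y, cbraid_map H r X Y, ctens H m Y X))\<rparr>"


section \<open>The braided zested category\<close>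

definition cdeg :: "('k::field, 'h::ring_1) coalg \<Rightarrow> ('h \<Rightarrow> ('g::ab_group_add \<Rightarrow>\<^sub>0 'k)) \<Rightarrow>
    ('k, 'h, 'u) comod \<Rightarrow> 'g \<Rightarrow> ('k, 'u) vec set"
  where "cdeg H \<pi> X s = {x \<in> carr X.
    csw H X x (\<lambda>h y. tens pscale pscale (\<pi> h) y) = tens pscale pscale (gbas s) x}"

definition chomog :: "('k::field, 'h::ring_1) coalg \<Rightarrow> ('h \<Rightarrow> ('g::ab_group_add \<Rightarrow>\<^sub>0 'k)) \<Rightarrow>
    ('k, 'h, 'u) comod \<Rightarrow> 'g \<Rightarrow> ('k, 'h, 'u) comod"
  where "chomog H \<pi> X s = \<lparr>carr = cdeg H \<pi> X s,
    coact = (\<lambda>x. if x \<in> cdeg H \<pi> X s then coact X x else 0)\<rparr>"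

text \<open>\<open>X\<^sub>a \<otimes> Y\<^sub>b \<otimes> \<Bbbk>\<lambda>(a, b)\<close>\<close>

definition zsummand :: "('k::field, 'h::ring_1) coalg \<Rightarrow> ('h \<Rightarrow> ('g::ab_group_add \<Rightarrow>\<^sub>0 'k)) \<Rightarrow>
    ('g \<Rightarrow> 'g \<Rightarrow> 'h) \<Rightarrow> ('k, 'h, 'u) comod \<Rightarrow> ('k, 'h, 'u) comod \<Rightarrow> 'g \<Rightarrow> 'g \<Rightarrow> ('k, 'h, 'u) comod"
  where "zsummand H \<pi> lam X Y a b =
    ctens H (*) (ctens H (*) (chomog H \<pi> X a) (chomog H \<pi> Y b)) (kline H (lam a b))"

text \<open>
  The (internal) direct sum of the comodules \<open>X\<^sub>a \<otimes> Y\<^sub>b \<otimes> \<Bbbk>\<lambda>(a, b)\<close>. All lines \<open>\<Bbbk>\<lambda>(a, b)\<close>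
  have the same underlying space \<open>\<Bbbk>\<close>, spanned by \<open>evec\<close>; they differ in their coaction.
\<close>

definition ztens_carr :: "('k::field, 'h::ring_1) coalg \<Rightarrow> ('h \<Rightarrow> ('g::ab_group_add \<Rightarrow>\<^sub>0 'k)) \<Rightarrow>
    ('g \<Rightarrow> 'g \<Rightarrow> 'h) \<Rightarrow> ('k, 'h, 'u) comod \<Rightarrow> ('k, 'h, 'u) comod \<Rightarrow> ('k, 'u) vec set"
  where "ztens_carr H \<pi> lam X Y = vspan (\<Union>a b. carr (zsummand H \<pi> lam X Y a b))"

definition ztens :: "('k::field, 'h::ring_1) coalg \<Rightarrow> ('h \<Rightarrow> ('g::ab_group_add \<Rightarrow>\<^sub>0 'k)) \<Rightarrow>
    ('g \<Rightarrow> 'g \<Rightarrow> 'h) \<Rightarrow> ('k, 'h, 'u) comod \<Rightarrow> ('k, 'h, 'u) comod \<Rightarrow> ('k, 'h, 'u) comod"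
  where "ztens H \<pi> lam X Y = \<lparr>carr = ztens_carr H \<pi> lam X Y,
    coact = the_lin pscale tscale (ztens_carr H \<pi> lam X Y)
      (\<lambda>f. \<forall>a b. \<forall>v\<in>carr (zsummand H \<pi> lam X Y a b). f v = coact (zsummand H \<pi> lam X Y a b) v)\<rparr>"

definition ztens_arr :: "('k::field, 'h::ring_1) coalg \<Rightarrow> ('h \<Rightarrow> ('g::ab_group_add \<Rightarrow>\<^sub>0 'k)) \<Rightarrow>
    ('g \<Rightarrow> 'g \<Rightarrow> 'h) \<Rightarrow> ('k, 'h, 'u) carrow \<Rightarrow> ('k, 'h, 'u) carrow \<Rightarrow> ('k, 'h, 'u) carrow"
  where "ztens_arr H \<pi> lam p q = (case (p, q) of ((X, f, X'), (Y, g, Y')) \<Rightarrow>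
    (ztens H \<pi> lam X Y,
     the_lin pscale pscale (ztens_carr H \<pi> lam X Y) (\<lambda>F. \<forall>x\<in>carr X. \<forall>y\<in>carr Y.
       F ((x \<otimes>\<^sub>v y) \<otimes>\<^sub>v evec) = (f x \<otimes>\<^sub>v g y) \<otimes>\<^sub>v evec),
     ztens H \<pi> lam X' Y'))"

text \<open>
  In the associator, the factor \<open>\<gamma>(\<lambda>(a, b))\<close> moves \<open>\<Bbbk>\<lambda>(a, b)\<close> past \<open>Z\<^sub>c\<close>, and
  \<open>\<omega>(a, b, c)\<close> is the isomorphism
  \<open>\<Bbbk>\<lambda>(a, b) \<otimes> \<Bbbk>\<lambda>(a + b, c) \<rightarrow> \<Bbbk>\<lambda>(b, c) \<otimes> \<Bbbk>\<lambda>(a, b + c)\<close>.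
\<close>

definition zested_category :: "('k::field, 'h::ring_1) coalg \<Rightarrow> ('h \<Rightarrow> 'h \<Rightarrow> 'k) \<Rightarrow>
    ('h \<Rightarrow> ('g::ab_group_add \<Rightarrow>\<^sub>0 'k)) \<Rightarrow>
    ('h \<Rightarrow> 'h \<Rightarrow> 'k) \<Rightarrow> ('g \<Rightarrow> 'g \<Rightarrow> 'h) \<Rightarrow> ('g \<Rightarrow> 'g \<Rightarrow> 'g \<Rightarrow> 'k) \<Rightarrow> ('g \<Rightarrow> 'g \<Rightarrow> 'k) \<Rightarrow>
    (('k, 'h, 'u) comod, ('k, 'h, 'u) carrow, 'k) bmcat"
  where "zested_category H r \<pi> \<gamma> lam \<omega> t = (let T = ztens H \<pi> lam; TC = ztens_carr H \<pi> lam in \<lparr>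
    Obj = {X. left_comodule H X},
    Hom = chom H, Idt = cid, Cmp = ccomp, Add = cadd, Smul = csmul,
    Unt = kline H 1,
    Tob = T,
    Tar = ztens_arr H \<pi> lam,
    Asc = (\<lambda>X Y Z. (T (T X Y) Z,
      the_lin pscale pscale (TC (T X Y) Z)
        (\<lambda>f. \<forall>a b c. \<forall>x\<in>cdeg H \<pi> X a. \<forall>y\<in>cdeg H \<pi> Y b. \<forall>z\<in>cdeg H \<pi> Z c.
          f ((((x \<otimes>\<^sub>v y) \<otimes>\<^sub>v evec) \<otimes>\<^sub>v z) \<otimes>\<^sub>v evec) =
          csw H Z z (\<lambda>l z0. pscale (\<gamma> (lam a b) l * \<omega> a b c)
            ((x \<otimes>\<^sub>v ((y \<otimes>\<^sub>v z0) \<otimes>\<^sub>v evec)) \<otimes>\<^sub>v evec))),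
      T X (T Y Z))),
    Lun = (\<lambda>X. (T (kline H 1) X,
      the_lin pscale pscale (TC (kline H 1) X)
        (\<lambda>f. \<forall>x\<in>carr X. f ((evec \<otimes>\<^sub>v x) \<otimes>\<^sub>v evec) = x), X)),
    Run = (\<lambda>X. (T X (kline H 1),
      the_lin pscale pscale (TC X (kline H 1))
        (\<lambda>f. \<forall>x\<in>carr X. f ((x \<otimes>\<^sub>v evec) \<otimes>\<^sub>v evec) = x), X)),
    Brd = (\<lambda>X Y. (T X Y,
      the_lin pscale pscale (TC X Y)
        (\<lambda>f. \<forall>a b. \<forall>x\<in>cdeg H \<pi> X a. \<forall>y\<in>cdeg H \<pi> Y b.
          f ((x \<otimes>\<^sub>v y) \<otimes>\<^sub>v evec) = pscale (t a b) (cbraid_map H r X Y (x \<otimes>\<^sub>v y) \<otimes>\<^sub>v evec)),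
      T Y X))\<rparr>)"

end

theory Submission
  imports Defs
begin

text \<open>
  Every identity between multilinear maps on \<open>H\<close> may be tested on homogeneous elements. There the
  structure maps of \<open>H\<^sup>\<lambda>\<close> are those of \<open>H\<close> up to scalars, multiplication by group-likes
  \<open>\<lambda>(a, b)\<close> and convolution with the algebra maps \<open>\<gamma>(\<lambda>(a, b))\<close>, and the axioms reduce to the
  cocycle conditions on \<open>\<lambda>\<close>, \<open>\<omega>\<close>, \<open>t\<close> and to two facts: \<open>\<gamma>(g)\<close> is the convolution inverse of
  \<open>r(-, g)\<close>, and \<open>r(g, -)\<close> agrees with \<open>\<chi>\<^sub>g(s) \<gamma>(g)\<close> in degree \<open>s\<close>.

  On the categorical side, \<open>v \<mapsto> v \<otimes> 1\<close> identifies the tensor product of \<open>H\<^sup>\<lambda>\<close>-comodules with the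
  zested one. All structure morphisms of the zested category are conjugate, under these
  isomorphisms, to those of the category of \<open>H\<^sup>\<lambda>\<close>-comodules. Hence the zested category is
  braided monoidal, and the identity functor together with these isomorphisms is a braided
  equivalence.
\<close>

section \<open>Transport of a braided structure\<close>

text \<open>Sweedler sums are evaluated on a chosen representation of a tensor, so each rewriting of
  such a sum carries multilinearity conditions on the summand; the rules \<open>lin\<close>
  discharge them by recursion on the term. Most structure maps are moreover definite descriptions:
  each one needs a witness, assembled from its values on homogeneous elements or pure tensors, and a
  uniqueness argument.

  The axioms of the comodule category become manageable by letting a multilinear form on
  \<open>H\<close> act on multilinear maps of comodules through the coactions. Acting twice is
  acting with the convolution product, the associator is the action of \<Omega> on a rebracketing,
  and the braiding is that of \<open>r\<close> on a flip. Colinearity, pentagon and hexagons thereby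
  turn into the corresponding equations of forms.

  The antipode of \<open>H\<^sup>\<lambda>\<close> is built, for \<open>h\<close> of degree a, from
  the component of degree -a of \<open>S h\<close> only, so that the effect of \<open>S\<close> on
  degrees never has to be determined.\<close>

lemma inv_arrow_eq:
  assumes "linear_category C" "X \<in> Obj C" "Y \<in> Obj C" "f \<in> Hom C X Y" "g \<in> Hom C Y X"
    "Cmp C g f = Idt C X" "Cmp C f g = Idt C Y"
  shows "inv_arrow C X Y f = g"
  unfolding inv_arrow_def
proof (rule the_equality)
  fix g' assume g': "g' \<in> Hom C Y X \<and> Cmp C g' f = Idt C X \<and> Cmp C f g' = Idt C Y"
  have as: "Cmp C g' (Cmp C f g) = Cmp C (Cmp C g' f) g"
    using assms(1-5) g' unfolding linear_category_def by meson
  have "Cmp C g' (Idt C Y) = g'" "Cmp C (Idt C X) g = g"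
    using assms(1-5) g' unfolding linear_category_def by meson+
  with as show "g' = g" using assms(6,7) g' by simp
qed (use assms in auto)

text \<open>The assumptions say that the identity functor with the constraint \<open>J\<close>
  respects the two structures, while no axiom of a monoidal category is assumed for
  \<open>D\<close>. Composition is associative for all arrows, composable or not, so that
  rebracketing a composite needs no membership conditions.\<close>

locale transported_category =
  fixes C D :: "('o, 'm, 'k::field) bmcat" and J :: "'o => 'o => 'm"
  assumes C: "braided_monoidal_category C"
    and same: "Obj D = Obj C" "Hom D = Hom C" "Idt D = Idt C" "Cmp D = Cmp C" "Add D = Add C"
      "Smul D = Smul C" "Unt D = Unt C"
    and assoc: "\<And>f g h. Cmp C (Cmp C h g) f = Cmp C h (Cmp C g f)"
    and Tob_D: "\<And>X Y. X \<in> Obj C ==> Y \<in> Obj C ==> Tob D X Y \<in> Obj C"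
    and J_iso: "\<And>X Y. X \<in> Obj C ==> Y \<in> Obj C ==> iso_in C (Tob D X Y) (Tob C X Y) (J X Y)"
    and Tar_D: "\<And>X X' Y Y' f g. X \<in> Obj C ==> X' \<in> Obj C ==> Y \<in> Obj C ==> Y' \<in> Obj C ==>
      f \<in> Hom C X X' ==> g \<in> Hom C Y Y' ==> Tar D f g \<in> Hom C (Tob D X Y) (Tob D X' Y')"
    and J_nat: "\<And>X X' Y Y' f g. X \<in> Obj C ==> X' \<in> Obj C ==> Y \<in> Obj C ==> Y' \<in> Obj C ==>
      f \<in> Hom C X X' ==> g \<in> Hom C Y Y' ==>
      Cmp C (J X' Y') (Tar D f g) = Cmp C (Tar C f g) (J X Y)"
    and Asc_D: "\<And>X Y Z. X \<in> Obj C ==> Y \<in> Obj C ==> Z \<in> Obj C ==>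
      Asc D X Y Z \<in> Hom C (Tob D (Tob D X Y) Z) (Tob D X (Tob D Y Z))"
    and J_Asc: "\<And>X Y Z. X \<in> Obj C ==> Y \<in> Obj C ==> Z \<in> Obj C ==>
      Cmp C (Asc C X Y Z) (Cmp C (J (Tob C X Y) Z) (Tar D (J X Y) (Idt C Z))) =
      Cmp C (J X (Tob C Y Z)) (Cmp C (Tar D (Idt C X) (J Y Z)) (Asc D X Y Z))"
    and J_Lun: "\<And>X. X \<in> Obj C ==> Cmp C (Lun C X) (J (Unt C) X) = Lun D X"
    and J_Run: "\<And>X. X \<in> Obj C ==> Cmp C (Run C X) (J X (Unt C)) = Run D X"
    and Brd_D: "\<And>X Y. X \<in> Obj C ==> Y \<in> Obj C ==> Brd D X Y \<in> Hom C (Tob D X Y) (Tob D Y X)"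
    and J_Brd: "\<And>X Y. X \<in> Obj C ==> Y \<in> Obj C ==>
      Cmp C (Brd C X Y) (J X Y) = Cmp C (J Y X) (Brd D X Y)"
begin

abbreviation comp (infixr "\<cdot>" 70) where "g \<cdot> f \<equiv> Cmp C g f"
abbreviation tc (infixr "\<otimes>" 75) where "X \<otimes> Y \<equiv> Tob C X Y"
abbreviation td (infixr "\<odot>" 75) where "X \<odot> Y \<equiv> Tob D X Y"
abbreviation ob where "ob X \<equiv> X \<in> Obj C"
abbreviation I where "I \<equiv> Idt C"

lemma monC: "monoidal_category C" and linC: "linear_category C"
  using C by (auto simp: braided_monoidal_category_def monoidal_category_def)

lemma linC_rules:
  "ob X ==> I X \<in> Hom C X X"
  "f \<in> Hom C X Y ==> g \<in> Hom C Y Z ==> ob X ==> ob Y ==> ob Z ==> g \<cdot> f \<in> Hom C X Z"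
  "f \<in> Hom C X Y ==> ob X ==> ob Y ==> f \<cdot> I X = f"
  "f \<in> Hom C X Y ==> ob X ==> ob Y ==> I Y \<cdot> f = f"
  using linC by (auto simp: linear_category_def)

lemma addC_rules:
  "f \<in> Hom C X Y ==> f' \<in> Hom C X Y ==> ob X ==> ob Y ==> Add C f f' \<in> Hom C X Y"
  "f \<in> Hom C X Y ==> ob X ==> ob Y ==> Smul C c f \<in> Hom C X Y"
  "f \<in> Hom C X Y ==> g \<in> Hom C Y Z ==> g' \<in> Hom C Y Z ==> ob X ==> ob Y ==> ob Z ==>
    Add C g g' \<cdot> f = Add C (g \<cdot> f) (g' \<cdot> f)"
  "f \<in> Hom C X Y ==> f' \<in> Hom C X Y ==> g \<in> Hom C Y Z ==> ob X ==> ob Y ==> ob Z ==>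
    g \<cdot> Add C f f' = Add C (g \<cdot> f) (g \<cdot> f')"
  "f \<in> Hom C X Y ==> g \<in> Hom C Y Z ==> ob X ==> ob Y ==> ob Z ==> Smul C c g \<cdot> f = Smul C c (g \<cdot> f)"
  "f \<in> Hom C X Y ==> g \<in> Hom C Y Z ==> ob X ==> ob Y ==> ob Z ==> g \<cdot> Smul C c f = Smul C c (g \<cdot> f)"
  using linC unfolding linear_category_def by meson+

lemma tensC_rules:
  "ob (Unt C)" "ob X ==> ob Y ==> ob (X \<otimes> Y)"
  "f \<in> Hom C X X' ==> g \<in> Hom C Y Y' ==> ob X ==> ob X' ==> ob Y ==> ob Y' ==>
     Tar C f g \<in> Hom C (X \<otimes> Y) (X' \<otimes> Y')"
  "f \<in> Hom C X X' ==> f' \<in> Hom C X X' ==> g \<in> Hom C Y Y' ==> ob X ==> ob X' ==> ob Y ==> ob Y' ==>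
     Tar C (Add C f f') g = Add C (Tar C f g) (Tar C f' g)"
  "f \<in> Hom C X X' ==> g \<in> Hom C Y Y' ==> g' \<in> Hom C Y Y' ==> ob X ==> ob X' ==> ob Y ==> ob Y' ==>
     Tar C f (Add C g g') = Add C (Tar C f g) (Tar C f g')"
  "f \<in> Hom C X X' ==> g \<in> Hom C Y Y' ==> ob X ==> ob X' ==> ob Y ==> ob Y' ==>
     Tar C (Smul C c f) g = Smul C c (Tar C f g)"
  "f \<in> Hom C X X' ==> g \<in> Hom C Y Y' ==> ob X ==> ob X' ==> ob Y ==> ob Y' ==>
     Tar C f (Smul C c g) = Smul C c (Tar C f g)"
  "ob X ==> ob Y ==> Tar C (I X) (I Y) = I (X \<otimes> Y)"
  "f \<in> Hom C X X' ==> f' \<in> Hom C X' X'' ==> g \<in> Hom C Y Y' ==> g' \<in> Hom C Y' Y'' ==>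
     ob X ==> ob X' ==> ob X'' ==> ob Y ==> ob Y' ==> ob Y'' ==>
     Tar C (f' \<cdot> f) (g' \<cdot> g) = Tar C f' g' \<cdot> Tar C f g"
  using monC unfolding monoidal_category_def by meson+

lemma cohC_rules:
  "ob X ==> ob Y ==> ob Z ==> iso_in C ((X \<otimes> Y) \<otimes> Z) (X \<otimes> (Y \<otimes> Z)) (Asc C X Y Z)"
  "f \<in> Hom C X X' ==> g \<in> Hom C Y Y' ==> h \<in> Hom C Z Z' ==>
    ob X ==> ob X' ==> ob Y ==> ob Y' ==> ob Z ==> ob Z' ==>
    Asc C X' Y' Z' \<cdot> Tar C (Tar C f g) h = Tar C f (Tar C g h) \<cdot> Asc C X Y Z"
  "ob X ==> iso_in C (Unt C \<otimes> X) X (Lun C X)" "ob X ==> iso_in C (X \<otimes> Unt C) X (Run C X)"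
  "f \<in> Hom C X Y ==> ob X ==> ob Y ==> Lun C Y \<cdot> Tar C (I (Unt C)) f = f \<cdot> Lun C X"
  "f \<in> Hom C X Y ==> ob X ==> ob Y ==> Run C Y \<cdot> Tar C f (I (Unt C)) = f \<cdot> Run C X"
  "ob X ==> ob Y ==> ob Z ==> ob W ==> Asc C X Y (Z \<otimes> W) \<cdot> Asc C (X \<otimes> Y) Z W =
       Tar C (I X) (Asc C Y Z W) \<cdot> Asc C X (Y \<otimes> Z) W \<cdot> Tar C (Asc C X Y Z) (I W)"
  "ob X ==> ob Y ==> Tar C (I X) (Lun C Y) \<cdot> Asc C X (Unt C) Y = Tar C (Run C X) (I Y)"
  using monC unfolding monoidal_category_def by meson+

lemma brdC_rules:
  "ob X ==> ob Y ==> iso_in C (X \<otimes> Y) (Y \<otimes> X) (Brd C X Y)"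
  "f \<in> Hom C X X' ==> g \<in> Hom C Y Y' ==> ob X ==> ob X' ==> ob Y ==> ob Y' ==>
    Brd C X' Y' \<cdot> Tar C f g = Tar C g f \<cdot> Brd C X Y"
  "ob X ==> ob Y ==> ob Z ==> Asc C Y Z X \<cdot> Brd C X (Y \<otimes> Z) \<cdot> Asc C X Y Z =
     Tar C (I Y) (Brd C X Z) \<cdot> Asc C Y X Z \<cdot> Tar C (Brd C X Y) (I Z)"
  "ob X ==> ob Y ==> ob Z ==> inv_Asc C Z X Y \<cdot> Brd C (X \<otimes> Y) Z \<cdot> inv_Asc C X Y Z =
     Tar C (Brd C X Z) (I Y) \<cdot> inv_Asc C X Z Y \<cdot> Tar C (I X) (Brd C Y Z)"
  using C unfolding braided_monoidal_category_def by meson+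

lemma iso_hom: "iso_in C X Y f ==> f \<in> Hom C X Y"
  by (simp add: iso_in_def)

lemma iso_comp:
  assumes "iso_in C X Y f" "iso_in C Y Z g" "ob X" "ob Y" "ob Z"
  shows "iso_in C X Z (g \<cdot> f)"
proof -
  obtain f' where f': "f' \<in> Hom C Y X" "f' \<cdot> f = I X" "f \<cdot> f' = I Y" using assms(1) by (auto simp: iso_in_def)
  obtain g' where g': "g' \<in> Hom C Z Y" "g' \<cdot> g = I Y" "g \<cdot> g' = I Z" using assms(2) by (auto simp: iso_in_def)
  note h = iso_hom[OF assms(1)] iso_hom[OF assms(2)]
  have "(f' \<cdot> g') \<cdot> g \<cdot> f = f' \<cdot> (g' \<cdot> g) \<cdot> f" "(g \<cdot> f) \<cdot> f' \<cdot> g' = g \<cdot> (f \<cdot> f') \<cdot> g'"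
    by (simp_all add: assoc)
  then have "(f' \<cdot> g') \<cdot> g \<cdot> f = I X" "(g \<cdot> f) \<cdot> f' \<cdot> g' = I Z"
    using f' g' h assms(3-5) by (simp_all add: linC_rules)
  then show ?thesis
    using f' g' h assms(3-5) by (auto simp: iso_in_def intro!: linC_rules(2)[of _ _ Y] bexI[of _ "f' \<cdot> g'"])
qed

lemma iso_mono:
  assumes "iso_in C Y Z j" "j \<cdot> f = j \<cdot> g" "f \<in> Hom C X Y" "g \<in> Hom C X Y" "ob X" "ob Y"
  shows "f = g"
proof -
  obtain j' where j': "j' \<cdot> j = I Y" using assms(1) by (auto simp: iso_in_def)
  have "j' \<cdot> j \<cdot> f = j' \<cdot> j \<cdot> g" by (simp add: assms(2))
  then show ?thesis using assms(3-6) by (simp add: assoc[symmetric] j' linC_rules)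
qed

text \<open>With \<open>g\<close> the inverse of \<open>j \<cdot> f\<close>, the inverse of
  \<open>f\<close> is \<open>g \<cdot> j\<close>; that it is a right inverse is checked after
  composing with the monomorphism \<open>j\<close>. Invertibility of the associator and of the
  braiding of \<open>D\<close> is obtained in this way.\<close>

lemma iso_cancel:
  assumes "iso_in C Y Z j" "iso_in C X Z (j \<cdot> f)" "f \<in> Hom C X Y" "ob X" "ob Y" "ob Z"
  shows "iso_in C X Y f"
proof -
  obtain g where g: "g \<in> Hom C Z X" "g \<cdot> j \<cdot> f = I X" "(j \<cdot> f) \<cdot> g = I Z"
    using assms(2) by (auto simp: iso_in_def)
  note j = iso_hom[OF assms(1)]
  have "f \<cdot> g \<cdot> j = I Y"
  proof (rule iso_mono[OF assms(1)])
    have "j \<cdot> f \<cdot> g \<cdot> j = ((j \<cdot> f) \<cdot> g) \<cdot> j" by (simp add: assoc)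
    also have "... = j \<cdot> I Y" using j assms by (simp add: g(3) linC_rules)
    finally show "j \<cdot> f \<cdot> g \<cdot> j = j \<cdot> I Y" .
    show "f \<cdot> g \<cdot> j \<in> Hom C Y Y"
      by (rule linC_rules(2)[OF linC_rules(2)[OF j g(1)] assms(3)]) (use assms in auto)
  qed (use assms in \<open>auto intro: linC_rules\<close>)
  moreover have "(g \<cdot> j) \<cdot> f = I X" using g(2) by (simp add: assoc)
  moreover have "g \<cdot> j \<in> Hom C Y X" by (rule linC_rules(2)[OF j g(1)]) (use assms in auto)
  ultimately show ?thesis using assms(3) by (auto simp: iso_in_def)
qed

lemma iso_Idt: "ob X ==> iso_in C X X (I X)"
  using linC_rules(1,3) by (auto simp: iso_in_def)

lemma iso_Tar:
  assumes "iso_in C X X' f" "iso_in C Y Y' g" "ob X" "ob X'" "ob Y" "ob Y'"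
  shows "iso_in C (X \<otimes> Y) (X' \<otimes> Y') (Tar C f g)"
proof -
  obtain f' where f': "f' \<in> Hom C X' X" "f' \<cdot> f = I X" "f \<cdot> f' = I X'" using assms(1) by (auto simp: iso_in_def)
  obtain g' where g': "g' \<in> Hom C Y' Y" "g' \<cdot> g = I Y" "g \<cdot> g' = I Y'" using assms(2) by (auto simp: iso_in_def)
  note h = iso_hom[OF assms(1)] iso_hom[OF assms(2)]
  have "Tar C f' g' \<cdot> Tar C f g = I (X \<otimes> Y)" "Tar C f g \<cdot> Tar C f' g' = I (X' \<otimes> Y')"
    using tensC_rules(9)[OF h(1) f'(1) h(2) g'(1)] tensC_rules(9)[OF f'(1) h(1) g'(1) h(2)] f' g' assms(3-6)
    by (simp_all add: tensC_rules)
  then show ?thesis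
    using tensC_rules(3)[OF h] tensC_rules(3)[OF f'(1) g'(1)] assms(3-6) unfolding iso_in_def by blast
qed

lemmas J_hom = iso_hom[OF J_iso]
lemmas ob_rules = tensC_rules(1,2) Tob_D
lemmas hom_rules = linC_rules(1) J_hom Tar_D Asc_D Brd_D

lemma Tar_D': "f \<in> Hom C X X' ==> g \<in> Hom C Y Y' ==> ob X ==> ob X' ==> ob Y ==> ob Y' ==>
  Tar D f g \<in> Hom C (X \<odot> Y) (X' \<odot> Y')"
  by (rule Tar_D)

text \<open>The axioms of \<open>D\<close> are tested after composition with comparison maps such as
  \<open>J\<close>, where naturality turns them into the axioms of \<open>C\<close>.\<close>

lemma J_mono:
  assumes "J X Y \<cdot> f = J X Y \<cdot> g" "f \<in> Hom C Z (X \<odot> Y)" "g \<in> Hom C Z (X \<odot> Y)" "ob X" "ob Y" "ob Z"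
  shows "f = g"
  by (rule iso_mono[OF J_iso assms(1-3)]) (use assms in \<open>auto intro: Tob_D\<close>)

lemma J_nat': 
  assumes "f \<in> Hom C X X'" "g \<in> Hom C Y Y'" "ob X" "ob X'" "ob Y" "ob Y'"
  shows "J X' Y' \<cdot> Tar D f g \<cdot> k = Tar C f g \<cdot> J X Y \<cdot> k"
  using J_nat[OF assms(3-6,1,2)] by (simp add: assoc[symmetric])

section \<open>Functoriality and linearity of the transported tensor product\<close>

lemma td_id: "ob X ==> ob Y ==> Tar D (I X) (I Y) = I (X \<odot> Y)"
  by (rule J_mono[of X Y _ _ "X \<odot> Y"])
    (auto simp: J_nat[of X X Y Y] linC_rules hom_rules tensC_rules ob_rules
      linC_rules(3)[OF J_hom] linC_rules(4)[OF J_hom])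

lemma td_comp:
  assumes "f \<in> Hom C X X'" "f' \<in> Hom C X' X''" "g \<in> Hom C Y Y'" "g' \<in> Hom C Y' Y''"
     "ob X" "ob X'" "ob X''" "ob Y" "ob Y'" "ob Y''"
  shows "Tar D f' g' \<cdot> Tar D f g = Tar D (f' \<cdot> f) (g' \<cdot> g)"
proof (rule J_mono[of X'' Y''])
  note c = linC_rules(2)[OF assms(1,2,5-7)] linC_rules(2)[OF assms(3,4,8-10)]
  have "J X'' Y'' \<cdot> Tar D f' g' \<cdot> Tar D f g = Tar C f' g' \<cdot> J X' Y' \<cdot> Tar D f g"
    by (rule J_nat'[OF assms(2,4,6,7,9,10)])
  also have "... = (Tar C f' g' \<cdot> Tar C f g) \<cdot> J X Y"
    by (simp only: J_nat[OF assms(5,6,8,9,1,3)] assoc)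
  also have "... = J X'' Y'' \<cdot> Tar D (f' \<cdot> f) (g' \<cdot> g)"
    by (simp only: J_nat[OF assms(5,7,8,10) c] tensC_rules(9)[OF assms])
  finally show "J X'' Y'' \<cdot> Tar D f' g' \<cdot> Tar D f g = J X'' Y'' \<cdot> Tar D (f' \<cdot> f) (g' \<cdot> g)" .
  show "Tar D f' g' \<cdot> Tar D f g \<in> Hom C (X \<odot> Y) (X'' \<odot> Y'')"
    by (rule linC_rules(2)[OF Tar_D[OF assms(5,6,8,9,1,3)] Tar_D[OF assms(6,7,9,10,2,4)]]) (intro Tob_D assms)+
  show "Tar D (f' \<cdot> f) (g' \<cdot> g) \<in> Hom C (X \<odot> Y) (X'' \<odot> Y'')"
    by (rule Tar_D[OF assms(5,7,8,10) c])
qed (intro Tob_D assms)+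

lemma td_linear:
  assumes f: "f \<in> Hom C X X'" and g: "g \<in> Hom C Y Y'" and o: "ob X" "ob X'" "ob Y" "ob Y'"
  shows "f' \<in> Hom C X X' ==> Tar D (Add C f f') g = Add C (Tar D f g) (Tar D f' g)"
    "g' \<in> Hom C Y Y' ==> Tar D f (Add C g g') = Add C (Tar D f g) (Tar D f g')"
    "Tar D (Smul C c f) g = Smul C c (Tar D f g)" "Tar D f (Smul C c g) = Smul C c (Tar D f g)"
proof -
  note T = Tar_D[OF o] and N = J_nat[OF o] and TC = tensC_rules(3)[OF _ _ o]
  note oT = Tob_D[OF o(1,3)] Tob_D[OF o(2,4)] tensC_rules(2)[OF o(1,3)] tensC_rules(2)[OF o(2,4)]
  note j = J_hom[OF o(1,3)] J_hom[OF o(2,4)]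
  note a1 = addC_rules(1)[OF _ _ o(1,2)] addC_rules(2)[OF _ o(1,2)] addC_rules(1)[OF _ _ o(3,4)] addC_rules(2)[OF _ o(3,4)]
  note a2 = addC_rules(1)[OF _ _ oT(1,2)] addC_rules(2)[OF _ oT(1,2)]
  note l = addC_rules(4)[OF _ _ j(2) oT(1,2,4)] addC_rules(6)[OF _ j(2) oT(1,2,4)]
    addC_rules(3)[OF j(1) _ _ oT(1,3,4)] addC_rules(5)[OF j(1) _ oT(1,3,4)]
  { assume f': "f' \<in> Hom C X X'"
    show "Tar D (Add C f f') g = Add C (Tar D f g) (Tar D f' g)"
      by (rule J_mono[OF _ T a2(1)]) (use f f' g o oT in \<open>simp_all add: N l a1 a2 T TC tensC_rules(4)\<close>) }
  { assume g': "g' \<in> Hom C Y Y'"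
    show "Tar D f (Add C g g') = Add C (Tar D f g) (Tar D f g')"
      by (rule J_mono[OF _ T a2(1)]) (use f g' g o oT in \<open>simp_all add: N l a1 a2 T TC tensC_rules(5)\<close>) }
  show "Tar D (Smul C c f) g = Smul C c (Tar D f g)"
    by (rule J_mono[OF _ T a2(2)]) (use f g o oT in \<open>simp_all add: N l a1 a2 T TC tensC_rules(6)\<close>)
  show "Tar D f (Smul C c g) = Smul C c (Tar D f g)"
    by (rule J_mono[OF _ T a2(2)]) (use f g o oT in \<open>simp_all add: N l a1 a2 T TC tensC_rules(7)\<close>)
qed

text \<open>\<open>J3l\<close> and \<open>J3r\<close> compare the two bracketings of a triple
  product in \<open>D\<close> with those in \<open>C\<close>; they conjugate the associator of
  \<open>D\<close> into that of \<open>C\<close>.\<close>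

definition J3l where "J3l X Y Z = J (X \<otimes> Y) Z \<cdot> Tar D (J X Y) (I Z)"
definition J3r where "J3r X Y Z = J X (Y \<otimes> Z) \<cdot> Tar D (I X) (J Y Z)"

context
  fixes X Y Z assumes o: "ob X" "ob Y" "ob Z"
begin

text \<open>Naturality of \<open>J\<close> with respect to the arrow \<open>J X Y\<close>. In this
  form the map is visibly a composite of isomorphisms.\<close>

lemma J3l_alt: "J3l X Y Z = Tar C (J X Y) (I Z) \<cdot> J (X \<odot> Y) Z"
  unfolding J3l_def by (rule J_nat) (intro o ob_rules J_hom linC_rules(1))+

lemma J3r_alt: "J3r X Y Z = Tar C (I X) (J Y Z) \<cdot> J X (Y \<odot> Z)"
  unfolding J3r_def by (rule J_nat) (intro o ob_rules J_hom linC_rules(1))+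

lemma J3l_iso: "iso_in C ((X \<odot> Y) \<odot> Z) ((X \<otimes> Y) \<otimes> Z) (J3l X Y Z)"
  unfolding J3l_alt by (rule iso_comp[of _ "(X \<odot> Y) \<otimes> Z"]) (intro J_iso iso_Tar iso_Idt o ob_rules)+

lemma J3r_iso: "iso_in C (X \<odot> (Y \<odot> Z)) (X \<otimes> (Y \<otimes> Z)) (J3r X Y Z)"
  unfolding J3r_alt by (rule iso_comp[of _ "X \<otimes> (Y \<odot> Z)"]) (intro J_iso iso_Tar iso_Idt o ob_rules)+

lemma J3_Asc: "J3r X Y Z \<cdot> Asc D X Y Z = Asc C X Y Z \<cdot> J3l X Y Z"
  unfolding J3l_def J3r_def using J_Asc[OF o] by (simp add: assoc)

lemma J3_Asc': "J3r X Y Z \<cdot> Asc D X Y Z \<cdot> k = Asc C X Y Z \<cdot> J3l X Y Z \<cdot> k"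
  using J3_Asc by (simp add: assoc[symmetric])

lemma Asc_D_iso: "iso_in C ((X \<odot> Y) \<odot> Z) (X \<odot> (Y \<odot> Z)) (Asc D X Y Z)"
proof (rule iso_cancel[OF J3r_iso])
  show "iso_in C ((X \<odot> Y) \<odot> Z) (X \<otimes> Y \<otimes> Z) (J3r X Y Z \<cdot> Asc D X Y Z)"
    unfolding J3_Asc by (rule iso_comp[OF J3l_iso cohC_rules(1)]) (intro o ob_rules)+
qed (intro o ob_rules Asc_D)+

text \<open>Both inverse associators are genuine inverses, so the second equation is
  \<open>J3_Asc\<close> multiplied by them on either side. The second hexagon is formulated with
  these inverses.\<close>

lemma inv_Asc_D:
  "inv_Asc D X Y Z \<in> Hom C (X \<odot> (Y \<odot> Z)) ((X \<odot> Y) \<odot> Z)"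
  "J3l X Y Z \<cdot> inv_Asc D X Y Z = inv_Asc C X Y Z \<cdot> J3r X Y Z"
proof -
  have inv: "inv_Asc E X Y Z \<in> Hom C B A \<and> inv_Asc E X Y Z \<cdot> a = I A \<and> a \<cdot> inv_Asc E X Y Z = I B"
    if i: "iso_in C A B a" "inv_Asc E X Y Z = inv_arrow C A B a" "ob A" "ob B" for E A B a
  proof -
    obtain b where b: "b \<in> Hom C B A" "b \<cdot> a = I A" "a \<cdot> b = I B" using i(1) by (auto simp: iso_in_def)
    show ?thesis
      using inv_arrow_eq[OF linC i(3,4) iso_hom[OF i(1)] b] b i(2) by simp
  qed
  have eD: "inv_Asc D X Y Z = inv_arrow C ((X \<odot> Y) \<odot> Z) (X \<odot> (Y \<odot> Z)) (Asc D X Y Z)"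
    by (simp add: inv_Asc_def inv_arrow_def same)
  note iD = inv[OF Asc_D_iso eD] and iC = inv[OF cohC_rules(1)[OF o] inv_Asc_def]
  note oo = o ob_rules
  show h: "inv_Asc D X Y Z \<in> Hom C (X \<odot> (Y \<odot> Z)) ((X \<odot> Y) \<odot> Z)"
    using iD by (simp add: oo)
  have "inv_Asc C X Y Z \<cdot> J3r X Y Z = inv_Asc C X Y Z \<cdot> J3r X Y Z \<cdot> Asc D X Y Z \<cdot> inv_Asc D X Y Z"
    using iD linC_rules(3)[OF iso_hom[OF J3r_iso]] by (simp add: oo)
  also have "... = (inv_Asc C X Y Z \<cdot> Asc C X Y Z) \<cdot> J3l X Y Z \<cdot> inv_Asc D X Y Z"
    by (simp add: assoc J3_Asc')
  also have "... = J3l X Y Z \<cdot> inv_Asc D X Y Z"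
    using iC linC_rules(4)[OF linC_rules(2)[OF h iso_hom[OF J3l_iso]]] by (simp add: oo)
  finally show "J3l X Y Z \<cdot> inv_Asc D X Y Z = inv_Asc C X Y Z \<cdot> J3r X Y Z" ..
qed

lemma inv_Asc_D': "J3l X Y Z \<cdot> inv_Asc D X Y Z \<cdot> k = inv_Asc C X Y Z \<cdot> J3r X Y Z \<cdot> k"
  using inv_Asc_D(2) by (simp add: assoc[symmetric])

end

context
  fixes X Y Z X' Y' Z' f g h
  assumes o: "ob X" "ob Y" "ob Z" and o': "ob X'" "ob Y'" "ob Z'"
    and fgh: "f \<in> Hom C X X'" "g \<in> Hom C Y Y'" "h \<in> Hom C Z Z'"
begin

lemma J3l_nat: "J3l X' Y' Z' \<cdot> Tar D (Tar D f g) h = Tar C (Tar C f g) h \<cdot> J3l X Y Z"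
proof -
  note oo = o o' ob_rules
  have "J3l X' Y' Z' \<cdot> Tar D (Tar D f g) h = J (X' \<otimes> Y') Z' \<cdot> Tar D (J X' Y' \<cdot> Tar D f g) (I Z' \<cdot> h)"
    by (simp add: J3l_def assoc td_comp[OF Tar_D'[OF fgh(1,2)] J_hom fgh(3) linC_rules(1)] oo)
  also have "... = J (X' \<otimes> Y') Z' \<cdot> Tar D (Tar C f g \<cdot> J X Y) (h \<cdot> I Z)"
    using fgh oo by (simp add: J_nat[of X X' Y Y'] linC_rules)
  also have "... = J (X' \<otimes> Y') Z' \<cdot> Tar D (Tar C f g) h \<cdot> Tar D (J X Y) (I Z)"
    by (simp add: td_comp[OF J_hom tensC_rules(3)[OF fgh(1,2)] linC_rules(1) fgh(3)] oo)
  also have "... = Tar C (Tar C f g) h \<cdot> J3l X Y Z"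
    unfolding J3l_def by (rule J_nat') (intro oo tensC_rules(3) fgh)+
  finally show ?thesis .
qed

lemma J3r_nat: "J3r X' Y' Z' \<cdot> Tar D f (Tar D g h) = Tar C f (Tar C g h) \<cdot> J3r X Y Z"
proof -
  note oo = o o' ob_rules
  have "J3r X' Y' Z' \<cdot> Tar D f (Tar D g h) = J X' (Y' \<otimes> Z') \<cdot> Tar D (I X' \<cdot> f) (J Y' Z' \<cdot> Tar D g h)"
    by (simp add: J3r_def assoc td_comp[OF fgh(1) linC_rules(1) Tar_D'[OF fgh(2,3)] J_hom] oo)
  also have "... = J X' (Y' \<otimes> Z') \<cdot> Tar D (f \<cdot> I X) (Tar C g h \<cdot> J Y Z)"
    using fgh oo by (simp add: J_nat[of Y Y' Z Z'] linC_rules)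
  also have "... = J X' (Y' \<otimes> Z') \<cdot> Tar D f (Tar C g h) \<cdot> Tar D (I X) (J Y Z)"
    by (simp add: td_comp[OF linC_rules(1) fgh(1) J_hom tensC_rules(3)[OF fgh(2,3)]] oo)
  also have "... = Tar C f (Tar C g h) \<cdot> J3r X Y Z"
    unfolding J3r_def by (rule J_nat') (intro oo tensC_rules(3) fgh)+
  finally show ?thesis .
qed

lemma Asc_D_nat: "Asc D X' Y' Z' \<cdot> Tar D (Tar D f g) h = Tar D f (Tar D g h) \<cdot> Asc D X Y Z"
proof (rule iso_mono[OF J3r_iso[of X' Y' Z']])
  note oo = o o' ob_rules
  have "J3r X' Y' Z' \<cdot> Asc D X' Y' Z' \<cdot> Tar D (Tar D f g) h = (Asc C X' Y' Z' \<cdot> Tar C (Tar C f g) h) \<cdot> J3l X Y Z"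
    by (simp add: J3_Asc' o' assoc J3l_nat)
  also have "... = Tar C f (Tar C g h) \<cdot> J3r X Y Z \<cdot> Asc D X Y Z"
    using fgh oo by (simp add: cohC_rules(2) assoc J3_Asc)
  also have "... = J3r X' Y' Z' \<cdot> Tar D f (Tar D g h) \<cdot> Asc D X Y Z"
    using arg_cong[OF J3r_nat, of "\<lambda>u. u \<cdot> Asc D X Y Z"] by (simp add: assoc)
  finally show "J3r X' Y' Z' \<cdot> Asc D X' Y' Z' \<cdot> Tar D (Tar D f g) h = J3r X' Y' Z' \<cdot> Tar D f (Tar D g h) \<cdot> Asc D X Y Z" .
  show "Asc D X' Y' Z' \<cdot> Tar D (Tar D f g) h \<in> Hom C ((X \<odot> Y) \<odot> Z) (X' \<odot> Y' \<odot> Z')"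
    by (rule linC_rules(2)[of _ _ "(X' \<odot> Y') \<odot> Z'"]) (intro oo Tar_D' Asc_D fgh)+
  show "Tar D f (Tar D g h) \<cdot> Asc D X Y Z \<in> Hom C ((X \<odot> Y) \<odot> Z) (X' \<odot> Y' \<odot> Z')"
    by (rule linC_rules(2)[of _ _ "X \<odot> Y \<odot> Z"]) (intro oo Tar_D' Asc_D fgh)+
qed (intro o o' ob_rules)+

end

lemma Brd_D_nat:
  assumes "f \<in> Hom C X X'" "g \<in> Hom C Y Y'" "ob X" "ob X'" "ob Y" "ob Y'"
  shows "Brd D X' Y' \<cdot> Tar D f g = Tar D g f \<cdot> Brd D X Y"
proof (rule J_mono[of Y' X'])
  have "J Y' X' \<cdot> Brd D X' Y' \<cdot> Tar D f g = Brd C X' Y' \<cdot> J X' Y' \<cdot> Tar D f g"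
    using J_Brd[OF assms(4,6)] by (simp add: assoc[symmetric])
  also have "... = (Brd C X' Y' \<cdot> Tar C f g) \<cdot> J X Y"
    by (simp add: J_nat[OF assms(3-6,1,2)] assoc)
  also have "... = Tar C g f \<cdot> J Y X \<cdot> Brd D X Y"
    using assms by (simp add: brdC_rules(2) assoc J_Brd)
  also have "... = J Y' X' \<cdot> Tar D g f \<cdot> Brd D X Y"
    by (rule J_nat'[symmetric, OF assms(2,1,5,6,3,4)])
  finally show "J Y' X' \<cdot> Brd D X' Y' \<cdot> Tar D f g = J Y' X' \<cdot> Tar D g f \<cdot> Brd D X Y" .
  show "Brd D X' Y' \<cdot> Tar D f g \<in> Hom C (X \<odot> Y) (Y' \<odot> X')"
    by (rule linC_rules(2)[of _ _ "X' \<odot> Y'"]) (intro ob_rules Tar_D' Brd_D assms)+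
  show "Tar D g f \<cdot> Brd D X Y \<in> Hom C (X \<odot> Y) (Y' \<odot> X')"
    by (rule linC_rules(2)[of _ _ "Y \<odot> X"]) (intro ob_rules Tar_D' Brd_D assms)+
qed (intro ob_rules assms)+

lemma Brd_D_iso: "ob X ==> ob Y ==> iso_in C (X \<odot> Y) (Y \<odot> X) (Brd D X Y)"
  by (rule iso_cancel[OF J_iso[of Y X]], unfold J_Brd[symmetric])
    (auto intro!: iso_comp[of _ "X \<otimes> Y"] J_iso brdC_rules(1) ob_rules Brd_D)

lemma unit_D:
  assumes "ob X"
  shows "iso_in C (Unt C \<odot> X) X (Lun D X)" "iso_in C (X \<odot> Unt C) X (Run D X)"
    "ob Y ==> f \<in> Hom C X Y ==> Lun D Y \<cdot> Tar D (I (Unt C)) f = f \<cdot> Lun D X"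
    "ob Y ==> f \<in> Hom C X Y ==> Run D Y \<cdot> Tar D f (I (Unt C)) = f \<cdot> Run D X"
proof -
  note u = tensC_rules(1)
  show "iso_in C (Unt C \<odot> X) X (Lun D X)" "iso_in C (X \<odot> Unt C) X (Run D X)"
    unfolding J_Lun[OF assms, symmetric] J_Run[OF assms, symmetric]
    by (rule iso_comp[OF J_iso cohC_rules(3)] iso_comp[OF J_iso cohC_rules(4)]; intro assms ob_rules)+
  assume Y: "ob Y" and f: "f \<in> Hom C X Y"
  have "Lun D Y \<cdot> Tar D (I (Unt C)) f = (Lun C Y \<cdot> Tar C (I (Unt C)) f) \<cdot> J (Unt C) X"
    unfolding J_Lun[OF Y, symmetric] by (simp add: assoc J_nat[OF u u assms Y linC_rules(1)[OF u] f])
  then show "Lun D Y \<cdot> Tar D (I (Unt C)) f = f \<cdot> Lun D X"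
    by (simp add: cohC_rules(5)[OF f assms Y] assoc J_Lun[OF assms])
  have "Run D Y \<cdot> Tar D f (I (Unt C)) = (Run C Y \<cdot> Tar C f (I (Unt C))) \<cdot> J X (Unt C)"
    unfolding J_Run[OF Y, symmetric] by (simp add: assoc J_nat[OF assms Y u u f linC_rules(1)[OF u]])
  then show "Run D Y \<cdot> Tar D f (I (Unt C)) = f \<cdot> Run D X"
    by (simp add: cohC_rules(6)[OF f assms Y] assoc J_Run[OF assms])
qed

lemma td_left: "f \<in> Hom C X X' ==> f' \<in> Hom C X' X'' ==> ob X ==> ob X' ==> ob X'' ==> ob Z ==>
  Tar D (f' \<cdot> f) (I Z) = Tar D f' (I Z) \<cdot> Tar D f (I Z)"
  using td_comp[of f X X' f' X'' "I Z" Z Z "I Z" Z] linC_rules(3)[OF linC_rules(1), of Z] by (simp add: linC_rules(1))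

lemma td_right: "f \<in> Hom C X X' ==> f' \<in> Hom C X' X'' ==> ob X ==> ob X' ==> ob X'' ==> ob Z ==>
  Tar D (I Z) (f' \<cdot> f) = Tar D (I Z) f' \<cdot> Tar D (I Z) f"
  using td_comp[of "I Z" Z Z "I Z" Z f X X' f' X''] linC_rules(3)[OF linC_rules(1), of Z] by (simp add: linC_rules(1))

lemma td_split: "f \<in> Hom C X X' ==> g \<in> Hom C Y Y' ==> ob X ==> ob X' ==> ob Y ==> ob Y' ==>
  Tar D f g = Tar D (I X') g \<cdot> Tar D f (I Y) \<and> Tar D f g = Tar D f (I Y') \<cdot> Tar D (I X) g"
  using td_comp[of f X X' "I X'" X' "I Y" Y Y g Y'] td_comp[of "I X" X X f X' g Y Y' "I Y'" Y'] by (simp add: linC_rules)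

section \<open>Triangle, hexagons and pentagon of the transported structure\<close>

lemma triangle_D:
  assumes o: "ob X" "ob Y"
  shows "Tar D (I X) (Lun D Y) \<cdot> Asc D X (Unt C) Y = Tar D (Run D X) (I Y)"
proof (rule J_mono[of X Y])
  let ?U = "Unt C"
  note oo = o ob_rules
  note L = iso_hom[OF cohC_rules(3)] and R = iso_hom[OF cohC_rules(4)]
  have "J X Y \<cdot> Tar D (I X) (Lun D Y) \<cdot> Asc D X ?U Y =
    J X Y \<cdot> Tar D (I X) (Lun C Y) \<cdot> Tar D (I X) (J ?U Y) \<cdot> Asc D X ?U Y"
    unfolding J_Lun[OF o(2), symmetric]
    by (subst td_right[OF J_hom L]) (simp_all add: oo assoc)
  also have "... = Tar C (I X) (Lun C Y) \<cdot> J3r X ?U Y \<cdot> Asc D X ?U Y"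
    by (subst J_nat'[OF linC_rules(1) L]) (simp_all add: oo assoc J3r_def)
  also have "... = (Tar C (I X) (Lun C Y) \<cdot> Asc C X ?U Y) \<cdot> J3l X ?U Y"
    by (simp add: J3_Asc oo assoc)
  also have "... = Tar C (Run C X) (I Y) \<cdot> J (X \<otimes> ?U) Y \<cdot> Tar D (J X ?U) (I Y)"
    by (simp add: cohC_rules(8) oo assoc J3l_def)
  also have "... = J X Y \<cdot> Tar D (Run C X) (I Y) \<cdot> Tar D (J X ?U) (I Y)"
    by (subst J_nat'[OF R linC_rules(1)]) (simp_all add: oo)
  also have "... = J X Y \<cdot> Tar D (Run D X) (I Y)"
    unfolding J_Run[OF o(1), symmetric]
    by (subst td_left[OF J_hom R]) (simp_all add: oo)
  finally show "J X Y \<cdot> Tar D (I X) (Lun D Y) \<cdot> Asc D X ?U Y = J X Y \<cdot> Tar D (Run D X) (I Y)" .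
  show "Tar D (I X) (Lun D Y) \<cdot> Asc D X ?U Y \<in> Hom C ((X \<odot> ?U) \<odot> Y) (X \<odot> Y)"
    by (rule linC_rules(2)[of _ _ "X \<odot> ?U \<odot> Y"]) (intro oo Asc_D Tar_D' linC_rules(1) iso_hom[OF unit_D(1)])+
  show "Tar D (Run D X) (I Y) \<in> Hom C ((X \<odot> ?U) \<odot> Y) (X \<odot> Y)"
    by (intro oo Tar_D' linC_rules(1) iso_hom[OF unit_D(2)])
qed (intro o ob_rules)+

text \<open>The squares \<open>e1\<close>, \<open>e2\<close>, \<open>e3\<close> show that each
  braiding in the hexagon, extended to three factors, is conjugate under \<open>J3l\<close> and
  \<open>J3r\<close> to its counterpart in \<open>C\<close>. Pasting them with the squares
  \<open>J3_Asc\<close> gives the hexagon of \<open>C\<close>.\<close>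

lemma hexagon1_D:
  assumes o: "ob X" "ob Y" "ob Z"
  shows "Asc D Y Z X \<cdot> Brd D X (Y \<odot> Z) \<cdot> Asc D X Y Z =
     Tar D (I Y) (Brd D X Z) \<cdot> Asc D Y X Z \<cdot> Tar D (Brd D X Y) (I Z)"
  (is "?L = ?R")
proof (rule iso_mono[OF J3r_iso[of Y Z X]])
  note oo = o ob_rules
  note BC = iso_hom[OF brdC_rules(1)]
  have e1: "J3l Y Z X \<cdot> Brd D X (Y \<odot> Z) = Brd C X (Y \<otimes> Z) \<cdot> J3r X Y Z"
  proof -
    have "J3l Y Z X \<cdot> Brd D X (Y \<odot> Z) = J (Y \<otimes> Z) X \<cdot> Brd D X (Y \<otimes> Z) \<cdot> Tar D (I X) (J Y Z)"
      by (simp add: J3l_def assoc Brd_D_nat[OF linC_rules(1) J_hom] oo)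
    also have "... = Brd C X (Y \<otimes> Z) \<cdot> J3r X Y Z"
      using J_Brd[of X "Y \<otimes> Z"] by (simp add: J3r_def assoc[symmetric] oo)
    finally show ?thesis .
  qed
  have e2: "J3r Y Z X \<cdot> Tar D (I Y) (Brd D X Z) = Tar C (I Y) (Brd C X Z) \<cdot> J3r Y X Z"
  proof -
    have "J3r Y Z X \<cdot> Tar D (I Y) (Brd D X Z) = J Y (Z \<otimes> X) \<cdot> Tar D (I Y) (J Z X \<cdot> Brd D X Z)"
      by (simp add: J3r_def assoc td_right[OF Brd_D J_hom] oo)
    also have "... = J Y (Z \<otimes> X) \<cdot> Tar D (I Y) (Brd C X Z) \<cdot> Tar D (I Y) (J X Z)"
      by (simp add: J_Brd[symmetric] td_right[OF J_hom BC] oo)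
    also have "... = Tar C (I Y) (Brd C X Z) \<cdot> J3r Y X Z"
      by (subst J_nat'[OF linC_rules(1) BC]) (simp_all add: oo J3r_def)
    finally show ?thesis .
  qed
  have e3: "J3l Y X Z \<cdot> Tar D (Brd D X Y) (I Z) = Tar C (Brd C X Y) (I Z) \<cdot> J3l X Y Z"
  proof -
    have "J3l Y X Z \<cdot> Tar D (Brd D X Y) (I Z) = J (Y \<otimes> X) Z \<cdot> Tar D (J Y X \<cdot> Brd D X Y) (I Z)"
      by (simp add: J3l_def assoc td_left[OF Brd_D J_hom] oo)
    also have "... = J (Y \<otimes> X) Z \<cdot> Tar D (Brd C X Y) (I Z) \<cdot> Tar D (J X Y) (I Z)"
      by (simp add: J_Brd[symmetric] td_left[OF J_hom BC] oo)
    also have "... = Tar C (Brd C X Y) (I Z) \<cdot> J3l X Y Z"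
      by (subst J_nat'[OF BC linC_rules(1)]) (simp_all add: oo J3l_def)
    finally show ?thesis .
  qed
  have e1': "J3l Y Z X \<cdot> Brd D X (Y \<odot> Z) \<cdot> k = Brd C X (Y \<otimes> Z) \<cdot> J3r X Y Z \<cdot> k"
    and e2': "J3r Y Z X \<cdot> Tar D (I Y) (Brd D X Z) \<cdot> k = Tar C (I Y) (Brd C X Z) \<cdot> J3r Y X Z \<cdot> k" for k
    using e1 e2 by (simp_all add: assoc[symmetric])
  have "J3r Y Z X \<cdot> ?L =
     (Asc C Y Z X \<cdot> Brd C X (Y \<otimes> Z) \<cdot> Asc C X Y Z) \<cdot> J3l X Y Z"
    by (simp add: J3_Asc' J3_Asc e1' assoc o)
  also have "... = (Tar C (I Y) (Brd C X Z) \<cdot> Asc C Y X Z \<cdot> Tar C (Brd C X Y) (I Z)) \<cdot> J3l X Y Z"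
    by (simp only: brdC_rules(3)[OF o])
  also have "... = J3r Y Z X \<cdot> ?R"
    by (simp add: J3_Asc' e2' e3 assoc o)
  finally show "J3r Y Z X \<cdot> ?L =
     J3r Y Z X \<cdot> ?R" .
  show "?L \<in> Hom C ((X \<odot> Y) \<odot> Z) (Y \<odot> Z \<odot> X)"
    by (rule linC_rules(2)[OF linC_rules(2)[OF Asc_D Brd_D] Asc_D]) (intro oo)+
  show "?R \<in> Hom C ((X \<odot> Y) \<odot> Z) (Y \<odot> Z \<odot> X)"
    by (rule linC_rules(2)[OF linC_rules(2)[OF Tar_D[OF _ _ _ _ Brd_D linC_rules(1)] Asc_D] Tar_D[OF _ _ _ _ linC_rules(1) Brd_D]]) (intro oo)+
qed (intro o ob_rules)+

lemma hexagon2_D: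
  assumes o: "ob X" "ob Y" "ob Z"
  shows "inv_Asc D Z X Y \<cdot> Brd D (X \<odot> Y) Z \<cdot> inv_Asc D X Y Z =
     Tar D (Brd D X Z) (I Y) \<cdot> inv_Asc D X Z Y \<cdot> Tar D (I X) (Brd D Y Z)"
  (is "?L = ?R")
proof (rule iso_mono[OF J3l_iso[of Z X Y]])
  note oo = o ob_rules
  note BC = iso_hom[OF brdC_rules(1)]
  have e1: "J3r Z X Y \<cdot> Brd D (X \<odot> Y) Z = Brd C (X \<otimes> Y) Z \<cdot> J3l X Y Z"
  proof -
    have "J3r Z X Y \<cdot> Brd D (X \<odot> Y) Z = J Z (X \<otimes> Y) \<cdot> Brd D (X \<otimes> Y) Z \<cdot> Tar D (J X Y) (I Z)"
      by (simp add: J3r_def assoc Brd_D_nat[OF J_hom linC_rules(1)] oo)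
    also have "... = Brd C (X \<otimes> Y) Z \<cdot> J3l X Y Z"
      using J_Brd[of "X \<otimes> Y" Z] by (simp add: J3l_def assoc[symmetric] oo)
    finally show ?thesis .
  qed
  have e2: "J3l Z X Y \<cdot> Tar D (Brd D X Z) (I Y) = Tar C (Brd C X Z) (I Y) \<cdot> J3l X Z Y"
  proof -
    have "J3l Z X Y \<cdot> Tar D (Brd D X Z) (I Y) = J (Z \<otimes> X) Y \<cdot> Tar D (J Z X \<cdot> Brd D X Z) (I Y)"
      by (simp add: J3l_def assoc td_left[OF Brd_D J_hom] oo)
    also have "... = J (Z \<otimes> X) Y \<cdot> Tar D (Brd C X Z) (I Y) \<cdot> Tar D (J X Z) (I Y)"
      by (simp add: J_Brd[symmetric] td_left[OF J_hom BC] oo)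
    also have "... = Tar C (Brd C X Z) (I Y) \<cdot> J3l X Z Y"
      by (subst J_nat'[OF BC linC_rules(1)]) (simp_all add: oo J3l_def)
    finally show ?thesis .
  qed
  have e3: "J3r X Z Y \<cdot> Tar D (I X) (Brd D Y Z) = Tar C (I X) (Brd C Y Z) \<cdot> J3r X Y Z"
  proof -
    have "J3r X Z Y \<cdot> Tar D (I X) (Brd D Y Z) = J X (Z \<otimes> Y) \<cdot> Tar D (I X) (J Z Y \<cdot> Brd D Y Z)"
      by (simp add: J3r_def assoc td_right[OF Brd_D J_hom] oo)
    also have "... = J X (Z \<otimes> Y) \<cdot> Tar D (I X) (Brd C Y Z) \<cdot> Tar D (I X) (J Y Z)"
      by (simp add: J_Brd[symmetric] td_right[OF J_hom BC] oo)
    also have "... = Tar C (I X) (Brd C Y Z) \<cdot> J3r X Y Z"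
      by (subst J_nat'[OF linC_rules(1) BC]) (simp_all add: oo J3r_def)
    finally show ?thesis .
  qed
  have e1': "J3r Z X Y \<cdot> Brd D (X \<odot> Y) Z \<cdot> k = Brd C (X \<otimes> Y) Z \<cdot> J3l X Y Z \<cdot> k"
    and e2': "J3l Z X Y \<cdot> Tar D (Brd D X Z) (I Y) \<cdot> k = Tar C (Brd C X Z) (I Y) \<cdot> J3l X Z Y \<cdot> k" for k
    using e1 e2 by (simp_all add: assoc[symmetric])
  have "J3l Z X Y \<cdot> ?L =
     (inv_Asc C Z X Y \<cdot> Brd C (X \<otimes> Y) Z \<cdot> inv_Asc C X Y Z) \<cdot> J3r X Y Z"
    by (simp add: inv_Asc_D' inv_Asc_D(2) e1' assoc o)
  also have "... = (Tar C (Brd C X Z) (I Y) \<cdot> inv_Asc C X Z Y \<cdot> Tar C (I X) (Brd C Y Z)) \<cdot> J3r X Y Z"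
    by (simp only: brdC_rules(4)[OF o])
  also have "... = J3l Z X Y \<cdot> ?R"
    by (simp add: inv_Asc_D' e2' e3 assoc o)
  finally show "J3l Z X Y \<cdot> ?L =
     J3l Z X Y \<cdot> ?R" .
  show "?L \<in> Hom C (X \<odot> Y \<odot> Z) ((Z \<odot> X) \<odot> Y)"
    by (rule linC_rules(2)[OF linC_rules(2)[OF inv_Asc_D(1) Brd_D] inv_Asc_D(1)]) (intro oo)+
  show "?R \<in> Hom C (X \<odot> Y \<odot> Z) ((Z \<odot> X) \<odot> Y)"
    by (rule linC_rules(2)[OF linC_rules(2)[OF Tar_D[OF _ _ _ _ linC_rules(1) Brd_D] inv_Asc_D(1)] Tar_D[OF _ _ _ _ Brd_D linC_rules(1)]]) (intro oo)+
qed (intro o ob_rules)+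

text \<open>The comparison maps \<open>K1\<close> to \<open>K5\<close>, one for each bracketing of
  four factors, conjugate the five edges of the pentagon in \<open>D\<close> to those in
  \<open>C\<close>. The map \<open>K5\<close> sits at the common end of both paths and is
  cancelled.\<close>

lemma pentagon_D:
  assumes o: "ob X" "ob Y" "ob Z" "ob W"
  shows "Asc D X Y (Z \<odot> W) \<cdot> Asc D (X \<odot> Y) Z W =
       Tar D (I X) (Asc D Y Z W) \<cdot> Asc D X (Y \<odot> Z) W \<cdot> Tar D (Asc D X Y Z) (I W)"
  (is "?L = ?R")
proof -
  note oo = o ob_rules
  note ho = J_hom linC_rules(1) Tar_D Asc_D
  note AC = iso_hom[OF cohC_rules(1)]
  define K1 where "K1 = J ((X \<otimes> Y) \<otimes> Z) W \<cdot> Tar D (J3l X Y Z) (I W)"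
  define K2 where "K2 = J (X \<otimes> Y) (Z \<otimes> W) \<cdot> Tar D (J X Y) (J Z W)"
  define K3 where "K3 = J (X \<otimes> (Y \<otimes> Z)) W \<cdot> Tar D (J3r X Y Z) (I W)"
  define K4 where "K4 = J X ((Y \<otimes> Z) \<otimes> W) \<cdot> Tar D (I X) (J3l Y Z W)"
  define K5 where "K5 = J X (Y \<otimes> (Z \<otimes> W)) \<cdot> Tar D (I X) (J3r Y Z W)"
  \<comment> \<open>The comparison maps are factored in two ways: one suits an associator of three
    factors tensored with an identity, the other an associator for which a product counts as one
    factor.\<close>
  have K1: "K1 = J3l (X \<otimes> Y) Z W \<cdot> Tar D (Tar D (J X Y) (I Z)) (I W)"
    unfolding K1_def J3l_def by (subst td_left[of _ "(X \<odot> Y) \<odot> Z" "(X \<otimes> Y) \<odot> Z" _ "(X \<otimes> Y) \<otimes> Z"]) (simp_all add: oo ho assoc)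
  have K3: "K3 = J3l X (Y \<otimes> Z) W \<cdot> Tar D (Tar D (I X) (J Y Z)) (I W)"
    unfolding K3_def J3l_def J3r_def by (subst td_left[of _ "X \<odot> (Y \<odot> Z)" "X \<odot> (Y \<otimes> Z)" _ "X \<otimes> (Y \<otimes> Z)"]) (simp_all add: oo ho assoc)
  have K4: "K4 = J3r X (Y \<otimes> Z) W \<cdot> Tar D (I X) (Tar D (J Y Z) (I W))"
    unfolding K4_def J3l_def J3r_def by (subst td_right[of _ "(Y \<odot> Z) \<odot> W" "(Y \<otimes> Z) \<odot> W" _ "(Y \<otimes> Z) \<otimes> W"]) (simp_all add: oo ho assoc)
  have K5: "K5 = J3r X Y (Z \<otimes> W) \<cdot> Tar D (I X) (Tar D (I Y) (J Z W))"
    unfolding K5_def J3r_def by (subst td_right[of _ "Y \<odot> (Z \<odot> W)" "Y \<odot> (Z \<otimes> W)" _ "Y \<otimes> (Z \<otimes> W)"]) (simp_all add: oo ho assoc)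
  \<comment> \<open>The two tensor factors are compared in either order, because one adjacent
    associator takes \<open>X\<close>, \<open>Y\<close> as a single factor and the other takes
    \<open>Z\<close>, \<open>W\<close>.\<close>
  have split: "Tar D (J X Y) (J Z W) = Tar D (I (X \<otimes> Y)) (J Z W) \<cdot> Tar D (J X Y) (I (Z \<odot> W)) \<and>
    Tar D (J X Y) (J Z W) = Tar D (J X Y) (I (Z \<otimes> W)) \<cdot> Tar D (I (X \<odot> Y)) (J Z W)"
    by (rule td_split[OF J_hom J_hom]) (intro oo)+
  have e12: "K2 \<cdot> Asc D (X \<odot> Y) Z W = Asc C (X \<otimes> Y) Z W \<cdot> K1"
  proof -
    have "Asc C (X \<otimes> Y) Z W \<cdot> K1 = J3r (X \<otimes> Y) Z W \<cdot> Asc D (X \<otimes> Y) Z W \<cdot> Tar D (Tar D (J X Y) (I Z)) (I W)"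
      by (simp add: K1 J3_Asc' oo)
    also have "... = J3r (X \<otimes> Y) Z W \<cdot> Tar D (J X Y) (I (Z \<odot> W)) \<cdot> Asc D (X \<odot> Y) Z W"
      by (subst Asc_D_nat[OF _ _ _ _ _ _ J_hom linC_rules(1) linC_rules(1)]) (simp_all add: oo td_id)
    also have "... = K2 \<cdot> Asc D (X \<odot> Y) Z W"
      unfolding K2_def split[THEN conjunct1] J3r_def by (simp add: assoc)
    finally show ?thesis ..
  qed
  have e25: "K5 \<cdot> Asc D X Y (Z \<odot> W) = Asc C X Y (Z \<otimes> W) \<cdot> K2"
  proof -
    have "Asc C X Y (Z \<otimes> W) \<cdot> K2 = J3r X Y (Z \<otimes> W) \<cdot> Asc D X Y (Z \<otimes> W) \<cdot> Tar D (Tar D (I X) (I Y)) (J Z W)"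
      unfolding K2_def split[THEN conjunct2] using J3_Asc'[of X Y "Z \<otimes> W"] by (simp add: J3l_def assoc oo td_id)
    also have "... = J3r X Y (Z \<otimes> W) \<cdot> Tar D (I X) (Tar D (I Y) (J Z W)) \<cdot> Asc D X Y (Z \<odot> W)"
      by (subst Asc_D_nat[OF _ _ _ _ _ _ linC_rules(1) linC_rules(1) J_hom]) (simp_all add: oo)
    also have "... = K5 \<cdot> Asc D X Y (Z \<odot> W)"
      unfolding K5 by (simp add: assoc)
    finally show ?thesis ..
  qed
  have e13: "K3 \<cdot> Tar D (Asc D X Y Z) (I W) = Tar C (Asc C X Y Z) (I W) \<cdot> K1"
  proof -
    have "K3 \<cdot> Tar D (Asc D X Y Z) (I W) = J (X \<otimes> (Y \<otimes> Z)) W \<cdot> Tar D (Asc C X Y Z \<cdot> J3l X Y Z) (I W)"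
      unfolding K3_def by (simp add: assoc td_left[OF Asc_D iso_hom[OF J3r_iso], symmetric] oo J3_Asc)
    also have "... = J (X \<otimes> (Y \<otimes> Z)) W \<cdot> Tar D (Asc C X Y Z) (I W) \<cdot> Tar D (J3l X Y Z) (I W)"
      by (simp add: td_left[OF iso_hom[OF J3l_iso] AC] oo)
    also have "... = Tar C (Asc C X Y Z) (I W) \<cdot> K1"
      unfolding K1_def by (subst J_nat'[OF AC linC_rules(1)]) (simp_all add: oo)
    finally show ?thesis .
  qed
  have e45: "K5 \<cdot> Tar D (I X) (Asc D Y Z W) = Tar C (I X) (Asc C Y Z W) \<cdot> K4"
  proof -
    have "K5 \<cdot> Tar D (I X) (Asc D Y Z W) = J X (Y \<otimes> (Z \<otimes> W)) \<cdot> Tar D (I X) (Asc C Y Z W \<cdot> J3l Y Z W)"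
      unfolding K5_def by (simp add: assoc td_right[OF Asc_D iso_hom[OF J3r_iso], symmetric] oo J3_Asc)
    also have "... = J X (Y \<otimes> (Z \<otimes> W)) \<cdot> Tar D (I X) (Asc C Y Z W) \<cdot> Tar D (I X) (J3l Y Z W)"
      by (simp add: td_right[OF iso_hom[OF J3l_iso] AC] oo)
    also have "... = Tar C (I X) (Asc C Y Z W) \<cdot> K4"
      unfolding K4_def by (subst J_nat'[OF linC_rules(1) AC]) (simp_all add: oo)
    finally show ?thesis .
  qed
  have e34: "K4 \<cdot> Asc D X (Y \<odot> Z) W = Asc C X (Y \<otimes> Z) W \<cdot> K3"
  proof -
    have "Asc C X (Y \<otimes> Z) W \<cdot> K3 = J3r X (Y \<otimes> Z) W \<cdot> Asc D X (Y \<otimes> Z) W \<cdot> Tar D (Tar D (I X) (J Y Z)) (I W)"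
      by (simp add: K3 J3_Asc' oo)
    also have "... = J3r X (Y \<otimes> Z) W \<cdot> Tar D (I X) (Tar D (J Y Z) (I W)) \<cdot> Asc D X (Y \<odot> Z) W"
      by (subst Asc_D_nat[OF _ _ _ _ _ _ linC_rules(1) J_hom linC_rules(1)]) (simp_all add: oo)
    also have "... = K4 \<cdot> Asc D X (Y \<odot> Z) W"
      unfolding K4 by (simp add: assoc)
    finally show ?thesis ..
  qed
  have K5_iso: "iso_in C (X \<odot> (Y \<odot> (Z \<odot> W))) (X \<otimes> (Y \<otimes> (Z \<otimes> W))) K5"
  proof -
    have "K5 = Tar C (I X) (J3r Y Z W) \<cdot> J X (Y \<odot> (Z \<odot> W))"
      unfolding K5_def by (rule J_nat) (intro oo linC_rules(1) iso_hom[OF J3r_iso])+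
    then show ?thesis
      by (auto intro!: iso_comp[of _ "X \<otimes> (Y \<odot> (Z \<odot> W))"] iso_Tar iso_Idt J_iso J3r_iso oo)
  qed
  show ?thesis
  proof (rule iso_mono[OF K5_iso])
    have "K5 \<cdot> ?L = (K5 \<cdot> Asc D X Y (Z \<odot> W)) \<cdot> Asc D (X \<odot> Y) Z W"
      by (simp add: assoc)
    also have "... = (Asc C X Y (Z \<otimes> W) \<cdot> Asc C (X \<otimes> Y) Z W) \<cdot> K1"
      by (simp add: e25 assoc e12)
    also have "... = Tar C (I X) (Asc C Y Z W) \<cdot> Asc C X (Y \<otimes> Z) W \<cdot> K3 \<cdot> Tar D (Asc D X Y Z) (I W)"
      by (simp add: cohC_rules(7)[OF o] assoc e13)
    also have "... = Tar C (I X) (Asc C Y Z W) \<cdot> (Asc C X (Y \<otimes> Z) W \<cdot> K3) \<cdot> Tar D (Asc D X Y Z) (I W)"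
      by (simp add: assoc)
    also have "... = (Tar C (I X) (Asc C Y Z W) \<cdot> K4) \<cdot> Asc D X (Y \<odot> Z) W \<cdot> Tar D (Asc D X Y Z) (I W)"
      unfolding e34[symmetric] by (simp add: assoc)
    also have "... = K5 \<cdot> ?R"
      unfolding e45[symmetric] by (simp add: assoc)
    finally show "K5 \<cdot> ?L =
       K5 \<cdot> ?R" .
    show "?L \<in> Hom C (((X \<odot> Y) \<odot> Z) \<odot> W) (X \<odot> (Y \<odot> (Z \<odot> W)))"
      by (rule linC_rules(2)[OF Asc_D Asc_D]) (intro oo)+
    show "?R \<in> Hom C (((X \<odot> Y) \<odot> Z) \<odot> W) (X \<odot> (Y \<odot> (Z \<odot> W)))"
      by (rule linC_rules(2)[OF linC_rules(2)[OF Tar_D[OF _ _ _ _ Asc_D linC_rules(1)] Asc_D] Tar_D[OF _ _ _ _ linC_rules(1) Asc_D]]) (intro oo)+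
  qed (intro oo)+
qed

lemma braided_D: "braided_monoidal_category D"
proof -
  have lin: "linear_category D"
    using linC unfolding linear_category_def same .
  have mon: "monoidal_category D"
    unfolding monoidal_category_def same iso_in_def[of D]
    unfolding iso_in_def[of C, symmetric]
    by (intro conjI ballI allI lin tensC_rules(1))
      (assumption | rule Tob_D Tar_D td_linear td_id td_comp[symmetric] Asc_D_iso Asc_D_nat unit_D pentagon_D triangle_D)+
  show ?thesis
    unfolding braided_monoidal_category_def same iso_in_def[of D]
    unfolding iso_in_def[of C, symmetric]
    by (intro conjI ballI mon) (assumption | rule Brd_D_iso Brd_D_nat hexagon1_D hexagon2_D)+
qed

theorem equivalent: "braided_tensor_equivalent C D"
proof -
  have linF: "linear_functor C D (\<lambda>X. X) (\<lambda>X Y f. f)" "linear_functor D C (\<lambda>X. X) (\<lambda>X Y f. f)"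
    using linC_rules(1) by (auto simp: linear_functor_def same)
  have iso: "iso_in D X Y f \<longleftrightarrow> iso_in C X Y f" for X Y f by (simp add: iso_in_def same)
  have eq: "equivalence_functor C D (\<lambda>X. X) (\<lambda>X Y f. f)"
    unfolding equivalence_functor_def natural_iso_def iso same
    by (intro conjI linF exI[of _ "\<lambda>X. X"] exI[of _ "\<lambda>X Y f. f"] exI[of _ I])
      (auto simp: linF iso_Idt linC_rules)
  have "braided_monoidal_functor C D (\<lambda>X. X) (\<lambda>X Y f. f) J (I (Unt C))"
    unfolding braided_monoidal_functor_def iso same
    using J_Asc J_Lun J_Run J_Brd J_nat
    by (auto simp: linF tensC_rules(1) iso_Idt J_iso td_id linC_rules(3)[OF J_hom] Tob_D ob_rules)
  with eq show ?thesis
    using C braided_D by (auto simp: braided_tensor_equivalent_def)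
qed

end

section \<open>Linear maps and tensors\<close>

notation vten (infixr "\<otimes>" 75)

text \<open>Linearity on \<open>V\<close> with no condition on the values outside \<open>V\<close>
  and none on the scalings. It is thus a property that rules can derive by following the shape of a
  term; \<open>lin_on\<close> adds the convention of vanishing outside.\<close>

definition linv ::
  "('k::field => 'a::ab_group_add => 'a) => 'a set => ('k => 'b::ab_group_add => 'b) =>
   ('a => 'b) => bool"
  where "linv s1 V s2 f \<longleftrightarrow> (\<forall>x\<in>V. \<forall>y\<in>V. f (x + y) = f x + f y) \<and> (\<forall>c. \<forall>x\<in>V. f (s1 c x) = s2 c (f x))"

named_theorems lin

lemma vsF [simp]: "vector_space ((*) :: 'k::field => 'k => 'k)"
  by unfold_locales (auto simp: algebra_simps)

lemma vsT [simp]: "vector_space (tscale :: 'k::field => ('x => 'k) => 'x => 'k)"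
  by unfold_locales (auto simp: tscale_def algebra_simps fun_eq_iff)

lemma lookup_pscale [simp]: "Poly_Mapping.lookup (pscale c p) i = c * Poly_Mapping.lookup p i"
  by (simp add: pscale_def Poly_Mapping.map.rep_eq when_def)

lemma vsP [simp]: "vector_space (pscale :: 'k::field => ('i \<Rightarrow>\<^sub>0 'k) => _)"
  by unfold_locales (auto intro!: poly_mapping_eqI simp: lookup_add algebra_simps)

lemma vs_module: "vector_space s ==> module s"
  by (simp add: module_iff_vector_space)

lemma vs_rules:
  assumes "vector_space s"
  shows "s c (x + y) = s c x + s c y" "s (c + d) x = s c x + s d x" "s c (s d x) = s (c * d) x"
    "s 1 x = x" "s c 0 = 0" "s 0 x = 0" "s c (- x) = - s c x" "s c (x - y) = s c x - s c y"
proof -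
  interpret vector_space s by fact
  show "s c (x + y) = s c x + s c y" "s (c + d) x = s c x + s d x" "s c (s d x) = s (c * d) x"
    "s 1 x = x" "s c 0 = 0" "s 0 x = 0" "s c (- x) = - s c x" "s c (x - y) = s c x - s c y"
    by (auto simp: scale_right_distrib scale_left_distrib scale_right_diff_distrib)
qed

lemma linear_iff_linv:
  "Vector_Spaces.linear s1 s2 f \<longleftrightarrow> vector_space s1 \<and> vector_space s2 \<and> linv s1 UNIV s2 f"
  unfolding Vector_Spaces.linear_def module_hom_def module_hom_axioms_def linv_def
  by (auto simp: module_iff_vector_space)

lemma bilin_iff_linv:
  "bilin s1 s2 s3 F \<longleftrightarrow> vector_space s1 \<and> vector_space s2 \<and> vector_space s3 \<and>
     (\<forall>a. linv s2 UNIV s3 (F a)) \<and> (\<forall>b. linv s1 UNIV s3 (\<lambda>a. F a b))"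
  by (auto simp: bilin_def linear_iff_linv)

lemma linvD:
  assumes "linv s1 V s2 f" "x \<in> V"
  shows "y \<in> V ==> f (x + y) = f x + f y" "f (s1 c x) = s2 c (f x)"
  using assms by (auto simp: linv_def)

lemma subspaceD:
  assumes "vector_space s" "module.subspace s V"
  shows "0 \<in> V" "x \<in> V ==> y \<in> V ==> x + y \<in> V" "x \<in> V ==> s c x \<in> V"
  using assms vs_module[OF assms(1)]
  by (auto simp: module.subspace_def)

lemma subspaceI:
  assumes "vector_space s" "0 \<in> V" "\<And>x y. x \<in> V ==> y \<in> V ==> x + y \<in> V" "\<And>c x. x \<in> V ==> s c x \<in> V"
  shows "module.subspace s V"
  using assms vs_module[OF assms(1)] by (auto simp: module.subspace_def)

lemma subspace_UNIV' [simp]: "vector_space s ==> module.subspace s UNIV"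
  by (rule subspaceI) auto

lemma linv_0: 
  assumes "linv s1 V s2 f" "vector_space s1" "vector_space s2" "module.subspace s1 V"
  shows "f 0 = 0"
  using linvD(2)[OF assms(1) subspaceD(1)[OF assms(2,4)], of 0] assms(2,3) by (simp add: vs_rules)

lemma linv_id [lin]: "linv s V s (\<lambda>x. x)"
  by (simp add: linv_def)

lemma linv_comp:
  assumes "linv s2 W s3 g" "linv s1 V s2 f" "\<And>x. x \<in> V ==> f x \<in> W"
  shows "linv s1 V s3 (\<lambda>x. g (f x))"
  using assms by (simp add: linv_def)

lemma linear_comp_linv:
  assumes "Vector_Spaces.linear s2 s3 g" "linv s1 V s2 f"
  shows "linv s1 V s3 (\<lambda>x. g (f x))"
  using assms by (auto simp: linear_iff_linv intro: linv_comp)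

lemma linv_subset: "linv s1 W s2 f ==> V \<subseteq> W ==> linv s1 V s2 f"
  unfolding linv_def by (meson subsetD)

lemma linv_cong:
  assumes "vector_space s1" "module.subspace s1 V" "\<And>x. x \<in> V ==> f x = g x"
  shows "linv s1 V s2 f \<longleftrightarrow> linv s1 V s2 g"
  using assms subspaceD[OF assms(1,2)] by (simp add: linv_def)

lemma linv_add:
  assumes "linv s1 V s2 f" "linv s1 V s2 g" "vector_space s2"
  shows "linv s1 V s2 (\<lambda>x. f x + g x)"
  using assms by (auto simp: linv_def vs_rules)

lemma linv_const_scale [lin]:
  assumes "linv s1 V s2 f" "vector_space s2"
  shows "linv s1 V s2 (\<lambda>x. s2 c (f x))"
  using assms by (auto simp: linv_def vs_rules mult.commute)

lemma linv_pscale_coeff [lin]: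
  assumes "linv s1 V (*) f"
  shows "linv s1 V pscale (\<lambda>x. pscale (f x) y)"
  using assms by (auto simp: linv_def vs_rules(2,3))

lemma linv_pscale [lin]:
  assumes "linv s1 V pscale f"
  shows "linv s1 V pscale (\<lambda>x. pscale c (f x))"
  using assms linv_const_scale[OF assms] by simp

lemma linv_mult_right [lin]:
  fixes f :: "_ => 'k::field"
  assumes "linv s1 V (*) f"
  shows "linv s1 V (*) (\<lambda>x. f x * c)"
  using assms by (auto simp: linv_def algebra_simps)

lemma linv_mult_left [lin]:
  fixes f :: "_ => 'k::field"
  assumes "linv s1 V (*) f"
  shows "linv s1 V (*) (\<lambda>x. c * f x)"
  using assms by (auto simp: linv_def algebra_simps)

section \<open>Finite sums over lists of pairs\<close>

definition lsum :: "('a \<times> 'b) list => ('a => 'b => 'u::ab_group_add) => 'u"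
  where "lsum L F = (\<Sum>(a, b)\<leftarrow>L. F a b)"

lemma lsum_simps [simp]: "lsum [] F = 0" "lsum ((a, b) # L) F = F a b + lsum L F"
  "lsum (L @ M) F = lsum L F + lsum M F"
  by (simp_all add: lsum_def)

lemma lsum_add: "lsum L (\<lambda>a b. F a b + G a b) = lsum L F + lsum L G"
  by (induction L) (auto simp: algebra_simps)

lemma lsum_zero [simp]: "lsum L (\<lambda>a b. 0) = 0"
  by (induction L) auto

lemma lsum_cong: "(\<And>a b. (a, b) \<in> set L ==> F a b = G a b) ==> lsum L F = lsum L G"
  by (induction L) auto

lemma lsum_swap: "lsum L (\<lambda>a b. lsum M (\<lambda>c d. F a b c d)) = lsum M (\<lambda>c d. lsum L (\<lambda>a b. F a b c d))"
  by (induction L) (auto simp: lsum_add)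

lemma lsum_in:
  assumes "vector_space s" "module.subspace s V" "\<And>a b. (a, b) \<in> set L ==> F a b \<in> V"
  shows "lsum L F \<in> V"
  using assms(3) by (induction L) (auto intro!: subspaceD[OF assms(1,2)])

lemma lsum_linv:
  assumes "linv s1 V s2 \<phi>" "vector_space s1" "vector_space s2" "module.subspace s1 V"
    and "\<And>a b. (a, b) \<in> set L ==> F a b \<in> V"
  shows "\<phi> (lsum L F) = lsum L (\<lambda>a b. \<phi> (F a b))"
  using assms(5)
proof (induction L)
  case Nil
  then show ?case using linv_0[OF assms(1-4)] by simp
next
  case (Cons p L)
  obtain a b where "p = (a, b)" by (cases p)
  have "lsum L F \<in> V" using Cons by (intro lsum_in[OF assms(2,4)]) auto
  with Cons \<open>p = (a, b)\<close> show ?case by (simp add: linvD[OF assms(1)])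
qed

lemma linv_lsum:
  assumes "vector_space s2" "\<And>a b. (a, b) \<in> set L ==> linv s1 V s2 (\<lambda>v. F v a b)"
  shows "linv s1 V s2 (\<lambda>v. lsum L (F v))"
  using assms(2)
  by (induction L) (auto simp: linv_def vs_rules[OF assms(1)])

lemma lsum_map: "lsum (map (\<lambda>(a, b). (f a b, g a b)) L) F = lsum L (\<lambda>a b. F (f a b) (g a b))"
  by (induction L) auto

section \<open>Universal properties of tensors on subspaces\<close>

definition bilin_on where
  "bilin_on s1 A s2 B s3 F \<longleftrightarrow> (\<forall>a\<in>A. linv s2 B s3 (F a)) \<and> (\<forall>b\<in>B. linv s1 A s3 (\<lambda>a. F a b))"

text \<open>Over a field every subspace is a direct summand. The projection extends multilinear maps
  given only on subspaces to the whole space, where the universal property is available.\<close>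

lemma subspace_projection:
  fixes V :: "'a::ab_group_add set"
  assumes "vector_space s" "module.subspace s V"
  obtains p where "linv s UNIV s p" "\<And>x. p x \<in> V" "\<And>x. x \<in> V ==> p x = x"
proof -
  interpret vector_space_pair s s using assms(1) by (simp add: vector_space_pair_def)
  obtain g where "range g \<subseteq> V" "Vector_Spaces.linear s s g" "\<forall>v\<in>V. g v = v"
    using linear_exists_left_inverse_on[OF _ assms(2), of "\<lambda>x. x"] vs1.linear_id
    by (auto simp: id_def)
  then show ?thesis by (intro that[of g]) (auto simp: linear_iff_linv)
qed

text \<open>Composed with projections onto \<open>A\<close> and \<open>B\<close>, the map
  \<open>F\<close> becomes bilinear on the whole spaces and keeps its values on both lists.\<close>

lemma tensor_universal_on:
  assumes vs: "vector_space s1" "vector_space s2" "vector_space s3"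
    and sub: "module.subspace s1 A" "module.subspace s2 B"
    and F: "bilin_on s1 A s2 B s3 F"
    and L: "set L \<subseteq> A \<times> B" "set M \<subseteq> A \<times> B"
    and eq: "lsum L (tens s1 s2) = lsum M (tens s1 s2)"
  shows "lsum L F = lsum M F"
proof -
  obtain p where p: "linv s1 UNIV s1 p" "\<And>x. p x \<in> A" "\<And>x. x \<in> A ==> p x = x"
    using subspace_projection[OF vs(1) sub(1)] by blast
  obtain q where q: "linv s2 UNIV s2 q" "\<And>x. q x \<in> B" "\<And>x. x \<in> B ==> q x = x"
    using subspace_projection[OF vs(2) sub(2)] by blast
  have "bilin s1 s2 s3 (\<lambda>a b. F (p a) (q b))"
    using F p q vs unfolding bilin_iff_linv bilin_on_def
    by (auto intro!: linv_comp[of _ A _ "\<lambda>a. F a (q b)" _ _ p for b] linv_comp[of _ B _ "F a" _ _ q for a])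
  then have "lsum L (\<lambda>a b. F (p a) (q b)) = lsum M (\<lambda>a b. F (p a) (q b))"
    using tensor_universal eq unfolding lsum_def by blast
  moreover have "lsum K (\<lambda>a b. F (p a) (q b)) = lsum K F" if "set K \<subseteq> A \<times> B" for K
    using that p(3) q(3) by (intro lsum_cong) auto
  ultimately show ?thesis using L by simp
qed

lemma tens_bilin:
  assumes "vector_space s1" "vector_space s2"
  shows "linv s1 UNIV tscale (\<lambda>a. tens s1 s2 a b)" "linv s2 UNIV tscale (\<lambda>b. tens s1 s2 a b)"
  by (auto simp: linv_def tens_def fun_eq_iff bilin_iff_linv tscale_def)

lemma linv_tens1 [lin]:
  assumes "linv s V s1 f" "vector_space s1" "vector_space s2"
  shows "linv s V tscale (\<lambda>x. tens s1 s2 (f x) b)"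
  using linv_comp[OF tens_bilin(1)[OF assms(2,3)] assms(1)] by simp

lemma linv_tens2 [lin]:
  assumes "linv s V s2 f" "vector_space s1" "vector_space s2"
  shows "linv s V tscale (\<lambda>x. tens s1 s2 a (f x))"
  using linv_comp[OF tens_bilin(2)[OF assms(2,3)] assms(1)] by simp

text \<open>Scalars are absorbed into the first tensor factor, so linear combinations of pure
  tensors are plain sums of pure tensors.\<close>

lemma tspace_list:
  assumes vs: "vector_space s1" "vector_space s2" and "module.subspace s1 A"
  shows "T \<in> tspace s1 s2 A B \<longleftrightarrow> (\<exists>L. set L \<subseteq> A \<times> B \<and> T = lsum L (tens s1 s2))"
proof
  interpret t: vector_space tscale by simp
  have scl: "tscale c (tens s1 s2 a b) = tens s1 s2 (s1 c a) b" for c a b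
    using tens_bilin(1)[OF vs] by (simp add: linv_def)
  assume "T \<in> tspace s1 s2 A B"
  then show "\<exists>L. set L \<subseteq> A \<times> B \<and> T = lsum L (tens s1 s2)"
    unfolding tspace_def
  proof (induction rule: t.span_induct_alt)
    case base
    show ?case by (intro exI[of _ "[]"]) auto
  next
    case (step c x y)
    then obtain L a b where "set L \<subseteq> A \<times> B" "y = lsum L (tens s1 s2)" "a \<in> A" "b \<in> B" "x = tens s1 s2 a b"
      by auto
    then show ?case
      by (intro exI[of _ "(s1 c a, b) # L"]) (auto simp: scl subspaceD[OF vs(1) assms(3)])
  qed
next
  interpret t: vector_space tscale by simp
  assume "\<exists>L. set L \<subseteq> A \<times> B \<and> T = lsum L (tens s1 s2)"
  then show "T \<in> tspace s1 s2 A B"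
    unfolding tspace_def
    by (auto intro!: lsum_in[OF vsT] t.subspace_span intro: t.span_base)
qed

lemma subspace_tspace [simp]: "module.subspace tscale (tspace s1 s2 A B)"
proof -
  interpret t: vector_space tscale by simp
  show ?thesis unfolding tspace_def by (rule t.subspace_span)
qed

lemma tens_in_tspace: "a \<in> A ==> b \<in> B ==> tens s1 s2 a b \<in> tspace s1 s2 A B"
proof -
  interpret t: vector_space tscale by simp
  show "a \<in> A ==> b \<in> B ==> tens s1 s2 a b \<in> tspace s1 s2 A B"
    unfolding tspace_def by (auto intro!: t.span_base)
qed

definition swlist where
  "swlist s1 s2 A B T = (SOME L. set L \<subseteq> A \<times> B \<and> T = (\<Sum>(a, b) \<leftarrow> L. tens s1 s2 a b))"

lemma sweedler_lsum: "sweedler s1 s2 A B T F = lsum (swlist s1 s2 A B T) F"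
  by (simp add: sweedler_def swlist_def lsum_def)

lemma swlist:
  assumes "vector_space s1" "vector_space s2" "module.subspace s1 A" "T \<in> tspace s1 s2 A B"
  shows "set (swlist s1 s2 A B T) \<subseteq> A \<times> B" "T = lsum (swlist s1 s2 A B T) (tens s1 s2)"
proof -
  have "\<exists>L. set L \<subseteq> A \<times> B \<and> T = (\<Sum>(a, b) \<leftarrow> L. tens s1 s2 a b)"
    using assms(4) unfolding tspace_list[OF assms(1-3)] lsum_def .
  from someI_ex[OF this]
  show "set (swlist s1 s2 A B T) \<subseteq> A \<times> B" "T = lsum (swlist s1 s2 A B T) (tens s1 s2)"
    by (auto simp: swlist_def lsum_def)
qed

lemma sweedler_on:
  assumes vs: "vector_space s1" "vector_space s2" "vector_space s3"
    and sub: "module.subspace s1 A" "module.subspace s2 B"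
    and F: "bilin_on s1 A s2 B s3 F"
    and L: "set L \<subseteq> A \<times> B" "T = lsum L (tens s1 s2)"
  shows "sweedler s1 s2 A B T F = lsum L F"
proof -
  have "T \<in> tspace s1 s2 A B" using L tspace_list[OF vs(1,2) sub(1)] by auto
  from swlist[OF vs(1,2) sub(1) this] show ?thesis
    unfolding sweedler_lsum using L by (intro tensor_universal_on[OF vs sub F]) auto
qed

lemma sweedler_tens:
  assumes vs: "vector_space s1" "vector_space s2" "vector_space s3"
    and sub: "module.subspace s1 A" "module.subspace s2 B"
    and F: "bilin_on s1 A s2 B s3 F" and "a \<in> A" "b \<in> B"
  shows "sweedler s1 s2 A B (tens s1 s2 a b) F = F a b"
  using sweedler_on[OF vs sub F, of "[(a, b)]" "tens s1 s2 a b"] assms(7,8) by simp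

text \<open>Concatenated representations represent the sum, and scaling all first entries represents
  the multiple; independence of the representation does the rest.\<close>

lemma linv_sweedler:
  assumes vs: "vector_space s1" "vector_space s2" "vector_space s3"
    and sub: "module.subspace s1 A" "module.subspace s2 B"
    and F: "bilin_on s1 A s2 B s3 F"
  shows "linv tscale (tspace s1 s2 A B) s3 (\<lambda>T. sweedler s1 s2 A B T F)"
proof -
  have scl: "tscale c (tens s1 s2 a b) = tens s1 s2 (s1 c a) b" for c a b
    using tens_bilin(1)[OF vs(1,2)] by (simp add: linv_def)
  show ?thesis unfolding linv_def
  proof (intro conjI ballI allI)
    fix T U assume T: "T \<in> tspace s1 s2 A B" and U: "U \<in> tspace s1 s2 A B"
    show "sweedler s1 s2 A B (T + U) F = sweedler s1 s2 A B T F + sweedler s1 s2 A B U F"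
      using swlist[OF vs(1,2) sub(1) T] swlist[OF vs(1,2) sub(1) U]
      by (subst sweedler_on[OF vs sub F, of "swlist s1 s2 A B T @ swlist s1 s2 A B U"])
        (auto simp: sweedler_lsum)
  next
    fix T c assume T: "T \<in> tspace s1 s2 A B"
    let ?L = "swlist s1 s2 A B T"
    have "tscale c T = lsum ?L (\<lambda>a b. tens s1 s2 (s1 c a) b)"
      by (subst (1) swlist(2)[OF vs(1,2) sub(1) T], subst lsum_linv[of tscale UNIV tscale])
        (auto simp: linv_const_scale[OF linv_id] scl)
    moreover have "lsum ?L (\<lambda>a b. F (s1 c a) b) = s3 c (lsum ?L F)"
      using swlist(1)[OF vs(1,2) sub(1) T] F vs(3)
      by (subst lsum_linv[of s3 UNIV s3 "\<lambda>x. s3 c x"])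
        (auto simp: linv_const_scale[OF linv_id] bilin_on_def linv_def vs_rules(1,3)[OF vs(3)] mult.commute intro!: lsum_cong)
    ultimately show "sweedler s1 s2 A B (tscale c T) F = s3 c (sweedler s1 s2 A B T F)"
      using swlist[OF vs(1,2) sub(1) T]  subspaceD[OF vs(1) sub(1)]
      by (subst sweedler_on[OF vs sub F, of "map (\<lambda>(a, b). (s1 c a, b)) ?L"])
        (auto simp: sweedler_lsum lsum_map)
  qed
qed

text \<open>The universal property for two factors is applied twice, first to \<open>F a\<close> for
  fixed \<open>a\<close>. The resulting \<Phi> transfers coassociativity, an equation in a triple
  tensor product, to arbitrary trilinear expressions.\<close>

lemma tensor3_universal:
  fixes F :: "_ => _ => _ => 'u::ab_group_add"
  assumes vs: "vector_space s1" "vector_space s2" "vector_space s3" "vector_space s"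
    and C: "module.subspace s3 C"
    and F: "\<And>b c. c \<in> C ==> linv s1 UNIV s (\<lambda>a. F a b c)" "\<And>a c. c \<in> C ==> linv s2 UNIV s (\<lambda>b. F a b c)"
      "\<And>a b. linv s3 C s (\<lambda>c. F a b c)"
  obtains \<Phi> V where "linv tscale V s \<Phi>" "module.subspace tscale V"
    "\<And>a b c. c \<in> C ==> tens s1 tscale a (tens s2 s3 b c) \<in> V"
    "\<And>a b c. c \<in> C ==> \<Phi> (tens s1 tscale a (tens s2 s3 b c)) = F a b c"
proof -
  let ?W = "tspace s2 s3 UNIV C"
  let ?G = "\<lambda>a T. sweedler s2 s3 UNIV C T (F a)"
  have Fa: "bilin_on s2 UNIV s3 C s (F a)" for a using F by (auto simp: bilin_on_def)
  have G: "bilin_on s1 UNIV tscale ?W s ?G"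
    unfolding bilin_on_def
  proof (intro conjI ballI)
    fix a show "linv tscale ?W s (?G a)"
      by (rule linv_sweedler[OF vs(2,3,4) subspace_UNIV'[OF vs(2)] C Fa])
  next
    fix T assume "T \<in> ?W"
    then show "linv s1 UNIV s (\<lambda>a. ?G a T)"
      unfolding sweedler_lsum using swlist(1)[OF vs(2,3) subspace_UNIV'[OF vs(2)]]
      by (intro linv_lsum vs F(1)) blast
  qed
  show ?thesis
  proof (rule that[of "tspace s1 tscale UNIV ?W" "\<lambda>T. sweedler s1 tscale UNIV ?W T ?G"])
    show "linv tscale (tspace s1 tscale UNIV ?W) s (\<lambda>T. sweedler s1 tscale UNIV ?W T ?G)"
      by (rule linv_sweedler[OF vs(1) vsT vs(4) subspace_UNIV'[OF vs(1)] subspace_tspace G])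
    show "tens s1 tscale a (tens s2 s3 b c) \<in> tspace s1 tscale UNIV ?W" if "c \<in> C" for a b c
      using that by (auto intro!: tens_in_tspace)
    show "sweedler s1 tscale UNIV ?W (tens s1 tscale a (tens s2 s3 b c)) ?G = F a b c" if "c \<in> C" for a b c
      using that by (simp add: sweedler_tens[OF vs(1) vsT vs(4) subspace_UNIV'[OF vs(1)] subspace_tspace G]
        sweedler_tens[OF vs(2,3,4) subspace_UNIV'[OF vs(2)] C Fa] tens_in_tspace)
  qed simp
qed

section \<open>Convolution\<close>

lemma lin_app2:
  assumes "bilin s1 s2 s3 F"
  shows "linv s V s1 f ==> linv s V s3 (\<lambda>x. F (f x) b)" "linv s V s2 f ==> linv s V s3 (\<lambda>x. F a (f x))"
  using assms linear_comp_linv[of s1 s3 "\<lambda>a. F a b"] linear_comp_linv[of s2 s3 "F a"]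
  by (auto simp: bilin_def)

lemma lin_app3:
  assumes "trilin_form H p"
  shows "linv s V (scal H) f ==> linv s V (*) (\<lambda>x. p (f x) b c)"
    "linv s V (scal H) f ==> linv s V (*) (\<lambda>x. p a (f x) c)"
    "linv s V (scal H) f ==> linv s V (*) (\<lambda>x. p a b (f x))"
  using assms linear_comp_linv[of "scal H" "(*)" "\<lambda>x. p x b c"] linear_comp_linv[of "scal H" "(*)" "\<lambda>x. p a x c"]
    linear_comp_linv[of "scal H" "(*)" "p a b"]
  by (auto simp: trilin_form_def)

lemma bilinI:
  assumes "vector_space s1" "vector_space s2" "vector_space s3"
    "\<And>b. linv s1 UNIV s3 (\<lambda>a. F a b)" "\<And>a. linv s2 UNIV s3 (\<lambda>b. F a b)"
  shows "bilin s1 s2 s3 F"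
  using assms by (simp add: bilin_iff_linv)

lemma trilinI:
  assumes "vector_space (scal H)"
    "\<And>b c. linv (scal H) UNIV (*) (\<lambda>a. p a b c)" "\<And>a c. linv (scal H) UNIV (*) (\<lambda>b. p a b c)"
    "\<And>a b. linv (scal H) UNIV (*) (\<lambda>c. p a b c)"
  shows "trilin_form H p"
  using assms by (simp add: trilin_form_def linear_iff_linv)

definition lform :: "('k::field, 'h::ab_group_add) coalg => ('h => 'k) => bool"
  where "lform H \<phi> \<longleftrightarrow> Vector_Spaces.linear (scal H) (*) \<phi>"

lemmas lin_app = linear_comp_linv

lemma lin_form: "lform H \<phi> ==> linv s V (scal H) f ==> linv s V (*) (\<lambda>x. \<phi> (f x))"
  unfolding lform_def by (rule lin_app)

locale coalg =
  fixes H :: "('k::field, 'h::ab_group_add) coalg"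
  assumes coalgebra: "coalgebra H"
begin

abbreviation lcomod :: "('k, 'h, 'u) comod => bool" where "lcomod == left_comodule H"

abbreviation scH :: "'k => 'h => 'h" where "scH \<equiv> scal H"
abbreviation eps :: "'h => 'k" where "eps \<equiv> cou H"

lemma vsH [simp]: "vector_space scH"
  using coalgebra by (simp add: coalgebra_def)

lemma lin_comul: "Vector_Spaces.linear scH tscale (comul H)"
  and comul_in: "comul H h \<in> tspace scH scH UNIV UNIV"
  and lin_eps: "Vector_Spaces.linear scH (*) eps"
  using coalgebra by (auto simp: coalgebra_def)

lemmas lin_cou [lin] = lin_app[OF lin_eps]

lemma linv_scH_coeff [lin]:
  assumes "linv s1 V (*) f"
  shows "linv s1 V scH (\<lambda>x. scH (f x) y)"
  using assms by (auto simp: linv_def vs_rules(2,3))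

lemma linv_scH [lin]:
  assumes "linv s1 V scH f"
  shows "linv s1 V scH (\<lambda>x. scH c (f x))"
  using assms linv_const_scale[OF assms] by simp

abbreviation dlist :: "'h => ('h \<times> 'h) list" where
  "dlist h \<equiv> swlist scH scH UNIV UNIV (comul H h)"

lemma sw2_lsum: "sw2 H h F = lsum (dlist h) F"
  by (simp add: sw2_def sweedler_lsum)

lemma comul_eq: "comul H h = lsum (dlist h) (tens scH scH)"
  using swlist(2)[OF vsH vsH _ comul_in] by simp

lemma sw2_eqI:
  assumes "comul H h = lsum L (tens scH scH)" "vector_space s"
    "\<And>b. linv scH UNIV s (\<lambda>a. F a b)" "\<And>a. linv scH UNIV s (\<lambda>b. F a b)"
  shows "sw2 H h F = lsum L F"
  unfolding sw2_def using assms
  by (intro sweedler_on[OF vsH vsH assms(2)]) (auto simp: bilin_on_def)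

lemma sw2_zero [simp]: "sw2 H h (\<lambda>a b. 0) = 0"
  by (simp add: sw2_lsum)

lemma sw2_swap: "sw2 H h (\<lambda>a b. sw2 H k (\<lambda>c d. F a b c d)) = sw2 H k (\<lambda>c d. sw2 H h (\<lambda>a b. F a b c d))"
  unfolding sw2_lsum by (rule lsum_swap)

lemma sw2_linear: 
  assumes "Vector_Spaces.linear s1 s2 \<phi>"
  shows "\<phi> (sw2 H h F) = sw2 H h (\<lambda>a b. \<phi> (F a b))"
  unfolding sw2_lsum using assms by (intro lsum_linv[of s1 UNIV s2]) (auto simp: linear_iff_linv)

lemma sw2_scale:
  assumes "vector_space s"
  shows "s c (sw2 H h F) = sw2 H h (\<lambda>a b. s c (F a b))"
  by (rule sw2_linear[of s s]) (auto simp: linear_iff_linv assms intro: linv_const_scale linv_id)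

lemma sw2_mult_left: "c * sw2 H h F = sw2 H h (\<lambda>a b. c * F a b)" for c :: 'k
  by (rule sw2_scale) simp

lemma sw2_mult_right: "sw2 H h F * c = sw2 H h (\<lambda>a b. F a b * c)" for c :: 'k
  using sw2_mult_left[of c] by (simp add: mult.commute)

lemma sw2_coeff: 
  assumes "vector_space s"
  shows "s (sw2 H h F) v = sw2 H h (\<lambda>a b. s (F a b) v)"
  by (rule sw2_linear[of "(*)" s "\<lambda>c. s c v"]) (auto simp: linear_iff_linv assms linv_def vs_rules(2,3)[OF assms])

lemma linv_sw2 [lin]:
  assumes "\<And>a b. linv s1 V s2 (\<lambda>v. F v a b)" "vector_space s2"
  shows "linv s1 V s2 (\<lambda>v. sw2 H h (F v))"
  unfolding sw2_lsum by (rule linv_lsum) (use assms in auto)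

lemma linv_sw2_arg0:
  assumes "vector_space s" "\<And>b. linv scH UNIV s (\<lambda>a. F a b)" "\<And>a. linv scH UNIV s (\<lambda>b. F a b)"
  shows "linv scH UNIV s (\<lambda>h. sw2 H h F)"
  unfolding sw2_def
  by (rule linv_comp[OF linv_sweedler[OF vsH vsH assms(1)]])
    (use lin_comul assms in \<open>auto simp: linear_iff_linv comul_in bilin_on_def\<close>)

lemma linv_sw2_arg [lin]:
  assumes "linv s1 V scH f" "vector_space s" 
    "\<And>b. linv scH UNIV s (\<lambda>a. F a b)" "\<And>a. linv scH UNIV s (\<lambda>b. F a b)"
  shows "linv s1 V s (\<lambda>v. sw2 H (f v) F)"
  by (rule linv_comp[OF linv_sw2_arg0 assms(1)]) (use assms in auto)

text \<open>The coassociativity axiom is an equation between sums of pure triple tensors. A linear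
  map sending each of these to the value of \<open>F\<close> is applied to both sides and moved
  inside the sums.\<close>

lemma sw2_coassoc:
  assumes "vector_space s"
    and F: "\<And>b c. linv scH UNIV s (\<lambda>a. F a b c)" "\<And>a c. linv scH UNIV s (\<lambda>b. F a b c)"
      "\<And>a b. linv scH UNIV s (\<lambda>c. F a b c)"
  shows "sw2 H h (\<lambda>a b. sw2 H a (\<lambda>a1 a2. F a1 a2 b)) = sw2 H h (\<lambda>a b. sw2 H b (\<lambda>b1 b2. F a b1 b2))"
proof -
  obtain \<Phi> V where V: "linv tscale V s \<Phi>" "module.subspace tscale V"
      "\<And>a b c. tens scH tscale a (tens scH scH b c) \<in> V"
      "\<And>a b c. \<Phi> (tens scH tscale a (tens scH scH b c)) = F a b c"
    by (rule tensor3_universal[OF vsH vsH vsH assms(1) subspace_UNIV'[OF vsH] F]) auto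
  have *: "\<Phi> (sw2 H h (\<lambda>a b. sw2 H (P a b) (\<lambda>c d. tens3 H (Q a b c d) (Q' a b c d) (Q'' a b c d)))) =
     sw2 H h (\<lambda>a b. sw2 H (P a b) (\<lambda>c d. F (Q a b c d) (Q' a b c d) (Q'' a b c d)))" for P Q Q' Q''
    unfolding sw2_lsum
    by (subst lsum_linv[OF V(1) _ assms(1) V(2)], simp,
        (rule lsum_in[OF vsT V(2)], simp add: tens3_def tens2_def V(3)),
        subst lsum_linv[OF V(1) _ assms(1) V(2)], simp, simp add: tens3_def tens2_def V(3),
        simp add: tens3_def tens2_def V(4))
  have "sw2 H h (\<lambda>a b. sw2 H a (\<lambda>a1 a2. tens3 H a1 a2 b)) = sw2 H h (\<lambda>a b. sw2 H b (\<lambda>b1 b2. tens3 H a b1 b2))"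
    using coalgebra by (auto simp: coalgebra_def)
  from arg_cong[OF this, of \<Phi>] show ?thesis unfolding * .
qed

lemma sw2_counit:
  assumes "linv scH UNIV s f" "vector_space s"
  shows "sw2 H h (\<lambda>a b. s (eps a) (f b)) = f h" "sw2 H h (\<lambda>a b. s (eps b) (f a)) = f h"
proof -
  have f: "Vector_Spaces.linear scH s f" using assms by (simp add: linear_iff_linv)
  have *: "f (scH c x) = s c (f x)" for c x using assms by (simp add: linv_def)
  have "f (sw2 H h (\<lambda>a b. scH (eps a) b)) = f h" "f (sw2 H h (\<lambda>a b. scH (eps b) a)) = f h"
    using coalgebra by (simp_all add: coalgebra_def)
  then show "sw2 H h (\<lambda>a b. s (eps a) (f b)) = f h" "sw2 H h (\<lambda>a b. s (eps b) (f a)) = f h"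
    unfolding sw2_linear[OF f] * by auto
qed

lemmas sw2_counit_field = sw2_counit[OF _ vsF]

lemma sw2_grouplike:
  assumes "grouplike H g" "vector_space s"
    "\<And>b. linv scH UNIV s (\<lambda>a. F a b)" "\<And>a. linv scH UNIV s (\<lambda>b. F a b)"
  shows "sw2 H g F = F g g"
  using sw2_eqI[of g "[(g, g)]", OF _ assms(2-4)] assms(1) by (simp add: grouplike_def tens2_def)

section \<open>Simultaneous coproducts of several elements and the convolution monoids\<close>

definition S2 where
  "S2 h k F = sw2 H h (\<lambda>h1 h2. sw2 H k (\<lambda>k1 k2. F h1 k1 h2 k2))"

definition S3 where
  "S3 h k l F = sw2 H h (\<lambda>h1 h2. sw2 H k (\<lambda>k1 k2. sw2 H l (\<lambda>l1 l2. F h1 k1 l1 h2 k2 l2)))"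

definition S4 where
  "S4 h k l t F = sw2 H h (\<lambda>h1 h2. sw2 H k (\<lambda>k1 k2. sw2 H l (\<lambda>l1 l2. sw2 H t (\<lambda>t1 t2. F h1 k1 l1 t1 h2 k2 l2 t2))))"

definition trilin where
  "trilin s G \<longleftrightarrow> (\<forall>b c. linv scH UNIV s (\<lambda>a. G a b c)) \<and> (\<forall>a c. linv scH UNIV s (\<lambda>b. G a b c)) \<and>
    (\<forall>a b. linv scH UNIV s (\<lambda>c. G a b c))"

lemma sw2_coassoc': "vector_space s ==> trilin s F ==>
  sw2 H h (\<lambda>a b. sw2 H a (\<lambda>a1 a2. F a1 a2 b)) = sw2 H h (\<lambda>a b. sw2 H b (\<lambda>b1 b2. F a b1 b2))"
  by (rule sw2_coassoc) (auto simp: trilin_def)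

lemma trilin_sw2: "vector_space s ==> (\<And>a b. trilin s (\<lambda>x y z. F a b x y z)) ==>
    trilin s (\<lambda>x y z. sw2 H h (\<lambda>a b. F a b x y z))"
  by (auto simp: trilin_def intro!: linv_sw2)

text \<open>Coassociativity of the tensor square of the coalgebra: sums over different elements are
  interchanged, and coassociativity is used in each variable separately.\<close>

lemma S2_coassoc:
  assumes vs: "vector_space s"
    and F: "\<And>x y z. trilin s (\<lambda>a b c. G a x b y c z)" "\<And>x y z. trilin s (\<lambda>a b c. G x a y b z c)"
  shows "S2 h k (\<lambda>a c b d. S2 a c (\<lambda>a1 c1 a2 c2. G a1 c1 a2 c2 b d)) =
         S2 h k (\<lambda>a c b d. S2 b d (\<lambda>b1 d1 b2 d2. G a c b1 d1 b2 d2))"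
  (is "?L = _")
proof -
  have "?L =
    sw2 H h (\<lambda>a b. sw2 H a (\<lambda>a1 a2. sw2 H k (\<lambda>c d. sw2 H c (\<lambda>c1 c2. G a1 c1 a2 c2 b d))))"
    unfolding S2_def by (subst sw2_swap) rule
  also have "... = sw2 H h (\<lambda>a b. sw2 H a (\<lambda>a1 a2. sw2 H k (\<lambda>c d. sw2 H d (\<lambda>c1 c2. G a1 c a2 c1 b c2))))"
    by (subst sw2_coassoc'[OF vs F(2)]) rule
  also have "... = sw2 H h (\<lambda>a b. sw2 H b (\<lambda>b1 b2. sw2 H k (\<lambda>c d. sw2 H d (\<lambda>c1 c2. G a c b1 c1 b2 c2))))"
    by (rule sw2_coassoc'[OF vs]) (intro trilin_sw2 vs F)
  also have "... = S2 h k (\<lambda>a c b d. S2 b d (\<lambda>b1 d1 b2 d2. G a c b1 d1 b2 d2))"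
    unfolding S2_def by (subst (2) sw2_swap) rule
  finally show ?thesis .
qed

lemma trilin_S2: "vector_space s ==> (\<And>a b c d. trilin s (\<lambda>x y z. F a b c d x y z)) ==>
    trilin s (\<lambda>x y z. S2 h k (\<lambda>a b c d. F a b c d x y z))"
  unfolding S2_def by (intro trilin_sw2)

lemma S3_coassoc:
  assumes vs: "vector_space s"
    and F: "\<And>x y z x' y' z'. trilin s (\<lambda>a b c. G a x x' b y y' c z z')"
      "\<And>x y z x' y' z'. trilin s (\<lambda>a b c. G x a x' y b y' z c z')"
      "\<And>x y z x' y' z'. trilin s (\<lambda>a b c. G x x' a y y' b z z' c)"
  shows "S3 h k l (\<lambda>a c e b d f. S3 a c e (\<lambda>a1 c1 e1 a2 c2 e2. G a1 c1 e1 a2 c2 e2 b d f)) =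
         S3 h k l (\<lambda>a c e b d f. S3 b d f (\<lambda>b1 d1 f1 b2 d2 f2. G a c e b1 d1 f1 b2 d2 f2))"
  (is "?L = _")
proof -
  have S3: "S3 h k l F = sw2 H h (\<lambda>a b. S2 k l (\<lambda>c e d f. F a c e b d f))" for h k l and F :: "_ => _ => _ => _ => _ => _ => 'b::ab_group_add"
    by (simp add: S3_def S2_def)
  have swap: "S2 k l (\<lambda>c e d f. sw2 H a (\<lambda>a1 a2. F c e d f a1 a2)) = sw2 H a (\<lambda>a1 a2. S2 k l (\<lambda>c e d f. F c e d f a1 a2))"
    for k l a and F :: "_ => _ => _ => _ => _ => _ => 'b::ab_group_add"
    unfolding S2_def by (subst sw2_swap[of l], rule sw2_swap)
  have "?L =
    sw2 H h (\<lambda>a b. sw2 H a (\<lambda>a1 a2. S2 k l (\<lambda>c e d f. S2 c e (\<lambda>c1 e1 c2 e2. G a1 c1 e1 a2 c2 e2 b d f))))"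
    unfolding S3 swap ..
  also have "... = sw2 H h (\<lambda>a b. sw2 H a (\<lambda>a1 a2. S2 k l (\<lambda>c e d f. S2 d f (\<lambda>c1 e1 c2 e2. G a1 c e a2 c1 e1 b c2 e2))))"
    by (subst S2_coassoc[OF vs F(2,3)]) rule
  also have "... = sw2 H h (\<lambda>a b. sw2 H b (\<lambda>a1 a2. S2 k l (\<lambda>c e d f. S2 d f (\<lambda>c1 e1 c2 e2. G a c e a1 c1 e1 a2 c2 e2))))"
    by (rule sw2_coassoc'[OF vs]) (intro trilin_S2 vs F)
  also have "... = S3 h k l (\<lambda>a c e b d f. S3 b d f (\<lambda>b1 d1 f1 b2 d2 f2. G a c e b1 d1 f1 b2 d2 f2))"
    unfolding S3 swap ..
  finally show ?thesis .
qed

lemma conv2_S2: "conv2 H p q h k = S2 h k (\<lambda>h1 k1 h2 k2. p h1 k1 * q h2 k2)"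
  by (simp add: conv2_def S2_def)

lemma conv3_S3: "conv3 H p q h k l = S3 h k l (\<lambda>h1 k1 l1 h2 k2 l2. p h1 k1 l1 * q h2 k2 l2)"
  by (simp add: conv3_def S3_def)

lemma S2_mult: "c * S2 h k F = S2 h k (\<lambda>h1 k1 h2 k2. c * F h1 k1 h2 k2)"
   "S2 h k F * c = S2 h k (\<lambda>h1 k1 h2 k2. F h1 k1 h2 k2 * c)" for c :: 'k
  by (simp_all add: S2_def sw2_mult_left sw2_mult_right)

lemma S3_mult: "c * S3 h k l F = S3 h k l (\<lambda>h1 k1 l1 h2 k2 l2. c * F h1 k1 l1 h2 k2 l2)"
   "S3 h k l F * c = S3 h k l (\<lambda>h1 k1 l1 h2 k2 l2. F h1 k1 l1 h2 k2 l2 * c)" for c :: 'k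
  by (simp_all add: S3_def sw2_mult_left sw2_mult_right)

abbreviation bform where "bform \<equiv> bilin scH scH ((*) :: 'k => _)"
abbreviation tform where "tform \<equiv> trilin_form H"

lemma conv2_assoc:
  assumes "bform p" "bform q" "bform s"
  shows "conv2 H (conv2 H p q) s = conv2 H p (conv2 H q s)"
proof (intro ext)
  fix h k
  have "S2 h k (\<lambda>a c b d. S2 a c (\<lambda>a1 c1 a2 c2. p a1 c1 * q a2 c2 * s b d)) =
         S2 h k (\<lambda>a c b d. S2 b d (\<lambda>b1 d1 b2 d2. p a c * q b1 d1 * s b2 d2))"
    by (rule S2_coassoc[OF vsF])
      (auto simp: trilin_def intro!: lin lin_app2[OF assms(1)] lin_app2[OF assms(2)] lin_app2[OF assms(3)])
  then show "conv2 H (conv2 H p q) s h k = conv2 H p (conv2 H q s) h k"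
    by (simp add: conv2_S2 S2_mult mult.assoc)
qed

lemma conv3_assoc:
  assumes "tform p" "tform q" "tform s"
  shows "conv3 H (conv3 H p q) s = conv3 H p (conv3 H q s)"
proof (intro ext)
  fix h k l
  have "S3 h k l (\<lambda>a c e b d f. S3 a c e (\<lambda>a1 c1 e1 a2 c2 e2. p a1 c1 e1 * q a2 c2 e2 * s b d f)) =
         S3 h k l (\<lambda>a c e b d f. S3 b d f (\<lambda>b1 d1 f1 b2 d2 f2. p a c e * q b1 d1 f1 * s b2 d2 f2))"
    by (rule S3_coassoc[OF vsF])
      (auto simp: trilin_def intro!: lin lin_app3[OF assms(1)] lin_app3[OF assms(2)] lin_app3[OF assms(3)])
  then show "conv3 H (conv3 H p q) s h k l = conv3 H p (conv3 H q s) h k l"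
    by (simp add: conv3_S3 S3_mult mult.assoc)
qed

text \<open>\<open>e2\<close> and \<open>e3\<close> are the units of the convolution algebras of
  bilinear and trilinear forms.\<close>

definition e2 where "e2 = (\<lambda>h k. eps h * eps k)"
definition e3 where "e3 = (\<lambda>h k l. eps h * eps k * eps l)"

lemma bform_conv2: "bform p ==> bform q ==> bform (conv2 H p q)"
  unfolding conv2_def
  by (rule bilinI) (auto intro!: lin lin_app2[of _ _ _ p] lin_app2[of _ _ _ q])

lemma tform_conv3: "tform p ==> tform q ==> tform (conv3 H p q)"
  unfolding conv3_def
  by (rule trilinI) (auto intro!: lin lin_app3[of _ p] lin_app3[of _ q])

lemma bform_e2: "bform e2"
  unfolding e2_def by (rule bilinI) (auto intro!: lin)

lemma tform_e3: "tform e3"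
  unfolding e3_def by (rule trilinI) (auto intro!: lin)

lemma sw2_eps_left: "linv scH UNIV (*) f ==> sw2 H h (\<lambda>a b. eps a * f b) = f h"
  using sw2_counit_field by blast

lemma sw2_eps_right: "linv scH UNIV (*) f ==> sw2 H h (\<lambda>a b. f a * eps b) = f h"
  using sw2_counit_field(2)[of f h] by (simp add: mult.commute)

lemma conv2_e2 [simp]:
  assumes "bform p"
  shows "conv2 H e2 p = p" "conv2 H p e2 = p"
proof -
  show "conv2 H e2 p = p"
    unfolding conv2_def e2_def using assms
    by (intro ext, simp add: mult.assoc flip: sw2_mult_left)
      (simp add: sw2_eps_left bilin_iff_linv)
  have *: "p a b * (eps x * eps y) = p a b * eps y * eps x" for a b x y
    by simp
  show "conv2 H p e2 = p"
    unfolding conv2_def e2_def * using assms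
    by (intro ext, simp add: sw2_eps_right bilin_iff_linv flip: sw2_mult_right)
qed

lemma conv3_e3 [simp]:
  assumes "tform p"
  shows "conv3 H e3 p = p" "conv3 H p e3 = p"
proof -
  show "conv3 H e3 p = p"
    unfolding conv3_def e3_def using assms
    by (intro ext, simp add: mult.assoc flip: sw2_mult_left)
      (simp add: sw2_eps_left trilin_form_def linear_iff_linv)
  have *: "p a b c * (eps x * eps y * eps z) = p a b c * eps z * eps y * eps x" for a b c x y z
    by simp
  show "conv3 H p e3 = p"
    unfolding conv3_def e3_def * using assms
    by (intro ext, simp add: sw2_eps_right trilin_form_def linear_iff_linv flip: sw2_mult_right)
qed

lemma is_cinv2_e2: "is_cinv2 H p q \<longleftrightarrow> bform q \<and> conv2 H p q = e2 \<and> conv2 H q p = e2"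
  by (simp add: is_cinv2_def e2_def)

lemma is_cinv3_e3: "is_cinv3 H p q \<longleftrightarrow> tform q \<and> conv3 H p q = e3 \<and> conv3 H q p = e3"
  by (simp add: is_cinv3_def e3_def)

text \<open>Two-sided inverses in a monoid are unique, so the definite description yields any
  inverse that has been exhibited.\<close>

lemma cinv2_eq:
  assumes "bform p" "is_cinv2 H p q"
  shows "cinv2 H p = q"
  unfolding cinv2_def
proof (rule the_equality)
  fix q' assume q': "is_cinv2 H p q'"
  have "q' = conv2 H q' (conv2 H p q)" using q' assms by (simp add: is_cinv2_e2)
  also have "... = conv2 H (conv2 H q' p) q" using q' assms by (subst conv2_assoc) (auto simp: is_cinv2_e2)
  also have "... = q" using q' assms by (simp add: is_cinv2_e2)
  finally show "q' = q" .
qed (fact assms(2))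

lemma cinv3_eq:
  assumes "tform p" "is_cinv3 H p q"
  shows "cinv3 H p = q"
  unfolding cinv3_def
proof (rule the_equality)
  fix q' assume q': "is_cinv3 H p q'"
  have "q' = conv3 H q' (conv3 H p q)" using q' assms by (simp add: is_cinv3_e3)
  also have "... = conv3 H (conv3 H q' p) q" using q' assms by (subst conv3_assoc) (auto simp: is_cinv3_e3)
  also have "... = q" using q' assms by (simp add: is_cinv3_e3)
  finally show "q' = q" .
qed (fact assms(2))

end

section \<open>Tensor products of spaces of vectors\<close>

lemma lin_on_iff: "lin_on s1 s2 V f \<longleftrightarrow> linv s1 V s2 f \<and> (\<forall>x. x \<notin> V \<longrightarrow> f x = 0)"
  by (auto simp: lin_on_def linv_def)

lemma lin_on_eqI:
  assumes "lin_on s1 s2 V f" "lin_on s1 s2 V g" "\<And>x. x \<in> V ==> f x = g x"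
  shows "f = g"
  using assms by (auto simp: lin_on_iff fun_eq_iff) metis

text \<open>Uniqueness has to be known only on \<open>V\<close>, since both candidates vanish
  elsewhere.\<close>

lemma the_lin_eq:
  assumes "lin_on s1 s2 V f" "P f" "\<And>g x. lin_on s1 s2 V g ==> P g ==> x \<in> V ==> g x = f x"
  shows "the_lin s1 s2 V P = f"
  unfolding the_lin_def using assms by (intro the_equality) (auto intro: lin_on_eqI)

lemma linv_sum:
  assumes "linv s1 UNIV s2 f" "vector_space s1" "vector_space s2"
  shows "f (\<Sum>i\<in>I. g i) = (\<Sum>i\<in>I. f (g i))"
  using linv_0[OF assms subspace_UNIV'[OF assms(2)]] assms(1)
  by (induction I rule: infinite_finite_induct) (auto simp: linv_def)

lemma vspan_subspace [simp]: "module.subspace pscale (vspan S)"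
proof -
  interpret p: vector_space pscale by simp
  show ?thesis unfolding vspan_def by (rule p.subspace_span)
qed

lemma vspan_base: "x \<in> S ==> x \<in> vspan S"
proof -
  interpret p: vector_space pscale by simp
  show "x \<in> S ==> x \<in> vspan S" unfolding vspan_def by (rule p.span_base)
qed

lemma vspan_minimal: "S \<subseteq> V ==> module.subspace pscale V ==> vspan S \<subseteq> V"
proof -
  interpret p: vector_space pscale by simp
  show "S \<subseteq> V ==> p.subspace V ==> vspan S \<subseteq> V" unfolding vspan_def by (rule p.span_minimal)
qed

lemma linv_eq_vspan:
  assumes f: "linv pscale (vspan S) s f" and g: "linv pscale (vspan S) s g" and vs: "vector_space s"
    and eq: "\<And>x. x \<in> S ==> f x = g x" and x: "x \<in> vspan S"
  shows "f x = g x"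
proof -
  have "vspan S \<subseteq> {x \<in> vspan S. f x = g x}"
    using linvD[OF f] linvD[OF g] subspaceD[OF vsP vspan_subspace]
      linv_0[OF f vsP vs vspan_subspace] linv_0[OF g vsP vs vspan_subspace] eq
    by (intro vspan_minimal subspaceI) (auto simp: vspan_base)
  with x show ?thesis by auto
qed

lemma linv_in_vspan:
  assumes f: "linv pscale (vspan S) s f" and vs: "vector_space s" and V: "module.subspace s V"
    and S: "\<And>x. x \<in> S ==> f x \<in> V" and x: "x \<in> vspan S"
  shows "f x \<in> V"
proof -
  have "vspan S \<subseteq> {x \<in> vspan S. f x \<in> V}"
    using linvD[OF f] subspaceD[OF vsP vspan_subspace] subspaceD[OF vs V]
      linv_0[OF f vsP vs vspan_subspace] S
    by (intro vspan_minimal subspaceI) (auto simp: vspan_base)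
  with x show ?thesis by auto
qed

abbreviation vbas :: "'i => ('i \<Rightarrow>\<^sub>0 'k::field)" where "vbas i \<equiv> Poly_Mapping.single i 1"

lemma single_vbas: "Poly_Mapping.single i c = pscale c (vbas i)"
  by (rule poly_mapping_eqI) (auto simp: lookup_single when_def)

lemma vec_expand: "v = (\<Sum>i\<in>Poly_Mapping.keys v. pscale (Poly_Mapping.lookup v i) (vbas i))"
  by (rule poly_mapping_eqI) (auto simp: lookup_sum lookup_single when_def in_keys_iff if_distrib[of "(*) _"] cong: if_cong)

text \<open>The linear extension of a function on the basis vectors \<open>vbas i\<close>.\<close>

definition vextend where
  "vextend s g v = (\<Sum>i\<in>Poly_Mapping.keys v. s (Poly_Mapping.lookup v i) (g i))"

lemma vextend_super:
  assumes "vector_space s" "finite I" "Poly_Mapping.keys v \<subseteq> I"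
  shows "vextend s g v = (\<Sum>i\<in>I. s (Poly_Mapping.lookup v i) (g i))"
  unfolding vextend_def
  by (rule sum.mono_neutral_left) (use assms in \<open>auto simp: in_keys_iff vs_rules\<close>)

lemma linv_vextend:
  fixes s :: "'k::field => 'b::ab_group_add => 'b" and g :: "'i => 'b"
  assumes "vector_space s"
  shows "linv pscale UNIV s (vextend s g)"
  unfolding linv_def
proof (intro conjI ballI allI)
  fix x y :: "'i \<Rightarrow>\<^sub>0 'k"
  let ?I = "Poly_Mapping.keys x \<union> Poly_Mapping.keys y"
  show "vextend s g (x + y) = vextend s g x + vextend s g y"
    using keys_add[of x y]
    by (simp add: vextend_super[OF assms, of ?I] lookup_add vs_rules[OF assms] sum.distrib)
next
  fix c and x :: "'i \<Rightarrow>\<^sub>0 'k"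
  have "Poly_Mapping.keys (pscale c x) \<subseteq> Poly_Mapping.keys x" by (auto simp: in_keys_iff)
  then show "vextend s g (pscale c x) = s c (vextend s g x)"
    using assms
    by (simp add: vextend_super[OF assms, of "Poly_Mapping.keys x"] vs_rules(3)[OF assms, symmetric]
        linv_sum[of s s "s c", OF linv_const_scale[OF linv_id]])
qed

lemma vextend_vbas [simp]: "vector_space s ==> vextend s g (vbas i) = g i"
  by (simp add: vextend_super[of s "{i}"] vs_rules)

text \<open>Because \<open>Node\<close> is injective, at most one term of the double sum contributes
  to a given coordinate.\<close>

lemma vten_lookup:
  "Poly_Mapping.lookup (x \<otimes> y) (Node i j) = Poly_Mapping.lookup x i * Poly_Mapping.lookup y j"
  "Poly_Mapping.lookup (x \<otimes> y) (Atom u) = 0" "Poly_Mapping.lookup (x \<otimes> y) Dot = 0"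
proof -
  let ?c = "\<lambda>i j. Poly_Mapping.lookup x i * Poly_Mapping.lookup y j"
  have "Poly_Mapping.lookup (x \<otimes> y) (Node i j) =
     (\<Sum>a\<in>Poly_Mapping.keys x. \<Sum>b\<in>Poly_Mapping.keys y. if a = i then (if b = j then ?c i j else 0) else 0)"
    unfolding vten_def lookup_sum lookup_single
    by (intro sum.cong refl) (auto simp: when_def)
  also have "... = (\<Sum>a\<in>Poly_Mapping.keys x. if a = i then (\<Sum>b\<in>Poly_Mapping.keys y. if b = j then ?c i j else 0) else 0)"
    by (intro sum.cong refl) auto
  also have "... = ?c i j"
    by (auto simp: in_keys_iff)
  finally show "Poly_Mapping.lookup (x \<otimes> y) (Node i j) = ?c i j" .
qed (simp_all add: vten_def lookup_sum lookup_single when_def)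

lemma vec_eqI:
  assumes "\<And>i j. Poly_Mapping.lookup x (Node i j) = Poly_Mapping.lookup y (Node i j)"
    "\<And>u. Poly_Mapping.lookup x (Atom u) = Poly_Mapping.lookup y (Atom u)"
    "Poly_Mapping.lookup x Dot = Poly_Mapping.lookup y Dot"
  shows "x = y"
  by (rule poly_mapping_eqI) (metis assms vindex.exhaust)

lemma vten_linv: "linv pscale UNIV pscale (\<lambda>x. x \<otimes> y)" "linv pscale UNIV pscale (\<lambda>y. x \<otimes> y)"
  by (auto simp: linv_def vten_lookup lookup_add algebra_simps intro!: vec_eqI)

lemma linv_vten1 [lin]: "linv s V pscale f ==> linv s V pscale (\<lambda>x. f x \<otimes> y)"
  using linv_comp[OF vten_linv(1)] by blast

lemma linv_vten2 [lin]: "linv s V pscale f ==> linv s V pscale (\<lambda>x. y \<otimes> f x)"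
  using linv_comp[OF vten_linv(2)] by blast

definition tcarr :: "('k::field, 'u) vec set => ('k, 'u) vec set => ('k, 'u) vec set" where
  "tcarr A B = vspan {x \<otimes> y | x y. x \<in> A \<and> y \<in> B}"

lemma ctens_carr_tcarr: "ctens_carr X Y = tcarr (carr X) (carr Y)"
  by (simp add: ctens_carr_def tcarr_def)

lemma subspace_tcarr [simp]: "module.subspace pscale (tcarr A B)"
  by (simp add: tcarr_def)

lemma vten_in_tcarr [simp]: "x \<in> A ==> y \<in> B ==> x \<otimes> y \<in> tcarr A B"
  unfolding tcarr_def by (rule vspan_base) blast

lemma tcarr_ext:
  assumes "linv pscale (tcarr A B) s f" "linv pscale (tcarr A B) s g" "vector_space s"
    "\<And>x y. x \<in> A ==> y \<in> B ==> f (x \<otimes> y) = g (x \<otimes> y)" "v \<in> tcarr A B"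
  shows "f v = g v"
  using linv_eq_vspan[of _ s f g v] assms unfolding tcarr_def by blast

lemma tcarr_in:
  assumes "linv pscale (tcarr A B) s f" "vector_space s" "module.subspace s V"
    "\<And>x y. x \<in> A ==> y \<in> B ==> f (x \<otimes> y) \<in> V" "v \<in> tcarr A B"
  shows "f v \<in> V"
  using linv_in_vspan[of _ s f V v] assms unfolding tcarr_def by blast

lemma tcarr_ext3:
  assumes "linv pscale (tcarr (tcarr A B) C) s f" "linv pscale (tcarr (tcarr A B) C) s g" "vector_space s"
    and eq: "\<And>x y z. x \<in> A ==> y \<in> B ==> z \<in> C ==> f ((x \<otimes> y) \<otimes> z) = g ((x \<otimes> y) \<otimes> z)"
    and v: "v \<in> tcarr (tcarr A B) C"
  shows "f v = g v"
proof (rule tcarr_ext[OF assms(1-3) _ v])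
  fix w z assume w: "w \<in> tcarr A B" and z: "z \<in> C"
  show "f (w \<otimes> z) = g (w \<otimes> z)"
    by (rule tcarr_ext[of A B s "\<lambda>w. f (w \<otimes> z)" "\<lambda>w. g (w \<otimes> z)", OF _ _ assms(3) _ w])
      (use z eq in \<open>auto intro!: linv_comp[OF assms(1)] linv_comp[OF assms(2)] lin\<close>)
qed

lemma tcarr_ext3r:
  assumes "linv pscale (tcarr A (tcarr B C)) s f" "linv pscale (tcarr A (tcarr B C)) s g" "vector_space s"
    and eq: "\<And>x y z. x \<in> A ==> y \<in> B ==> z \<in> C ==> f (x \<otimes> (y \<otimes> z)) = g (x \<otimes> (y \<otimes> z))"
    and v: "v \<in> tcarr A (tcarr B C)"
  shows "f v = g v"
proof (rule tcarr_ext[OF assms(1-3) _ v])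
  fix x w assume w: "w \<in> tcarr B C" and x: "x \<in> A"
  show "f (x \<otimes> w) = g (x \<otimes> w)"
    by (rule tcarr_ext[of B C s "\<lambda>w. f (x \<otimes> w)" "\<lambda>w. g (x \<otimes> w)", OF _ _ assms(3) _ w])
      (use x eq in \<open>auto intro!: linv_comp[OF assms(1)] linv_comp[OF assms(2)] lin\<close>)
qed

lemma tcarr_ext4:
  assumes "linv pscale (tcarr (tcarr (tcarr A B) C) D) s f" "linv pscale (tcarr (tcarr (tcarr A B) C) D) s g" "vector_space s"
    and eq: "\<And>x y z w. x \<in> A ==> y \<in> B ==> z \<in> C ==> w \<in> D ==>
       f (((x \<otimes> y) \<otimes> z) \<otimes> w) = g (((x \<otimes> y) \<otimes> z) \<otimes> w)"
    and v: "v \<in> tcarr (tcarr (tcarr A B) C) D"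
  shows "f v = g v"
proof (rule tcarr_ext[OF assms(1-3) _ v])
  fix w z assume w: "w \<in> tcarr (tcarr A B) C" and z: "z \<in> D"
  show "f (w \<otimes> z) = g (w \<otimes> z)"
    by (rule tcarr_ext3[of A B C s "\<lambda>w. f (w \<otimes> z)" "\<lambda>w. g (w \<otimes> z)", OF _ _ assms(3) _ w])
      (use z eq in \<open>auto intro!: linv_comp[OF assms(1)] linv_comp[OF assms(2)] lin\<close>)
qed

lemma lin_on_restrict:
  assumes "linv s1 V s2 f" "vector_space s1" "module.subspace s1 V"
  shows "lin_on s1 s2 V (\<lambda>v. if v \<in> V then f v else 0)"
  using assms(1) subspaceD[OF assms(2,3)] by (auto simp: lin_on_iff linv_def)

lemma vten_expand:
  assumes "bilin_on pscale UNIV pscale UNIV s F" "vector_space s" "linv pscale UNIV s f"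
    "\<And>i j. f (vbas (Node i j)) = F (vbas i) (vbas j)"
  shows "f (x \<otimes> y) = F x y"
proof -
  have l: "linv pscale UNIV s (F x)" "linv pscale UNIV s (\<lambda>x. F x y)" for x y
    using assms(1) by (auto simp: bilin_on_def)
  have "F x y = (\<Sum>i\<in>Poly_Mapping.keys x. \<Sum>j\<in>Poly_Mapping.keys y.
      s (Poly_Mapping.lookup x i * Poly_Mapping.lookup y j) (F (vbas i) (vbas j)))"
    by (subst vec_expand[of x], subst linv_sum[OF l(2) _ assms(2)], simp, intro sum.cong refl,
        subst vec_expand[of y], subst linv_sum[OF l(1) _ assms(2)], simp, intro sum.cong refl)
      (simp add: linvD[OF l(1)] linvD[OF l(2)] vs_rules[OF assms(2)] mult.commute)
  also have "... = f (x \<otimes> y)"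
    unfolding vten_def linv_sum[OF assms(3) vsP assms(2)]
    by (intro sum.cong refl, subst single_vbas) (simp only: linvD(2)[OF assms(3) UNIV_I] assms(4))
  finally show ?thesis ..
qed

text \<open>The universal property of the concrete tensor product. Preceded by projections,
  \<open>F\<close> is defined on pairs of basis vectors, hence on the basis vectors with index
  \<open>Node i j\<close>, and is extended linearly.\<close>

lemma tcarr_lift:
  assumes A: "module.subspace pscale A" and B: "module.subspace pscale B" and vs: "vector_space s"
    and F: "bilin_on pscale A pscale B s F"
  obtains f where "lin_on pscale s (tcarr A B) f" "\<And>x y. x \<in> A ==> y \<in> B ==> f (x \<otimes> y) = F x y"
proof -
  obtain p where p: "linv pscale UNIV pscale p" "\<And>x. p x \<in> A" "\<And>x. x \<in> A ==> p x = x"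
    using subspace_projection[OF vsP A] by blast
  obtain q where q: "linv pscale UNIV pscale q" "\<And>x. q x \<in> B" "\<And>x. x \<in> B ==> q x = x"
    using subspace_projection[OF vsP B] by blast
  \<comment> \<open>The value 0 is a default: elements of \<open>tcarr A B\<close> have coordinates
    only at indices of the form \<open>Node i j\<close>.\<close>
  let ?g = "\<lambda>n. case n of Node i j => F (p (vbas i)) (q (vbas j)) | _ => 0"
  have b: "bilin_on pscale UNIV pscale UNIV s (\<lambda>a b. F (p a) (q b))"
    using F p q unfolding bilin_on_def
    by (metis linv_comp[of _ A _ "\<lambda>a. F a (q b)" _ _ p for b] linv_comp[of _ B _ "F a" _ _ q for a])
  have "vextend s ?g (x \<otimes> y) = F (p x) (q y)" for x y
    by (rule vten_expand[OF b vs linv_vextend[OF vs]]) (simp add: vs)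
  then show ?thesis
    using linv_subset[OF linv_vextend[OF vs]] p q
    by (intro that[of "\<lambda>v. if v \<in> tcarr A B then vextend s ?g v else 0"])
      (auto intro!: lin_on_restrict)
qed

text \<open>Existence comes from \<open>tcarr_lift\<close>, uniqueness from agreement on pure
  tensors. Coactions, tensor products of arrows and braidings, all prescribed on pure tensors, are
  evaluated through this rule.\<close>

lemma the_lin_tcarr:
  assumes A: "module.subspace pscale A" and B: "module.subspace pscale B" and vs: "vector_space s"
    and F: "bilin_on pscale A pscale B s F"
    and P: "\<And>f. P f \<longleftrightarrow> (\<forall>x\<in>A. \<forall>y\<in>B. f (x \<otimes> y) = F x y)"
  shows "lin_on pscale s (tcarr A B) (the_lin pscale s (tcarr A B) P)"
    "\<And>x y. x \<in> A ==> y \<in> B ==> the_lin pscale s (tcarr A B) P (x \<otimes> y) = F x y"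
proof -
  obtain f where f: "lin_on pscale s (tcarr A B) f" "\<And>x y. x \<in> A ==> y \<in> B ==> f (x \<otimes> y) = F x y"
    using tcarr_lift[OF A B vs F] by blast
  have "the_lin pscale s (tcarr A B) P = f"
  proof (rule the_lin_eq)
    fix g x assume "lin_on pscale s (tcarr A B) g" "P g" "x \<in> tcarr A B"
    then show "g x = f x"
      using f by - (rule tcarr_ext[OF _ _ vs, of A B g f], auto simp: P lin_on_iff)
  qed (use f in \<open>auto simp: P\<close>)
  with f show "lin_on pscale s (tcarr A B) (the_lin pscale s (tcarr A B) P)"
    "\<And>x y. x \<in> A ==> y \<in> B ==> the_lin pscale s (tcarr A B) P (x \<otimes> y) = F x y" by auto
qed

definition trilin_on where
  "trilin_on s1 A s2 B s3 C s F \<longleftrightarrow>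
    (\<forall>b\<in>B. \<forall>c\<in>C. linv s1 A s (\<lambda>a. F a b c)) \<and> (\<forall>a\<in>A. \<forall>c\<in>C. linv s2 B s (\<lambda>b. F a b c)) \<and>
    (\<forall>a\<in>A. \<forall>b\<in>B. linv s3 C s (\<lambda>c. F a b c))"

text \<open>The lift is applied twice. For fixed \<open>z\<close> the first two arguments factor
  through \<open>tcarr A B\<close>; the resulting map depends linearly on \<open>z\<close> because
  it does so on pure tensors.\<close>

lemma the_lin_tcarr3:
  assumes A: "module.subspace pscale A" and B: "module.subspace pscale B" and C: "module.subspace pscale C"
    and vs: "vector_space s"
    and F: "trilin_on pscale A pscale B pscale C s F"
    and P: "\<And>f. P f \<longleftrightarrow> (\<forall>x\<in>A. \<forall>y\<in>B. \<forall>z\<in>C. f ((x \<otimes> y) \<otimes> z) = F x y z)"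
  shows "lin_on pscale s (tcarr (tcarr A B) C) (the_lin pscale s (tcarr (tcarr A B) C) P)"
    "\<And>x y z. x \<in> A ==> y \<in> B ==> z \<in> C ==>
      the_lin pscale s (tcarr (tcarr A B) C) P ((x \<otimes> y) \<otimes> z) = F x y z"
proof -
  have "\<exists>g. lin_on pscale s (tcarr A B) g \<and> (\<forall>x\<in>A. \<forall>y\<in>B. g (x \<otimes> y) = F x y z)" if "z \<in> C" for z
    by (rule tcarr_lift[OF A B vs, of "\<lambda>x y. F x y z"]) (use F that in \<open>auto simp: bilin_on_def trilin_on_def\<close>)
  then obtain g where g: "\<And>z. z \<in> C ==> lin_on pscale s (tcarr A B) (g z)"
    "\<And>x y z. z \<in> C ==> x \<in> A ==> y \<in> B ==> g z (x \<otimes> y) = F x y z"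
    by metis
  have gl: "linv pscale (tcarr A B) s (g z)" if "z \<in> C" for z using g(1)[OF that] by (simp add: lin_on_iff)
  have lC: "linv pscale C s (\<lambda>z. F x y z)" if "x \<in> A" "y \<in> B" for x y
    using F that by (auto simp: trilin_on_def)
  have "linv pscale C s (\<lambda>z. g z w)" if w: "w \<in> tcarr A B" for w
    unfolding linv_def
  proof (intro conjI ballI allI)
    fix z z' assume z: "z \<in> C" "z' \<in> C"
    then have "z + z' \<in> C" using subspaceD[OF vsP C] by auto
    with z show "g (z + z') w = g z w + g z' w"
      by - (rule tcarr_ext[OF gl linv_add[OF gl gl vs] vs _ w], auto simp: g(2) linvD[OF lC])
  next
    fix z c assume z: "z \<in> C"
    then have "pscale c z \<in> C" using subspaceD[OF vsP C] by auto
    with z show "g (pscale c z) w = s c (g z w)"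
      by - (rule tcarr_ext[OF gl linv_const_scale[OF gl vs] vs _ w], auto simp: g(2) linvD[OF lC])
  qed
  then have "bilin_on pscale (tcarr A B) pscale C s (\<lambda>w z. g z w)"
    using gl by (auto simp: bilin_on_def)
  then obtain f where f: "lin_on pscale s (tcarr (tcarr A B) C) f"
    "\<And>w z. w \<in> tcarr A B ==> z \<in> C ==> f (w \<otimes> z) = g z w"
    using tcarr_lift[OF subspace_tcarr C vs] by blast
  have "the_lin pscale s (tcarr (tcarr A B) C) P = f"
  proof (rule the_lin_eq)
    fix h x assume "lin_on pscale s (tcarr (tcarr A B) C) h" "P h" "x \<in> tcarr (tcarr A B) C"
    then show "h x = f x"
      using f g(2) by - (rule tcarr_ext3[OF _ _ vs, of A B C h f], auto simp: P lin_on_iff)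
  qed (use f g(2) in \<open>auto simp: P\<close>)
  with f g(2) show "lin_on pscale s (tcarr (tcarr A B) C) (the_lin pscale s (tcarr (tcarr A B) C) P)"
    "\<And>x y z. x \<in> A ==> y \<in> B ==> z \<in> C ==>
      the_lin pscale s (tcarr (tcarr A B) C) P ((x \<otimes> y) \<otimes> z) = F x y z" by auto
qed

lemma vspan_evec: "v \<in> vspan {evec} \<longleftrightarrow> v = pscale (Poly_Mapping.lookup v Dot) evec"
proof
  have e: "Poly_Mapping.lookup evec Dot = 1" by (simp add: evec_def)
  have l: "linv pscale UNIV pscale (\<lambda>v. pscale (Poly_Mapping.lookup v Dot) evec)"
    by (auto simp: linv_def lookup_add vs_rules)
  show "v \<in> vspan {evec} ==> v = pscale (Poly_Mapping.lookup v Dot) evec"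
    by (rule linv_eq_vspan[OF linv_id linv_subset[OF l] vsP]) (auto simp: e vs_rules)
  show "v = pscale (Poly_Mapping.lookup v Dot) evec ==> v \<in> vspan {evec}"
    using subspaceD(3)[OF vsP vspan_subspace vspan_base[of evec "{evec}"]]
    by (metis insertI1)
qed

lemma evec_in [simp]: "evec \<in> vspan {evec}"
  by (simp add: vspan_base)

lemma lookup_evec [simp]: "Poly_Mapping.lookup evec Dot = 1"
  by (simp add: evec_def)

section \<open>Comodules\<close>

context coalg begin

text \<open>The part of the comodule axioms that gives a meaning to coaction sums; coassociativity
  and counit are left out. Tensor products and homogeneous parts are shown to be of this kind before
  anything else is computed in them.\<close>

definition precomod :: "('k, 'h, 'u) comod => bool" where
  "precomod X \<longleftrightarrow> module.subspace pscale (carr X) \<and> lin_on pscale tscale (carr X) (coact X) \<and>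
    (\<forall>x\<in>carr X. coact X x \<in> tspace scH pscale UNIV (carr X))"

lemma comod_precomod: "lcomod X ==> precomod X"
  by (simp add: left_comodule_def precomod_def)

lemma precomod_subspace: "precomod X ==> module.subspace pscale (carr X)"
  by (simp add: precomod_def)

lemma coact_in: "precomod X ==> coact X x \<in> tspace scH pscale UNIV (carr X)"
  using subspaceD(1)[OF vsT subspace_tspace]
  by (cases "x \<in> carr X") (auto simp: precomod_def lin_on_def)

abbreviation clist :: "('k, 'h, 'u) comod => ('k, 'u) vec => ('h \<times> ('k, 'u) vec) list" where
  "clist X x \<equiv> swlist scH pscale UNIV (carr X) (coact X x)"

lemma csw_lsum: "csw H X x F = lsum (clist X x) F"
  by (simp add: csw_def sweedler_lsum)

lemma clist:
  assumes "precomod X"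
  shows "set (clist X x) \<subseteq> UNIV \<times> carr X" "coact X x = lsum (clist X x) (htens H)"
  using swlist[OF vsH vsP _ coact_in[OF assms]] by (auto simp: htens_def[abs_def])

lemma csw_in_carr: "precomod X ==> (a, b) \<in> set (clist X x) ==> b \<in> carr X"
  using clist(1) by blast

lemma csw_eqI:
  assumes "precomod X" "coact X x = lsum L (htens H)" "set L \<subseteq> UNIV \<times> carr X" "vector_space s"
    "\<And>y. y \<in> carr X ==> linv scH UNIV s (\<lambda>h. F h y)" "\<And>h. linv pscale (carr X) s (F h)"
  shows "csw H X x F = lsum L F"
  unfolding csw_def using assms
  by (intro sweedler_on[OF vsH vsP assms(4)])
    (auto simp: bilin_on_def htens_def[abs_def] precomod_def)

lemma csw_add: "csw H X x (\<lambda>a b. F a b + G a b) = csw H X x F + csw H X x G"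
  by (simp add: csw_lsum lsum_add)

lemma csw_cong:
  assumes "precomod X" "\<And>h y. y \<in> carr X ==> F h y = G h y"
  shows "csw H X x F = csw H X x G"
  unfolding csw_lsum by (rule lsum_cong) (use assms csw_in_carr[OF assms(1)] in auto)

lemma csw_in:
  assumes "precomod X" "vector_space s" "module.subspace s V" "\<And>h y. y \<in> carr X ==> F h y \<in> V"
  shows "csw H X x F \<in> V"
  unfolding csw_lsum by (rule lsum_in[OF assms(2,3)]) (use assms csw_in_carr[OF assms(1)] in auto)

lemma csw_swap: "csw H X x (\<lambda>a b. csw H Y y (\<lambda>c d. F a b c d)) = csw H Y y (\<lambda>c d. csw H X x (\<lambda>a b. F a b c d))"
  unfolding csw_lsum by (rule lsum_swap)

lemma csw_sw2_swap: "csw H X x (\<lambda>a b. sw2 H y (\<lambda>c d. F a b c d)) = sw2 H y (\<lambda>c d. csw H X x (\<lambda>a b. F a b c d))"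
  unfolding csw_lsum sw2_lsum by (rule lsum_swap)

lemma csw_linv:
  assumes "linv s1 V s2 \<phi>" "vector_space s1" "vector_space s2" "module.subspace s1 V"
    and "precomod X" "\<And>h y. y \<in> carr X ==> F h y \<in> V"
  shows "\<phi> (csw H X x F) = csw H X x (\<lambda>a b. \<phi> (F a b))"
  unfolding csw_lsum by (rule lsum_linv[OF assms(1-4)]) (use assms csw_in_carr[OF assms(5)] in auto)

lemma csw_linear:
  assumes "linv s1 UNIV s2 \<phi>" "vector_space s1" "vector_space s2"
  shows "\<phi> (csw H X x F) = csw H X x (\<lambda>a b. \<phi> (F a b))"
  unfolding csw_lsum by (rule lsum_linv[OF assms]) (use assms in auto)

lemma csw_scale: "vector_space s ==> s c (csw H X x F) = csw H X x (\<lambda>a b. s c (F a b))"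
  by (rule csw_linear) (auto intro: linv_const_scale linv_id)

lemma linv_csw [lin]:
  assumes "\<And>h y. y \<in> carr X ==> linv s1 V s2 (\<lambda>v. F v h y)" "vector_space s2" "precomod X"
  shows "linv s1 V s2 (\<lambda>v. csw H X x (F v))"
  unfolding csw_lsum by (rule linv_lsum) (use assms csw_in_carr[OF assms(3)] in auto)

text \<open>A coaction sum is the value of a linear map \<Phi> at the coaction. Equations between
  coactions are thereby carried over to coaction sums with arbitrary bilinear summands.\<close>

lemma csw_functional:
  assumes "precomod X" "vector_space s"
    "\<And>y. y \<in> carr X ==> linv scH UNIV s (\<lambda>h. F h y)" "\<And>h. linv pscale (carr X) s (F h)"
  defines "\<Phi> \<equiv> \<lambda>T. sweedler scH pscale UNIV (carr X) T F"
  shows "linv tscale (tspace scH pscale UNIV (carr X)) s \<Phi>" "csw H X x F = \<Phi> (coact X x)"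
    "\<And>h y. y \<in> carr X ==> \<Phi> (htens H h y) = F h y"
proof -
  have b: "bilin_on scH UNIV pscale (carr X) s F" using assms by (auto simp: bilin_on_def)
  note * = vsH vsP assms(2) subspace_UNIV'[OF vsH] precomod_subspace[OF assms(1)] b
  show "linv tscale (tspace scH pscale UNIV (carr X)) s \<Phi>"
    unfolding \<Phi>_def by (rule linv_sweedler[OF *])
  show "csw H X x F = \<Phi> (coact X x)" by (simp add: csw_def \<Phi>_def)
  show "\<And>h y. y \<in> carr X ==> \<Phi> (htens H h y) = F h y"
    unfolding \<Phi>_def htens_def by (rule sweedler_tens[OF *]) auto
qed

lemma linv_csw_arg [lin]:
  assumes "linv s1 V pscale f" "precomod X" "\<And>v. v \<in> V ==> f v \<in> carr X" "vector_space s"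
    "\<And>y. y \<in> carr X ==> linv scH UNIV s (\<lambda>h. F h y)" "\<And>h. linv pscale (carr X) s (F h)"
  shows "linv s1 V s (\<lambda>v. csw H X (f v) F)"
proof -
  note F = csw_functional[of X s F, OF assms(2,4,5,6)]
  have "linv pscale (carr X) tscale (coact X)" using assms(2) by (auto simp: precomod_def lin_on_iff)
  from linv_comp[OF linv_comp[OF F(1) this] assms(1,3)] show ?thesis
    using coact_in[OF assms(2)] by (simp add: csw_def)
qed

text \<open>Off the carrier the coaction is zero and is represented by the empty list. Rules such as
  \<open>csw_coassoc\<close> can therefore be stated for every vector.\<close>

lemma csw_outside:
  assumes "x \<notin> carr X" "precomod X" "vector_space s"
    "\<And>y. y \<in> carr X ==> linv scH UNIV s (\<lambda>h. F h y)" "\<And>h. linv pscale (carr X) s (F h)"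
  shows "csw H X x F = 0"
  using csw_eqI[of X x "[]", OF assms(2) _ _ assms(3-5)] assms(1,2) by (auto simp: precomod_def lin_on_def)

definition mtri where
  "mtri X s F \<longleftrightarrow> (\<forall>k. \<forall>y\<in>carr X. linv scH UNIV s (\<lambda>h. F h k y)) \<and>
     (\<forall>h. \<forall>y\<in>carr X. linv scH UNIV s (\<lambda>k. F h k y)) \<and> (\<forall>h k. linv pscale (carr X) s (\<lambda>y. F h k y))"

lemma mtri_csw: "precomod Y ==> vector_space s ==> (\<And>a b. b \<in> carr Y ==> mtri X s (\<lambda>h k y. F a b h k y)) ==>
  mtri X s (\<lambda>h k y. csw H Y z (\<lambda>a b. F a b h k y))"
  by (auto simp: mtri_def intro!: linv_csw)

lemma mtri_sw2: "vector_space s ==> (\<And>a b. mtri X s (\<lambda>h k y. F a b h k y)) ==>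
  mtri X s (\<lambda>h k y. sw2 H z (\<lambda>a b. F a b h k y))"
  by (auto simp: mtri_def intro!: linv_sw2)

text \<open>As for the coproduct, a linear map on triple tensors, now with the last factor in
  \<open>carr X\<close>, is applied to the axiom. Off the carrier both sides are zero.\<close>

lemma csw_coassoc:
  assumes X: "lcomod X" and vs: "vector_space s" and F: "mtri X s F"
  shows "csw H X x (\<lambda>h y. csw H X y (\<lambda>k z. F h k z)) = csw H X x (\<lambda>h y. sw2 H h (\<lambda>h1 h2. F h1 h2 y))"
  (is "?L = ?R")
proof (cases "x \<in> carr X")
  case True
  note pX = comod_precomod[OF X]
  obtain \<Phi> V where V: "linv tscale V s \<Phi>" "module.subspace tscale V"
      "\<And>a b c. c \<in> carr X ==> tens scH tscale a (tens scH pscale b c) \<in> V"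
      "\<And>a b c. c \<in> carr X ==> \<Phi> (tens scH tscale a (tens scH pscale b c)) = F a b c"
    using tensor3_universal[OF vsH vsH vsP vs precomod_subspace[OF pX], of F] F 
    unfolding mtri_def by metis
  have "csw H X x (\<lambda>h y. sw2 H h (\<lambda>h1 h2. tens scH tscale h1 (htens H h2 y))) =
       csw H X x (\<lambda>h y. csw H X y (\<lambda>k z. tens scH tscale h (htens H k z)))"
    using X True by (simp add: left_comodule_def)
  from arg_cong[OF this, of \<Phi>]
  have "csw H X x (\<lambda>h y. \<Phi> (sw2 H h (\<lambda>h1 h2. tens scH tscale h1 (htens H h2 y)))) =
       csw H X x (\<lambda>h y. \<Phi> (csw H X y (\<lambda>k z. tens scH tscale h (htens H k z))))"
    by (subst (asm) (1 2) csw_linv[OF V(1) vsT vs V(2) pX])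
      (auto simp: htens_def V(3) sw2_lsum intro!: lsum_in[OF vsT V(2)] csw_in[OF pX vsT V(2)])
  moreover have "\<Phi> (sw2 H h (\<lambda>h1 h2. tens scH tscale h1 (htens H h2 y))) = sw2 H h (\<lambda>h1 h2. F h1 h2 y)"
    if "y \<in> carr X" for h y
    using that unfolding sw2_lsum
    by (subst lsum_linv[OF V(1) vsT vs V(2)]) (auto simp: htens_def V(3,4))
  moreover have "\<Phi> (csw H X y (\<lambda>k z. tens scH tscale h (htens H k z))) = csw H X y (\<lambda>k z. F h k z)" for h y
    by (subst csw_linv[OF V(1) vsT vs V(2) pX])
      (auto simp: htens_def V(3,4) intro!: csw_cong[OF pX])
  ultimately show ?thesis by (simp cong: csw_cong[OF pX])
next
  case False
  note pX = comod_precomod[OF X]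
  have "?L = 0"
    by (rule csw_outside[OF False pX vs])
      (use F pX vs in \<open>auto simp: mtri_def intro!: linv_csw linv_csw_arg[OF linv_id]\<close>)
  moreover have "?R = 0"
    by (rule csw_outside[OF False pX vs])
      (use F pX vs in \<open>auto simp: mtri_def intro!: linv_sw2 linv_sw2_arg[OF linv_id]\<close>)
  ultimately show ?thesis by simp
qed

lemma csw_counit:
  assumes X: "lcomod X" and vs: "vector_space s" and f: "linv pscale (carr X) s f" and x: "x \<in> carr X"
  shows "csw H X x (\<lambda>h y. s (eps h) (f y)) = f x"
proof -
  note pX = comod_precomod[OF X]
  have "f (csw H X x (\<lambda>h y. pscale (eps h) y)) = f x"
    using X x by (simp add: left_comodule_def)
  then show ?thesis
    using f subspaceD(3)[OF vsP precomod_subspace[OF pX]]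
    by (subst (asm) csw_linv[OF f vsP vs precomod_subspace[OF pX] pX])
      (auto simp: linv_def intro!: csw_cong[OF pX] elim!: trans[rotated])
qed

section \<open>Coactions of several comodules at once\<close>

definition A2 where
  "A2 X Y x y F = csw H X x (\<lambda>h x0. csw H Y y (\<lambda>k y0. F h k x0 y0))"

definition A3 where
  "A3 X Y Z x y z F = csw H X x (\<lambda>h x0. csw H Y y (\<lambda>k y0. csw H Z z (\<lambda>l z0. F h k l x0 y0 z0)))"

definition A4 where
  "A4 X Y Z W x y z w F = csw H X x (\<lambda>h x0. csw H Y y (\<lambda>k y0. csw H Z z (\<lambda>l z0.
     csw H W w (\<lambda>t w0. F h k l t x0 y0 z0 w0))))"

lemma A3_A2: "A3 X Y Z x y z F = csw H X x (\<lambda>h x0. A2 Y Z y z (\<lambda>k l y0 z0. F h k l x0 y0 z0))"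
  by (simp add: A3_def A2_def)

lemma A4_A3: "A4 X Y Z W x y z w F = csw H X x (\<lambda>h x0. A3 Y Z W y z w (\<lambda>k l t y0 z0 w0. F h k l t x0 y0 z0 w0))"
  by (simp add: A4_def A3_def)

text \<open>Sums over different comodules can be interchanged, so coassociativity is applied to one
  comodule at a time. The versions for three and four comodules follow by the same induction
  step.\<close>

lemma A2_coassoc:
  assumes X: "lcomod X" and Y: "lcomod Y" and vs: "vector_space s"
    and G: "\<And>k k' y. y \<in> carr Y ==> mtri X s (\<lambda>h h' x. G h k h' k' x y)"
      "\<And>h h' x. x \<in> carr X ==> mtri Y s (\<lambda>k k' y. G h k h' k' x y)"
  shows "A2 X Y x y (\<lambda>h k x0 y0. A2 X Y x0 y0 (\<lambda>h' k' x1 y1. G h k h' k' x1 y1)) =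
    A2 X Y x y (\<lambda>h k x0 y0. S2 h k (\<lambda>h1 k1 h2 k2. G h1 k1 h2 k2 x0 y0))"
  (is "?L = _")
proof -
  note p = comod_precomod[OF X] comod_precomod[OF Y]
  have "?L =
    csw H X x (\<lambda>h x0. csw H X x0 (\<lambda>h' x1. csw H Y y (\<lambda>k y0. csw H Y y0 (\<lambda>k' y1. G h k h' k' x1 y1))))"
    unfolding A2_def by (subst csw_swap) rule
  also have "... = csw H X x (\<lambda>h x0. csw H X x0 (\<lambda>h' x1. csw H Y y (\<lambda>k y0. sw2 H k (\<lambda>k1 k2. G h k1 h' k2 x1 y0))))"
    by (intro csw_cong[OF p(1)] csw_coassoc[OF Y vs] G)
  also have "... = csw H X x (\<lambda>h x0. sw2 H h (\<lambda>h1 h2. csw H Y y (\<lambda>k y0. sw2 H k (\<lambda>k1 k2. G h1 k1 h2 k2 x0 y0))))"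
    by (rule csw_coassoc[OF X vs]) (intro mtri_csw[OF p(2) vs] mtri_sw2[OF vs] G)
  also have "... = A2 X Y x y (\<lambda>h k x0 y0. S2 h k (\<lambda>h1 k1 h2 k2. G h1 k1 h2 k2 x0 y0))"
    unfolding A2_def S2_def by (subst csw_sw2_swap) rule
  finally show ?thesis .
qed

lemma A2_swap:
  "A2 X Y x y (\<lambda>h k x0 y0. csw H Z z (\<lambda>l z0. F h k x0 y0 l z0)) = csw H Z z (\<lambda>l z0. A2 X Y x y (\<lambda>h k x0 y0. F h k x0 y0 l z0))"
and A2_swap_sw2:
  "A2 X Y x y (\<lambda>h k x0 y0. sw2 H l (\<lambda>l1 l2. K h k x0 y0 l1 l2)) = sw2 H l (\<lambda>l1 l2. A2 X Y x y (\<lambda>h k x0 y0. K h k x0 y0 l1 l2))"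
  unfolding A2_def
  by (subst csw_swap[of Y], rule csw_swap) (subst csw_sw2_swap[of Y], rule csw_sw2_swap)

lemma mtri_A2: "precomod Y ==> precomod Z ==> vector_space s ==>
  (\<And>a b c d. c \<in> carr Y ==> d \<in> carr Z ==> mtri X s (\<lambda>h k y. F a b c d h k y)) ==>
  mtri X s (\<lambda>h k y. A2 Y Z x z (\<lambda>a b c d. F a b c d h k y))"
  unfolding A2_def by (intro mtri_csw)

lemma mtri_S2: "vector_space s ==>
  (\<And>a b c d. mtri X s (\<lambda>h k y. F a b c d h k y)) ==> mtri X s (\<lambda>h k y. S2 x z (\<lambda>a b c d. F a b c d h k y))"
  unfolding S2_def by (intro mtri_sw2)

lemma A2_cong: "precomod X ==> precomod Y ==>
  (\<And>h k x0 y0. x0 \<in> carr X ==> y0 \<in> carr Y ==> F h k x0 y0 = G h k x0 y0) ==> A2 X Y x y F = A2 X Y x y G"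
  unfolding A2_def by (intro csw_cong)

lemma A3_cong: "precomod X ==> precomod Y ==> precomod Z ==>
  (\<And>h k l x0 y0 z0. x0 \<in> carr X ==> y0 \<in> carr Y ==> z0 \<in> carr Z ==> F h k l x0 y0 z0 = G h k l x0 y0 z0) ==>
  A3 X Y Z x y z F = A3 X Y Z x y z G"
  unfolding A3_def by (intro csw_cong)

lemma A3_coassoc:
  assumes X: "lcomod X" and Y: "lcomod Y" and Z: "lcomod Z" and vs: "vector_space s"
    and G: "\<And>k k' y l l' z. y \<in> carr Y ==> z \<in> carr Z ==> mtri X s (\<lambda>h h' x. G h k l h' k' l' x y z)"
      "\<And>h h' x l l' z. x \<in> carr X ==> z \<in> carr Z ==> mtri Y s (\<lambda>k k' y. G h k l h' k' l' x y z)"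
      "\<And>h h' x k k' y. x \<in> carr X ==> y \<in> carr Y ==> mtri Z s (\<lambda>l l' z. G h k l h' k' l' x y z)"
  shows "A3 X Y Z x y z (\<lambda>h k l x0 y0 z0. A3 X Y Z x0 y0 z0 (\<lambda>h' k' l' x1 y1 z1. G h k l h' k' l' x1 y1 z1)) =
    A3 X Y Z x y z (\<lambda>h k l x0 y0 z0. S3 h k l (\<lambda>h1 k1 l1 h2 k2 l2. G h1 k1 l1 h2 k2 l2 x0 y0 z0))"
  (is "?L = _")
proof -
  note p = comod_precomod[OF X] comod_precomod[OF Y] comod_precomod[OF Z]
  have "?L =
    csw H X x (\<lambda>h x0. csw H X x0 (\<lambda>h' x1. A2 Y Z y z (\<lambda>k l y0 z0. A2 Y Z y0 z0 (\<lambda>k' l' y1 z1. G h k l h' k' l' x1 y1 z1))))"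
    unfolding A3_A2 A2_swap ..
  also have "... = csw H X x (\<lambda>h x0. csw H X x0 (\<lambda>h' x1. A2 Y Z y z (\<lambda>k l y0 z0. S2 k l (\<lambda>k1 l1 k2 l2. G h k1 l1 h' k2 l2 x1 y0 z0))))"
    by (intro csw_cong[OF p(1)] A2_coassoc[OF Y Z vs] G)
  also have "... = csw H X x (\<lambda>h x0. sw2 H h (\<lambda>h1 h2. A2 Y Z y z (\<lambda>k l y0 z0. S2 k l (\<lambda>k1 l1 k2 l2. G h1 k1 l1 h2 k2 l2 x0 y0 z0))))"
    by (rule csw_coassoc[OF X vs]) (intro mtri_A2[OF p(2,3) vs] mtri_S2[OF vs] G)
  also have "... = A3 X Y Z x y z (\<lambda>h k l x0 y0 z0. S3 h k l (\<lambda>h1 k1 l1 h2 k2 l2. G h1 k1 l1 h2 k2 l2 x0 y0 z0))"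
    unfolding A3_A2 S3_def S2_def A2_swap_sw2[symmetric] ..
  finally show ?thesis .
qed

lemma A3_swap:
  "A3 X Y W x y w (\<lambda>h k t x0 y0 w0. csw H Z z (\<lambda>l z0. F h k t x0 y0 w0 l z0)) = csw H Z z (\<lambda>l z0. A3 X Y W x y w (\<lambda>h k t x0 y0 w0. F h k t x0 y0 w0 l z0))"
and A3_swap_sw2:
  "A3 X Y W x y w (\<lambda>h k t x0 y0 w0. sw2 H l (\<lambda>l1 l2. K h k t x0 y0 w0 l1 l2)) = sw2 H l (\<lambda>l1 l2. A3 X Y W x y w (\<lambda>h k t x0 y0 w0. K h k t x0 y0 w0 l1 l2))"
  unfolding A3_def
  by (subst csw_swap[of W], subst csw_swap[of Y], rule csw_swap,
      subst csw_sw2_swap[of W], subst csw_sw2_swap[of Y], rule csw_sw2_swap)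

lemma mtri_A3: "precomod Y ==> precomod Z ==> precomod W ==> vector_space s ==>
  (\<And>a b e c d f. c \<in> carr Y ==> d \<in> carr Z ==> f \<in> carr W ==> mtri X s (\<lambda>h k y. F a b e c d f h k y)) ==>
  mtri X s (\<lambda>h k y. A3 Y Z W x z w (\<lambda>a b e c d f. F a b e c d f h k y))"
  unfolding A3_def by (intro mtri_csw)

lemma mtri_S3: "vector_space s ==>
  (\<And>a b c d e f. mtri X s (\<lambda>h k y. F a b c d e f h k y)) ==> mtri X s (\<lambda>h k y. S3 x z w (\<lambda>a b c d e f. F a b c d e f h k y))"
  unfolding S3_def by (intro mtri_sw2)

lemma A4_coassoc:
  assumes X: "lcomod X" and Y: "lcomod Y" and Z: "lcomod Z" and W: "lcomod W"
    and vs: "vector_space s"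
    and G: "\<And>k k' y l l' z t t' w. y \<in> carr Y ==> z \<in> carr Z ==> w \<in> carr W ==> mtri X s (\<lambda>h h' x. G h k l t h' k' l' t' x y z w)"
      "\<And>h h' x l l' z t t' w. x \<in> carr X ==> z \<in> carr Z ==> w \<in> carr W ==> mtri Y s (\<lambda>k k' y. G h k l t h' k' l' t' x y z w)"
      "\<And>h h' x k k' y t t' w. x \<in> carr X ==> y \<in> carr Y ==> w \<in> carr W ==> mtri Z s (\<lambda>l l' z. G h k l t h' k' l' t' x y z w)"
      "\<And>h h' x k k' y l l' z. x \<in> carr X ==> y \<in> carr Y ==> z \<in> carr Z ==> mtri W s (\<lambda>t t' w. G h k l t h' k' l' t' x y z w)"
  shows "A4 X Y Z W x y z w (\<lambda>h k l t x0 y0 z0 w0. A4 X Y Z W x0 y0 z0 w0 (\<lambda>h' k' l' t' x1 y1 z1 w1. G h k l t h' k' l' t' x1 y1 z1 w1)) =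
    A4 X Y Z W x y z w (\<lambda>h k l t x0 y0 z0 w0. S4 h k l t (\<lambda>h1 k1 l1 t1 h2 k2 l2 t2. G h1 k1 l1 t1 h2 k2 l2 t2 x0 y0 z0 w0))"
  (is "?L = _")
proof -
  note p = comod_precomod[OF X] comod_precomod[OF Y] comod_precomod[OF Z] comod_precomod[OF W]
  have "?L =
    csw H X x (\<lambda>h x0. csw H X x0 (\<lambda>h' x1. A3 Y Z W y z w (\<lambda>k l t y0 z0 w0. A3 Y Z W y0 z0 w0 (\<lambda>k' l' t' y1 z1 w1. G h k l t h' k' l' t' x1 y1 z1 w1))))"
    unfolding A4_A3 A3_swap ..
  also have "... = csw H X x (\<lambda>h x0. csw H X x0 (\<lambda>h' x1. A3 Y Z W y z w (\<lambda>k l t y0 z0 w0. S3 k l t (\<lambda>k1 l1 t1 k2 l2 t2. G h k1 l1 t1 h' k2 l2 t2 x1 y0 z0 w0))))"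
    by (intro csw_cong[OF p(1)] A3_coassoc[OF Y Z W vs] G)
  also have "... = csw H X x (\<lambda>h x0. sw2 H h (\<lambda>h1 h2. A3 Y Z W y z w (\<lambda>k l t y0 z0 w0. S3 k l t (\<lambda>k1 l1 t1 k2 l2 t2. G h1 k1 l1 t1 h2 k2 l2 t2 x0 y0 z0 w0))))"
    by (rule csw_coassoc[OF X vs]) (intro mtri_A3[OF p(2-4) vs] mtri_S3[OF vs] G)
  also have "... = A4 X Y Z W x y z w (\<lambda>h k l t x0 y0 z0 w0. S4 h k l t (\<lambda>h1 k1 l1 t1 h2 k2 l2 t2. G h1 k1 l1 t1 h2 k2 l2 t2 x0 y0 z0 w0))"
    unfolding A4_A3 S4_def S3_def A3_swap_sw2[symmetric] ..
  finally show ?thesis .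
qed

end

definition quadlin_on where
  "quadlin_on s1 A s2 B s3 C s4 D s F \<longleftrightarrow>
    (\<forall>b\<in>B. \<forall>c\<in>C. \<forall>d\<in>D. linv s1 A s (\<lambda>a. F a b c d)) \<and> (\<forall>a\<in>A. \<forall>c\<in>C. \<forall>d\<in>D. linv s2 B s (\<lambda>b. F a b c d)) \<and>
    (\<forall>a\<in>A. \<forall>b\<in>B. \<forall>d\<in>D. linv s3 C s (\<lambda>c. F a b c d)) \<and> (\<forall>a\<in>A. \<forall>b\<in>B. \<forall>c\<in>C. linv s4 D s (\<lambda>d. F a b c d))"

context coalg begin

section \<open>Multilinear forms acting on multilinear maps of comodules\<close>

definition qform where
  "qform p \<longleftrightarrow> quadlin_on scH UNIV scH UNIV scH UNIV scH UNIV ((*) :: 'k => _) p"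

lemma lin_app4:
  assumes "qform p"
  shows "linv s V scH f ==> linv s V (*) (\<lambda>x. p (f x) b c d)"
    "linv s V scH f ==> linv s V (*) (\<lambda>x. p a (f x) c d)"
    "linv s V scH f ==> linv s V (*) (\<lambda>x. p a b (f x) d)"
    "linv s V scH f ==> linv s V (*) (\<lambda>x. p a b c (f x))"
  using assms linear_comp_linv[of scH "(*)" "\<lambda>x. p x b c d"] linear_comp_linv[of scH "(*)" "\<lambda>x. p a x c d"]
    linear_comp_linv[of scH "(*)" "\<lambda>x. p a b x d"] linear_comp_linv[of scH "(*)" "p a b c"]
  by (auto simp: qform_def quadlin_on_def linear_iff_linv)

definition conv1 where "conv1 p q h = sw2 H h (\<lambda>a b. p a * q b)" for p q :: "'h => 'k"

definition conv4 where
  "conv4 p q h k l t = S4 h k l t (\<lambda>h1 k1 l1 t1 h2 k2 l2 t2. p h1 k1 l1 t1 * q h2 k2 l2 t2)"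
  for p q :: "'h => 'h => 'h => 'h => 'k"

lemma qform_conv4: "qform p ==> qform q ==> qform (conv4 p q)"
  unfolding conv4_def[abs_def] S4_def
  by (subst qform_def) (auto simp: quadlin_on_def intro!: lin lin_app4[of p] lin_app4[of q])

lemma lform_conv1: "lform H p ==> lform H q ==> lform H (conv1 p q)"
  unfolding conv1_def[abs_def] by (subst lform_def) (auto simp: linear_iff_linv intro!: lin lin_form[of H p] lin_form[of H q])

lemma lform_eps: "lform H eps"
  by (simp add: lform_def lin_eps)

text \<open>The map \<open>f\<close> is precomposed with the operator on \<open>X\<close> that
  contracts the coaction with the form \<open>p\<close>; \<open>act2\<close> to \<open>act4\<close>
  do the same for forms in several variables. The associator is \<Omega> acting on a rebracketing,
  the braiding \<open>r\<close> acting on a flip, and colinearity is tested by linear forms acting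
  on the identity.\<close>

definition act1 where
  "act1 X p f x = csw H X x (\<lambda>h x0. pscale (p h) (f x0))"

definition act2 where
  "act2 X Y p f x y = A2 X Y x y (\<lambda>h k x0 y0. pscale (p h k) (f x0 y0))"

definition act3 where
  "act3 X Y Z p f x y z = A3 X Y Z x y z (\<lambda>h k l x0 y0 z0. pscale (p h k l) (f x0 y0 z0))"

definition act4 where
  "act4 X Y Z W p f x y z w = A4 X Y Z W x y z w (\<lambda>h k l t x0 y0 z0 w0. pscale (p h k l t) (f x0 y0 z0 w0))"

abbreviation lmap where "lmap X f \<equiv> linv pscale (carr X) pscale f"
abbreviation bmap where "bmap X Y f \<equiv> bilin_on pscale (carr X) pscale (carr Y) pscale f"
abbreviation tmap where "tmap X Y Z f \<equiv> trilin_on pscale (carr X) pscale (carr Y) pscale (carr Z) pscale f"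
abbreviation qmap where "qmap X Y Z W f \<equiv> quadlin_on pscale (carr X) pscale (carr Y) pscale (carr Z) pscale (carr W) pscale f"

lemmas multilin_on_defs = bilin_on_def trilin_on_def quadlin_on_def

lemma pscale_sums:
  "pscale c (csw H X x F) = csw H X x (\<lambda>h y. pscale c (F h y))"
  "pscale (sw2 H h G) v = sw2 H h (\<lambda>a b. pscale (G a b) v)"
  "pscale c (A2 X Y x y F2) = A2 X Y x y (\<lambda>h k x0 y0. pscale c (F2 h k x0 y0))"
  "pscale c (A3 X Y Z x y z F3) = A3 X Y Z x y z (\<lambda>h k l x0 y0 z0. pscale c (F3 h k l x0 y0 z0))"
  "pscale c (A4 X Y Z W x y z w F4) = A4 X Y Z W x y z w (\<lambda>h k l t x0 y0 z0 w0. pscale c (F4 h k l t x0 y0 z0 w0))"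
  unfolding A2_def A3_def A4_def by (simp_all add: csw_scale sw2_coeff)

text \<open>Coassociativity of the coaction turns a composite of two actions into the action of a
  convolution product. With its versions for more variables this derives identities of morphisms
  from identities of forms.\<close>

lemma act1_act1:
  assumes X: "lcomod X" and p: "lform H p" and q: "lform H q" and f: "lmap X f"
  shows "act1 X p (act1 X q f) x = act1 X (conv1 p q) f x"
proof -
  have "csw H X x (\<lambda>h y. csw H X y (\<lambda>k z. pscale (p h * q k) (f z))) =
    csw H X x (\<lambda>h y. sw2 H h (\<lambda>h1 h2. pscale (p h1 * q h2) (f y)))"
    by (rule csw_coassoc[OF X vsP])
      (use f in \<open>auto simp: mtri_def intro!: lin lin_form[OF p] lin_form[OF q]\<close>)
  then show ?thesis by (simp add: act1_def conv1_def pscale_sums vs_rules(3))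
qed

lemma act2_act2:
  assumes X: "lcomod X" and Y: "lcomod Y" and p: "bform p" and q: "bform q" and f: "bmap X Y f"
  shows "act2 X Y p (act2 X Y q f) x y = act2 X Y (conv2 H p q) f x y"
proof -
  have "A2 X Y x y (\<lambda>h k x0 y0. A2 X Y x0 y0 (\<lambda>h' k' x1 y1. pscale (p h k * q h' k') (f x1 y1))) =
    A2 X Y x y (\<lambda>h k x0 y0. S2 h k (\<lambda>h1 k1 h2 k2. pscale (p h1 k1 * q h2 k2) (f x0 y0)))"
    by (rule A2_coassoc[OF X Y vsP])
      (use f in \<open>auto simp: mtri_def multilin_on_defs intro!: lin lin_app2[OF p] lin_app2[OF q]\<close>)
  then show ?thesis by (simp add: act2_def conv2_def S2_def pscale_sums vs_rules(3))
qed

lemma act3_act3: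
  assumes X: "lcomod X" and Y: "lcomod Y" and Z: "lcomod Z"
    and p: "tform p" and q: "tform q" and f: "tmap X Y Z f"
  shows "act3 X Y Z p (act3 X Y Z q f) x y z = act3 X Y Z (conv3 H p q) f x y z"
proof -
  have "A3 X Y Z x y z (\<lambda>h k l x0 y0 z0. A3 X Y Z x0 y0 z0 (\<lambda>h' k' l' x1 y1 z1. pscale (p h k l * q h' k' l') (f x1 y1 z1))) =
    A3 X Y Z x y z (\<lambda>h k l x0 y0 z0. S3 h k l (\<lambda>h1 k1 l1 h2 k2 l2. pscale (p h1 k1 l1 * q h2 k2 l2) (f x0 y0 z0)))"
    by (rule A3_coassoc[OF X Y Z vsP])
      (use f in \<open>auto simp: mtri_def multilin_on_defs intro!: lin lin_app3[OF p] lin_app3[OF q]\<close>)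
  then show ?thesis by (simp add: act3_def conv3_def S3_def pscale_sums vs_rules(3))
qed

lemma act4_act4:
  assumes X: "lcomod X" and Y: "lcomod Y" and Z: "lcomod Z" and W: "lcomod W"
    and p: "qform p" and q: "qform q" and f: "qmap X Y Z W f"
  shows "act4 X Y Z W p (act4 X Y Z W q f) x y z w = act4 X Y Z W (conv4 p q) f x y z w"
proof -
  have "A4 X Y Z W x y z w (\<lambda>h k l t x0 y0 z0 w0. A4 X Y Z W x0 y0 z0 w0 (\<lambda>h' k' l' t' x1 y1 z1 w1. pscale (p h k l t * q h' k' l' t') (f x1 y1 z1 w1))) =
    A4 X Y Z W x y z w (\<lambda>h k l t x0 y0 z0 w0. S4 h k l t (\<lambda>h1 k1 l1 t1 h2 k2 l2 t2. pscale (p h1 k1 l1 t1 * q h2 k2 l2 t2) (f x0 y0 z0 w0)))"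
    by (rule A4_coassoc[OF X Y Z W vsP])
      (use f in \<open>auto simp: mtri_def multilin_on_defs intro!: lin lin_app4[OF p] lin_app4[OF q]\<close>)
  then show ?thesis by (simp add: act4_def conv4_def S4_def pscale_sums vs_rules(3))
qed

lemma lmap_act1: 
  assumes "precomod X" "lform H p" "lmap X f"
  shows "lmap X (act1 X p f)"
  unfolding act1_def[abs_def]
  using assms by (auto intro!: lin lin_form[OF assms(2)])

lemma bmap_act2:
  assumes "precomod X" "precomod Y" "bform p" "bmap X Y f"
  shows "bmap X Y (act2 X Y p f)"
  using assms unfolding bilin_on_def act2_def[abs_def] A2_def
  by (auto intro!: lin lin_app2[OF assms(3)])

lemma tmap_act3:
  assumes "precomod X" "precomod Y" "precomod Z" "tform p" "tmap X Y Z f"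
  shows "tmap X Y Z (act3 X Y Z p f)"
  using assms unfolding trilin_on_def act3_def[abs_def] A3_def
  by (auto intro!: lin lin_app3[OF assms(4)])

lemma act1_eps: "lcomod X ==> lmap X f ==> x \<in> carr X ==> act1 X eps f x = f x"
  unfolding act1_def by (rule csw_counit) auto

lemma act2_split:
  assumes "precomod X"
  shows "act2 X Y (\<lambda>h k. p h * q k) f x y = act1 X p (\<lambda>x. act1 Y q (f x) y) x"
  by (simp add: act2_def act1_def A2_def pscale_sums vs_rules(3))

lemma act2_e2:
  assumes "lcomod X" "lcomod Y" "bmap X Y f" "x \<in> carr X" "y \<in> carr Y"
  shows "act2 X Y e2 f x y = f x y"
  using assms unfolding e2_def act2_split[OF comod_precomod[OF assms(1)]]
  by (subst act1_eps) (auto simp: act1_def multilin_on_defs csw_counit intro!: lin comod_precomod)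

lemma act3_split3:
  "act3 X Y Z (\<lambda>h k l. p h k * q l) f x y z = act2 X Y p (\<lambda>x y. act1 Z q (f x y) z) x y"
  by (simp add: act3_def act2_def act1_def A2_def A3_def pscale_sums vs_rules(3))

lemma act3_split1:
  "act3 X Y Z (\<lambda>h k l. q h * p k l) f x y z = act1 X q (\<lambda>x. act2 Y Z p (f x) y z) x"
  by (simp add: act3_def act2_def act1_def A2_def A3_def pscale_sums vs_rules(3))

lemma act3_split2:
  "act3 X Y Z (\<lambda>h k l. p h l * q k) f x y z = act2 X Z p (\<lambda>x z. act1 Y q (\<lambda>y. f x y z) y) x z"
  by (simp add: act3_def act2_def act1_def A2_def A3_def pscale_sums vs_rules(3) csw_swap[of Y])

lemma act4_split4:
  "act4 X Y Z W (\<lambda>h k l t. p h k l * q t) f x y z w = act3 X Y Z p (\<lambda>x y z. act1 W q (f x y z) w) x y z"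
  by (simp add: act4_def act3_def act1_def A4_def A3_def pscale_sums vs_rules(3))

lemma act4_split1:
  "act4 X Y Z W (\<lambda>h k l t. q h * p k l t) f x y z w = act1 X q (\<lambda>x. act3 Y Z W p (f x) y z w) x"
  by (simp add: act4_def act3_def act1_def A4_def A3_def pscale_sums vs_rules(3))

lemma act2_cong: "precomod X ==> precomod Y ==>
  (\<And>x0 y0. x0 \<in> carr X ==> y0 \<in> carr Y ==> f x0 y0 = g x0 y0) ==> act2 X Y p f x y = act2 X Y p g x y"
  unfolding act2_def by (intro A2_cong) auto

lemma act3_cong: "precomod X ==> precomod Y ==> precomod Z ==>
  (\<And>x0 y0 z0. x0 \<in> carr X ==> y0 \<in> carr Y ==> z0 \<in> carr Z ==> f x0 y0 z0 = g x0 y0 z0) ==>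
  act3 X Y Z p f x y z = act3 X Y Z p g x y z"
  unfolding act3_def by (intro A3_cong) auto

lemma act4_cong: "precomod X ==> precomod Y ==> precomod Z ==> precomod W ==>
  (\<And>x0 y0 z0 w0. x0 \<in> carr X ==> y0 \<in> carr Y ==> z0 \<in> carr Z ==> w0 \<in> carr W ==> f x0 y0 z0 w0 = g x0 y0 z0 w0) ==>
  act4 X Y Z W p f x y z w = act4 X Y Z W p g x y z w"
  unfolding act4_def A4_def by (intro csw_cong) auto

text \<open>A counit in one variable leaves that tensor factor untouched. This matches a morphism
  tensored with an identity with a form padded by \<open>eps\<close>, and makes all forms in one
  computation depend on the same variables.\<close>

lemma act3_pad3:
  assumes "precomod X" "precomod Y" "lcomod Z" "tmap X Y Z f" "z \<in> carr Z"
  shows "act3 X Y Z (\<lambda>h k l. p h k * eps l) f x y z = act2 X Y p (\<lambda>x y. f x y z) x y"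
  unfolding act3_split3 using assms
  by (intro act2_cong act1_eps) (auto simp: multilin_on_defs)

lemma act3_pad2:
  assumes "precomod X" "lcomod Y" "precomod Z" "tmap X Y Z f" "y \<in> carr Y"
  shows "act3 X Y Z (\<lambda>h k l. p h l * eps k) f x y z = act2 X Z p (\<lambda>x z. f x y z) x z"
  unfolding act3_split2 using assms
  by (intro act2_cong) (auto simp: multilin_on_defs act1_eps)

lemma act3_pad1:
  assumes "lcomod X" "precomod Y" "precomod Z" "tmap X Y Z f" "x \<in> carr X"
  shows "act3 X Y Z (\<lambda>h k l. eps h * p k l) f x y z = act2 Y Z p (f x) y z"
proof -
  have "lmap X (\<lambda>x. act2 Y Z p (f x) y z)"
    using assms unfolding act2_def A2_def by (auto simp: multilin_on_defs intro!: lin)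
  then show ?thesis unfolding act3_split1 by (rule act1_eps[OF assms(1) _ assms(5)])
qed

lemma act3_e3:
  assumes "lcomod X" "lcomod Y" "lcomod Z" "tmap X Y Z f" "x \<in> carr X" "y \<in> carr Y" "z \<in> carr Z"
  shows "act3 X Y Z e3 f x y z = f x y z"
  using act3_pad3[of X Y Z f z e2] act2_e2[of X Y "\<lambda>x y. f x y z" x y] assms
  by (simp add: e3_def e2_def comod_precomod multilin_on_defs)

lemma act4_pad4:
  assumes "precomod X" "precomod Y" "precomod Z" "lcomod W" "qmap X Y Z W f" "w \<in> carr W"
  shows "act4 X Y Z W (\<lambda>h k l t. p h k l * eps t) f x y z w = act3 X Y Z p (\<lambda>x y z. f x y z w) x y z"
  unfolding act4_split4 using assms
  by (intro act3_cong act1_eps) (auto simp: multilin_on_defs)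

lemma act4_pad1:
  assumes "lcomod X" "precomod Y" "precomod Z" "precomod W" "qmap X Y Z W f" "x \<in> carr X"
  shows "act4 X Y Z W (\<lambda>h k l t. eps h * p k l t) f x y z w = act3 Y Z W p (f x) y z w"
proof -
  have "lmap X (\<lambda>x. act3 Y Z W p (f x) y z w)"
    using assms unfolding act3_def A3_def by (auto simp: multilin_on_defs intro!: lin)
  then show ?thesis unfolding act4_split1 by (rule act1_eps[OF assms(1) _ assms(6)])
qed

text \<open>An action produces a finite linear combination of values of the given map, and a linear
  map can be moved inside it.\<close>

lemma act_linear:
  assumes "linv pscale V pscale g" "module.subspace pscale V"
  shows act1_linear: "precomod X ==> (\<And>x. x \<in> carr X ==> f1 x \<in> V) ==>
      g (act1 X p1 f1 x) = act1 X p1 (\<lambda>x. g (f1 x)) x"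
    and act2_linear: "precomod X ==> precomod Y ==> (\<And>x y. x \<in> carr X ==> y \<in> carr Y ==> f2 x y \<in> V) ==>
      g (act2 X Y p2 f2 x y) = act2 X Y p2 (\<lambda>x y. g (f2 x y)) x y"
    and act3_linear: "precomod X ==> precomod Y ==> precomod Z ==>
      (\<And>x y z. x \<in> carr X ==> y \<in> carr Y ==> z \<in> carr Z ==> f3 x y z \<in> V) ==>
      g (act3 X Y Z p3 f3 x y z) = act3 X Y Z p3 (\<lambda>x y z. g (f3 x y z)) x y z"
    and act4_linear: "precomod X ==> precomod Y ==> precomod Z ==> precomod W ==>
      (\<And>x y z w. x \<in> carr X ==> y \<in> carr Y ==> z \<in> carr Z ==> w \<in> carr W ==> f4 x y z w \<in> V) ==>
      g (act4 X Y Z W p4 f4 x y z w) = act4 X Y Z W p4 (\<lambda>x y z w. g (f4 x y z w)) x y z w"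
proof -
  note sub = subspaceD[OF vsP assms(2)]
  note l = csw_linv[OF assms(1) vsP vsP assms(2)]
  note i = csw_in[OF _ vsP assms(2)]
  note s = linvD(2)[OF assms(1)]
  show "precomod X ==> (\<And>x. x \<in> carr X ==> f1 x \<in> V) ==>
      g (act1 X p1 f1 x) = act1 X p1 (\<lambda>x. g (f1 x)) x"
    unfolding act1_def by (subst l) (auto simp: s sub intro!: csw_cong)
  show "precomod X ==> precomod Y ==> (\<And>x y. x \<in> carr X ==> y \<in> carr Y ==> f2 x y \<in> V) ==>
      g (act2 X Y p2 f2 x y) = act2 X Y p2 (\<lambda>x y. g (f2 x y)) x y"
    unfolding act2_def A2_def by (subst l, assumption) (auto simp: s sub l intro!: i csw_cong)
  show "precomod X ==> precomod Y ==> precomod Z ==>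
      (\<And>x y z. x \<in> carr X ==> y \<in> carr Y ==> z \<in> carr Z ==> f3 x y z \<in> V) ==>
      g (act3 X Y Z p3 f3 x y z) = act3 X Y Z p3 (\<lambda>x y z. g (f3 x y z)) x y z"
    unfolding act3_def A3_def by (subst l, assumption) (auto simp: s sub l i intro!: i csw_cong)
  show "precomod X ==> precomod Y ==> precomod Z ==> precomod W ==>
      (\<And>x y z w. x \<in> carr X ==> y \<in> carr Y ==> z \<in> carr Z ==> w \<in> carr W ==> f4 x y z w \<in> V) ==>
      g (act4 X Y Z W p4 f4 x y z w) = act4 X Y Z W p4 (\<lambda>x y z w. g (f4 x y z w)) x y z w"
    unfolding act4_def A4_def by (subst l, assumption) (auto simp: s sub l i intro!: i csw_cong)
qed

lemma act_in:
  assumes "module.subspace pscale V"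
  shows act1_in: "precomod X ==> (\<And>x. x \<in> carr X ==> f1 x \<in> V) ==> act1 X p1 f1 x \<in> V"
    and act2_in: "precomod X ==> precomod Y ==> (\<And>x y. x \<in> carr X ==> y \<in> carr Y ==> f2 x y \<in> V) ==>
      act2 X Y p2 f2 x y \<in> V"
    and act3_in: "precomod X ==> precomod Y ==> precomod Z ==>
      (\<And>x y z. x \<in> carr X ==> y \<in> carr Y ==> z \<in> carr Z ==> f3 x y z \<in> V) ==> act3 X Y Z p3 f3 x y z \<in> V"
  unfolding act1_def act2_def act3_def A2_def A3_def
  by (auto intro!: csw_in[OF _ vsP assms] subspaceD(3)[OF vsP assms])

lemma csw_chom:
  assumes "(X, f, Y) \<in> chom H X Y" "precomod X" "precomod Y" "vector_space s" "x \<in> carr X"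
    "\<And>y. y \<in> carr Y ==> linv scH UNIV s (\<lambda>h. F h y)" "\<And>h. linv pscale (carr Y) s (F h)"
  shows "csw H Y (f x) F = csw H X x (\<lambda>h y. F h (f y))"
proof -
  have f: "\<And>y. y \<in> carr X ==> f y \<in> carr Y" "coact Y (f x) = csw H X x (\<lambda>h y. htens H h (f y))"
    using assms(1,5) by (auto simp: chom_def)
  note F = csw_functional[of Y s F, OF assms(3,4,6,7)]
  have "csw H Y (f x) F = sweedler scH pscale UNIV (carr Y) (csw H X x (\<lambda>h y. htens H h (f y))) F"
    using F(2)[of "f x"] by (simp add: f(2))
  also have "... = csw H X x (\<lambda>h y. sweedler scH pscale UNIV (carr Y) (htens H h (f y)) F)"
    by (rule csw_linv[OF F(1) vsT assms(4) subspace_tspace assms(2)])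
      (simp_all add: f(1) htens_def tens_in_tspace)
  also have "... = csw H X x (\<lambda>h y. F h (f y))"
    by (rule csw_cong[OF assms(2)]) (simp add: f(1) F(3))
  finally show ?thesis .
qed

text \<open>Linear forms on \<open>H\<close> separate the elements of \<open>H\<close> tensored with
  a space of vectors: a bilinear form \<beta> is expanded along the finitely many coordinates that
  occur, and each \<beta>(-, \<open>vbas i\<close>) is a linear form on \<open>H\<close>.\<close>

lemma htens_separate:
  assumes "\<And>\<phi>. lform H \<phi> ==> lsum L (\<lambda>h y. pscale (\<phi> h) y) = lsum M (\<lambda>h y. pscale (\<phi> h) y)"
  shows "lsum L (htens H) = lsum M (htens H)"
proof (rule ext)
  fix \<beta> :: "'h => ('k, 'a) vec => 'k"
  have app: "lsum K (htens H) \<beta> = lsum K (\<lambda>h y. htens H h y \<beta>)" for K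
    by (induction K) auto
  show "lsum L (htens H) \<beta> = lsum M (htens H) \<beta>"
  proof (cases "bilin scH pscale (*) \<beta>")
    case False
    then show ?thesis by (simp add: app htens_def tens_def)
  next
    case True
    define I where "I = (\<Union>(h, y)\<in>set L \<union> set M. Poly_Mapping.keys y)"
    have fin: "finite I" by (auto simp: I_def)
    have lb: "lform H (\<lambda>h. \<beta> h (vbas i))" "linv pscale UNIV (*) (\<beta> h)" for i h
      using True by (auto simp: lform_def linear_iff_linv bilin_iff_linv)
    have look: "Poly_Mapping.lookup (lsum K (\<lambda>h y. pscale (g h) y)) i = lsum K (\<lambda>h y. g h * Poly_Mapping.lookup y i)" for K i
        and g :: "'h => 'k"
      by (induction K) (auto simp: lookup_add)
    have bv: "\<beta> h y = (\<Sum>i\<in>I. \<beta> h (vbas i) * Poly_Mapping.lookup y i)" if "Poly_Mapping.keys y \<subseteq> I" for h and y :: "('k, 'a) vec"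
    proof -
      have "\<beta> h y = (\<Sum>i\<in>Poly_Mapping.keys y. \<beta> h (vbas i) * Poly_Mapping.lookup y i)"
        by (subst vec_expand[of y], subst linv_sum[OF lb(2)])
          (auto simp: linvD[OF lb(2)] mult.commute)
      also have "... = (\<Sum>i\<in>I. \<beta> h (vbas i) * Poly_Mapping.lookup y i)"
        using that fin by (intro sum.mono_neutral_left) (auto simp: in_keys_iff)
      finally show ?thesis .
    qed
    have "lsum K (htens H) \<beta> = (\<Sum>i\<in>I. Poly_Mapping.lookup (lsum K (\<lambda>h y. pscale (\<beta> h (vbas i)) y)) i)"
      if "set K \<subseteq> set L \<union> set M" for K
      using that unfolding app look
    proof (induction K)
      case (Cons a K)
      obtain h y where a: "a = (h, y)" by (cases a)
      have "Poly_Mapping.keys y \<subseteq> I" using Cons.prems by (auto simp: I_def a)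
      from bv[OF this] Cons True show ?case
        by (simp add: a htens_def tens_def sum.distrib)
    qed simp
    then show ?thesis using assms[OF lb(1)] by simp
  qed
qed

lemma chomI:
  assumes X: "precomod X" and Y: "precomod Y" and f: "lin_on pscale pscale (carr X) f"
    and mem: "\<And>x. x \<in> carr X ==> f x \<in> carr Y"
    and eq: "\<And>\<phi> x. lform H \<phi> ==> x \<in> carr X ==> act1 Y \<phi> (\<lambda>y. y) (f x) = f (act1 X \<phi> (\<lambda>y. y) x)"
  shows "(X, f, Y) \<in> chom H X Y"
proof -
  have "coact Y (f x) = csw H X x (\<lambda>h y. htens H h (f y))" if x: "x \<in> carr X" for x
  proof -
    have "lsum (clist Y (f x)) (htens H) = lsum (map (\<lambda>(h, y). (h, f y)) (clist X x)) (htens H)"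
    proof (rule htens_separate)
      fix \<phi> assume \<phi>: "lform H \<phi>"
      have "f (act1 X \<phi> (\<lambda>y. y) x) = act1 X \<phi> f x"
        using f by (subst act1_linear[OF _ precomod_subspace[OF X] X]) (auto simp: lin_on_iff)
      with eq[OF \<phi> x] show "lsum (clist Y (f x)) (\<lambda>h y. pscale (\<phi> h) y) =
        lsum (map (\<lambda>(h, y). (h, f y)) (clist X x)) (\<lambda>h y. pscale (\<phi> h) y)"
        by (simp add: lsum_map act1_def csw_lsum)
    qed
    then show ?thesis using clist(2)[OF Y, of "f x"] by (simp add: lsum_map csw_lsum)
  qed
  then show ?thesis using f mem by (auto simp: chom_def)
qed

lemma act1_chom:
  assumes "(X, f, Y) \<in> chom H X Y" "precomod X" "precomod Y" "x \<in> carr X" "lform H \<phi>" "lmap Y g"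
  shows "act1 Y \<phi> g (f x) = act1 X \<phi> (\<lambda>x. g (f x)) x"
  unfolding act1_def
  by (rule csw_chom[OF assms(1-3) _ assms(4)]) (use assms in \<open>auto intro!: lin lin_form[OF assms(5)]\<close>)

end

section \<open>The braided category of comodules\<close>

definition mp :: "('k::field, 'h, 'u) carrow => ('k, 'u) vec => ('k, 'u) vec" where
  "mp a = fst (snd a)"

lemma mp_simps [simp]: "mp (X, f, Y) = f" "mp (ccomp b a) = mp b \<circ> mp a"
  "mp (cadd a b) = (\<lambda>x. mp a x + mp b x)" "mp (csmul c a) = (\<lambda>x. pscale c (mp a x))"
  "mp (cid Z) = (\<lambda>x. if x \<in> carr Z then x else 0)"
  by (auto simp: mp_def ccomp_def cadd_def csmul_def cid_def split: prod.splits)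

lemma pscale_minus_one: "x + pscale (-1) x = 0"
  by (rule poly_mapping_eqI) (simp add: lookup_add)

lemma ccomp_assoc: "ccomp c (ccomp b a) = ccomp (ccomp c b) a"
  by (auto simp: ccomp_def o_assoc split: prod.splits)

context coalg begin

lemma chom_mp:
  assumes "a \<in> chom H X Y"
  shows "a = (X, mp a, Y)" "lin_on pscale pscale (carr X) (mp a)" "linv pscale (carr X) pscale (mp a)"
    "x \<in> carr X ==> mp a x \<in> carr Y" "x \<notin> carr X ==> mp a x = 0"
  using assms by (auto simp: chom_def lin_on_iff)

lemma chom_eqI:
  assumes "a \<in> chom H X Y" "b \<in> chom H X Y" "\<And>x. x \<in> carr X ==> mp a x = mp b x"
  shows "a = b"
  using chom_mp(1)[OF assms(1)] chom_mp(1)[OF assms(2)]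
    lin_on_eqI[OF chom_mp(2)[OF assms(1)] chom_mp(2)[OF assms(2)] assms(3)] by metis

text \<open>
  Colinearity is tested by applying linear forms on \<open>H\<close> to the coactions; this turns it into an
  identity between elements of convolution algebras of forms.
\<close>

lemma chomI':
  assumes "precomod X" "precomod Y" "a = (X, f, Y)" "lin_on pscale pscale (carr X) f"
    "\<And>x. x \<in> carr X ==> f x \<in> carr Y"
    "\<And>\<phi> x. lform H \<phi> ==> x \<in> carr X ==> act1 Y \<phi> (\<lambda>y. y) (f x) = act1 X \<phi> f x"
  shows "a \<in> chom H X Y"
proof -
  have "f (act1 X \<phi> (\<lambda>y. y) x) = act1 X \<phi> f x" for \<phi> x
    using assms(4) by (subst act1_linear[OF _ precomod_subspace[OF assms(1)] assms(1)]) (auto simp: lin_on_iff)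
  with assms show ?thesis by (auto intro!: chomI)
qed

lemma act1_mp:
  assumes "a \<in> chom H X Y" "precomod X" "precomod Y" "x \<in> carr X" "lform H \<phi>" "lmap Y g"
  shows "act1 Y \<phi> g (mp a x) = act1 X \<phi> (\<lambda>x. g (mp a x)) x"
  using act1_chom[of X "mp a" Y x \<phi> g] assms chom_mp(1)[OF assms(1)] by simp

lemma act1_cong: "precomod X ==> (\<And>x. x \<in> carr X ==> f x = g x) ==> act1 X p f x = act1 X p g x"
  unfolding act1_def by (intro csw_cong) auto

lemma lmap_id: "lmap X (\<lambda>x. x)"
  by (rule linv_id)

lemma chom_id: 
  assumes "precomod X" shows "cid X \<in> chom H X X"
  using subspaceD[OF vsP precomod_subspace[OF assms]] assms
  by (intro chomI'[of X X _ "\<lambda>x. if x \<in> carr X then x else 0"])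
    (auto simp: cid_def lin_on_def intro!: act1_cong)

lemma chom_comp:
  assumes "precomod X" "precomod Y" "precomod Z" "a \<in> chom H X Y" "b \<in> chom H Y Z"
  shows "ccomp b a \<in> chom H X Z"
proof -
  note A = chom_mp[OF assms(4)] and B = chom_mp[OF assms(5)]
  have "ccomp b a = (X, mp b \<circ> mp a, Z)"
    by (subst A(1), subst B(1)) (simp add: ccomp_def)
  moreover have "mp b 0 = 0"
    using linv_0[OF B(3) _ _ precomod_subspace[OF assms(2)]] by simp
  ultimately show ?thesis
    using assms A B
    by (intro chomI'[of X Z]) (auto simp: lin_on_iff o_def act1_mp lmap_id intro: linv_comp)
qed

lemma chom_add:
  assumes "precomod X" "precomod Y" "a \<in> chom H X Y" "b \<in> chom H X Y"
  shows "cadd a b \<in> chom H X Y" "cadd a b = (X, \<lambda>x. mp a x + mp b x, Y)"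
proof -
  note A = chom_mp[OF assms(3)] and B = chom_mp[OF assms(4)]
  show e: "cadd a b = (X, \<lambda>x. mp a x + mp b x, Y)"
    by (subst A(1), subst B(1)) (simp add: cadd_def)
  have "act1 Y \<phi> (\<lambda>y. y) (mp a x + mp b x) = act1 X \<phi> (\<lambda>x. mp a x + mp b x) x"
    if "lform H \<phi>" "x \<in> carr X" for \<phi> x
    using linvD(1)[OF lmap_act1[OF assms(2) that(1) lmap_id], of "mp a x" "mp b x"] that assms A(4) B(4)
    by (simp add: act1_mp lmap_id) (simp add: act1_def csw_add vs_rules)
  with e show "cadd a b \<in> chom H X Y"
    using assms A B subspaceD(2)[OF vsP precomod_subspace[OF assms(2)]]
    by (intro chomI'[of X Y]) (auto simp: lin_on_iff intro!: linv_add)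
qed

lemma chom_smul:
  assumes "precomod X" "precomod Y" "a \<in> chom H X Y"
  shows "csmul c a \<in> chom H X Y" "csmul c a = (X, \<lambda>x. pscale c (mp a x), Y)"
proof -
  note A = chom_mp[OF assms(3)]
  show e: "csmul c a = (X, \<lambda>x. pscale c (mp a x), Y)"
    by (subst A(1)) (simp add: csmul_def)
  have "act1 Y \<phi> (\<lambda>y. y) (pscale c (mp a x)) = act1 X \<phi> (\<lambda>x. pscale c (mp a x)) x"
    if "lform H \<phi>" "x \<in> carr X" for \<phi> x
    using linvD(2)[OF lmap_act1[OF assms(2) that(1) lmap_id], of "mp a x" c] that assms A(4)
    by (simp add: act1_mp lmap_id) (simp add: act1_def pscale_sums vs_rules(3) mult.commute)
  with e show "csmul c a \<in> chom H X Y"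
    using assms A subspaceD(3)[OF vsP precomod_subspace[OF assms(2)]]
    by (intro chomI'[of X Y]) (auto simp: lin_on_iff vs_rules intro!: linv_pscale)
qed

lemma linear_category_comod:
  assumes "Obj C = {X. lcomod X}" "Hom C = chom H" "Idt C = cid" "Cmp C = ccomp" "Add C = cadd" "Smul C = csmul"
  shows "linear_category C"
proof -
  note p = comod_precomod
  have zero: "\<exists>z\<in>chom H X Y. \<forall>f\<in>chom H X Y. cadd z f = f \<and> cadd f (csmul (-1) f) = z"
    if "precomod X" "precomod Y" for X Y :: "('k, 'h, 'd) comod"
  proof (rule bexI[of _ "(X, \<lambda>x. 0, Y)"])
    have "(X, \<lambda>x. 0, Y) \<in> chom H X Y"
    proof (rule chomI'[OF that refl])
      fix \<phi> x assume "lform H \<phi>"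
      from linv_0[OF lmap_act1[OF that(2) this lmap_id] _ _ precomod_subspace[OF that(2)]]
      have "act1 Y \<phi> (\<lambda>y. y) 0 = 0" by simp
      then show "act1 Y \<phi> (\<lambda>y. y) 0 = act1 X \<phi> (\<lambda>x. 0) x"
        by (simp add: act1_def csw_lsum vs_rules)
    qed (use subspaceD(1)[OF vsP precomod_subspace[OF that(2)]] in \<open>auto simp: lin_on_def vs_rules\<close>)
    then show "(X, \<lambda>x. 0, Y) \<in> chom H X Y" .
    show "\<forall>f\<in>chom H X Y. cadd (X, \<lambda>x. 0, Y) f = f \<and> cadd f (csmul (-1) f) = (X, \<lambda>x. 0, Y)"
      using that by (auto intro!: chom_eqI[of _ X Y] chom_add chom_smul \<open>(X, \<lambda>x. 0, Y) \<in> chom H X Y\<close>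
        simp: pscale_minus_one)
  qed
  show ?thesis
    unfolding linear_category_def assms
  proof (intro conjI ballI allI; (elim CollectE)?)
    fix X Y Z W :: "('k, 'h, 'd) comod"
    assume X: "lcomod X"
    show "cid X \<in> chom H X X" by (rule chom_id[OF p[OF X]])
    assume Y: "lcomod Y"
    note XY = p[OF X] p[OF Y]
    show "\<exists>z\<in>chom H X Y. \<forall>f\<in>chom H X Y. cadd z f = f \<and> cadd f (csmul (- 1) f) = z"
      by (rule zero[OF XY])
    fix f g h assume f: "f \<in> chom H X Y"
    show "ccomp f (cid X) = f" "ccomp (cid Y) f = f"
      using f chom_mp[OF f] chom_comp[OF XY(1,1,2) chom_id[OF XY(1)] f] chom_comp[OF XY(1,2,2) f chom_id[OF XY(2)]]
      by (auto intro!: chom_eqI[of _ X Y])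
    show "csmul 1 f = f"
      using XY f by (auto intro!: chom_eqI[of _ X Y] chom_smul simp: vs_rules)
    fix c d show "csmul c f \<in> chom H X Y" using XY f by (rule chom_smul)
    show "csmul (c * d) f = csmul c (csmul d f)" "csmul (c + d) f = cadd (csmul c f) (csmul d f)"
      using XY f by (auto intro!: chom_eqI[of _ X Y] chom_smul chom_add simp: vs_rules)
    assume g: "g \<in> chom H X Y"
    show "cadd f g \<in> chom H X Y" using XY f g by (intro chom_add)
    show "cadd f g = cadd g f" "csmul c (cadd f g) = cadd (csmul c f) (csmul c g)"
      using XY f g by (auto intro!: chom_eqI[of _ X Y] chom_smul chom_add simp: vs_rules add.commute)
    assume h: "h \<in> chom H X Y"
    show "cadd (cadd f g) h = cadd f (cadd g h)"
      using XY f g h by (auto intro!: chom_eqI[of _ X Y] chom_add simp: add.assoc)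
  next
    fix X Y Z :: "('k, 'h, 'd) comod" and f g
    assume "lcomod X" "lcomod Y" "lcomod Z" "f \<in> chom H X Y" "g \<in> chom H Y Z"
    then show "ccomp g f \<in> chom H X Z" by (intro chom_comp[of X Y Z] p)
  next
    fix X Y Z W :: "('k, 'h, 'd) comod" and f g h
    show "ccomp h (ccomp g f) = ccomp (ccomp h g) f" by (rule ccomp_assoc)
  next
    fix X Y Z :: "('k, 'h, 'd) comod" and f f' g g' c
    assume "lcomod X" "lcomod Y" "lcomod Z"
      and *: "f \<in> chom H X Y" "f' \<in> chom H X Y" "g \<in> chom H Y Z" "g' \<in> chom H Y Z"
    then have XYZ: "precomod X" "precomod Y" "precomod Z" by (auto intro: p)
    note mem = chom_comp[OF XYZ] chom_add[OF XYZ(1,2)] chom_add[OF XYZ(1,3)] chom_add[OF XYZ(2,3)]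
      chom_smul[OF XYZ(1,2)] chom_smul[OF XYZ(1,3)] chom_smul[OF XYZ(2,3)]
    show "ccomp (cadd g g') f = cadd (ccomp g f) (ccomp g' f)"
      "ccomp g (cadd f f') = cadd (ccomp g f) (ccomp g f')"
      "ccomp (csmul c g) f = csmul c (ccomp g f)" "ccomp g (csmul c f) = csmul c (ccomp g f)"
      using * chom_mp(4)[OF *(1)] chom_mp(4)[OF *(2)]
      by (auto intro!: chom_eqI[of _ X Z] mem simp: linvD[OF chom_mp(3)[OF *(3)]])
  qed
qed

text \<open>The inverse of a bijective colinear map is colinear: \<open>y\<close> is written as
  \<open>f (g y)\<close> and the testing form is moved through \<open>f\<close>.\<close>

lemma chom_inverse:
  assumes "precomod X" "precomod Y" "(X, f, Y) \<in> chom H X Y" "lin_on pscale pscale (carr Y) g"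
    "\<And>y. y \<in> carr Y ==> g y \<in> carr X"
    "\<And>x. x \<in> carr X ==> g (f x) = x" "\<And>y. y \<in> carr Y ==> f (g y) = y"
  shows "(Y, g, X) \<in> chom H Y X" "ccomp (Y, g, X) (X, f, Y) = cid X" "ccomp (X, f, Y) (Y, g, X) = cid Y"
proof -
  note F = chom_mp[OF assms(3), simplified]
  have g: "lmap Y g" using assms(4) by (simp add: lin_on_iff)
  have 0: "f 0 = 0" "g 0 = 0"
    using linv_0[OF F(3) _ _ precomod_subspace[OF assms(1)]] linv_0[OF g _ _ precomod_subspace[OF assms(2)]] by auto
  show G: "(Y, g, X) \<in> chom H Y X"
  proof (rule chomI'[OF assms(2,1) refl assms(4,5)])
    fix \<phi> y assume \<phi>: "lform H \<phi>" and y: "y \<in> carr Y"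
    have "act1 Y \<phi> g y = act1 Y \<phi> g (f (g y))" using y assms(7) by simp
    also have "... = act1 X \<phi> (\<lambda>x. g (f x)) (g y)"
      by (rule act1_chom[OF assms(3,1,2) assms(5)[OF y] \<phi> g])
    also have "... = act1 X \<phi> (\<lambda>x. x) (g y)" by (rule act1_cong[OF assms(1)]) (rule assms(6))
    finally show "act1 X \<phi> (\<lambda>y. y) (g y) = act1 Y \<phi> g y" ..
  qed
  show "ccomp (Y, g, X) (X, f, Y) = cid X" "ccomp (X, f, Y) (Y, g, X) = cid Y"
    using F(4,5) assms(4,6,7) 0 by (auto simp: ccomp_def cid_def fun_eq_iff lin_on_iff)
qed

end

lemma tcarr_lift3r:
  assumes A: "module.subspace pscale A" and B: "module.subspace pscale B" and C: "module.subspace pscale C"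
    and vs: "vector_space s"
    and F: "trilin_on pscale A pscale B pscale C s F"
  obtains f where "lin_on pscale s (tcarr A (tcarr B C)) f"
    "\<And>x y z. x \<in> A ==> y \<in> B ==> z \<in> C ==> f (x \<otimes> (y \<otimes> z)) = F x y z"
proof -
  have "\<exists>g. lin_on pscale s (tcarr B C) g \<and> (\<forall>y\<in>B. \<forall>z\<in>C. g (y \<otimes> z) = F x y z)" if "x \<in> A" for x
    by (rule tcarr_lift[OF B C vs, of "F x"]) (use F that in \<open>auto simp: bilin_on_def trilin_on_def\<close>)
  then obtain g where g: "\<And>x. x \<in> A ==> lin_on pscale s (tcarr B C) (g x)"
    "\<And>x y z. z \<in> C ==> x \<in> A ==> y \<in> B ==> g x (y \<otimes> z) = F x y z"
    by metis
  have gl: "linv pscale (tcarr B C) s (g z)" if "z \<in> A" for z using g(1)[OF that] by (simp add: lin_on_iff)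
  have lC: "linv pscale A s (\<lambda>x. F x y z)" if "y \<in> B" "z \<in> C" for y z
    using F that by (auto simp: trilin_on_def)
  have "linv pscale A s (\<lambda>z. g z w)" if w: "w \<in> tcarr B C" for w
    unfolding linv_def
  proof (intro conjI ballI allI)
    fix z z' assume z: "z \<in> A" "z' \<in> A"
    then have "z + z' \<in> A" using subspaceD[OF vsP A] by auto
    with z show "g (z + z') w = g z w + g z' w"
      by - (rule tcarr_ext[OF gl linv_add[OF gl gl vs] vs _ w], auto simp: g(2) linvD[OF lC])
  next
    fix z c assume z: "z \<in> A"
    then have "pscale c z \<in> A" using subspaceD[OF vsP A] by auto
    with z show "g (pscale c z) w = s c (g z w)"
      by - (rule tcarr_ext[OF gl linv_const_scale[OF gl vs] vs _ w], auto simp: g(2) linvD[OF lC])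
  qed
  then have "bilin_on pscale A pscale (tcarr B C) s g"
    using gl by (auto simp: bilin_on_def)
  from tcarr_lift[OF A subspace_tcarr vs this]
  obtain f where f: "lin_on pscale s (tcarr A (tcarr B C)) f"
    "\<And>x w. x \<in> A ==> w \<in> tcarr B C ==> f (x \<otimes> w) = g x w" by blast
  show ?thesis
    by (rule that[OF f(1)]) (simp add: f(2) g(2))
qed

text \<open>A product that is a coalgebra map is what the diagonal coaction on a tensor product is
  made of. The locale is instantiated with the product of \<open>H\<close> and with that of
  \<open>H\<^sup>\<lambda>\<close>, for which associativity holds only up to the associator.\<close>

locale coalg_mult = coalg +
  fixes m :: "'b => 'b => 'b"
  assumes mult: "mult_coalg_map H m"
begin

abbreviation TA where "TA == ctens_arr H m"
abbreviation T :: "('a, 'b, 'u) comod => ('a, 'b, 'u) comod => ('a, 'b, 'u) comod" where "T \<equiv> ctens H m"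

lemma bilin_m: "bilin scH scH scH m"
  using mult by (simp add: mult_coalg_map_def)

lemmas lin_m [lin] = lin_app2[OF bilin_m]

lemma eps_m: "eps (m h k) = eps h * eps k"
  using mult by (simp add: mult_coalg_map_def)

lemma sw2_m:
  assumes vs: "vector_space s" "\<And>b. linv scH UNIV s (\<lambda>a. F a b)" "\<And>a. linv scH UNIV s (\<lambda>b. F a b)"
  shows "sw2 H (m h k) F = S2 h k (\<lambda>h1 k1 h2 k2. F (m h1 k1) (m h2 k2))"
proof -
  have F: "bilin_on scH UNIV scH UNIV s F" using assms by (auto simp: bilin_on_def)
  define \<Phi> where "\<Phi> = (\<lambda>T. sweedler scH scH UNIV UNIV T F)"
  have \<Phi>: "linv tscale (tspace scH scH UNIV UNIV) s \<Phi>" "\<Phi> (tens2 H a b) = F a b" for a b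
    unfolding \<Phi>_def tens2_def using linv_sweedler[OF _ _ vs(1) _ _ F] sweedler_tens[OF _ _ vs(1) _ _ F] by auto
  have "sw2 H (m h k) F = \<Phi> (sw2 H h (\<lambda>h1 h2. sw2 H k (\<lambda>k1 k2. tens2 H (m h1 k1) (m h2 k2))))"
    using mult by (simp add: sw2_def[of _ "m h k"] \<Phi>_def mult_coalg_map_def)
  also have "... = S2 h k (\<lambda>h1 k1 h2 k2. F (m h1 k1) (m h2 k2))"
    unfolding S2_def \<Phi>(2)[symmetric] sw2_lsum
    by (subst lsum_linv[OF \<Phi>(1) vsT vs(1) subspace_tspace],
        (rule lsum_in[OF vsT subspace_tspace], simp add: tens2_def tens_in_tspace),
        subst lsum_linv[OF \<Phi>(1) vsT vs(1) subspace_tspace],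
        simp add: tens2_def tens_in_tspace, rule refl)
  finally show ?thesis .
qed

lemma carr_T [simp]: "carr (T X Y) = tcarr (carr X) (carr Y)"
  by (simp add: ctens_def ctens_carr_tcarr)

lemma htens_linv [lin]:
  "linv s V scH f ==> linv s V tscale (\<lambda>v. htens H (f v) y)"
  "linv s V pscale g ==> linv s V tscale (\<lambda>v. htens H h (g v))"
  unfolding htens_def by (auto intro!: linv_tens1 linv_tens2)

context
  fixes X Y :: "('a, 'b, 'u) comod"
  assumes XY: "precomod X" "precomod Y"
begin

lemma coact_T: "lin_on pscale tscale (tcarr (carr X) (carr Y)) (coact (T X Y))"
  "x \<in> carr X ==> y \<in> carr Y ==> coact (T X Y) (x \<otimes> y) = A2 X Y x y (\<lambda>h k x0 y0. htens H (m h k) (x0 \<otimes> y0))"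
proof -
  let ?F = "\<lambda>x y. A2 X Y x y (\<lambda>h k x0 y0. htens H (m h k) (x0 \<otimes> y0))"
  have "bilin_on pscale (carr X) pscale (carr Y) tscale ?F"
    unfolding bilin_on_def A2_def using XY by (auto intro!: lin)
  note * = the_lin_tcarr[OF precomod_subspace[OF XY(1)] precomod_subspace[OF XY(2)] vsT this refl]
  show "lin_on pscale tscale (tcarr (carr X) (carr Y)) (coact (T X Y))"
    "x \<in> carr X ==> y \<in> carr Y ==> coact (T X Y) (x \<otimes> y) = ?F x y"
    using * by (simp_all add: ctens_def ctens_carr_tcarr A2_def)
qed

lemma precomod_T: "precomod (T X Y)"
  unfolding precomod_def carr_T
proof (intro conjI ballI)
  show "coact (T X Y) v \<in> tspace scH pscale UNIV (tcarr (carr X) (carr Y))" if v: "v \<in> tcarr (carr X) (carr Y)" for v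
  proof (rule tcarr_in[OF _ vsT subspace_tspace _ v])
    fix x y assume "x \<in> carr X" "y \<in> carr Y"
    then show "coact (T X Y) (x \<otimes> y) \<in> tspace scH pscale UNIV (tcarr (carr X) (carr Y))"
      using XY unfolding coact_T(2)[OF \<open>x \<in> carr X\<close> \<open>y \<in> carr Y\<close>] A2_def
      by (intro csw_in[OF _ vsT subspace_tspace]) (auto simp: htens_def intro!: tens_in_tspace)
  qed (use coact_T(1) in \<open>simp add: lin_on_iff\<close>)
qed (simp_all add: coact_T(1))

lemma csw_T:
  assumes "vector_space s" "x \<in> carr X" "y \<in> carr Y"
    "\<And>v. v \<in> tcarr (carr X) (carr Y) ==> linv scH UNIV s (\<lambda>h. F h v)"
    "\<And>h. linv pscale (tcarr (carr X) (carr Y)) s (F h)"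
  shows "csw H (T X Y) (x \<otimes> y) F = A2 X Y x y (\<lambda>h k x0 y0. F (m h k) (x0 \<otimes> y0))"
proof -
  define \<Phi> where "\<Phi> = (\<lambda>U. sweedler scH pscale UNIV (carr (T X Y)) U F)"
  have \<Phi>: "linv tscale (tspace scH pscale UNIV (carr (T X Y))) s \<Phi>" "csw H (T X Y) x F = \<Phi> (coact (T X Y) x)"
    "\<And>h y. y \<in> carr (T X Y) ==> \<Phi> (htens H h y) = F h y" for x
    using csw_functional[of "T X Y" s F] precomod_T assms unfolding \<Phi>_def by auto
  have in2: "htens H h v \<in> tspace scH pscale UNIV (carr (T X Y))" if "v \<in> carr (T X Y)" for h v
    using that by (simp add: htens_def tens_in_tspace)
  have "csw H (T X Y) (x \<otimes> y) F = \<Phi> (A2 X Y x y (\<lambda>h k x0 y0. htens H (m h k) (x0 \<otimes> y0)))"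
    by (simp add: \<Phi>(2) coact_T(2)[OF assms(2,3)])
  also have "... = A2 X Y x y (\<lambda>h k x0 y0. \<Phi> (htens H (m h k) (x0 \<otimes> y0)))"
    unfolding A2_def
    by (subst csw_linv[OF \<Phi>(1) vsT assms(1) subspace_tspace XY(1)],
        rule csw_in[OF XY(2) vsT subspace_tspace in2], simp,
        intro csw_cong[OF XY(1)], rule csw_linv[OF \<Phi>(1) vsT assms(1) subspace_tspace XY(2) in2], simp)
  also have "... = A2 X Y x y (\<lambda>h k x0 y0. F (m h k) (x0 \<otimes> y0))"
    by (rule A2_cong[OF XY]) (simp add: \<Phi>(3))
  finally show ?thesis .
qed

end

text \<open>Evaluated on \<open>x \<otimes> y\<close>, the coassociativity of the diagonal coaction
  combines coassociativity in both factors, \<open>A2_coassoc\<close>, with the multiplicativity of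
  the coproduct, \<open>sw2_m\<close>.\<close>

lemma comod_T:
  assumes X: "lcomod X" and Y: "lcomod Y"
  shows "lcomod (T X Y)"
proof -
  note XY = comod_precomod[OF X] comod_precomod[OF Y]
  note pT = precomod_T[OF XY]
  note sub = precomod_subspace[OF XY(1)] precomod_subspace[OF XY(2)]
  have co: "csw H (T X Y) v (\<lambda>h y. sw2 H h (\<lambda>h1 h2. tens scH tscale h1 (htens H h2 y))) =
       csw H (T X Y) v (\<lambda>h y. csw H (T X Y) y (\<lambda>k z. tens scH tscale h (htens H k z)))"
    if v: "v \<in> tcarr (carr X) (carr Y)" for v
  proof (rule tcarr_ext[OF _ _ vsT _ v])
    fix x y assume xy: "x \<in> carr X" "y \<in> carr Y"
    have "csw H (T X Y) (x \<otimes> y) (\<lambda>h y. sw2 H h (\<lambda>h1 h2. tens scH tscale h1 (htens H h2 y))) =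
      A2 X Y x y (\<lambda>h k x0 y0. S2 h k (\<lambda>h1 k1 h2 k2. tens scH tscale (m h1 k1) (htens H (m h2 k2) (x0 \<otimes> y0))))"
      using xy by (subst csw_T[OF XY vsT])
        (auto intro!: lin A2_cong[OF XY] sw2_m[OF vsT])
    also have "... = A2 X Y x y (\<lambda>h k x0 y0. A2 X Y x0 y0 (\<lambda>h' k' x1 y1. tens scH tscale (m h k) (htens H (m h' k') (x1 \<otimes> y1))))"
      by (rule A2_coassoc[symmetric, OF X Y vsT]) (auto simp: mtri_def intro!: lin)
    also have "... = A2 X Y x y (\<lambda>h k x0 y0. csw H (T X Y) (x0 \<otimes> y0) (\<lambda>h' z. tens scH tscale (m h k) (htens H h' z)))"
      using XY by (intro A2_cong, simp_all, subst csw_T[OF XY vsT]) (auto intro!: lin)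
    also have "... = csw H (T X Y) (x \<otimes> y) (\<lambda>h y. csw H (T X Y) y (\<lambda>k z. tens scH tscale h (htens H k z)))"
      using xy pT by (subst csw_T[OF XY vsT]) (auto intro!: lin)
    finally show "csw H (T X Y) (x \<otimes> y) (\<lambda>h y. sw2 H h (\<lambda>h1 h2. tens scH tscale h1 (htens H h2 y))) =
       csw H (T X Y) (x \<otimes> y) (\<lambda>h y. csw H (T X Y) y (\<lambda>k z. tens scH tscale h (htens H k z)))" .
  qed (use pT in \<open>auto intro!: lin\<close>)
  have cu: "csw H (T X Y) v (\<lambda>h y. pscale (eps h) y) = v" if v: "v \<in> tcarr (carr X) (carr Y)" for v
  proof (rule tcarr_ext[OF _ _ vsP _ v])
    fix x y assume xy: "x \<in> carr X" "y \<in> carr Y"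
    have "csw H (T X Y) (x \<otimes> y) (\<lambda>h y. pscale (eps h) y) = act2 X Y e2 (\<otimes>) x y"
      using xy by (subst csw_T[OF XY vsP]) (auto simp: eps_m act2_def e2_def intro!: lin)
    also have "... = x \<otimes> y"
      using X Y xy by (intro act2_e2) (auto simp: bilin_on_def intro!: lin)
    finally show "csw H (T X Y) (x \<otimes> y) (\<lambda>h y. pscale (eps h) y) = x \<otimes> y" .
  qed (use pT in \<open>auto intro!: lin\<close>)
  show ?thesis
    unfolding left_comodule_def using pT co cu by (simp add: precomod_def)
qed

lemma act1_T:
  assumes "precomod X" "precomod Y" "lform H p" "lmap (T X Y) f" "x \<in> carr X" "y \<in> carr Y"
  shows "act1 (T X Y) p f (x \<otimes> y) = act2 X Y (\<lambda>h k. p (m h k)) (\<lambda>x y. f (x \<otimes> y)) x y"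
  using assms unfolding act1_def act2_def by (subst csw_T[OF assms(1,2) vsP]) (auto intro!: lin lin_form[OF assms(3)])

lemma act2_T1:
  assumes "precomod X" "precomod Y" "precomod Z" "bform p" "bmap (T X Y) Z f" "x \<in> carr X" "y \<in> carr Y"
  shows "act2 (T X Y) Z p f (x \<otimes> y) z = act3 X Y Z (\<lambda>h k l. p (m h k) l) (\<lambda>x y z. f (x \<otimes> y) z) x y z"
  using assms unfolding act2_def act3_def A2_def A3_def
  by (subst csw_T[OF assms(1,2) vsP]) (auto simp: A2_def bilin_on_def intro!: lin lin_app2[OF assms(4)])

lemma act2_T2:
  assumes "precomod X" "precomod Y" "precomod Z" "bform p" "bmap X (T Y Z) f" "y \<in> carr Y" "z \<in> carr Z"
  shows "act2 X (T Y Z) p f x (y \<otimes> z) = act3 X Y Z (\<lambda>h k l. p h (m k l)) (\<lambda>x y z. f x (y \<otimes> z)) x y z"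
  using assms unfolding act2_def act3_def A2_def A3_def
  by (intro csw_cong[OF assms(1)], subst csw_T[OF assms(2,3) vsP]) (auto simp: A2_def bilin_on_def intro!: lin lin_app2[OF assms(4)])

lemma act3_T1:
  assumes "precomod X" "precomod Y" "precomod Z" "precomod W" "tform p" "tmap (T X Y) Z W f" "x \<in> carr X" "y \<in> carr Y"
  shows "act3 (T X Y) Z W p f (x \<otimes> y) z w =
    act4 X Y Z W (\<lambda>h k l t. p (m h k) l t) (\<lambda>x y z w. f (x \<otimes> y) z w) x y z w"
  using assms unfolding act3_def act4_def A3_def A4_def
  by (subst csw_T[OF assms(1,2) vsP]) (auto simp: A2_def trilin_on_def intro!: lin lin_app3[OF assms(5)])

lemma act3_T2:
  assumes "precomod X" "precomod Y" "precomod Z" "precomod W" "tform p" "tmap X (T Y Z) W f" "y \<in> carr Y" "z \<in> carr Z"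
  shows "act3 X (T Y Z) W p f x (y \<otimes> z) w =
    act4 X Y Z W (\<lambda>h k l t. p h (m k l) t) (\<lambda>x y z w. f x (y \<otimes> z) w) x y z w"
  using assms unfolding act3_def act4_def A3_def A4_def
  by (intro csw_cong[OF assms(1)], subst csw_T[OF assms(2,3) vsP]) (auto simp: A2_def trilin_on_def intro!: lin lin_app3[OF assms(5)])

lemma act3_T3:
  assumes "precomod X" "precomod Y" "precomod Z" "precomod W" "tform p" "tmap X Y (T Z W) f" "z \<in> carr Z" "w \<in> carr W"
  shows "act3 X Y (T Z W) p f x y (z \<otimes> w) =
    act4 X Y Z W (\<lambda>h k l t. p h k (m l t)) (\<lambda>x y z w. f x y (z \<otimes> w)) x y z w"
  using assms unfolding act3_def act4_def A3_def A4_def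
  by (intro csw_cong[OF assms(1)] csw_cong[OF assms(2)], subst csw_T[OF assms(3,4) vsP])
    (auto simp: A2_def trilin_on_def intro!: lin lin_app3[OF assms(5)])

section \<open>Colinear maps out of iterated tensor products\<close>

lemma chom_T_ext:
  assumes "a \<in> chom H (T X Y) Z" "b \<in> chom H (T X Y) Z"
    "\<And>x y. x \<in> carr X ==> y \<in> carr Y ==> mp a (x \<otimes> y) = mp b (x \<otimes> y)"
  shows "a = b"
  by (rule chom_eqI[OF assms(1,2)], rule tcarr_ext[OF chom_mp(3)[OF assms(1), simplified] chom_mp(3)[OF assms(2), simplified] vsP assms(3)]) simp_all

lemma chom_T3_ext:
  assumes "a \<in> chom H (T (T X Y) Z) W" "b \<in> chom H (T (T X Y) Z) W"
    "\<And>x y z. x \<in> carr X ==> y \<in> carr Y ==> z \<in> carr Z ==> mp a ((x \<otimes> y) \<otimes> z) = mp b ((x \<otimes> y) \<otimes> z)"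
  shows "a = b"
  by (rule chom_eqI[OF assms(1,2)], rule tcarr_ext3[OF chom_mp(3)[OF assms(1), simplified] chom_mp(3)[OF assms(2), simplified] vsP assms(3)]) simp_all

lemma chom_T3r_ext:
  assumes "a \<in> chom H (T X (T Y Z)) W" "b \<in> chom H (T X (T Y Z)) W"
    "\<And>x y z. x \<in> carr X ==> y \<in> carr Y ==> z \<in> carr Z ==> mp a (x \<otimes> (y \<otimes> z)) = mp b (x \<otimes> (y \<otimes> z))"
  shows "a = b"
  by (rule chom_eqI[OF assms(1,2)], rule tcarr_ext3r[OF chom_mp(3)[OF assms(1), simplified] chom_mp(3)[OF assms(2), simplified] vsP assms(3)]) simp_all

lemma chom_T4_ext:
  assumes "a \<in> chom H (T (T (T X Y) Z) W) V" "b \<in> chom H (T (T (T X Y) Z) W) V"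
    "\<And>x y z w. x \<in> carr X ==> y \<in> carr Y ==> z \<in> carr Z ==> w \<in> carr W ==>
      mp a (((x \<otimes> y) \<otimes> z) \<otimes> w) = mp b (((x \<otimes> y) \<otimes> z) \<otimes> w)"
  shows "a = b"
  by (rule chom_eqI[OF assms(1,2)], rule tcarr_ext4[OF chom_mp(3)[OF assms(1), simplified] chom_mp(3)[OF assms(2), simplified] vsP assms(3)]) simp_all

lemma chom_TI:
  assumes XY: "precomod X" "precomod Y" and Z: "precomod Z" and f: "lin_on pscale pscale (tcarr (carr X) (carr Y)) f"
    and mem: "\<And>x y. x \<in> carr X ==> y \<in> carr Y ==> f (x \<otimes> y) \<in> carr Z"
    and eq: "\<And>\<phi> x y. lform H \<phi> ==> x \<in> carr X ==> y \<in> carr Y ==>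
      act1 Z \<phi> (\<lambda>z. z) (f (x \<otimes> y)) = act2 X Y (\<lambda>h k. \<phi> (m h k)) (\<lambda>x y. f (x \<otimes> y)) x y"
  shows "(T X Y, f, Z) \<in> chom H (T X Y) Z"
proof (rule chomI'[OF precomod_T[OF XY] Z refl])
  have fl: "linv pscale (tcarr (carr X) (carr Y)) pscale f" using f by (simp add: lin_on_iff)
  show memT: "f v \<in> carr Z" if "v \<in> carr (T X Y)" for v
    using tcarr_in[OF fl vsP precomod_subspace[OF Z] mem] that by simp
  fix \<phi> v assume \<phi>: "lform H \<phi>" and v: "v \<in> carr (T X Y)"
  have l: "lmap (T X Y) (act1 (T X Y) \<phi> f)"
    using precomod_T[OF XY] \<phi> fl by (intro lmap_act1) auto
  show "act1 Z \<phi> (\<lambda>y. y) (f v) = act1 (T X Y) \<phi> f v"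
  proof (rule tcarr_ext[OF _ l[unfolded carr_T] vsP _ v[unfolded carr_T]])
    show "linv pscale (tcarr (carr X) (carr Y)) pscale (\<lambda>v. act1 Z \<phi> (\<lambda>y. y) (f v))"
      by (rule linv_comp[OF lmap_act1[OF Z \<phi> lmap_id] fl]) (use memT in simp)
    show "act1 Z \<phi> (\<lambda>y. y) (f (x \<otimes> y)) = act1 (T X Y) \<phi> f (x \<otimes> y)" if "x \<in> carr X" "y \<in> carr Y" for x y
      using eq[OF \<phi> that] that XY \<phi> fl by (subst act1_T) auto
  qed
qed (use f in simp)

lemma T_arr:
  assumes "precomod X" "precomod Y" "precomod X'" "precomod Y'" "a \<in> chom H X X'" "b \<in> chom H Y Y'"
  shows "TA a b \<in> chom H (T X Y) (T X' Y')"
    "x \<in> carr X ==> y \<in> carr Y ==> mp (TA a b) (x \<otimes> y) = mp a x \<otimes> mp b y"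
proof -
  note A = chom_mp[OF assms(5)] and B = chom_mp[OF assms(6)]
  define f where "f = mp (TA a b)"
  have e: "TA a b = (T X Y, f, T X' Y')"
    using A(1) B(1) unfolding f_def by (cases a, cases b) (simp add: ctens_arr_def)
  have fe: "f = the_lin pscale pscale (tcarr (carr X) (carr Y)) (\<lambda>p. \<forall>x\<in>carr X. \<forall>y\<in>carr Y. p (x \<otimes> y) = mp a x \<otimes> mp b y)"
    using A(1) B(1) unfolding f_def by (cases a, cases b) (simp add: ctens_arr_def ctens_carr_tcarr)
  have bl: "bmap X Y (\<lambda>x y. mp a x \<otimes> mp b y)"
    using A(3) B(3) by (auto simp: bilin_on_def intro!: lin)
  note * = the_lin_tcarr[OF precomod_subspace[OF assms(1)] precomod_subspace[OF assms(2)] vsP bl refl, folded fe]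
  show "x \<in> carr X ==> y \<in> carr Y ==> mp (TA a b) (x \<otimes> y) = mp a x \<otimes> mp b y"
    unfolding f_def[symmetric] by (rule *(2))
  show "TA a b \<in> chom H (T X Y) (T X' Y')"
    unfolding e
  proof (rule chom_TI[OF assms(1,2) precomod_T[OF assms(3,4)] *(1)])
    fix \<phi> x y assume \<phi>: "lform H \<phi>" and xy: "x \<in> carr X" "y \<in> carr Y"
    have "act1 (T X' Y') \<phi> (\<lambda>z. z) (f (x \<otimes> y)) = act2 X' Y' (\<lambda>h k. \<phi> (m h k)) (\<otimes>) (mp a x) (mp b y)"
      using xy A(4) B(4) assms \<phi> by (simp add: *(2) act1_T linv_id)
    also have "... = act2 X Y (\<lambda>h k. \<phi> (m h k)) (\<lambda>x y. f (x \<otimes> y)) x y"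
    proof -
      have "csw H X' (mp a x) (\<lambda>h x0. csw H Y' (mp b y) (\<lambda>k y0. pscale (\<phi> (m h k)) (x0 \<otimes> y0))) =
        csw H X x (\<lambda>h x0. csw H Y' (mp b y) (\<lambda>k y0. pscale (\<phi> (m h k)) (mp a x0 \<otimes> y0)))"
        using assms A(1) xy
        by (intro csw_chom[OF _ _ _ vsP]) (auto intro!: lin lin_form[OF \<phi>])
      also have "... = csw H X x (\<lambda>h x0. csw H Y y (\<lambda>k y0. pscale (\<phi> (m h k)) (mp a x0 \<otimes> mp b y0)))"
        using assms B(1) xy
        by (intro csw_cong[OF assms(1)] csw_chom[OF _ _ _ vsP]) (auto intro!: lin lin_form[OF \<phi>])
      also have "... = csw H X x (\<lambda>h x0. csw H Y y (\<lambda>k y0. pscale (\<phi> (m h k)) (f (x0 \<otimes> y0))))"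
        by (intro csw_cong[OF assms(1)] csw_cong[OF assms(2)]) (simp add: *(2))
      finally show ?thesis by (simp add: act2_def A2_def)
    qed
    finally show "act1 (T X' Y') \<phi> (\<lambda>z. z) (f (x \<otimes> y)) = act2 X Y (\<lambda>h k. \<phi> (m h k)) (\<lambda>x y. f (x \<otimes> y)) x y" .
  qed (use *(2) A(4) B(4) in auto)
qed

end

context coalg begin

lemma carr_kline [simp]: "carr (kline H g) = vspan {evec}"
  by (simp add: kline_def)

lemma coact_kline: "coact (kline H g :: ('k, 'h, 'u) comod) = (\<lambda>v. if v \<in> vspan {evec} then htens H g v else 0)"
  (is "_ = ?f")
proof -
  have fl: "lin_on pscale tscale (vspan {evec}) ?f"
    unfolding htens_def by (intro lin_on_restrict linv_tens2 linv_id) auto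
  have "the_lin pscale tscale (vspan {evec}) (\<lambda>f. f evec = htens H g evec) = ?f"
  proof (rule the_lin_eq[OF fl])
    fix k :: "('k, 'u) vec => ('h, ('k, 'u) vec, 'k) tensor" and v :: "('k, 'u) vec"
    assume k: "lin_on pscale tscale (vspan {evec}) k" "k evec = htens H g evec" and v: "v \<in> vspan {evec}"
    show "k v = ?f v"
      by (rule linv_eq_vspan[OF _ _ vsT _ v]) (use k fl in \<open>auto simp: lin_on_iff\<close>)
  qed simp
  then show ?thesis by (simp add: kline_def)
qed

lemma precomod_kline: "precomod (kline H g)"
  unfolding precomod_def coact_kline htens_def
  by (auto simp: tens_in_tspace intro!: lin_on_restrict linv_tens2 linv_id)

lemma csw_kline:
  assumes "vector_space s" "\<And>y. y \<in> vspan {evec} ==> linv scH UNIV s (\<lambda>h. F h y)"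
     "\<And>h. linv pscale (vspan {evec}) s (F h)" "v \<in> vspan {evec}"
  shows "csw H (kline H g) v F = F g v"
  using csw_eqI[OF precomod_kline, of g v "[(g, v)]" s F] assms by (simp add: coact_kline)

lemma comod_kline:
  assumes "grouplike H g"
  shows "lcomod (kline H g)"
  unfolding left_comodule_def
proof (intro conjI ballI)
  let ?K = "kline H g :: ('k, 'h, 'b) comod"
  fix x assume x: "x \<in> carr ?K"
  have "csw H ?K x (\<lambda>h y. sw2 H h (\<lambda>h1 h2. tens scH tscale h1 (htens H h2 y))) = tens scH tscale g (htens H g x)"
    using x assms unfolding htens_def
    by (subst csw_kline[OF vsT], auto intro!: lin)
      (subst sw2_grouplike[OF assms vsT], auto intro!: lin)
  moreover have "csw H ?K x (\<lambda>h y. csw H ?K y (\<lambda>k z. tens scH tscale h (htens H k z))) = tens scH tscale g (htens H g x)"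
    using x precomod_kline unfolding htens_def
    by (subst csw_kline[OF vsT], auto intro!: lin)
      (subst csw_kline[OF vsT], auto intro!: lin)
  ultimately show "csw H ?K x (\<lambda>h y. sw2 H h (\<lambda>h1 h2. tens scH tscale h1 (htens H h2 y))) =
      csw H ?K x (\<lambda>h y. csw H ?K y (\<lambda>k z. tens scH tscale h (htens H k z)))" by simp
  show "csw H ?K x (\<lambda>h y. pscale (eps h) y) = x"
    using x assms by (subst csw_kline[OF vsP]) (auto simp: grouplike_def vs_rules intro!: lin)
qed (use precomod_kline in \<open>auto simp: precomod_def\<close>)

lemma sw2_cong: "(\<And>a b. F a b = G a b) ==> sw2 H h F = sw2 H h G"
  by presburger

section \<open>Convolution with forms padded by the counit\<close>

lemma conv3_pad2:
  assumes "tform q"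
  shows "conv3 H q (\<lambda>h k l. b h l * eps k) h k l = sw2 H h (\<lambda>h1 h2. sw2 H l (\<lambda>l1 l2. q h1 k l1 * b h2 l2))"
proof -
  have "conv3 H q (\<lambda>h k l. b h l * eps k) h k l =
     sw2 H h (\<lambda>h1 h2. sw2 H l (\<lambda>l1 l2. sw2 H k (\<lambda>k1 k2. (q h1 k1 l1 * b h2 l2) * eps k2)))"
    unfolding conv3_def by (subst sw2_swap[of k]) (simp add: mult.assoc)
  also have "... = sw2 H h (\<lambda>h1 h2. sw2 H l (\<lambda>l1 l2. q h1 k l1 * b h2 l2))"
    by (intro sw2_cong sw2_eps_right lin lin_app3[OF assms])
  finally show ?thesis .
qed

lemma conv3_pad3L:
  assumes "tform s"
  shows "conv3 H (\<lambda>h k l. a h k * eps l) s h k l = sw2 H h (\<lambda>h1 h2. sw2 H k (\<lambda>k1 k2. a h1 k1 * s h2 k2 l))"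
proof -
  have "conv3 H (\<lambda>h k l. a h k * eps l) s h k l =
     sw2 H h (\<lambda>h1 h2. sw2 H k (\<lambda>k1 k2. sw2 H l (\<lambda>l1 l2. eps l1 * (a h1 k1 * s h2 k2 l2))))"
    unfolding conv3_def by (simp add: mult_ac)
  also have "... = sw2 H h (\<lambda>h1 h2. sw2 H k (\<lambda>k1 k2. a h1 k1 * s h2 k2 l))"
    by (intro sw2_cong sw2_eps_left lin lin_app3[OF assms])
  finally show ?thesis .
qed

lemma conv3_pad1L:
  assumes "tform s"
  shows "conv3 H (\<lambda>h k l. eps h * a k l) s h k l = sw2 H k (\<lambda>k1 k2. sw2 H l (\<lambda>l1 l2. a k1 l1 * s h k2 l2))"
proof -
  have "conv3 H (\<lambda>h k l. eps h * a k l) s h k l =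
     sw2 H h (\<lambda>h1 h2. eps h1 * sw2 H k (\<lambda>k1 k2. sw2 H l (\<lambda>l1 l2. a k1 l1 * s h2 k2 l2)))"
    unfolding conv3_def by (simp add: mult_ac sw2_mult_left)
  also have "... = sw2 H k (\<lambda>k1 k2. sw2 H l (\<lambda>l1 l2. a k1 l1 * s h k2 l2))"
    by (intro sw2_eps_left lin lin_app3[OF assms] vsF)
  finally show ?thesis .
qed

lemma tform_pads:
  assumes "bform a"
  shows "tform (\<lambda>h k l. a h k * eps l)" "tform (\<lambda>h k l. a h l * eps k)" "tform (\<lambda>h k l. eps h * a k l)"
  by (auto intro!: trilinI lin lin_app2[OF assms])

text \<open>The four coproduct factors in the hexagon axiom for \<open>r\<close> arise from an
  iterated convolution of trilinear forms, the bilinear ones padded by the counit. Removing the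
  paddings and interchanging independent sums gives the expanded expression.\<close>

lemma hexagon1_rhs:
  assumes "tform p" "tform q" "bform a" "bform b"
  shows "conv3 H p (conv3 H (\<lambda>h k l. a h k * eps l) (conv3 H q (\<lambda>h k l. b h l * eps k))) h k l =
    sw4 H h (\<lambda>h1 h2 h3 h4. sw3 H k (\<lambda>k1 k2 k3. sw3 H l (\<lambda>l1 l2 l3.
      p h1 k1 l1 * a h2 k2 * q h3 k3 l2 * b h4 l3)))"
proof -
  have q: "tform (conv3 H q (\<lambda>h k l. b h l * eps k))"
    by (intro tform_conv3 assms tform_pads)
  have *: "sw2 H h' (\<lambda>h2 h''. sw2 H k' (\<lambda>k2 k3. sw2 H h'' (\<lambda>h3 h4. F h2 h3 h4 k2 k3))) =
      sw2 H h' (\<lambda>h2 h''. sw2 H h'' (\<lambda>h3 h4. sw2 H k' (\<lambda>k2 k3. F h2 h3 h4 k2 k3)))" for h' k' and F :: "_ => _ => _ => _ => _ => 'k"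
    by (intro sw2_cong sw2_swap)
  show ?thesis
    by (subst conv3_def, simp only: conv3_pad3L[OF q] conv3_pad2[OF assms(2)] sw4_def sw3_def)
      (simp only: sw2_mult_left mult.assoc, simp only: sw2_swap[of _ l], simp only: sw2_swap[of _ k], simp only: *)
qed

lemma hexagon2_rhs:
  assumes "tform p" "tform q" "bform a" "bform b"
  shows "conv3 H p (conv3 H (\<lambda>h k l. eps h * a k l) (conv3 H q (\<lambda>h k l. b h l * eps k))) h k l =
    sw3 H h (\<lambda>h1 h2 h3. sw3 H k (\<lambda>k1 k2 k3. sw4 H l (\<lambda>l1 l2 l3 l4.
      p h1 k1 l1 * a k2 l2 * q h2 k3 l3 * b h3 l4)))"
proof -
  have q: "tform (conv3 H q (\<lambda>h k l. b h l * eps k))"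
    by (intro tform_conv3 assms tform_pads)
  have *: "sw2 H k' (\<lambda>k2 k3. sw2 H l' (\<lambda>l2 l''. sw2 H h' (\<lambda>h2 h3. sw2 H l'' (\<lambda>l3 l4. F h2 h3 k2 k3 l2 l3 l4)))) =
      sw2 H h' (\<lambda>h2 h3. sw2 H k' (\<lambda>k2 k3. sw2 H l' (\<lambda>l2 l''. sw2 H l'' (\<lambda>l3 l4. F h2 h3 k2 k3 l2 l3 l4))))" for h' k' l' 
      and F :: "_ => _ => _ => _ => _ => _ => _ => 'k"
    by (rule trans[OF sw2_cong[OF sw2_swap] sw2_swap])
  show ?thesis
    by (subst conv3_def, simp only: conv3_pad1L[OF q] conv3_pad2[OF assms(2)] sw4_def sw3_def)
      (simp only: sw2_mult_left mult.assoc, simp only: sw2_swap[of _ l], simp only: sw2_swap[of _ k], simp only: *)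
qed

text \<open>The three-factor side of the pentagon axiom as a convolution of forms in four variables;
  the first and the last factor are padded by the counit in the variable they do not see.\<close>

lemma pentagon_rhs:
  assumes "tform p" "qform q" "tform s"
  shows "conv4 (\<lambda>h k l t. p h k l * eps t) (conv4 q (\<lambda>h k l t. eps h * s k l t)) h k l t =
    sw2 H h (\<lambda>h1 h2. sw3 H k (\<lambda>k1 k2 k3. sw3 H l (\<lambda>l1 l2 l3. sw2 H t (\<lambda>t1 t2.
         p h1 k1 l1 * q h2 k2 l2 t1 * s k3 l3 t2))))"
  (is "?L = _")
proof -
  have inner: "conv4 q (\<lambda>h k l t. eps h * s k l t) h k l t =
     sw2 H k (\<lambda>k1 k2. sw2 H l (\<lambda>l1 l2. sw2 H t (\<lambda>t1 t2. q h k1 l1 t1 * s k2 l2 t2)))" for h k l t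
  proof -
    have "conv4 q (\<lambda>h k l t. eps h * s k l t) h k l t =
       sw2 H h (\<lambda>h1 h2. sw2 H k (\<lambda>k1 k2. sw2 H l (\<lambda>l1 l2. sw2 H t (\<lambda>t1 t2. q h1 k1 l1 t1 * s k2 l2 t2))) * eps h2)"
      unfolding conv4_def S4_def by (simp add: sw2_mult_right sw2_mult_left mult_ac)
    also have "... = sw2 H k (\<lambda>k1 k2. sw2 H l (\<lambda>l1 l2. sw2 H t (\<lambda>t1 t2. q h k1 l1 t1 * s k2 l2 t2)))"
      by (intro sw2_eps_right lin lin_app4[OF assms(2)] vsF)
    finally show ?thesis .
  qed
  have q: "qform (conv4 q (\<lambda>h k l t. eps h * s k l t))"
    by (intro qform_conv4 assms) (auto simp: qform_def quadlin_on_def intro!: lin lin_app3[OF assms(3)])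
  have "?L =
    sw2 H h (\<lambda>h1 h2. sw2 H k (\<lambda>k1 k2. sw2 H l (\<lambda>l1 l2. sw2 H t (\<lambda>t1 t2.
      eps t1 * (p h1 k1 l1 * conv4 q (\<lambda>h k l t. eps h * s k l t) h2 k2 l2 t2)))))"
    by (subst conv4_def, subst S4_def) (simp add: mult_ac)
  also have "... = sw2 H h (\<lambda>h1 h2. sw2 H k (\<lambda>k1 k2. sw2 H l (\<lambda>l1 l2.
      p h1 k1 l1 * conv4 q (\<lambda>h k l t. eps h * s k l t) h2 k2 l2 t)))"
    by (intro sw2_cong sw2_eps_left lin lin_app4[OF q])
  also have "... = sw2 H h (\<lambda>h1 h2. sw3 H k (\<lambda>k1 k2 k3. sw3 H l (\<lambda>l1 l2 l3. sw2 H t (\<lambda>t1 t2.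
         p h1 k1 l1 * q h2 k2 l2 t1 * s k3 l3 t2))))"
    unfolding inner sw3_def by (simp only: sw2_mult_left mult.assoc, simp only: sw2_swap[of _ l])
  finally show ?thesis .
qed

end

context coalg_mult begin

lemma lforms:
  assumes "lform H \<phi>"
  shows "bform (\<lambda>h k. \<phi> (m h k))" "bform (\<lambda>h k. \<phi> (m k h))"
    "tform (\<lambda>h k l. \<phi> (m (m h k) l))" "tform (\<lambda>h k l. \<phi> (m h (m k l)))"
  by (auto intro!: bilinI trilinI lin lin_form[OF assms])

lemma bforms:
  assumes "bform p"
  shows "tform (\<lambda>h k l. p (m h k) l)" "tform (\<lambda>h k l. p h (m k l))"
  by (auto intro!: trilinI lin lin_app2[OF assms])

lemma tforms:
  assumes "tform q"
  shows "qform (\<lambda>h k l t. q (m h k) l t)" "qform (\<lambda>h k l t. q h (m k l) t)"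
    "qform (\<lambda>h k l t. q h k (m l t))" "qform (\<lambda>h k l t. q h k l * eps t)" "qform (\<lambda>h k l t. eps h * q k l t)"
    "tform (\<lambda>h k l. q k l h)" "tform (\<lambda>h k l. q k h l)" "tform (\<lambda>h k l. q l h k)" "tform (\<lambda>h k l. q h l k)"
  by (auto intro!: trilinI lin lin_app3[OF assms] simp: qform_def quadlin_on_def)

lemmas forms = lforms bforms tforms

lemma act1_T3l:
  assumes "precomod X" "precomod Y" "precomod Z" "lform H p" "lmap (T (T X Y) Z) f" "x \<in> carr X" "y \<in> carr Y" "z \<in> carr Z"
  shows "act1 (T (T X Y) Z) p f ((x \<otimes> y) \<otimes> z) =
    act3 X Y Z (\<lambda>h k l. p (m (m h k) l)) (\<lambda>x y z. f ((x \<otimes> y) \<otimes> z)) x y z"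
proof -
  have "bmap (T X Y) Z (\<lambda>x y. f (x \<otimes> y))"
    using assms(5) by (auto simp: bilin_on_def intro!: linv_comp[OF assms(5)] lin)
  with assms show ?thesis
    by (subst act1_T) (auto simp: precomod_T forms intro: act2_T1)
qed

lemma act1_T3r:
  assumes "precomod X" "precomod Y" "precomod Z" "lform H p" "lmap (T X (T Y Z)) f" "x \<in> carr X" "y \<in> carr Y" "z \<in> carr Z"
  shows "act1 (T X (T Y Z)) p f (x \<otimes> (y \<otimes> z)) =
    act3 X Y Z (\<lambda>h k l. p (m h (m k l))) (\<lambda>x y z. f (x \<otimes> (y \<otimes> z))) x y z"
proof -
  have "bmap X (T Y Z) (\<lambda>x y. f (x \<otimes> y))"
    using assms(5) by (auto simp: bilin_on_def intro!: linv_comp[OF assms(5)] lin)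
  with assms show ?thesis
    by (subst act1_T) (auto simp: precomod_T forms intro: act2_T2)
qed

lemma chom_T3I:
  assumes XYZ: "precomod X" "precomod Y" "precomod Z" and W: "precomod W"
    and f: "lin_on pscale pscale (tcarr (tcarr (carr X) (carr Y)) (carr Z)) f"
    and mem: "\<And>x y z. x \<in> carr X ==> y \<in> carr Y ==> z \<in> carr Z ==> f ((x \<otimes> y) \<otimes> z) \<in> carr W"
    and eq: "\<And>\<phi> x y z. lform H \<phi> ==> x \<in> carr X ==> y \<in> carr Y ==> z \<in> carr Z ==>
      act1 W \<phi> (\<lambda>z. z) (f ((x \<otimes> y) \<otimes> z)) =
      act3 X Y Z (\<lambda>h k l. \<phi> (m (m h k) l)) (\<lambda>x y z. f ((x \<otimes> y) \<otimes> z)) x y z"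
  shows "(T (T X Y) Z, f, W) \<in> chom H (T (T X Y) Z) W"
proof (rule chomI'[OF precomod_T[OF precomod_T[OF XYZ(1,2)] XYZ(3)] W refl])
  have fl: "linv pscale (tcarr (tcarr (carr X) (carr Y)) (carr Z)) pscale f" using f by (simp add: lin_on_iff)
  have fz: "linv pscale (tcarr (carr X) (carr Y)) pscale (\<lambda>v. f (v \<otimes> z))" if "z \<in> carr Z" for z
    using that by (auto intro!: linv_comp[OF fl] lin)
  have mem2: "f (v \<otimes> z) \<in> carr W" if "v \<in> tcarr (carr X) (carr Y)" "z \<in> carr Z" for v z
    using tcarr_in[OF fz[OF that(2)] vsP precomod_subspace[OF W]] mem that by auto
  show memT: "f v \<in> carr W" if "v \<in> carr (T (T X Y) Z)" for v
    using tcarr_in[OF fl vsP precomod_subspace[OF W]] mem2 that by auto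
  fix \<phi> v assume \<phi>: "lform H \<phi>" and v: "v \<in> carr (T (T X Y) Z)"
  have l: "lmap (T (T X Y) Z) (act1 (T (T X Y) Z) \<phi> f)"
    using XYZ \<phi> fl by (intro lmap_act1 precomod_T) auto
  show "act1 W \<phi> (\<lambda>y. y) (f v) = act1 (T (T X Y) Z) \<phi> f v"
  proof (rule tcarr_ext3[OF _ l[unfolded carr_T] vsP _ v[unfolded carr_T]])
    show "linv pscale (tcarr (tcarr (carr X) (carr Y)) (carr Z)) pscale (\<lambda>v. act1 W \<phi> (\<lambda>y. y) (f v))"
      by (rule linv_comp[OF lmap_act1[OF W \<phi> lmap_id] fl]) (use memT in simp)
    show "act1 W \<phi> (\<lambda>y. y) (f ((x \<otimes> y) \<otimes> z)) = act1 (T (T X Y) Z) \<phi> f ((x \<otimes> y) \<otimes> z)"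
      if "x \<in> carr X" "y \<in> carr Y" "z \<in> carr Z" for x y z
      by (subst act1_T3l[OF XYZ \<phi> _ that]) (use fl eq[OF \<phi> that] in simp_all)
  qed
qed (use f in simp)

lemma tmaps:
  "tmap X Y Z (\<lambda>x y z. (x \<otimes> y) \<otimes> z)" "tmap X Y Z (\<lambda>x y z. x \<otimes> (y \<otimes> z))"
  "bmap X Y (\<lambda>x y. x \<otimes> y)" "bmap X Y (\<lambda>x y. y \<otimes> x)"
  by (auto simp: multilin_on_defs intro!: lin)

text \<open>Colinear maps are moved inside the action one variable at a time. This is naturality for
  all morphisms that are given by forms.\<close>

lemma act3_mp:
  assumes "precomod X" "precomod Y" "precomod Z" "precomod X'" "precomod Y'" "precomod Z'"
    "a \<in> chom H X X'" "b \<in> chom H Y Y'" "c \<in> chom H Z Z'" "tform p" "tmap X' Y' Z' f"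
    "x \<in> carr X" "y \<in> carr Y" "z \<in> carr Z"
  shows "act3 X' Y' Z' p f (mp a x) (mp b y) (mp c z) = act3 X Y Z p (\<lambda>x y z. f (mp a x) (mp b y) (mp c z)) x y z"
proof -
  note A = chom_mp[OF assms(7)] and B = chom_mp[OF assms(8)] and C = chom_mp[OF assms(9)]
  have "act3 X' Y' Z' p f (mp a x) (mp b y) (mp c z) =
     csw H X x (\<lambda>h x0. csw H Y' (mp b y) (\<lambda>k y0. csw H Z' (mp c z) (\<lambda>l z0. pscale (p h k l) (f (mp a x0) y0 z0))))"
    unfolding act3_def A3_def using assms A
    by (intro csw_chom[OF _ _ _ vsP]) (auto simp: trilin_on_def intro!: lin lin_app3[OF assms(10)])
  also have "... = csw H X x (\<lambda>h x0. csw H Y y (\<lambda>k y0. csw H Z' (mp c z) (\<lambda>l z0. pscale (p h k l) (f (mp a x0) (mp b y0) z0))))"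
    using assms A B
    by (intro csw_cong[OF assms(1)] csw_chom[OF _ _ _ vsP])
       (auto simp: trilin_on_def intro!: lin lin_app3[OF assms(10)])
  also have "... = act3 X Y Z p (\<lambda>x y z. f (mp a x) (mp b y) (mp c z)) x y z"
    unfolding act3_def A3_def using assms A B C
    by (intro csw_cong[OF assms(1)] csw_cong[OF assms(2)] csw_chom[OF _ _ _ vsP])
       (auto simp: trilin_on_def intro!: lin lin_app3[OF assms(10)])
  finally show ?thesis .
qed

lemma act2_mp:
  assumes "precomod X" "precomod Y" "precomod X'" "precomod Y'"
    "a \<in> chom H X X'" "b \<in> chom H Y Y'" "bform p" "bmap X' Y' f"
    "x \<in> carr X" "y \<in> carr Y"
  shows "act2 X' Y' p f (mp a x) (mp b y) = act2 X Y p (\<lambda>x y. f (mp a x) (mp b y)) x y"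
proof -
  note A = chom_mp[OF assms(5)] and B = chom_mp[OF assms(6)]
  have "act2 X' Y' p f (mp a x) (mp b y) =
     csw H X x (\<lambda>h x0. csw H Y' (mp b y) (\<lambda>k y0. pscale (p h k) (f (mp a x0) y0)))"
    unfolding act2_def A2_def using assms A
    by (intro csw_chom[OF _ _ _ vsP]) (auto simp: bilin_on_def intro!: lin lin_app2[OF assms(7)])
  also have "... = act2 X Y p (\<lambda>x y. f (mp a x) (mp b y)) x y"
    unfolding act2_def A2_def using assms A B
    by (intro csw_cong[OF assms(1)] csw_chom[OF _ _ _ vsP])
       (auto simp: bilin_on_def intro!: lin lin_app2[OF assms(7)])
  finally show ?thesis .
qed

end

locale cqt =
  fixes H :: "('k::field, 'h::ab_group_add) coalg" and m e \<Omega> r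
  assumes cqt: "coquasitriangular H m e \<Omega> r"
begin

lemma cqb: "coquasi_bialgebra H m e \<Omega>"
  using cqt by (simp add: coquasitriangular_def)

sublocale coalg_mult H m
  by unfold_locales (use cqb in \<open>auto simp: coquasi_bialgebra_def\<close>)

lemma grouplike_e: "grouplike H e" and tform_\<Omega>: "tform \<Omega>" and unit_m: "m e h = h" "m h e = h"
  and \<Omega>_unit: "\<Omega> h e k = eps h * eps k"
  using cqb by (auto simp: coquasi_bialgebra_def)

definition Oi where "Oi = cinv3 H \<Omega>"

lemma Oi: "tform Oi" "conv3 H \<Omega> Oi = e3" "conv3 H Oi \<Omega> = e3"
proof -
  obtain q where q: "is_cinv3 H \<Omega> q" using cqb by (auto simp: coquasi_bialgebra_def)
  then have "Oi = q" unfolding Oi_def by (rule cinv3_eq[OF tform_\<Omega>])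
  with q show "tform Oi" "conv3 H \<Omega> Oi = e3" "conv3 H Oi \<Omega> = e3" by (auto simp: is_cinv3_e3)
qed

text \<open>A linear form is applied to the law of associativity up to \<Omega>. The resulting
  equation of trilinear forms is exactly the colinearity of the associator.\<close>

lemma \<Omega>_mult:
  assumes "lform H \<phi>"
  shows "conv3 H (\<lambda>h k l. \<phi> (m (m h k) l)) \<Omega> = conv3 H \<Omega> (\<lambda>h k l. \<phi> (m h (m k l)))"
proof (intro ext)
  fix h k l
  have sc: "\<phi> (scH c x) = c * \<phi> x" for c x
    using assms by (auto simp: lform_def linear_iff_linv linv_def)
  have "sw2 H h (\<lambda>h1 h2. sw2 H k (\<lambda>k1 k2. sw2 H l (\<lambda>l1 l2. scal H (\<Omega> h2 k2 l2) (m (m h1 k1) l1)))) =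
       sw2 H h (\<lambda>h1 h2. sw2 H k (\<lambda>k1 k2. sw2 H l (\<lambda>l1 l2. scal H (\<Omega> h1 k1 l1) (m h2 (m k2 l2)))))"
    using cqb by (simp add: coquasi_bialgebra_def)
  from arg_cong[OF this, of \<phi>]
  show "conv3 H (\<lambda>h k l. \<phi> (m (m h k) l)) \<Omega> h k l = conv3 H \<Omega> (\<lambda>h k l. \<phi> (m h (m k l))) h k l"
    by (simp add: conv3_def sw2_linear[OF assms[unfolded lform_def]] sc mult.commute)
qed

lemma pentagon:
  "conv4 (\<lambda>h k l t. \<Omega> (m h k) l t) (\<lambda>h k l t. \<Omega> h k (m l t)) =
   conv4 (\<lambda>h k l t. \<Omega> h k l * eps t) (conv4 (\<lambda>h k l t. \<Omega> h (m k l) t) (\<lambda>h k l t. eps h * \<Omega> k l t))"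
proof (intro ext)
  fix h k l t
  show "conv4 (\<lambda>h k l t. \<Omega> (m h k) l t) (\<lambda>h k l t. \<Omega> h k (m l t)) h k l t =
   conv4 (\<lambda>h k l t. \<Omega> h k l * eps t) (conv4 (\<lambda>h k l t. \<Omega> h (m k l) t) (\<lambda>h k l t. eps h * \<Omega> k l t)) h k l t"
    unfolding pentagon_rhs[OF tform_\<Omega> forms(8)[OF tform_\<Omega>] tform_\<Omega>]
    unfolding conv4_def S4_def using cqb by (simp add: coquasi_bialgebra_def)
qed

lemma bform_r: "bform r"
  using cqt by (simp add: coquasitriangular_def)

lemma r_comm:
  assumes "lform H \<phi>"
  shows "conv2 H r (\<lambda>h k. \<phi> (m k h)) = conv2 H (\<lambda>h k. \<phi> (m h k)) r"
proof (intro ext)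
  fix h k
  have sc: "\<phi> (scH c x) = c * \<phi> x" for c x
    using assms by (auto simp: lform_def linear_iff_linv linv_def)
  have "sw2 H h (\<lambda>h1 h2. sw2 H k (\<lambda>k1 k2. scal H (r h1 k1) (m k2 h2))) =
       sw2 H h (\<lambda>h1 h2. sw2 H k (\<lambda>k1 k2. scal H (r h2 k2) (m h1 k1)))"
    using cqt by (simp add: coquasitriangular_def)
  from arg_cong[OF this, of \<phi>]
  show "conv2 H r (\<lambda>h k. \<phi> (m k h)) h k = conv2 H (\<lambda>h k. \<phi> (m h k)) r h k"
    by (simp add: conv2_def sw2_linear[OF assms[unfolded lform_def]] sc mult.commute)
qed

text \<open>The axiom convolved with \<Omega> on the left, which clears the inverse. Each side is
  then a product of three forms, in the order in which the arrows of the first hexagon are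
  composed.\<close>

lemma hexagon1:
  "conv3 H \<Omega> (conv3 H (\<lambda>h k l. r h (m k l)) (\<lambda>h k l. \<Omega> k l h)) =
   conv3 H (\<lambda>h k l. r h k * eps l) (conv3 H (\<lambda>h k l. \<Omega> k h l) (\<lambda>h k l. r h l * eps k))"
  (is "_ = ?R")
proof -
  have "conv3 H (\<lambda>h k l. r h (m k l)) (\<lambda>h k l. \<Omega> k l h) =
    conv3 H Oi ?R"
  proof (intro ext)
    fix h k l
    show "conv3 H (\<lambda>h k l. r h (m k l)) (\<lambda>h k l. \<Omega> k l h) h k l =
      conv3 H Oi ?R h k l"
      unfolding hexagon1_rhs[OF Oi(1) forms(13)[OF tform_\<Omega>] bform_r bform_r]
      unfolding conv3_def Oi_def using cqt by (simp add: coquasitriangular_def)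
  qed
  then show ?thesis
    by (simp add: conv3_assoc[symmetric] Oi tform_\<Omega> tform_conv3 tform_pads bform_r forms)
qed

lemma hexagon2:
  "conv3 H Oi (conv3 H (\<lambda>h k l. r (m h k) l) (\<lambda>h k l. Oi l h k)) =
   conv3 H (\<lambda>h k l. eps h * r k l) (conv3 H (\<lambda>h k l. Oi h l k) (\<lambda>h k l. r h l * eps k))"
  (is "_ = ?R")
proof -
  have "conv3 H (\<lambda>h k l. r (m h k) l) (\<lambda>h k l. Oi l h k) =
    conv3 H \<Omega> ?R"
  proof (intro ext)
    fix h k l
    show "conv3 H (\<lambda>h k l. r (m h k) l) (\<lambda>h k l. Oi l h k) h k l =
      conv3 H \<Omega> ?R h k l"
      unfolding hexagon2_rhs[OF tform_\<Omega> forms(15)[OF Oi(1)] bform_r bform_r]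
      unfolding conv3_def Oi_def using cqt by (simp add: coquasitriangular_def)
  qed
  then show ?thesis
    by (simp add: conv3_assoc[symmetric] Oi tform_\<Omega> tform_conv3 tform_pads bform_r forms)
qed

definition ri where "ri = (SOME q. is_cinv2 H r q)"

lemma ri: "bform ri" "conv2 H r ri = e2" "conv2 H ri r = e2"
proof -
  have "\<exists>q. is_cinv2 H r q" using cqt by (auto simp: coquasitriangular_def)
  then have "is_cinv2 H r ri" unfolding ri_def by (rule someI_ex)
  then show "bform ri" "conv2 H r ri = e2" "conv2 H ri r = e2" by (auto simp: is_cinv2_e2)
qed

end

lemma vten_scale: "pscale c x \<otimes> y = pscale c (x \<otimes> y)" "x \<otimes> pscale c y = pscale c (x \<otimes> y)"
  by (auto simp: vten_lookup intro!: vec_eqI)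

lemma linv_lookup_Dot: "linv pscale V pscale (\<lambda>v. pscale (Poly_Mapping.lookup v Dot) x)"
  by (auto simp: linv_def lookup_add vs_rules)

lemma tcarr_evec_ext:
  fixes A :: "('k::field, 'u) vec set"
  assumes "linv pscale (tcarr (vspan {evec}) A) s f" "linv pscale (tcarr (vspan {evec}) A) s g" "vector_space s"
    "\<And>x. x \<in> A ==> f (evec \<otimes> x) = g (evec \<otimes> x)" "v \<in> tcarr (vspan {evec}) A"
  shows "f v = g v"
proof (rule tcarr_ext[OF assms(1-3) _ assms(5)])
  fix c x :: "('k, 'u) vec" assume c: "c \<in> vspan {evec}" and x: "x \<in> A"
  have "c \<otimes> x = pscale (Poly_Mapping.lookup c Dot) (evec \<otimes> x)"
    using c unfolding vspan_evec by (metis vten_scale)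
  then show "f (c \<otimes> x) = g (c \<otimes> x)"
    using x assms(4) by (simp add: linvD(2)[OF assms(1)] linvD(2)[OF assms(2)])
qed

lemma tcarr_evec_ext_right:
  fixes A :: "('k::field, 'u) vec set"
  assumes "linv pscale (tcarr A (vspan {evec})) s f" "linv pscale (tcarr A (vspan {evec})) s g" "vector_space s"
    "\<And>x. x \<in> A ==> f (x \<otimes> evec) = g (x \<otimes> evec)" "v \<in> tcarr A (vspan {evec})"
  shows "f v = g v"
proof (rule tcarr_ext[OF assms(1-3) _ assms(5)])
  fix c x :: "('k, 'u) vec" assume c: "c \<in> vspan {evec}" and x: "x \<in> A"
  have "x \<otimes> c = pscale (Poly_Mapping.lookup c Dot) (x \<otimes> evec)"
    using c unfolding vspan_evec by (metis vten_scale)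
  then show "f (x \<otimes> c) = g (x \<otimes> c)"
    using x assms(4) by (simp add: linvD(2)[OF assms(1)] linvD(2)[OF assms(2)])
qed

text \<open>The prescription only concerns \<open>evec \<otimes> x\<close>. The bilinear map
  realising it multiplies \<open>x\<close> by the coefficient of the first factor along
  \<open>evec\<close>, which is its coordinate at \<open>Dot\<close>.\<close>

lemma the_lin_evec_left:
  assumes A: "module.subspace pscale A"
  defines "f \<equiv> the_lin pscale pscale (tcarr (vspan {evec}) A) (\<lambda>f. \<forall>x\<in>A. f (evec \<otimes> x) = x)"
  shows "lin_on pscale pscale (tcarr (vspan {evec}) A) f" "\<And>x. x \<in> A ==> f (evec \<otimes> x) = x"
proof -
  have b: "bilin_on pscale (vspan {evec}) pscale A pscale (\<lambda>c x. pscale (Poly_Mapping.lookup c Dot) x)"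
    by (auto simp: bilin_on_def intro!: lin linv_lookup_Dot)
  obtain g where g: "lin_on pscale pscale (tcarr (vspan {evec}) A) g"
    "\<And>c x. c \<in> vspan {evec} ==> x \<in> A ==> g (c \<otimes> x) = pscale (Poly_Mapping.lookup c Dot) x"
    by (rule tcarr_lift[OF vspan_subspace A vsP b]) (erule that, auto)
  have "f = g" unfolding f_def
  proof (rule the_lin_eq[OF g(1)])
    fix h x assume "lin_on pscale pscale (tcarr (vspan {evec}) A) h" "\<forall>x\<in>A. h (evec \<otimes> x) = x" "x \<in> tcarr (vspan {evec}) A"
    then show "h x = g x" using g
      by - (rule tcarr_evec_ext[of A pscale h g], auto simp: lin_on_iff vs_rules(4)[OF vsP])
  qed (use g in \<open>auto simp: vs_rules(4)[OF vsP]\<close>)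
  with g show "lin_on pscale pscale (tcarr (vspan {evec}) A) f" "\<And>x. x \<in> A ==> f (evec \<otimes> x) = x"
    by (auto simp: vs_rules(4)[OF vsP])
qed

lemma the_lin_evec_right:
  assumes A: "module.subspace pscale A"
  defines "f \<equiv> the_lin pscale pscale (tcarr A (vspan {evec})) (\<lambda>f. \<forall>x\<in>A. f (x \<otimes> evec) = x)"
  shows "lin_on pscale pscale (tcarr A (vspan {evec})) f" "\<And>x. x \<in> A ==> f (x \<otimes> evec) = x"
proof -
  have b: "bilin_on pscale A pscale (vspan {evec}) pscale (\<lambda>x c. pscale (Poly_Mapping.lookup c Dot) x)"
    by (auto simp: bilin_on_def intro!: lin linv_lookup_Dot)
  obtain g where g: "lin_on pscale pscale (tcarr A (vspan {evec})) g"
    "\<And>c x. c \<in> vspan {evec} ==> x \<in> A ==> g (x \<otimes> c) = pscale (Poly_Mapping.lookup c Dot) x"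
    by (rule tcarr_lift[OF A vspan_subspace vsP b]) (erule that, auto)
  have "f = g" unfolding f_def
  proof (rule the_lin_eq[OF g(1)])
    fix h x assume "lin_on pscale pscale (tcarr A (vspan {evec})) h" "\<forall>x\<in>A. h (x \<otimes> evec) = x" "x \<in> tcarr A (vspan {evec})"
    then show "h x = g x" using g
      by - (rule tcarr_evec_ext_right[of A pscale h g], auto simp: lin_on_iff vs_rules(4)[OF vsP])
  qed (use g in \<open>auto simp: vs_rules(4)[OF vsP]\<close>)
  with g show "lin_on pscale pscale (tcarr A (vspan {evec})) f" "\<And>x. x \<in> A ==> f (x \<otimes> evec) = x"
    by (auto simp: vs_rules(4)[OF vsP])
qed

section \<open>Associator, unit constraints and braiding of comodules\<close>

context cqt begin

abbreviation CC :: "(('k, 'h, 'u) comod, ('k, 'h, 'u) carrow, 'k) bmcat" where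
  "CC \<equiv> comod_category H m e \<Omega> r"

lemma CC_simps [simp]: "Obj CC = {X. lcomod X}" "Hom CC = chom H" "Idt CC = cid" "Cmp CC = ccomp"
  "Add CC = cadd" "Smul CC = csmul" "Unt CC = kline H e" "Tob CC = ctens H m" "Tar CC = ctens_arr H m"
  by (simp_all add: comod_category_def)

lemma linear_CC: "linear_category CC"
  by (rule linear_category_comod) simp_all

lemma iso_CCI:
  assumes "precomod X" "precomod Y" "(X, f, Y) \<in> chom H X Y" "lin_on pscale pscale (carr Y) g"
    "\<And>y. y \<in> carr Y ==> g y \<in> carr X"
    "\<And>x. x \<in> carr X ==> g (f x) = x" "\<And>y. y \<in> carr Y ==> f (g y) = y"
  shows "iso_in CC X Y (X, f, Y)"
  using chom_inverse[OF assms] assms(3) by (auto simp: iso_in_def)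

text \<open>Colinearity is \<open>\<Omega>_mult\<close>. The inverse arrow is the action of the
  convolution inverse \<open>Oi\<close> on the opposite rebracketing, because the two composites are
  actions of \<open>e3\<close>.\<close>

lemma Asc_CC:
  assumes X: "lcomod X" and Y: "lcomod Y" and Z: "lcomod Z"
  shows "Asc CC X Y Z \<in> chom H (T (T X Y) Z) (T X (T Y Z))"
    "x \<in> carr X ==> y \<in> carr Y ==> z \<in> carr Z ==>
       mp (Asc CC X Y Z) ((x \<otimes> y) \<otimes> z) = act3 X Y Z \<Omega> (\<lambda>x y z. x \<otimes> (y \<otimes> z)) x y z"
    "iso_in CC (T (T X Y) Z) (T X (T Y Z)) (Asc CC X Y Z)"
    "inv_Asc CC X Y Z \<in> chom H (T X (T Y Z)) (T (T X Y) Z)"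
    "x \<in> carr X ==> y \<in> carr Y ==> z \<in> carr Z ==>
       mp (inv_Asc CC X Y Z) (x \<otimes> (y \<otimes> z)) = act3 X Y Z Oi (\<lambda>x y z. (x \<otimes> y) \<otimes> z) x y z"
proof -
  note p = comod_precomod[OF X] comod_precomod[OF Y] comod_precomod[OF Z]
  note pT = precomod_T[OF precomod_T[OF p(1,2)] p(3)] precomod_T[OF p(1) precomod_T[OF p(2,3)]]
  note sub = precomod_subspace[OF p(1)] precomod_subspace[OF p(2)] precomod_subspace[OF p(3)]
  let ?r = "\<lambda>x y z. x \<otimes> (y \<otimes> z)" and ?l = "\<lambda>x y z. (x \<otimes> y) \<otimes> z"
  define f where "f = mp (Asc CC X Y Z)"
  have e: "Asc CC X Y Z = (T (T X Y) Z, f, T X (T Y Z))"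
    by (simp add: f_def comod_category_def)
  have fe: "f = the_lin pscale pscale (tcarr (tcarr (carr X) (carr Y)) (carr Z))
     (\<lambda>f. \<forall>x\<in>carr X. \<forall>y\<in>carr Y. \<forall>z\<in>carr Z. f ((x \<otimes> y) \<otimes> z) = act3 X Y Z \<Omega> ?r x y z)"
    by (simp add: f_def comod_category_def ctens_carr_tcarr act3_def A3_def)
  note * = the_lin_tcarr3[OF sub vsP tmap_act3[OF p tform_\<Omega> tmaps(2)] refl, folded fe]
  have fl: "linv pscale (tcarr (tcarr (carr X) (carr Y)) (carr Z)) pscale f"
    using *(1) by (simp add: lin_on_iff)
  show v: "x \<in> carr X ==> y \<in> carr Y ==> z \<in> carr Z ==>
       mp (Asc CC X Y Z) ((x \<otimes> y) \<otimes> z) = act3 X Y Z \<Omega> ?r x y z" for x y z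
    unfolding f_def[symmetric] by (rule *(2))
  have hom: "(T (T X Y) Z, f, T X (T Y Z)) \<in> chom H (T (T X Y) Z) (T X (T Y Z))"
  proof (rule chom_T3I[OF p pT(2) *(1)])
    fix x y z assume xyz: "x \<in> carr X" "y \<in> carr Y" "z \<in> carr Z"
    then show "f ((x \<otimes> y) \<otimes> z) \<in> carr (T X (T Y Z))"
      using p by (auto simp: *(2) intro!: act3_in)
    fix \<phi> assume \<phi>: "lform H \<phi>"
    have "act1 (T X (T Y Z)) \<phi> (\<lambda>z. z) (f ((x \<otimes> y) \<otimes> z)) =
       act3 X Y Z \<Omega> (\<lambda>x y z. act1 (T X (T Y Z)) \<phi> (\<lambda>z. z) (?r x y z)) x y z"
      unfolding *(2)[OF xyz]
      by (rule act3_linear[OF lmap_act1[OF pT(2) \<phi> lmap_id] precomod_subspace[OF pT(2)] p]) simp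
    also have "... = act3 X Y Z \<Omega> (act3 X Y Z (\<lambda>h k l. \<phi> (m h (m k l))) ?r) x y z"
      using p \<phi> by (intro act3_cong p) (simp add: act1_T3r linv_id)
    also have "... = act3 X Y Z (conv3 H \<Omega> (\<lambda>h k l. \<phi> (m h (m k l)))) ?r x y z"
      by (intro act3_act3 X Y Z tform_\<Omega> forms \<phi> tmaps)
    also have "... = act3 X Y Z (conv3 H (\<lambda>h k l. \<phi> (m (m h k) l)) \<Omega>) ?r x y z"
      by (simp only: \<Omega>_mult[OF \<phi>])
    also have "... = act3 X Y Z (\<lambda>h k l. \<phi> (m (m h k) l)) (act3 X Y Z \<Omega> ?r) x y z"
      by (intro act3_act3[symmetric] X Y Z tform_\<Omega> forms \<phi> tmaps)
    also have "... = act3 X Y Z (\<lambda>h k l. \<phi> (m (m h k) l)) (\<lambda>x y z. f ((x \<otimes> y) \<otimes> z)) x y z"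
      by (intro act3_cong p) (simp add: *(2))
    finally show "act1 (T X (T Y Z)) \<phi> (\<lambda>z. z) (f ((x \<otimes> y) \<otimes> z)) =
       act3 X Y Z (\<lambda>h k l. \<phi> (m (m h k) l)) (\<lambda>x y z. f ((x \<otimes> y) \<otimes> z)) x y z" .
  qed
  then show "Asc CC X Y Z \<in> chom H (T (T X Y) Z) (T X (T Y Z))" by (simp add: e)
  obtain g where g: "lin_on pscale pscale (tcarr (carr X) (tcarr (carr Y) (carr Z))) g"
    "\<And>x y z. x \<in> carr X ==> y \<in> carr Y ==> z \<in> carr Z ==> g (x \<otimes> (y \<otimes> z)) = act3 X Y Z Oi ?l x y z"
    by (rule tcarr_lift3r[OF sub vsP tmap_act3[OF p Oi(1) tmaps(1)]]) (erule that, auto)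
  have gl: "linv pscale (tcarr (carr X) (tcarr (carr Y) (carr Z))) pscale g"
    using g(1) by (simp add: lin_on_iff)
  have gmem: "g v \<in> carr (T (T X Y) Z)" if v: "v \<in> carr (T X (T Y Z))" for v
  proof -
    have "g (x \<otimes> w) \<in> carr (T (T X Y) Z)" if x: "x \<in> carr X" and w: "w \<in> tcarr (carr Y) (carr Z)" for x w
    proof (rule tcarr_in[OF _ vsP precomod_subspace[OF pT(1)] _ w])
      show "linv pscale (tcarr (carr Y) (carr Z)) pscale (\<lambda>w. g (x \<otimes> w))"
        using x by (auto intro!: linv_comp[OF gl] lin)
      show "g (x \<otimes> (y \<otimes> z)) \<in> carr (T (T X Y) Z)" if "y \<in> carr Y" "z \<in> carr Z" for y z
        using x that p by (auto simp: g(2) intro!: act3_in)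
    qed
    then show ?thesis
      using tcarr_in[OF gl vsP precomod_subspace[OF pT(1)] _ v[unfolded carr_T]] by simp
  qed
  have fmem: "f v \<in> carr (T X (T Y Z))" if "v \<in> carr (T (T X Y) Z)" for v
    using chom_mp(4)[OF hom] that by simp
  have gf: "g (f v) = v" if v: "v \<in> carr (T (T X Y) Z)" for v
  proof (rule tcarr_ext3[OF linv_comp[OF gl fl] linv_id vsP _ v[unfolded carr_T]])
    fix x y z assume xyz: "x \<in> carr X" "y \<in> carr Y" "z \<in> carr Z"
    have "g (f (?l x y z)) = act3 X Y Z \<Omega> (\<lambda>x y z. g (?r x y z)) x y z"
      unfolding *(2)[OF xyz] by (rule act3_linear[OF gl _ p]) simp_all
    also have "... = act3 X Y Z \<Omega> (act3 X Y Z Oi ?l) x y z"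
      by (intro act3_cong p) (simp add: g(2))
    also have "... = act3 X Y Z e3 ?l x y z"
      by (subst act3_act3[OF X Y Z tform_\<Omega> Oi(1) tmaps(1)]) (simp add: Oi)
    also have "... = ?l x y z" by (intro act3_e3 X Y Z tmaps xyz)
    finally show "g (f (?l x y z)) = ?l x y z" .
  qed (use fmem in simp)
  have fg: "f (g v) = v" if v: "v \<in> carr (T X (T Y Z))" for v
  proof (rule tcarr_ext3r[OF linv_comp[OF fl gl] linv_id vsP _ v[unfolded carr_T]])
    fix x y z assume xyz: "x \<in> carr X" "y \<in> carr Y" "z \<in> carr Z"
    have "f (g (?r x y z)) = act3 X Y Z Oi (\<lambda>x y z. f (?l x y z)) x y z"
      unfolding g(2)[OF xyz] by (rule act3_linear[OF fl _ p]) simp_all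
    also have "... = act3 X Y Z Oi (act3 X Y Z \<Omega> ?r) x y z"
      by (intro act3_cong p) (simp add: *(2))
    also have "... = act3 X Y Z e3 ?r x y z"
      by (subst act3_act3[OF X Y Z Oi(1) tform_\<Omega> tmaps(2)]) (simp add: Oi)
    also have "... = ?r x y z" by (intro act3_e3 X Y Z tmaps xyz)
    finally show "f (g (?r x y z)) = ?r x y z" .
  qed (use gmem in simp)
  show "iso_in CC (T (T X Y) Z) (T X (T Y Z)) (Asc CC X Y Z)"
    unfolding e by (rule iso_CCI[OF pT hom _ gmem gf fg]) (use g in simp_all)
  note inv = chom_inverse[OF pT hom _ gmem gf fg, unfolded carr_T, OF g(1)]
  have "inv_Asc CC X Y Z = (T X (T Y Z), g, T (T X Y) Z)"
    unfolding inv_Asc_def e using hom inv X Y Z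
    by (intro inv_arrow_eq linear_CC) (auto intro!: comod_T)
  then show "inv_Asc CC X Y Z \<in> chom H (T X (T Y Z)) (T (T X Y) Z)"
    "x \<in> carr X ==> y \<in> carr Y ==> z \<in> carr Z ==> mp (inv_Asc CC X Y Z) (?r x y z) = act3 X Y Z Oi ?l x y z"
    using inv g by auto
qed

text \<open>The coaction of the unit line contributes the factor \<open>e\<close>, so colinearity
  amounts to the unit law of \<open>m\<close>. The inverse tensors with \<open>evec\<close>.\<close>

lemma Lun_CC:
  fixes X :: "('k, 'h, 'u) comod"
  assumes X: "lcomod X"
  shows "Lun CC X \<in> chom H (T (kline H e) X) X" "x \<in> carr X ==> mp (Lun CC X) (evec \<otimes> x) = x"
    "iso_in CC (T (kline H e) X) X (Lun CC X)"
proof -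
  note p = comod_precomod[OF X]
  let ?K = "kline H e :: ('k, 'h, 'u) comod"
  note pT = precomod_T[OF precomod_kline p, of e]
  define f where "f = mp (Lun CC X)"
  have e: "Lun CC X = (T ?K X, f, X)"
    by (simp add: f_def comod_category_def)
  have fe: "f = the_lin pscale pscale (tcarr (vspan {evec}) (carr X)) (\<lambda>f. \<forall>x\<in>carr X. f (evec \<otimes> x) = x)"
    by (simp add: f_def comod_category_def ctens_carr_tcarr)
  note * = the_lin_evec_left[OF precomod_subspace[OF p], folded fe]
  have fl: "linv pscale (tcarr (vspan {evec}) (carr X)) pscale f" using *(1) by (simp add: lin_on_iff)
  show "x \<in> carr X ==> mp (Lun CC X) (evec \<otimes> x) = x" by (simp add: f_def[symmetric] *)
  have fc: "f (c \<otimes> x) = pscale (Poly_Mapping.lookup c Dot) x" if "c \<in> vspan {evec}" "x \<in> carr X" for c x :: "('k, 'u) vec"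
  proof -
    have "c \<otimes> x = pscale (Poly_Mapping.lookup c Dot) (evec \<otimes> x)"
      using that(1) unfolding vspan_evec by (metis vten_scale)
    then show ?thesis using that by (simp add: linvD(2)[OF fl] *(2))
  qed
  have hom: "(T ?K X, f, X) \<in> chom H (T ?K X) X"
  proof (rule chom_TI[OF precomod_kline p p])
    fix \<phi> and c x :: "('k, 'u) vec" assume \<phi>: "lform H \<phi>" and c: "c \<in> carr ?K" and x: "x \<in> carr X"
    have "act2 ?K X (\<lambda>h k. \<phi> (m h k)) (\<lambda>c x. f (c \<otimes> x)) c x =
       csw H X x (\<lambda>h x0. pscale (\<phi> (m e h)) (f (c \<otimes> x0)))"
      unfolding act2_def A2_def using c p
      by (intro csw_kline[OF vsP]) (auto intro!: lin linv_comp[OF fl] lin_form[OF \<phi>])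
    also have "... = act1 X \<phi> (\<lambda>x. pscale (Poly_Mapping.lookup c Dot) x) x"
      unfolding act1_def using c by (intro csw_cong[OF p]) (simp add: unit_m fc)
    also have "... = act1 X \<phi> (\<lambda>z. z) (f (c \<otimes> x))"
      using c x linvD(2)[OF lmap_act1[OF p \<phi> lmap_id], of x]
      by (simp add: fc) (simp add: act1_def pscale_sums vs_rules mult.commute)
    finally show "act1 X \<phi> (\<lambda>z. z) (f (c \<otimes> x)) = act2 ?K X (\<lambda>h k. \<phi> (m h k)) (\<lambda>c x. f (c \<otimes> x)) c x" ..
  qed (use *(1) fc subspaceD(3)[OF vsP precomod_subspace[OF p]] in auto)
  then show "Lun CC X \<in> chom H (T ?K X) X" by (simp add: e)
  have gl: "linv pscale (carr X) pscale (\<lambda>x. evec \<otimes> x)" by (intro lin)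
  show "iso_in CC (T ?K X) X (Lun CC X)"
    unfolding e
  proof (rule iso_CCI[OF pT p hom lin_on_restrict[OF gl]])
    fix v assume "v \<in> carr (T ?K X)"
    then have v: "v \<in> tcarr (vspan {evec}) (carr X)" by simp
    have fv: "f w \<in> carr X" if "w \<in> tcarr (vspan {evec}) (carr X)" for w
      using chom_mp(4)[OF hom] that by simp
    have "evec \<otimes> f v = v"
      by (rule tcarr_evec_ext[OF linv_vten2[OF fl] linv_id vsP _ v]) (simp add: *)
    with fv[OF v] show "(if f v \<in> carr X then evec \<otimes> f v else 0) = v" by simp
  qed (use p * precomod_subspace[OF p] in auto)
qed

lemma Run_CC:
  fixes X :: "('k, 'h, 'u) comod"
  assumes X: "lcomod X"
  shows "Run CC X \<in> chom H (T X (kline H e)) X" "x \<in> carr X ==> mp (Run CC X) (x \<otimes> evec) = x"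
    "iso_in CC (T X (kline H e)) X (Run CC X)"
proof -
  note p = comod_precomod[OF X]
  let ?K = "kline H e :: ('k, 'h, 'u) comod"
  note pT = precomod_T[OF p precomod_kline, of e]
  define f where "f = mp (Run CC X)"
  have e: "Run CC X = (T X ?K, f, X)"
    by (simp add: f_def comod_category_def)
  have fe: "f = the_lin pscale pscale (tcarr (carr X) (vspan {evec})) (\<lambda>f. \<forall>x\<in>carr X. f (x \<otimes> evec) = x)"
    by (simp add: f_def comod_category_def ctens_carr_tcarr)
  note * = the_lin_evec_right[OF precomod_subspace[OF p], folded fe]
  have fl: "linv pscale (tcarr (carr X) (vspan {evec})) pscale f" using *(1) by (simp add: lin_on_iff)
  show "x \<in> carr X ==> mp (Run CC X) (x \<otimes> evec) = x" by (simp add: f_def[symmetric] *)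
  have fc: "f (x \<otimes> c) = pscale (Poly_Mapping.lookup c Dot) x" if "c \<in> vspan {evec}" "x \<in> carr X" for c x :: "('k, 'u) vec"
  proof -
    have "x \<otimes> c = pscale (Poly_Mapping.lookup c Dot) (x \<otimes> evec)"
      using that(1) unfolding vspan_evec by (metis vten_scale)
    then show ?thesis using that by (simp add: linvD(2)[OF fl] *(2))
  qed
  have hom: "(T X ?K, f, X) \<in> chom H (T X ?K) X"
  proof (rule chom_TI[OF p precomod_kline p])
    fix \<phi> and c x :: "('k, 'u) vec" assume \<phi>: "lform H \<phi>" and c: "c \<in> carr ?K" and x: "x \<in> carr X"
    have "act2 X ?K (\<lambda>h k. \<phi> (m h k)) (\<lambda>x c. f (x \<otimes> c)) x c =
       csw H X x (\<lambda>h x0. pscale (\<phi> (m h e)) (f (x0 \<otimes> c)))"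
      unfolding act2_def A2_def using c
      by (intro csw_cong[OF p] csw_kline[OF vsP]) (auto intro!: lin linv_comp[OF fl] lin_form[OF \<phi>])
    also have "... = act1 X \<phi> (\<lambda>x. pscale (Poly_Mapping.lookup c Dot) x) x"
      unfolding act1_def using c by (intro csw_cong[OF p]) (simp add: unit_m fc)
    also have "... = act1 X \<phi> (\<lambda>z. z) (f (x \<otimes> c))"
      using c x linvD(2)[OF lmap_act1[OF p \<phi> lmap_id], of x]
      by (simp add: fc) (simp add: act1_def pscale_sums vs_rules mult.commute)
    finally show "act1 X \<phi> (\<lambda>z. z) (f (x \<otimes> c)) = act2 X ?K (\<lambda>h k. \<phi> (m h k)) (\<lambda>x c. f (x \<otimes> c)) x c" ..
  qed (use *(1) fc subspaceD(3)[OF vsP precomod_subspace[OF p]] in auto)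
  then show "Run CC X \<in> chom H (T X ?K) X" by (simp add: e)
  have gl: "linv pscale (carr X) pscale (\<lambda>x. x \<otimes> evec)" by (intro lin)
  show "iso_in CC (T X ?K) X (Run CC X)"
    unfolding e
  proof (rule iso_CCI[OF pT p hom lin_on_restrict[OF gl]])
    fix v assume "v \<in> carr (T X ?K)"
    then have v: "v \<in> tcarr (carr X) (vspan {evec})" by simp
    have fv: "f w \<in> carr X" if "w \<in> tcarr (carr X) (vspan {evec})" for w
      using chom_mp(4)[OF hom] that by simp
    have "f v \<otimes> evec = v"
      by (rule tcarr_evec_ext_right[OF linv_vten1[OF fl] linv_id vsP _ v]) (simp add: *)
    with fv[OF v] show "(if f v \<in> carr X then f v \<otimes> evec else 0) = v" by simp
  qed (use p * precomod_subspace[OF p] in auto)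
qed

lemma cbraid_map:
  assumes X: "precomod X" and Y: "precomod Y"
  shows "lin_on pscale pscale (tcarr (carr X) (carr Y)) (cbraid_map H r X Y)"
    "x \<in> carr X ==> y \<in> carr Y ==> cbraid_map H r X Y (x \<otimes> y) = act2 X Y r (\<lambda>x y. y \<otimes> x) x y"
proof -
  have fe: "cbraid_map H r X Y = the_lin pscale pscale (tcarr (carr X) (carr Y))
     (\<lambda>f. \<forall>x\<in>carr X. \<forall>y\<in>carr Y. f (x \<otimes> y) = act2 X Y r (\<lambda>x y. y \<otimes> x) x y)"
    by (simp add: cbraid_map_def ctens_carr_tcarr act2_def A2_def)
  show "lin_on pscale pscale (tcarr (carr X) (carr Y)) (cbraid_map H r X Y)"
    "x \<in> carr X ==> y \<in> carr Y ==> cbraid_map H r X Y (x \<otimes> y) = act2 X Y r (\<lambda>x y. y \<otimes> x) x y"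
    using the_lin_tcarr[OF precomod_subspace[OF X] precomod_subspace[OF Y] vsP
      bmap_act2[OF X Y bform_r tmaps(4)] refl] unfolding fe by blast+
qed

text \<open>The pattern of the associator with \<open>r\<close> acting on the flip: colinearity is
  \<open>r_comm\<close>, and the inverse arrow comes from the convolution inverse
  \<open>ri\<close>.\<close>

lemma Brd_CC:
  assumes X: "lcomod X" and Y: "lcomod Y"
  shows "Brd CC X Y \<in> chom H (T X Y) (T Y X)"
    "x \<in> carr X ==> y \<in> carr Y ==> mp (Brd CC X Y) (x \<otimes> y) = act2 X Y r (\<lambda>x y. y \<otimes> x) x y"
    "iso_in CC (T X Y) (T Y X) (Brd CC X Y)"
proof -
  note p = comod_precomod[OF X] comod_precomod[OF Y]
  note pT = precomod_T[OF p] precomod_T[OF p(2,1)]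
  note sub = precomod_subspace[OF p(1)] precomod_subspace[OF p(2)]
  let ?s = "\<lambda>x y. y \<otimes> x"
  define f where "f = mp (Brd CC X Y)"
  have e: "Brd CC X Y = (T X Y, f, T Y X)"
    by (simp add: f_def comod_category_def)
  have fe: "f = cbraid_map H r X Y"
    by (simp add: f_def comod_category_def)
  note * = cbraid_map[OF p, folded fe]
  have fl: "linv pscale (tcarr (carr X) (carr Y)) pscale f"
    using *(1) by (simp add: lin_on_iff)
  show v: "x \<in> carr X ==> y \<in> carr Y ==> mp (Brd CC X Y) (x \<otimes> y) = act2 X Y r ?s x y" for x y
    unfolding f_def[symmetric] by (rule *(2))
  have hom: "(T X Y, f, T Y X) \<in> chom H (T X Y) (T Y X)"
  proof (rule chom_TI[OF p pT(2) *(1)])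
    fix x y assume xy: "x \<in> carr X" "y \<in> carr Y"
    then show "f (x \<otimes> y) \<in> carr (T Y X)"
      using p by (auto simp: *(2) intro!: act2_in)
    fix \<phi> assume \<phi>: "lform H \<phi>"
    have "act1 (T Y X) \<phi> (\<lambda>z. z) (f (x \<otimes> y)) = act2 X Y r (\<lambda>x y. act1 (T Y X) \<phi> (\<lambda>z. z) (?s x y)) x y"
      unfolding *(2)[OF xy]
      by (rule act2_linear[OF lmap_act1[OF pT(2) \<phi> lmap_id] precomod_subspace[OF pT(2)] p]) simp
    also have "... = act2 X Y r (act2 X Y (\<lambda>h k. \<phi> (m k h)) ?s) x y"
      using p \<phi> by (intro act2_cong p) (simp add: act1_T linv_id act2_def A2_def csw_swap[of Y])
    also have "... = act2 X Y (conv2 H r (\<lambda>h k. \<phi> (m k h))) ?s x y"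
      by (intro act2_act2 X Y bform_r forms \<phi> tmaps)
    also have "... = act2 X Y (conv2 H (\<lambda>h k. \<phi> (m h k)) r) ?s x y"
      by (simp only: r_comm[OF \<phi>])
    also have "... = act2 X Y (\<lambda>h k. \<phi> (m h k)) (act2 X Y r ?s) x y"
      by (intro act2_act2[symmetric] X Y bform_r forms \<phi> tmaps)
    also have "... = act2 X Y (\<lambda>h k. \<phi> (m h k)) (\<lambda>x y. f (x \<otimes> y)) x y"
      by (intro act2_cong p) (simp add: *(2))
    finally show "act1 (T Y X) \<phi> (\<lambda>z. z) (f (x \<otimes> y)) = act2 X Y (\<lambda>h k. \<phi> (m h k)) (\<lambda>x y. f (x \<otimes> y)) x y" .
  qed
  then show "Brd CC X Y \<in> chom H (T X Y) (T Y X)" by (simp add: e)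
  have bg: "bmap Y X (\<lambda>y x. act2 X Y ri (\<otimes>) x y)"
    using bmap_act2[OF p ri(1) tmaps(3)] by (auto simp: bilin_on_def)
  obtain g where g: "lin_on pscale pscale (tcarr (carr Y) (carr X)) g"
    "\<And>x y. x \<in> carr X ==> y \<in> carr Y ==> g (y \<otimes> x) = act2 X Y ri (\<otimes>) x y"
    by (rule tcarr_lift[OF sub(2,1) vsP bg]) (erule that, auto)
  have gl: "linv pscale (tcarr (carr Y) (carr X)) pscale g"
    using g(1) by (simp add: lin_on_iff)
  have gmem: "g v \<in> carr (T X Y)" if v: "v \<in> carr (T Y X)" for v
    by (rule tcarr_in[OF gl vsP precomod_subspace[OF pT(1)] _ v[unfolded carr_T]])
      (use p in \<open>auto simp: g(2) intro!: act2_in\<close>)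
  have fmem: "f v \<in> carr (T Y X)" if "v \<in> carr (T X Y)" for v
    using chom_mp(4)[OF hom] that by simp
  have gf: "g (f v) = v" if v: "v \<in> carr (T X Y)" for v
  proof (rule tcarr_ext[OF linv_comp[OF gl fl] linv_id vsP _ v[unfolded carr_T]])
    fix x y assume xy: "x \<in> carr X" "y \<in> carr Y"
    have "g (f (x \<otimes> y)) = act2 X Y r (\<lambda>x y. g (?s x y)) x y"
      unfolding *(2)[OF xy] by (rule act2_linear[OF gl _ p]) simp_all
    also have "... = act2 X Y r (act2 X Y ri (\<otimes>)) x y"
      by (intro act2_cong p) (simp add: g(2))
    also have "... = act2 X Y e2 (\<otimes>) x y"
      by (subst act2_act2[OF X Y bform_r ri(1) tmaps(3)]) (simp add: ri)
    also have "... = x \<otimes> y" by (intro act2_e2 X Y tmaps xy)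
    finally show "g (f (x \<otimes> y)) = x \<otimes> y" .
  qed (use fmem in simp)
  have fg: "f (g v) = v" if v: "v \<in> carr (T Y X)" for v
  proof (rule tcarr_ext[OF linv_comp[OF fl gl] linv_id vsP _ v[unfolded carr_T]])
    fix y x assume xy: "y \<in> carr Y" "x \<in> carr X"
    have "f (g (y \<otimes> x)) = act2 X Y ri (\<lambda>x y. f (x \<otimes> y)) x y"
      unfolding g(2)[OF xy(2,1)] by (rule act2_linear[OF fl _ p]) simp_all
    also have "... = act2 X Y ri (act2 X Y r ?s) x y"
      by (intro act2_cong p) (simp add: *(2))
    also have "... = act2 X Y e2 ?s x y"
      by (subst act2_act2[OF X Y ri(1) bform_r tmaps(4)]) (simp add: ri)
    also have "... = y \<otimes> x" by (rule act2_e2[OF X Y tmaps(4) xy(2,1)])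
    finally show "f (g (y \<otimes> x)) = y \<otimes> x" .
  qed (use gmem in simp)
  show "iso_in CC (T X Y) (T Y X) (Brd CC X Y)"
    unfolding e by (rule iso_CCI[OF pT hom _ gmem gf fg]) (use g in simp_all)
qed

end

context coalg_mult begin

lemma qmaps:
  "qmap X Y Z W (\<lambda>x y z w. x \<otimes> (y \<otimes> (z \<otimes> w)))"
  "qmap X Y Z W (\<lambda>x y z w. (x \<otimes> (y \<otimes> z)) \<otimes> w)"
  "qmap X Y Z W (\<lambda>x y z w. x \<otimes> ((y \<otimes> z) \<otimes> w))"
  by (auto simp: multilin_on_defs intro!: lin)

lemma tmaps_perm:
  "tmap X Y Z (\<lambda>x y z. y \<otimes> (z \<otimes> x))" "tmap X Y Z (\<lambda>x y z. (y \<otimes> z) \<otimes> x)"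
  "tmap X Y Z (\<lambda>x y z. y \<otimes> (x \<otimes> z))" "tmap X Y Z (\<lambda>x y z. (y \<otimes> x) \<otimes> z)"
  "tmap X Y Z (\<lambda>x y z. (z \<otimes> x) \<otimes> y)" "tmap X Y Z (\<lambda>x y z. z \<otimes> (x \<otimes> y))"
  "tmap X Y Z (\<lambda>x y z. (x \<otimes> z) \<otimes> y)" "tmap X Y Z (\<lambda>x y z. x \<otimes> (z \<otimes> y))"
  by (auto simp: multilin_on_defs intro!: lin)

text \<open>Coactions of different comodules commute, so permuting the comodules only permutes the
  arguments of the form.\<close>

lemma act3_rotate:
  "act3 Y Z X p f y z x = act3 X Y Z (\<lambda>h k l. p k l h) (\<lambda>x y z. f y z x) x y z"
  unfolding act3_def A3_def by (subst (2) csw_swap, subst csw_swap, rule refl)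

lemma act3_swap12:
  "act3 Y X Z p f y x z = act3 X Y Z (\<lambda>h k l. p k h l) (\<lambda>x y z. f y x z) x y z"
  unfolding act3_def A3_def by (rule csw_swap)

lemma act3_swap23:
  "act3 X Z Y p f x z y = act3 X Y Z (\<lambda>h k l. p h l k) (\<lambda>x y z. f x z y) x y z"
  unfolding act3_def A3_def by (subst csw_swap[of Y], rule refl)

end

context coalg begin

lemma act3_act3_act3:
  assumes "lcomod X" "lcomod Y" "lcomod Z"
    "tform p" "tform q" "tform s" "tmap X Y Z f"
  shows "act3 X Y Z p (act3 X Y Z q (act3 X Y Z s f)) x y z = act3 X Y Z (conv3 H p (conv3 H q s)) f x y z"
proof -
  have "act3 X Y Z q (act3 X Y Z s f) = act3 X Y Z (conv3 H q s) f"
    by (intro ext act3_act3 assms)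
  then show ?thesis using act3_act3[OF assms(1-4) tform_conv3[OF assms(5,6)] assms(7)] by simp
qed

lemma act4_act4_act4:
  assumes "lcomod X" "lcomod Y" "lcomod Z" "lcomod W"
    "qform p" "qform q" "qform s" "qmap X Y Z W f"
  shows "act4 X Y Z W p (act4 X Y Z W q (act4 X Y Z W s f)) x y z w =
    act4 X Y Z W (conv4 p (conv4 q s)) f x y z w"
proof -
  have "act4 X Y Z W q (act4 X Y Z W s f) = act4 X Y Z W (conv4 q s) f"
    by (intro ext act4_act4 assms)
  then show ?thesis using act4_act4[OF assms(1-5) qform_conv4[OF assms(6,7)] assms(8)] by simp
qed

end

section \<open>Coherence of the comodule category\<close>

context cqt begin

context
  fixes X Y :: "('k, 'h, 'u) comod"
  assumes X: "lcomod X" and Y: "lcomod Y"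
begin

lemma T_id: "TA (cid X) (cid Y) = cid (T X Y)"
  using comod_precomod[OF X] comod_precomod[OF Y]
  by (auto intro!: chom_T_ext[of _ X Y "T X Y"] T_arr chom_id precomod_T simp: T_arr[of X Y X Y] chom_id)

text \<open>On \<open>(x \<otimes> evec) \<otimes> y\<close> the middle coaction inserts
  \<open>e\<close> into \<Omega>, and by normalisation the associator becomes the action of
  \<open>e2\<close>.\<close>

lemma triangle_CC:
  "ccomp (TA (cid X) (Lun CC Y)) (Asc CC X (kline H e) Y) = TA (Run CC X) (cid Y)"
proof -
  let ?K = "kline H e :: ('k, 'h, 'u) comod"
  note p = comod_precomod[OF X] comod_precomod[OF Y] precomod_kline[of e]
  note K = comod_kline[OF grouplike_e]
  note A = Asc_CC[OF X K Y]
  note L = T_arr[OF p(1) precomod_T[OF p(3,2)] p(1,2) chom_id[OF p(1)] Lun_CC(1)[OF Y]]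
  note R = T_arr[OF precomod_T[OF p(1,3)] p(2) p(1,2) Run_CC(1)[OF X] chom_id[OF p(2)]]
  have in1: "ccomp (TA (cid X) (Lun CC Y)) (Asc CC X ?K Y) \<in> chom H (T (T X ?K) Y) (T X Y)"
    by (rule chom_comp[OF _ _ _ A(1) L(1)]) (intro precomod_T p)+
  note lL = chom_mp(3)[OF in1] and lR = chom_mp(3)[OF R(1)]
  show ?thesis
  proof (rule chom_T_ext[OF in1 R(1)])
    fix v y assume v: "v \<in> carr (T X ?K)" and y: "y \<in> carr Y"
    show "mp (ccomp (TA (cid X) (Lun CC Y)) (Asc CC X ?K Y)) (v \<otimes> y) = mp (TA (Run CC X) (cid Y)) (v \<otimes> y)"
    proof (rule tcarr_evec_ext_right[of "carr X" pscale "\<lambda>v. mp (ccomp (TA (cid X) (Lun CC Y)) (Asc CC X ?K Y)) (v \<otimes> y)"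
         "\<lambda>v. mp (TA (Run CC X) (cid Y)) (v \<otimes> y)", OF _ _ vsP])
      show "v \<in> tcarr (carr X) (vspan {evec})" using v by simp
      fix x assume x: "x \<in> carr X"
      have ev: "evec \<in> carr ?K" by simp
      have "mp (ccomp (TA (cid X) (Lun CC Y)) (Asc CC X ?K Y)) ((x \<otimes> evec) \<otimes> y) =
         mp (TA (cid X) (Lun CC Y)) (act3 X ?K Y \<Omega> (\<lambda>x c y. x \<otimes> (c \<otimes> y)) x evec y)"
        using A(2)[OF x ev y] by simp
      also have "... = act3 X ?K Y \<Omega> (\<lambda>x c y. mp (TA (cid X) (Lun CC Y)) (x \<otimes> (c \<otimes> y))) x evec y"
        by (rule act3_linear[OF chom_mp(3)[OF L(1)] precomod_subspace[OF precomod_T[OF p(1) precomod_T[OF p(3,2)]]] p(1,3,2)]) simp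
      also have "... = csw H X x (\<lambda>h x0. csw H Y y (\<lambda>l y0. pscale (\<Omega> h e l) (x0 \<otimes> y0)))"
      proof -
        have "csw H ?K evec (\<lambda>k c. csw H Y y (\<lambda>l y0. pscale (\<Omega> h k l) (mp (TA (cid X) (Lun CC Y)) (x0 \<otimes> (c \<otimes> y0))))) =
           csw H Y y (\<lambda>l y0. pscale (\<Omega> h e l) (x0 \<otimes> y0))" if x0: "x0 \<in> carr X" for h x0
          by (subst csw_kline[OF vsP])
            (use p x0 L(2) Lun_CC(2)[OF Y] in \<open>auto simp: lin_on_iff intro!: lin lin_app3[OF tform_\<Omega>] linv_comp[OF chom_mp(3)[OF L(1)]] csw_cong[OF p(2)]\<close>)
        then show ?thesis unfolding act3_def A3_def by (intro csw_cong[OF p(1)])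
      qed
      also have "... = act2 X Y e2 (\<otimes>) x y"
        by (simp add: \<Omega>_unit act2_def A2_def e2_def)
      also have "... = x \<otimes> y" by (rule act2_e2[OF X Y tmaps(3) x y])
      also have "... = mp (TA (Run CC X) (cid Y)) ((x \<otimes> evec) \<otimes> y)"
        using x y Run_CC(2)[OF X x] by (subst R(2)) auto
      finally show "mp (ccomp (TA (cid X) (Lun CC Y)) (Asc CC X ?K Y)) ((x \<otimes> evec) \<otimes> y) =
        mp (TA (Run CC X) (cid Y)) ((x \<otimes> evec) \<otimes> y)" .
    qed ((rule linv_comp[OF lL] linv_comp[OF lR]; use y in \<open>auto intro!: lin\<close>)+)
  qed
qed

context
  fixes Z :: "('k, 'h, 'u) comod"
  assumes Z: "lcomod Z"
begin

text \<open>On a pure tensor both composites are trilinear forms acting on the same map, with values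
  \<open>y \<otimes> (z \<otimes> x)\<close>. Each arrow contributes one convolution factor, with
  its arguments permuted according to the current order of the tensor factors.\<close>

lemma hexagon1_CC:
  "ccomp (Asc CC Y Z X) (ccomp (Brd CC X (T Y Z)) (Asc CC X Y Z)) =
   ccomp (TA (cid Y) (Brd CC X Z)) (ccomp (Asc CC Y X Z) (TA (Brd CC X Y) (cid Z)))"
  (is "?L = ?R")
proof -
  note p = comod_precomod[OF X] comod_precomod[OF Y] comod_precomod[OF Z]
  note YZ = comod_T[OF Y Z]
  note A1 = Asc_CC[OF X Y Z] and A2 = Asc_CC[OF Y Z X] and A3 = Asc_CC[OF Y X Z]
  note B1 = Brd_CC[OF X YZ] and B2 = Brd_CC[OF X Y] and B3 = Brd_CC[OF X Z]
  note T1 = T_arr[OF precomod_T[OF p(1,2)] p(3) precomod_T[OF p(2,1)] p(3) B2(1) chom_id[OF p(3)]]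
  note T2 = T_arr[OF p(2) precomod_T[OF p(1,3)] p(2) precomod_T[OF p(3,1)] chom_id[OF p(2)] B3(1)]
  note linear = act3_linear[OF chom_mp(3) precomod_subspace]
  show ?thesis
  proof (rule chom_T3_ext[of _ X Y Z "T Y (T Z X)"])
    show "?L \<in> chom H (T (T X Y) Z) (T Y (T Z X))"
      by (rule chom_comp[OF _ _ _ chom_comp[OF _ _ _ A1(1) B1(1)] A2(1)]) (intro precomod_T p)+
    show "ccomp (TA (cid Y) (Brd CC X Z)) (ccomp (Asc CC Y X Z) (TA (Brd CC X Y) (cid Z)))
      \<in> chom H (T (T X Y) Z) (T Y (T Z X))"
      by (rule chom_comp[OF _ _ _ chom_comp[OF _ _ _ T1(1) A3(1)] T2(1)]) (intro precomod_T p)+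
    fix x y z assume xyz: "x \<in> carr X" "y \<in> carr Y" "z \<in> carr Z"
    let ?t = "\<lambda>x y z. y \<otimes> (z \<otimes> x)"
    have "mp ?L ((x \<otimes> y) \<otimes> z) =
      mp (Asc CC Y Z X) (mp (Brd CC X (T Y Z)) (act3 X Y Z \<Omega> (\<lambda>x y z. x \<otimes> (y \<otimes> z)) x y z))"
      using A1(2)[OF xyz] by simp
    also have "... = mp (Asc CC Y Z X) (act3 X Y Z \<Omega> (\<lambda>x y z. mp (Brd CC X (T Y Z)) (x \<otimes> (y \<otimes> z))) x y z)"
      by (subst linear[OF B1(1)]) (auto intro!: precomod_T p)
    also have "... = act3 X Y Z \<Omega> (\<lambda>x y z. mp (Asc CC Y Z X) (mp (Brd CC X (T Y Z)) (x \<otimes> (y \<otimes> z)))) x y z"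
      by (rule linear[OF A2(1)]) (use chom_mp(4)[OF B1(1)] p in \<open>auto intro!: precomod_T\<close>)
    also have "... = act3 X Y Z \<Omega> (act3 X Y Z (\<lambda>h k l. r h (m k l)) (act3 X Y Z (\<lambda>h k l. \<Omega> k l h) ?t)) x y z"
    proof (intro act3_cong p)
      fix x y z assume xyz: "x \<in> carr X" "y \<in> carr Y" "z \<in> carr Z"
      have "mp (Asc CC Y Z X) (mp (Brd CC X (T Y Z)) (x \<otimes> (y \<otimes> z))) =
        mp (Asc CC Y Z X) (act2 X (T Y Z) r (\<lambda>x w. w \<otimes> x) x (y \<otimes> z))"
        using xyz by (subst B1(2)) auto
      also have "... = mp (Asc CC Y Z X) (act3 X Y Z (\<lambda>h k l. r h (m k l)) (\<lambda>x y z. (y \<otimes> z) \<otimes> x) x y z)"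
        by (subst act2_T2[OF p bform_r tmaps(4) xyz(2,3)]) simp
      also have "... = act3 X Y Z (\<lambda>h k l. r h (m k l)) (\<lambda>x y z. mp (Asc CC Y Z X) ((y \<otimes> z) \<otimes> x)) x y z"
        by (rule linear[OF A2(1)]) (use p in \<open>auto intro!: precomod_T\<close>)
      also have "... = act3 X Y Z (\<lambda>h k l. r h (m k l)) (act3 X Y Z (\<lambda>h k l. \<Omega> k l h) ?t) x y z"
        by (intro act3_cong p) (simp add: A2(2) act3_rotate[of Y Z X])
      finally show "mp (Asc CC Y Z X) (mp (Brd CC X (T Y Z)) (x \<otimes> (y \<otimes> z))) = ..." .
    qed
    also have "... = act3 X Y Z (conv3 H \<Omega> (conv3 H (\<lambda>h k l. r h (m k l)) (\<lambda>h k l. \<Omega> k l h))) ?t x y z"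
      by (rule act3_act3_act3[OF X Y Z tform_\<Omega> bforms(2)[OF bform_r] tforms(6)[OF tform_\<Omega>] tmaps_perm(1)])
    \<comment> \<open>The hexagon equation of forms is used here; the rest of the chain reads the
      three factors back as arrows.\<close>
    also have "... = act3 X Y Z (\<lambda>h k l. r h k * eps l) (act3 X Y Z (\<lambda>h k l. \<Omega> k h l) (act3 X Y Z (\<lambda>h k l. r h l * eps k) ?t)) x y z"
      unfolding hexagon1
      by (rule act3_act3_act3[symmetric, OF X Y Z tform_pads(1)[OF bform_r] tforms(7)[OF tform_\<Omega>] tform_pads(2)[OF bform_r] tmaps_perm(1)])
    also have "... = act3 X Y Z (\<lambda>h k l. r h k * eps l) (\<lambda>x y z. mp (TA (cid Y) (Brd CC X Z)) (mp (Asc CC Y X Z) ((y \<otimes> x) \<otimes> z))) x y z"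
    proof (intro act3_cong p)
      fix x y z assume xyz: "x \<in> carr X" "y \<in> carr Y" "z \<in> carr Z"
      have "mp (TA (cid Y) (Brd CC X Z)) (mp (Asc CC Y X Z) ((y \<otimes> x) \<otimes> z)) =
        mp (TA (cid Y) (Brd CC X Z)) (act3 X Y Z (\<lambda>h k l. \<Omega> k h l) (\<lambda>x y z. y \<otimes> (x \<otimes> z)) x y z)"
        using xyz by (simp add: A3(2) act3_swap12[of Y X])
      also have "... = act3 X Y Z (\<lambda>h k l. \<Omega> k h l) (\<lambda>x y z. mp (TA (cid Y) (Brd CC X Z)) (y \<otimes> (x \<otimes> z))) x y z"
        by (rule linear[OF T2(1)]) (use p in \<open>auto intro!: precomod_T\<close>)
      also have "... = act3 X Y Z (\<lambda>h k l. \<Omega> k h l) (act3 X Y Z (\<lambda>h k l. r h l * eps k) ?t) x y z"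
      proof (intro act3_cong p)
        fix x y z assume xyz: "x \<in> carr X" "y \<in> carr Y" "z \<in> carr Z"
        have "mp (TA (cid Y) (Brd CC X Z)) (y \<otimes> (x \<otimes> z)) = y \<otimes> act2 X Z r (\<lambda>x z. z \<otimes> x) x z"
          using xyz by (subst T2(2)) (auto simp: B3(2))
        also have "... = act2 X Z r (\<lambda>x z. ?t x y z) x z"
          by (rule act2_linear[OF vten_linv(2) _ p(1,3)]) auto
        also have "... = act3 X Y Z (\<lambda>h k l. r h l * eps k) ?t x y z"
          by (rule act3_pad2[symmetric, OF p(1) Y p(3) tmaps_perm(1) xyz(2)])
        finally show "mp (TA (cid Y) (Brd CC X Z)) (y \<otimes> (x \<otimes> z)) = ..." .
      qed
      finally show "act3 X Y Z (\<lambda>h k l. \<Omega> k h l) (act3 X Y Z (\<lambda>h k l. r h l * eps k) ?t) x y z =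
         mp (TA (cid Y) (Brd CC X Z)) (mp (Asc CC Y X Z) ((y \<otimes> x) \<otimes> z))" ..
    qed
    also have "... = mp (TA (cid Y) (Brd CC X Z)) (act3 X Y Z (\<lambda>h k l. r h k * eps l) (\<lambda>x y z. mp (Asc CC Y X Z) ((y \<otimes> x) \<otimes> z)) x y z)"
      by (rule linear[symmetric, OF T2(1)]) (use chom_mp(4)[OF A3(1)] p in \<open>auto intro!: precomod_T\<close>)
    also have "... = mp (TA (cid Y) (Brd CC X Z)) (mp (Asc CC Y X Z) (act3 X Y Z (\<lambda>h k l. r h k * eps l) (\<lambda>x y z. (y \<otimes> x) \<otimes> z) x y z))"
      by (subst linear[OF A3(1)]) (use p in \<open>auto intro!: precomod_T\<close>)
    also have "act3 X Y Z (\<lambda>h k l. r h k * eps l) (\<lambda>x y z. (y \<otimes> x) \<otimes> z) x y z = act2 X Y r (\<lambda>x y. (y \<otimes> x) \<otimes> z) x y"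
      by (rule act3_pad3[OF p(1,2) Z tmaps_perm(4) xyz(3)])
    also have "... = act2 X Y r (\<lambda>x y. y \<otimes> x) x y \<otimes> z"
      by (rule act2_linear[symmetric, OF vten_linv(1) _ p(1,2)]) auto
    also have "... = mp (TA (Brd CC X Y) (cid Z)) ((x \<otimes> y) \<otimes> z)"
      using xyz by (subst T1(2)) (auto simp: B2(2))
    finally show "mp ?L ((x \<otimes> y) \<otimes> z) =
      mp ?R ((x \<otimes> y) \<otimes> z)"
      by simp
  qed
qed

text \<open>The same computation with inverse associators, hence with \<open>Oi\<close>, on
  right-bracketed tensors; all forms act on the map with values
  \<open>(z \<otimes> x) \<otimes> y\<close>.\<close>

lemma hexagon2_CC:
  "ccomp (inv_Asc CC Z X Y) (ccomp (Brd CC (T X Y) Z) (inv_Asc CC X Y Z)) =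
   ccomp (TA (Brd CC X Z) (cid Y)) (ccomp (inv_Asc CC X Z Y) (TA (cid X) (Brd CC Y Z)))"
  (is "?L = ?R")
proof -
  note p = comod_precomod[OF X] comod_precomod[OF Y] comod_precomod[OF Z]
  note XY = comod_T[OF X Y]
  note A1 = Asc_CC(4,5)[OF X Y Z] and A2 = Asc_CC(4,5)[OF Z X Y] and A3 = Asc_CC(4,5)[OF X Z Y]
  note B1 = Brd_CC[OF XY Z] and B2 = Brd_CC[OF Y Z] and B3 = Brd_CC[OF X Z]
  note T1 = T_arr[OF p(1) precomod_T[OF p(2,3)] p(1) precomod_T[OF p(3,2)] chom_id[OF p(1)] B2(1)]
  note T2 = T_arr[OF precomod_T[OF p(1,3)] p(2) precomod_T[OF p(3,1)] p(2) B3(1) chom_id[OF p(2)]]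
  note linear = act3_linear[OF chom_mp(3) precomod_subspace]
  let ?t = "\<lambda>x y z. (z \<otimes> x) \<otimes> y"
  show ?thesis
  proof (rule chom_T3r_ext[of _ X Y Z "T (T Z X) Y"])
    show "?L \<in> chom H (T X (T Y Z)) (T (T Z X) Y)"
      by (rule chom_comp[OF _ _ _ chom_comp[OF _ _ _ A1(1) B1(1)] A2(1)]) (intro precomod_T p)+
    show "ccomp (TA (Brd CC X Z) (cid Y)) (ccomp (inv_Asc CC X Z Y) (TA (cid X) (Brd CC Y Z)))
      \<in> chom H (T X (T Y Z)) (T (T Z X) Y)"
      by (rule chom_comp[OF _ _ _ chom_comp[OF _ _ _ T1(1) A3(1)] T2(1)]) (intro precomod_T p)+
    fix x y z assume xyz: "x \<in> carr X" "y \<in> carr Y" "z \<in> carr Z"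
    have "mp ?L (x \<otimes> (y \<otimes> z)) =
      mp (inv_Asc CC Z X Y) (mp (Brd CC (T X Y) Z) (act3 X Y Z Oi (\<lambda>x y z. (x \<otimes> y) \<otimes> z) x y z))"
      using A1(2)[OF xyz] by simp
    also have "... = mp (inv_Asc CC Z X Y) (act3 X Y Z Oi (\<lambda>x y z. mp (Brd CC (T X Y) Z) ((x \<otimes> y) \<otimes> z)) x y z)"
      by (subst linear[OF B1(1)]) (auto intro!: precomod_T p)
    also have "... = act3 X Y Z Oi (\<lambda>x y z. mp (inv_Asc CC Z X Y) (mp (Brd CC (T X Y) Z) ((x \<otimes> y) \<otimes> z))) x y z"
      by (rule linear[OF A2(1)]) (use chom_mp(4)[OF B1(1)] p in \<open>auto intro!: precomod_T\<close>)
    also have "... = act3 X Y Z Oi (act3 X Y Z (\<lambda>h k l. r (m h k) l) (act3 X Y Z (\<lambda>h k l. Oi l h k) ?t)) x y z"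
    proof (intro act3_cong p)
      fix x y z assume xyz: "x \<in> carr X" "y \<in> carr Y" "z \<in> carr Z"
      have "mp (inv_Asc CC Z X Y) (mp (Brd CC (T X Y) Z) ((x \<otimes> y) \<otimes> z)) =
        mp (inv_Asc CC Z X Y) (act2 (T X Y) Z r (\<lambda>x w. w \<otimes> x) (x \<otimes> y) z)"
        using xyz by (subst B1(2)) auto
      also have "... = mp (inv_Asc CC Z X Y) (act3 X Y Z (\<lambda>h k l. r (m h k) l) (\<lambda>x y z. z \<otimes> (x \<otimes> y)) x y z)"
        by (subst act2_T1[OF p bform_r tmaps(4) xyz(1,2)]) simp
      also have "... = act3 X Y Z (\<lambda>h k l. r (m h k) l) (\<lambda>x y z. mp (inv_Asc CC Z X Y) (z \<otimes> (x \<otimes> y))) x y z"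
        by (rule linear[OF A2(1)]) (use p in \<open>auto intro!: precomod_T\<close>)
      also have "... = act3 X Y Z (\<lambda>h k l. r (m h k) l) (act3 X Y Z (\<lambda>h k l. Oi l h k) ?t) x y z"
      proof (intro act3_cong p)
        fix x y z assume xyz: "x \<in> carr X" "y \<in> carr Y" "z \<in> carr Z"
        show "mp (inv_Asc CC Z X Y) (z \<otimes> (x \<otimes> y)) = act3 X Y Z (\<lambda>h k l. Oi l h k) ?t x y z"
          using act3_rotate[of X Y Z "\<lambda>h k l. Oi l h k" ?t x y z] by (simp add: A2(2) xyz)
      qed
      finally show "mp (inv_Asc CC Z X Y) (mp (Brd CC (T X Y) Z) ((x \<otimes> y) \<otimes> z)) = ..." .
    qed
    also have "... = act3 X Y Z (conv3 H Oi (conv3 H (\<lambda>h k l. r (m h k) l) (\<lambda>h k l. Oi l h k))) ?t x y z"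
      by (rule act3_act3_act3[OF X Y Z Oi(1) bforms(1)[OF bform_r] tforms(8)[OF Oi(1)] tmaps_perm(5)])
    also have "... = act3 X Y Z (\<lambda>h k l. eps h * r k l) (act3 X Y Z (\<lambda>h k l. Oi h l k) (act3 X Y Z (\<lambda>h k l. r h l * eps k) ?t)) x y z"
      unfolding hexagon2
      by (rule act3_act3_act3[symmetric, OF X Y Z tform_pads(3)[OF bform_r] tforms(9)[OF Oi(1)] tform_pads(2)[OF bform_r] tmaps_perm(5)])
    also have "... = act3 X Y Z (\<lambda>h k l. eps h * r k l) (\<lambda>x y z. mp (TA (Brd CC X Z) (cid Y)) (mp (inv_Asc CC X Z Y) (x \<otimes> (z \<otimes> y)))) x y z"
    proof (intro act3_cong p)
      fix x y z assume xyz: "x \<in> carr X" "y \<in> carr Y" "z \<in> carr Z"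
      have "mp (TA (Brd CC X Z) (cid Y)) (mp (inv_Asc CC X Z Y) (x \<otimes> (z \<otimes> y))) =
        mp (TA (Brd CC X Z) (cid Y)) (act3 X Y Z (\<lambda>h k l. Oi h l k) (\<lambda>x y z. (x \<otimes> z) \<otimes> y) x y z)"
        using xyz by (simp add: A3(2) act3_swap23[of X Z Y])
      also have "... = act3 X Y Z (\<lambda>h k l. Oi h l k) (\<lambda>x y z. mp (TA (Brd CC X Z) (cid Y)) ((x \<otimes> z) \<otimes> y)) x y z"
        by (rule linear[OF T2(1)]) (use p in \<open>auto intro!: precomod_T\<close>)
      also have "... = act3 X Y Z (\<lambda>h k l. Oi h l k) (act3 X Y Z (\<lambda>h k l. r h l * eps k) ?t) x y z"
      proof (intro act3_cong p)
        fix x y z assume xyz: "x \<in> carr X" "y \<in> carr Y" "z \<in> carr Z"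
        have "mp (TA (Brd CC X Z) (cid Y)) ((x \<otimes> z) \<otimes> y) = act2 X Z r (\<lambda>x z. z \<otimes> x) x z \<otimes> y"
          using xyz by (subst T2(2)) (auto simp: B3(2))
        also have "... = act2 X Z r (\<lambda>x z. ?t x y z) x z"
          by (rule act2_linear[OF vten_linv(1) _ p(1,3)]) auto
        also have "... = act3 X Y Z (\<lambda>h k l. r h l * eps k) ?t x y z"
          by (rule act3_pad2[symmetric, OF p(1) Y p(3) tmaps_perm(5) xyz(2)])
        finally show "mp (TA (Brd CC X Z) (cid Y)) ((x \<otimes> z) \<otimes> y) = ..." .
      qed
      finally show "act3 X Y Z (\<lambda>h k l. Oi h l k) (act3 X Y Z (\<lambda>h k l. r h l * eps k) ?t) x y z =
         mp (TA (Brd CC X Z) (cid Y)) (mp (inv_Asc CC X Z Y) (x \<otimes> (z \<otimes> y)))" ..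
    qed
    also have "... = mp (TA (Brd CC X Z) (cid Y)) (act3 X Y Z (\<lambda>h k l. eps h * r k l) (\<lambda>x y z. mp (inv_Asc CC X Z Y) (x \<otimes> (z \<otimes> y))) x y z)"
      by (rule linear[symmetric, OF T2(1)]) (use chom_mp(4)[OF A3(1)] p in \<open>auto intro!: precomod_T\<close>)
    also have "... = mp (TA (Brd CC X Z) (cid Y)) (mp (inv_Asc CC X Z Y) (act3 X Y Z (\<lambda>h k l. eps h * r k l) (\<lambda>x y z. x \<otimes> (z \<otimes> y)) x y z))"
      by (subst linear[OF A3(1)]) (use p in \<open>auto intro!: precomod_T\<close>)
    also have "act3 X Y Z (\<lambda>h k l. eps h * r k l) (\<lambda>x y z. x \<otimes> (z \<otimes> y)) x y z = act2 Y Z r (\<lambda>y z. x \<otimes> (z \<otimes> y)) y z"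
      by (rule act3_pad1[OF X p(2,3) tmaps_perm(8) xyz(1)])
    also have "... = x \<otimes> act2 Y Z r (\<lambda>y z. z \<otimes> y) y z"
      by (rule act2_linear[symmetric, OF vten_linv(2) _ p(2,3)]) auto
    also have "... = mp (TA (cid X) (Brd CC Y Z)) (x \<otimes> (y \<otimes> z))"
      using xyz by (subst T1(2)) (auto simp: B2(2))
    finally show "mp ?L (x \<otimes> (y \<otimes> z)) =
      mp ?R (x \<otimes> (y \<otimes> z))"
      by simp
  qed
qed

text \<open>Both composites are forms in four variables acting on the fully right-bracketed tensor.
  An associator with a product among its arguments contributes \<Omega> with a product inserted; one
  tensored with an identity contributes \<Omega> padded by the counit.\<close>

lemma pentagon_CC:
  assumes W: "lcomod W"
  shows "ccomp (Asc CC X Y (T Z W)) (Asc CC (T X Y) Z W) =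
   ccomp (TA (cid X) (Asc CC Y Z W)) (ccomp (Asc CC X (T Y Z) W) (TA (Asc CC X Y Z) (cid W)))"
  (is "?L = ?R")
proof -
  note p = comod_precomod[OF X] comod_precomod[OF Y] comod_precomod[OF Z] comod_precomod[OF W]
  note XY = comod_T[OF X Y] and YZ = comod_T[OF Y Z] and ZW = comod_T[OF Z W]
  note pXY = comod_precomod[OF XY] and pYZ = comod_precomod[OF YZ] and pZW = comod_precomod[OF ZW]
  note A1 = Asc_CC[OF XY Z W] and A2 = Asc_CC[OF X Y ZW] and A3 = Asc_CC[OF X Y Z] and A4 = Asc_CC[OF X YZ W]
    and A5 = Asc_CC[OF Y Z W]
  note T1 = T_arr[OF precomod_T[OF pXY p(3)] p(4) precomod_T[OF p(1) pYZ] p(4) A3(1) chom_id[OF p(4)]]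
  note T2 = T_arr[OF p(1) precomod_T[OF pYZ p(4)] p(1) precomod_T[OF p(2) pZW] chom_id[OF p(1)] A5(1)]
  note linear = act4_linear[OF chom_mp(3) precomod_subspace]
  let ?t = "\<lambda>x y z w. x \<otimes> (y \<otimes> (z \<otimes> w))"
  show ?thesis
  proof (rule chom_T4_ext[of _ X Y Z W "T X (T Y (T Z W))"])
    show "?L \<in> chom H (T (T (T X Y) Z) W) (T X (T Y (T Z W)))"
      by (rule chom_comp[OF _ _ _ A1(1) A2(1)]) (intro precomod_T p)+
    show "ccomp (TA (cid X) (Asc CC Y Z W)) (ccomp (Asc CC X (T Y Z) W) (TA (Asc CC X Y Z) (cid W)))
      \<in> chom H (T (T (T X Y) Z) W) (T X (T Y (T Z W)))"
      by (rule chom_comp[OF _ _ _ chom_comp[OF _ _ _ T1(1) A4(1)] T2(1)]) (intro precomod_T p)+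
    fix x y z w assume xyz: "x \<in> carr X" "y \<in> carr Y" "z \<in> carr Z" "w \<in> carr W"
    have "mp ?L (((x \<otimes> y) \<otimes> z) \<otimes> w) =
       mp (Asc CC X Y (T Z W)) (act3 (T X Y) Z W \<Omega> (\<lambda>x y z. x \<otimes> (y \<otimes> z)) (x \<otimes> y) z w)"
      using xyz by (simp add: A1(2))
    also have "... = mp (Asc CC X Y (T Z W)) (act4 X Y Z W (\<lambda>h k l t. \<Omega> (m h k) l t) (\<lambda>x y z w. (x \<otimes> y) \<otimes> (z \<otimes> w)) x y z w)"
      by (subst act3_T1[OF p tform_\<Omega> tmaps(2) xyz(1,2)]) simp
    also have "... = act4 X Y Z W (\<lambda>h k l t. \<Omega> (m h k) l t) (\<lambda>x y z w. mp (Asc CC X Y (T Z W)) ((x \<otimes> y) \<otimes> (z \<otimes> w))) x y z w"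
      by (rule linear[OF A2(1)]) (auto intro!: precomod_T p)
    also have "... = act4 X Y Z W (\<lambda>h k l t. \<Omega> (m h k) l t) (act4 X Y Z W (\<lambda>h k l t. \<Omega> h k (m l t)) ?t) x y z w"
      by (intro act4_cong p) (simp add: A2(2) act3_T3[OF p tform_\<Omega> tmaps(2)])
    also have "... = act4 X Y Z W (\<lambda>h k l t. \<Omega> h k l * eps t) (act4 X Y Z W (\<lambda>h k l t. \<Omega> h (m k l) t)
      (act4 X Y Z W (\<lambda>h k l t. eps h * \<Omega> k l t) ?t)) x y z w"
      by (subst act4_act4[OF X Y Z W tforms(1)[OF tform_\<Omega>] tforms(3)[OF tform_\<Omega>] qmaps(1)],
          subst act4_act4_act4[OF X Y Z W tforms(4)[OF tform_\<Omega>] tforms(2)[OF tform_\<Omega>] tforms(5)[OF tform_\<Omega>] qmaps(1)])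
        (simp only: pentagon)
    also have "... = act4 X Y Z W (\<lambda>h k l t. \<Omega> h k l * eps t) (\<lambda>x y z w. 
       mp (TA (cid X) (Asc CC Y Z W)) (mp (Asc CC X (T Y Z) W) ((x \<otimes> (y \<otimes> z)) \<otimes> w))) x y z w"
    proof (intro act4_cong p)
      fix x y z w assume xyz: "x \<in> carr X" "y \<in> carr Y" "z \<in> carr Z" "w \<in> carr W"
      have "mp (TA (cid X) (Asc CC Y Z W)) (mp (Asc CC X (T Y Z) W) ((x \<otimes> (y \<otimes> z)) \<otimes> w)) =
        mp (TA (cid X) (Asc CC Y Z W)) (act4 X Y Z W (\<lambda>h k l t. \<Omega> h (m k l) t) (\<lambda>x y z w. x \<otimes> ((y \<otimes> z) \<otimes> w)) x y z w)"
        using xyz by (simp add: A4(2) act3_T2[OF p tform_\<Omega> tmaps(2)])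
      also have "... = act4 X Y Z W (\<lambda>h k l t. \<Omega> h (m k l) t) (\<lambda>x y z w. mp (TA (cid X) (Asc CC Y Z W)) (x \<otimes> ((y \<otimes> z) \<otimes> w))) x y z w"
        by (rule linear[OF T2(1)]) (auto intro!: precomod_T p)
      also have "... = act4 X Y Z W (\<lambda>h k l t. \<Omega> h (m k l) t) (act4 X Y Z W (\<lambda>h k l t. eps h * \<Omega> k l t) ?t) x y z w"
      proof (intro act4_cong p)
        fix x y z w assume xyz: "x \<in> carr X" "y \<in> carr Y" "z \<in> carr Z" "w \<in> carr W"
        have "mp (TA (cid X) (Asc CC Y Z W)) (x \<otimes> ((y \<otimes> z) \<otimes> w)) =
           x \<otimes> act3 Y Z W \<Omega> (\<lambda>y z w. y \<otimes> (z \<otimes> w)) y z w"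
          using xyz by (subst T2(2)) (auto simp: A5(2))
        also have "... = act3 Y Z W \<Omega> (\<lambda>y z w. ?t x y z w) y z w"
          by (rule act3_linear[OF vten_linv(2) _ p(2-4)]) auto
        also have "... = act4 X Y Z W (\<lambda>h k l t. eps h * \<Omega> k l t) ?t x y z w"
          by (rule act4_pad1[symmetric, OF X p(2-4) qmaps(1) xyz(1)])
        finally show "mp (TA (cid X) (Asc CC Y Z W)) (x \<otimes> ((y \<otimes> z) \<otimes> w)) = ..." .
      qed
      finally show "act4 X Y Z W (\<lambda>h k l t. \<Omega> h (m k l) t) (act4 X Y Z W (\<lambda>h k l t. eps h * \<Omega> k l t) ?t) x y z w =
        mp (TA (cid X) (Asc CC Y Z W)) (mp (Asc CC X (T Y Z) W) ((x \<otimes> (y \<otimes> z)) \<otimes> w))" ..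
    qed
    also have "... = mp (TA (cid X) (Asc CC Y Z W)) (act4 X Y Z W (\<lambda>h k l t. \<Omega> h k l * eps t)
       (\<lambda>x y z w. mp (Asc CC X (T Y Z) W) ((x \<otimes> (y \<otimes> z)) \<otimes> w)) x y z w)"
      by (rule linear[symmetric, OF T2(1)]) (use chom_mp(4)[OF A4(1)] p in \<open>auto intro!: precomod_T\<close>)
    also have "... = mp (TA (cid X) (Asc CC Y Z W)) (mp (Asc CC X (T Y Z) W)
       (act4 X Y Z W (\<lambda>h k l t. \<Omega> h k l * eps t) (\<lambda>x y z w. (x \<otimes> (y \<otimes> z)) \<otimes> w) x y z w))"
      by (subst linear[OF A4(1)]) (use p in \<open>auto intro!: precomod_T\<close>)
    also have "act4 X Y Z W (\<lambda>h k l t. \<Omega> h k l * eps t) (\<lambda>x y z w. (x \<otimes> (y \<otimes> z)) \<otimes> w) x y z w =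
       act3 X Y Z \<Omega> (\<lambda>x y z. (x \<otimes> (y \<otimes> z)) \<otimes> w) x y z"
      by (rule act4_pad4[OF p(1-3) W qmaps(2) xyz(4)])
    also have "... = act3 X Y Z \<Omega> (\<lambda>x y z. x \<otimes> (y \<otimes> z)) x y z \<otimes> w"
      by (rule act3_linear[symmetric, OF vten_linv(1) _ p(1-3)]) auto
    also have "... = mp (TA (Asc CC X Y Z) (cid W)) (((x \<otimes> y) \<otimes> z) \<otimes> w)"
      using xyz by (subst T1(2)) (auto simp: A3(2))
    finally show "mp ?L (((x \<otimes> y) \<otimes> z) \<otimes> w) =
      mp ?R (((x \<otimes> y) \<otimes> z) \<otimes> w)"
      by simp
  qed
qed

end

end

section \<open>Naturality, functoriality and the braided monoidal category\<close>

lemma monoidal_naturality_CC: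
  assumes X: "lcomod X" "lcomod X'" and Y: "lcomod Y" "lcomod Y'"
    and Z: "lcomod Z" "lcomod Z'"
    and f: "f \<in> chom H X X'" and g: "g \<in> chom H Y Y'" and h: "h \<in> chom H Z Z'"
  shows "ccomp (Asc CC X' Y' Z') (TA (TA f g) h) =
         ccomp (TA f (TA g h)) (Asc CC X Y Z)"
proof -
  note p = X[THEN comod_precomod] Y[THEN comod_precomod] Z[THEN comod_precomod]
  note A = Asc_CC[OF X(1) Y(1) Z(1)] and A' = Asc_CC[OF X(2) Y(2) Z(2)]
  note fg = T_arr[OF p(1,3,2,4) f g] and gh = T_arr[OF p(3,5,4,6) g h]
  note L = T_arr[OF precomod_T[OF p(1,3)] p(5) precomod_T[OF p(2,4)] p(6) fg(1) h]
  note R = T_arr[OF p(1) precomod_T[OF p(3,5)] p(2) precomod_T[OF p(4,6)] f gh(1)]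
  show ?thesis
  proof (rule chom_T3_ext[of _ X Y Z "T X' (T Y' Z')"])
    show "ccomp (Asc CC X' Y' Z') (TA (TA f g) h) \<in> chom H (T (T X Y) Z) (T X' (T Y' Z'))"
      by (rule chom_comp[OF _ _ _ L(1) A'(1)]) (intro precomod_T p)+
    show "ccomp (TA f (TA g h)) (Asc CC X Y Z) \<in> chom H (T (T X Y) Z) (T X' (T Y' Z'))"
      by (rule chom_comp[OF _ _ _ A(1) R(1)]) (intro precomod_T p)+
    fix x y z assume xyz: "x \<in> carr X" "y \<in> carr Y" "z \<in> carr Z"
    note mem = chom_mp(4)[OF f] chom_mp(4)[OF g] chom_mp(4)[OF h]
    have "mp (ccomp (Asc CC X' Y' Z') (TA (TA f g) h)) ((x \<otimes> y) \<otimes> z) =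
      act3 X' Y' Z' \<Omega> (\<lambda>x y z. x \<otimes> (y \<otimes> z)) (mp f x) (mp g y) (mp h z)"
      using xyz mem by (simp add: L(2) fg(2) A'(2))
    also have "... = act3 X Y Z \<Omega> (\<lambda>x y z. mp f x \<otimes> (mp g y \<otimes> mp h z)) x y z"
      by (intro act3_mp p f g h tform_\<Omega> tmaps xyz)
    also have "... = act3 X Y Z \<Omega> (\<lambda>x y z. mp (TA f (TA g h)) (x \<otimes> (y \<otimes> z))) x y z"
      by (intro act3_cong p) (simp add: R(2) gh(2))
    also have "... = mp (TA f (TA g h)) (act3 X Y Z \<Omega> (\<lambda>x y z. x \<otimes> (y \<otimes> z)) x y z)"
      by (rule act3_linear[symmetric, OF chom_mp(3)[OF R(1)] precomod_subspace]) (use p in \<open>auto intro!: precomod_T\<close>)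
    finally show "mp (ccomp (Asc CC X' Y' Z') (TA (TA f g) h)) ((x \<otimes> y) \<otimes> z) =
      mp (ccomp (TA f (TA g h)) (Asc CC X Y Z)) ((x \<otimes> y) \<otimes> z)"
      using xyz by (simp add: A(2))
  qed
qed

lemma braid_naturality_CC:
  assumes X: "lcomod X" "lcomod X'" and Y: "lcomod Y" "lcomod Y'"
    and f: "f \<in> chom H X X'" and g: "g \<in> chom H Y Y'"
  shows "ccomp (Brd CC X' Y') (TA f g) = ccomp (TA g f) (Brd CC X Y)"
proof -
  note p = X[THEN comod_precomod] Y[THEN comod_precomod]
  note B = Brd_CC[OF X(1) Y(1)] and B' = Brd_CC[OF X(2) Y(2)]
  note fg = T_arr[OF p(1,3,2,4) f g] and gf = T_arr[OF p(3,1,4,2) g f]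
  show ?thesis
  proof (rule chom_T_ext[of _ X Y "T Y' X'"])
    show "ccomp (Brd CC X' Y') (TA f g) \<in> chom H (T X Y) (T Y' X')"
      by (rule chom_comp[OF _ _ _ fg(1) B'(1)]) (intro precomod_T p)+
    show "ccomp (TA g f) (Brd CC X Y) \<in> chom H (T X Y) (T Y' X')"
      by (rule chom_comp[OF _ _ _ B(1) gf(1)]) (intro precomod_T p)+
    fix x y assume xy: "x \<in> carr X" "y \<in> carr Y"
    note mem = chom_mp(4)[OF f] chom_mp(4)[OF g]
    have "mp (ccomp (Brd CC X' Y') (TA f g)) (x \<otimes> y) = act2 X' Y' r (\<lambda>x y. y \<otimes> x) (mp f x) (mp g y)"
      using xy mem by (simp add: fg(2) B'(2))
    also have "... = act2 X Y r (\<lambda>x y. mp g y \<otimes> mp f x) x y"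
      by (rule act2_mp[OF p(1,3,2,4) f g bform_r tmaps(4) xy])
    also have "... = act2 X Y r (\<lambda>x y. mp (TA g f) (y \<otimes> x)) x y"
      by (intro act2_cong p) (simp add: gf(2))
    also have "... = mp (TA g f) (act2 X Y r (\<lambda>x y. y \<otimes> x) x y)"
      by (rule act2_linear[symmetric, OF chom_mp(3)[OF gf(1)] precomod_subspace]) (use p in \<open>auto intro!: precomod_T\<close>)
    finally show "mp (ccomp (Brd CC X' Y') (TA f g)) (x \<otimes> y) = mp (ccomp (TA g f) (Brd CC X Y)) (x \<otimes> y)"
      using xy by (simp add: B(2))
  qed
qed

lemma unit_naturality_CC:
  assumes X: "lcomod X" and Y: "lcomod Y" and f: "f \<in> chom H X Y"
  shows "ccomp (Lun CC Y) (TA (cid (kline H e)) f) = ccomp f (Lun CC X)"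
    "ccomp (Run CC Y) (TA f (cid (kline H e))) = ccomp f (Run CC X)"
proof -
  note p = X[THEN comod_precomod] Y[THEN comod_precomod] precomod_kline[of e]
  note L = T_arr[OF p(3,1,3,2) chom_id[OF p(3)] f] and R = T_arr[OF p(1,3,2,3) f chom_id[OF p(3)]]
  note U = Lun_CC[OF X] Run_CC[OF X] and U' = Lun_CC[OF Y] Run_CC[OF Y]
  have l: "ccomp (Lun CC Y) (TA (cid (kline H e)) f) \<in> chom H (T (kline H e) X) Y"
    "ccomp f (Lun CC X) \<in> chom H (T (kline H e) X) Y"
    "ccomp (Run CC Y) (TA f (cid (kline H e))) \<in> chom H (T X (kline H e)) Y"
    "ccomp f (Run CC X) \<in> chom H (T X (kline H e)) Y"
    by (rule chom_comp[OF _ _ _ L(1) U'(1)] chom_comp[OF _ _ _ U(1) f] chom_comp[OF _ _ _ R(1) U'(4)] chom_comp[OF _ _ _ U(4) f];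
        intro precomod_T p)+
  show "ccomp (Lun CC Y) (TA (cid (kline H e)) f) = ccomp f (Lun CC X)"
  proof (rule chom_eqI[OF l(1,2)])
    fix v assume "v \<in> carr (T (kline H e) X)"
    then have v: "v \<in> tcarr (vspan {evec}) (carr X)" by simp
    show "mp (ccomp (Lun CC Y) (TA (cid (kline H e)) f)) v = mp (ccomp f (Lun CC X)) v"
      by (rule tcarr_evec_ext[OF chom_mp(3)[OF l(1), unfolded carr_T carr_kline] chom_mp(3)[OF l(2), unfolded carr_T carr_kline] vsP _ v])
       (simp add: L(2) U'(2) U(2) chom_mp(4)[OF f])
  qed
  show "ccomp (Run CC Y) (TA f (cid (kline H e))) = ccomp f (Run CC X)"
  proof (rule chom_eqI[OF l(3,4)])
    fix v assume "v \<in> carr (T X (kline H e))"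
    then have v: "v \<in> tcarr (carr X) (vspan {evec})" by simp
    show "mp (ccomp (Run CC Y) (TA f (cid (kline H e)))) v = mp (ccomp f (Run CC X)) v"
      by (rule tcarr_evec_ext_right[OF chom_mp(3)[OF l(3), unfolded carr_T carr_kline] chom_mp(3)[OF l(4), unfolded carr_T carr_kline] vsP _ v])
       (simp add: R(2) U'(5) U(5) chom_mp(4)[OF f])
  qed
qed

lemma T_functor:
  assumes f: "f \<in> chom H X X'" "f' \<in> chom H X' X''" and g: "g \<in> chom H Y Y'" "g' \<in> chom H Y' Y''"
    and X: "lcomod X" "lcomod X'" "lcomod X''"
    and Y: "lcomod Y" "lcomod Y'" "lcomod Y''"
  shows "TA (ccomp f' f) (ccomp g' g) = ccomp (TA f' g') (TA f g)"
proof -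
  note p = X[THEN comod_precomod] Y[THEN comod_precomod]
  note c = chom_comp[OF p(1-3) f] chom_comp[OF p(4-6) g]
  note 1 = T_arr[OF p(1,4,2,5) f(1) g(1)] and 2 = T_arr[OF p(2,5,3,6) f(2) g(2)] and 3 = T_arr[OF p(1,4,3,6) c]
  show ?thesis
    by (rule chom_T_ext[OF 3(1) chom_comp[OF _ _ _ 1(1) 2(1)]])
      (auto intro!: precomod_T p simp: 1(2) 2(2) 3(2) chom_mp(4)[OF f(1)] chom_mp(4)[OF g(1)])
qed

lemma vten_add: "(u + v) \<otimes> w = u \<otimes> w + v \<otimes> w" "w \<otimes> (u + v) = w \<otimes> u + w \<otimes> v"
  using linvD(1)[OF vten_linv(1)] linvD(1)[OF vten_linv(2)] by auto

lemma T_add: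
  assumes f: "f \<in> chom H X X'" "f' \<in> chom H X X'" and g: "g \<in> chom H Y Y'"
    and X: "lcomod X" "lcomod X'" and Y: "lcomod Y" "lcomod Y'"
  shows "TA (cadd f f') g = cadd (TA f g) (TA f' g)"
    "TA g (cadd f f') = cadd (TA g f) (TA g f')"
proof -
  note p = X[THEN comod_precomod] Y[THEN comod_precomod]
  note a = chom_add(1)[OF p(1,2) f]
  note T = T_arr[OF p(1,3,2,4) _ g] T_arr[OF p(3,1,4,2) g]
  show "TA (cadd f f') g = cadd (TA f g) (TA f' g)"
    by (rule chom_T_ext[OF T(1)[OF a] chom_add(1)[OF precomod_T[OF p(1,3)] precomod_T[OF p(2,4)] T(1)[OF f(1)] T(1)[OF f(2)]]])
      (simp add: T(2)[OF a] T(2)[OF f(1)] T(2)[OF f(2)] vten_add)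
  show "TA g (cadd f f') = cadd (TA g f) (TA g f')"
    by (rule chom_T_ext[OF T(3)[OF a] chom_add(1)[OF precomod_T[OF p(3,1)] precomod_T[OF p(4,2)] T(3)[OF f(1)] T(3)[OF f(2)]]])
      (simp add: T(4)[OF a] T(4)[OF f(1)] T(4)[OF f(2)] vten_add)
qed

lemma T_smul:
  assumes f: "f \<in> chom H X X'" and g: "g \<in> chom H Y Y'"
    and X: "lcomod X" "lcomod X'" and Y: "lcomod Y" "lcomod Y'"
  shows "TA (csmul c f) g = csmul c (TA f g)"
    "TA g (csmul c f) = csmul c (TA g f)"
proof -
  note p = X[THEN comod_precomod] Y[THEN comod_precomod]
  note a = chom_smul(1)[OF p(1,2) f, of c]
  note T = T_arr[OF p(1,3,2,4) _ g] T_arr[OF p(3,1,4,2) g]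
  show "TA (csmul c f) g = csmul c (TA f g)"
    by (rule chom_T_ext[OF T(1)[OF a] chom_smul(1)[OF precomod_T[OF p(1,3)] precomod_T[OF p(2,4)] T(1)[OF f]]])
      (simp add: T(2)[OF a] T(2)[OF f] vten_scale)
  show "TA g (csmul c f) = csmul c (TA g f)"
    by (rule chom_T_ext[OF T(3)[OF a] chom_smul(1)[OF precomod_T[OF p(3,1)] precomod_T[OF p(4,2)] T(3)[OF f]]])
      (simp add: T(4)[OF a] T(4)[OF f] vten_scale)
qed

theorem braided_CC: "braided_monoidal_category CC"
proof -
  note c = comod_T comod_kline[OF grouplike_e]
  have mon: "monoidal_category CC"
    unfolding monoidal_category_def CC_simps mem_Collect_eq
    by (intro conjI ballI allI linear_CC c; (unfold mem_Collect_eq)?)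
      (assumption | rule T_arr(1) comod_precomod T_add T_smul T_id T_functor Asc_CC(3) monoidal_naturality_CC
        Lun_CC(3) Run_CC(3) unit_naturality_CC pentagon_CC triangle_CC)+
  show ?thesis
    unfolding braided_monoidal_category_def CC_simps
    by (intro conjI ballI mon; (unfold mem_Collect_eq)?)
      (assumption | rule Brd_CC(3) braid_naturality_CC hexagon1_CC hexagon2_CC)+
qed

end

section \<open>Cocentral gradings\<close>

lemma linv_lookup [lin]: "linv s V pscale f ==> linv s V (*) (\<lambda>x. Poly_Mapping.lookup (f x) a)"
  by (auto simp: linv_def lookup_add)

lemma lookup_gbas: "Poly_Mapping.lookup (gbas a) b = (if a = b then 1 else 0)"
  by (simp add: gbas_def lookup_single when_def)

lemma pscale_mult: "pscale c p * q = pscale c (p * q)" "p * pscale c q = pscale c (p * q)"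
  for p q :: "'g::ab_group_add \<Rightarrow>\<^sub>0 'k::field"
  by (simp_all add: pscale_def mult_map_scale_conv_mult mult.assoc mult.left_commute)

lemma gbas_mult: "gbas a * gbas b = gbas (a + b)"
  by (simp add: gbas_def mult_single)

lemma linv_lsum_functional:
  assumes "vector_space s1" "vector_space s2" "vector_space s3" "bilin s1 s2 s3 F"
    "lsum L (\<lambda>a b. tens s1 s2 (f a b) (g a b)) = lsum M (\<lambda>a b. tens s1 s2 (f' a b) (g' a b))"
  shows "lsum L (\<lambda>a b. F (f a b) (g a b)) = lsum M (\<lambda>a b. F (f' a b) (g' a b))"
  using tensor_universal[OF assms(4), of "map (\<lambda>(a, b). (f a b, g a b)) L" "map (\<lambda>(a, b). (f' a b, g' a b)) M"] assms(5)
  unfolding lsum_def[symmetric] lsum_map by simp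

lemma sum_fun_apply: "(\<Sum>i\<in>A. f i) x = (\<Sum>i\<in>A. f i x)" for f :: "'i => 'x => 'y::comm_monoid_add"
  by (induction A rule: infinite_finite_induct) auto

lemma linv_tscale_coeff [lin]: "linv s V (*) f ==> linv s V tscale (\<lambda>x. tscale (f x) T)"
  by (auto simp: linv_def tscale_def algebra_simps fun_eq_iff)

locale graded =
  fixes H :: "('k::field, 'h::ring_1) coalg" and S :: "'h => 'h"
    and \<pi> :: "'h => ('g::ab_group_add \<Rightarrow>\<^sub>0 'k)"
  assumes hopf: "hopf_algebra H S" and map: "hopf_map_to_galg H \<pi>" and cocentral: "cocentral H \<pi>"
begin

abbreviation Hd :: "'g => 'h set" where "Hd == hdeg H \<pi>"
abbreviation Cd :: "('k, 'h, 'u) comod => 'g => ('k, 'u) vec set" where "Cd == cdeg H \<pi>"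

sublocale coalg_mult H "(*)"
  by unfold_locales (use hopf in \<open>auto simp: hopf_algebra_def\<close>)

lemma grouplike_1: "grouplike H 1" and linear_S: "Vector_Spaces.linear scH scH S"
  and antipode: "sw2 H h (\<lambda>h1 h2. S h1 * h2) = scH (eps h) 1" "sw2 H h (\<lambda>h1 h2. h1 * S h2) = scH (eps h) 1"
  using hopf by (auto simp: hopf_algebra_def)

lemmas lin_S [lin] = lin_app[OF linear_S]

lemma linear_\<pi>: "Vector_Spaces.linear scH pscale \<pi>" and \<pi>_mult: "\<pi> (h * k) = \<pi> h * \<pi> k" and \<pi>_1: "\<pi> 1 = 1"
  using map by (auto simp: hopf_map_to_galg_def)

lemmas lin_\<pi> [lin] = lin_app[OF linear_\<pi>]

text \<open>These forms are orthogonal idempotents of the convolution algebra dual to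
  \<open>H\<close>, and on each element finitely many of them sum to the counit. Cocentrality of
  \<pi> makes them central.\<close>

definition \<delta> where "\<delta> a h = Poly_Mapping.lookup (\<pi> h) a"

lemma lin_\<delta> [lin]: "linv s V scH f ==> linv s V (*) (\<lambda>x. \<delta> a (f x))"
  unfolding \<delta>_def by (intro lin)

text \<open>The compatibility of \<pi> with coproducts is an equation of functionals; it is
  evaluated at the bilinear form reading the coordinates a and b. Off-diagonal coordinates vanish
  because group elements are group-like.\<close>

lemma \<delta>_comul: "sw2 H h (\<lambda>h1 h2. \<delta> a h1 * \<delta> b h2) = (if a = b then \<delta> a h else 0)"
proof -
  let ?\<beta> = "\<lambda>p q :: 'g \<Rightarrow>\<^sub>0 'k. Poly_Mapping.lookup p a * Poly_Mapping.lookup q b"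
  have b: "bilin pscale pscale (*) ?\<beta>"
    by (rule bilinI) (auto intro!: lin)
  have "comul galg (\<pi> h) ?\<beta> = sw2 H h (\<lambda>h1 h2. tens2 galg (\<pi> h1) (\<pi> h2)) ?\<beta>"
    using map by (simp add: hopf_map_to_galg_def)
  also have "... = sw2 H h (\<lambda>h1 h2. \<delta> a h1 * \<delta> b h2)"
    using b by (simp add: sw2_lsum lsum_def sum_list_fun_apply tens2_def tens_def galg_def \<delta>_def case_prod_unfold)
  also have "comul galg (\<pi> h) ?\<beta> = (if a = b then \<delta> a h else 0)"
    using b by (auto simp: galg_def tens_def tscale_def sum_fun_apply lookup_gbas \<delta>_def in_keys_iff
        if_distrib[of "\<lambda>x. _ * x"] if_distrib[of "\<lambda>x. x * _"] cong: if_cong)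
  finally show ?thesis by simp
qed

lemma \<delta>_counit: "finite A ==> Poly_Mapping.keys (\<pi> h) \<subseteq> A ==> (\<Sum>a\<in>A. \<delta> a h) = eps h"
proof -
  assume A: "finite A" "Poly_Mapping.keys (\<pi> h) \<subseteq> A"
  have "cou galg (\<pi> h) = eps h" using map by (simp add: hopf_map_to_galg_def)
  moreover have "(\<Sum>a\<in>Poly_Mapping.keys (\<pi> h). \<delta> a h) = (\<Sum>a\<in>A. \<delta> a h)"
    using A by (intro sum.mono_neutral_left) (auto simp: \<delta>_def in_keys_iff)
  ultimately show ?thesis by (simp add: galg_def \<delta>_def)
qed

text \<open>The projection onto the component of degree \<open>a\<close>: the idempotent
  \<open>\<delta> a\<close> acting on \<open>H\<close> through the coproduct.\<close>

definition P where "P a h = sw2 H h (\<lambda>h1 h2. scH (\<delta> a h1) h2)"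

lemma lin_P [lin]: "linv s V scH f ==> linv s V scH (\<lambda>x. P a (f x))"
  unfolding P_def by (auto intro!: lin)

lemma linear_P: "Vector_Spaces.linear scH scH (P a)"
  using lin_P[OF linv_id, of UNIV a] by (simp add: linear_iff_linv)

text \<open>Cocentrality, read at the coordinate \<open>a\<close> of the group algebra
  factor.\<close>

lemma P_right: "P a h = sw2 H h (\<lambda>h1 h2. scH (\<delta> a h2) h1)"
proof -
  have "sw2 H h (\<lambda>h1 h2. tens scH pscale h1 (\<pi> h2)) = sw2 H h (\<lambda>h1 h2. tens scH pscale h2 (\<pi> h1))"
    using cocentral by (simp add: cocentral_def)
  then show ?thesis
    unfolding P_def \<delta>_def sw2_lsum
    by (intro linv_lsum_functional[symmetric, of scH pscale scH "\<lambda>x p. scH (Poly_Mapping.lookup p a) x"] bilinI)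
      (auto intro!: lin)
qed

text \<open>By coassociativity the composite is the action of the convolution product of two of the
  idempotents \<open>\<delta>\<close>.\<close>

lemma P_P: "P a (P b h) = (if a = b then P a h else 0)"
proof -
  have "P a (P b h) = sw2 H h (\<lambda>x h2. scH (\<delta> b x) (P a h2))"
    unfolding P_def[of b] sw2_linear[OF linear_P]
    using linear_P[of a] by (simp add: linear_iff_linv linv_def)
  also have "... = sw2 H h (\<lambda>x y. sw2 H y (\<lambda>y1 y2. scH (\<delta> b x * \<delta> a y1) y2))"
    unfolding P_def by (simp add: sw2_scale[OF vsH] vs_rules(3)[OF vsH])
  also have "... = sw2 H h (\<lambda>x y. sw2 H x (\<lambda>x1 x2. scH (\<delta> b x1 * \<delta> a x2) y))"
    by (rule sw2_coassoc[symmetric]) (auto intro!: lin)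
  also have "... = sw2 H h (\<lambda>x y. scH (if a = b then \<delta> a x else 0) y)"
    by (subst sw2_coeff[OF vsH, symmetric], subst \<delta>_comul) (auto intro!: sw2_cong)
  finally show ?thesis by (auto simp: P_def vs_rules)
qed

text \<open>In a representation of the coproduct of \<open>h\<close>, the images of the finitely
  many first entries under \<pi> involve only finitely many group elements. Over these the forms
  \<open>\<delta> a\<close> sum to the counit, which returns \<open>h\<close>.\<close>

lemma P_finite: 
  obtains A where "finite A" "\<And>a. a \<notin> A ==> P a h = 0" "(\<Sum>a\<in>A. P a h) = h"
proof -
  define A where "A = (\<Union>(x, y)\<in>set (dlist h). Poly_Mapping.keys (\<pi> x))"
  have fin: "finite A" by (auto simp: A_def)
  have sub: "Poly_Mapping.keys (\<pi> x) \<subseteq> A" if "(x, y) \<in> set (dlist h)" for x y using that by (auto simp: A_def)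
  have "P a h = 0" if "a \<notin> A" for a
  proof -
    have "P a h = lsum (dlist h) (\<lambda>x y. 0)"
      unfolding P_def sw2_lsum
    proof (rule lsum_cong)
      fix x y assume "(x, y) \<in> set (dlist h)"
      then have "\<delta> a x = 0" using sub that unfolding \<delta>_def by (meson in_keys_iff subsetD)
      then show "scH (\<delta> a x) y = 0" by (simp add: vs_rules(6)[OF vsH])
    qed
    then show ?thesis by simp
  qed
  moreover have "(\<Sum>a\<in>A. P a h) = h"
  proof -
    have ls: "(\<Sum>a\<in>A. lsum L (\<lambda>x y. F a x y)) = lsum L (\<lambda>x y. \<Sum>a\<in>A. F a x y)" for L and F :: "'g => 'h => 'h => 'h"
      by (induction L) (auto simp: sum.distrib)
    have "scH (\<Sum>a\<in>A. f a) y = (\<Sum>a\<in>A. scH (f a) y)" for f y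
      using fin by (induction A) (auto simp: vs_rules)
    then have "(\<Sum>a\<in>A. scH (\<delta> a x) y) = scH (eps x) y" if "(x, y) \<in> set (dlist h)" for x y
      using \<delta>_counit[OF fin sub[OF that]] by metis
    then have "(\<Sum>a\<in>A. P a h) = lsum (dlist h) (\<lambda>x y. scH (eps x) y)"
      unfolding P_def sw2_lsum ls by (intro lsum_cong)
    also have "... = h" using sw2_counit(1)[OF linv_id vsH] by (simp add: sw2_lsum)
    finally show ?thesis .
  qed
  ultimately show ?thesis using fin by (intro that)
qed

lemma hdeg_sw:
  assumes "h \<in> Hd a" "bilin pscale scH s F"
  shows "sw2 H h (\<lambda>x y. F (\<pi> x) y) = F (gbas a) h"
  unfolding sw2_lsum using assms linv_lsum_functional[of pscale scH s F "dlist h" "\<lambda>x y. \<pi> x" "\<lambda>x y. y" "[(h, h)]" "\<lambda>x y. gbas a" "\<lambda>x y. h"]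
  by (auto simp: hdeg_def sw2_lsum bilin_iff_linv)

lemma \<delta>_\<pi>: "sw2 H u (\<lambda>x y. pscale (\<delta> a x) (\<pi> y)) = pscale (\<delta> a u) (gbas a)"
proof (rule poly_mapping_eqI)
  fix b
  have "Vector_Spaces.linear pscale (*) (\<lambda>p :: 'g \<Rightarrow>\<^sub>0 'k. Poly_Mapping.lookup p b)"
    by (auto simp: linear_iff_linv linv_def lookup_add)
  from sw2_linear[OF this]
  show "Poly_Mapping.lookup (sw2 H u (\<lambda>x y. pscale (\<delta> a x) (\<pi> y))) b = Poly_Mapping.lookup (pscale (\<delta> a u) (gbas a)) b"
    by (simp add: \<delta>_comul lookup_gbas flip: \<delta>_def)
qed

text \<open>Homogeneity is defined by an equation of tensors and becomes a fixed-point equation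
  here. For the converse the coproduct of \<open>P a h\<close> is expanded by coassociativity, and
  \<open>\<delta>_\<pi>\<close> collapses its first factor to \<open>gbas a\<close>.\<close>

lemma hdeg_P: "h \<in> Hd a \<longleftrightarrow> P a h = h"
proof
  have b: "bilin pscale scH scH (\<lambda>p x. scH (Poly_Mapping.lookup p a) x)"
    by (rule bilinI) (auto intro!: lin)
  assume "h \<in> Hd a"
  then show "P a h = h"
    using hdeg_sw[of h a scH "\<lambda>p x. scH (Poly_Mapping.lookup p a) x"] b
    by (simp add: P_def \<delta>_def lookup_gbas vs_rules(4)[OF vsH])
next
  assume h: "P a h = h"
  have l: "linv scH UNIV tscale (\<lambda>h. sw2 H h (\<lambda>x y. tens pscale scH (\<pi> x) y))"
    by (auto intro!: lin)
  have ts: "tscale c (tens pscale scH x y) = tens pscale scH (pscale c x) y" "tscale c (tens pscale scH x y) = tens pscale scH x (scH c y)"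
    for c and x :: "'g \<Rightarrow>\<^sub>0 'k" and y
    using linvD(2)[OF tens_bilin(1)[OF vsP vsH], of x]
      linvD(2)[OF tens_bilin(2)[OF vsP vsH, of x], of y] by simp_all
  have tl: "Vector_Spaces.linear pscale tscale (\<lambda>p. tens pscale scH (p :: 'g \<Rightarrow>\<^sub>0 'k) y)" 
    "Vector_Spaces.linear scH tscale (tens pscale scH (x :: 'g \<Rightarrow>\<^sub>0 'k))" for x y
    by (auto simp: linear_iff_linv intro!: tens_bilin)
  have "sw2 H (P a h) (\<lambda>x y. tens pscale scH (\<pi> x) y) = sw2 H h (\<lambda>u v. tscale (\<delta> a u) (sw2 H v (\<lambda>x y. tens pscale scH (\<pi> x) y)))"
    unfolding P_def
    using sw2_linear[of scH tscale "\<lambda>h. sw2 H h (\<lambda>x y. tens pscale scH (\<pi> x) y)"] l linvD(2)[OF l]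
    by (simp add: linear_iff_linv)
  also have "... = sw2 H h (\<lambda>u v. sw2 H v (\<lambda>x y. tens pscale scH (pscale (\<delta> a u) (\<pi> x)) y))"
    by (simp add: sw2_scale ts(1))
  also have "... = sw2 H h (\<lambda>u v. sw2 H u (\<lambda>u1 u2. tens pscale scH (pscale (\<delta> a u1) (\<pi> u2)) v))"
    by (rule sw2_coassoc[symmetric, OF vsT]) (auto intro!: lin)
  also have "... = sw2 H h (\<lambda>u v. tens pscale scH (gbas a) (scH (\<delta> a u) v))"
    by (simp only: sw2_linear[OF tl(1), symmetric] \<delta>_\<pi>) (simp flip: ts)
  also have "... = tens pscale scH (gbas a) (P a h)"
    unfolding P_def by (rule sw2_linear[OF tl(2), symmetric])
  finally show "h \<in> Hd a" by (simp add: hdeg_def h)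
qed

lemma P_in: "P a h \<in> Hd a"
  by (simp add: hdeg_P P_P)

lemma P_hdeg: "h \<in> Hd a ==> P b h = (if a = b then h else 0)"
  using P_P[of b a h] by (auto simp: hdeg_P)

lemma hdeg_subspace: "module.subspace scH (Hd a)"
  using lin_P[OF linv_id, of UNIV a] linv_0[OF lin_P[OF linv_id] vsH vsH subspace_UNIV'[OF vsH], of a]
  by (intro subspaceI) (auto simp: hdeg_P linv_def)

lemma hdeg_ext:
  assumes "linv scH UNIV s f" "linv scH UNIV s g" "vector_space s"
    "\<And>a h. h \<in> Hd a ==> f h = g h"
  shows "f h = g h"
proof -
  obtain A where "finite A" "(\<Sum>a\<in>A. P a h) = h" using P_finite by metis
  then have "f h = (\<Sum>a\<in>A. f (P a h))" "g h = (\<Sum>a\<in>A. g (P a h))"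
    using linv_sum[OF assms(1) vsH assms(3), of "\<lambda>a. P a h" A] linv_sum[OF assms(2) vsH assms(3), of "\<lambda>a. P a h" A] by auto
  then show ?thesis using assms(4)[OF P_in] by simp
qed

lemma comul_sw2: "sw2 H x (\<lambda>x1 x2. tens scH scH x1 x2) = comul H x"
  unfolding sw2_lsum by (rule comul_eq[symmetric])

text \<open>With its mirror image this makes each homogeneous component a subcoalgebra. Writing the
  projection by \<open>P_right\<close> puts \<open>\<delta> a\<close> at the outer end of the
  iterated coproduct, and coassociativity pulls the projection back to \<open>h\<close>.\<close>

lemma comul_P_right: 
  assumes "h \<in> Hd a" 
  shows "comul H h = sw2 H h (\<lambda>x y. tens scH scH x (P a y))"
proof -
  have tl: "Vector_Spaces.linear scH tscale (tens scH scH x)" for x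
    by (auto simp: linear_iff_linv intro!: tens_bilin)
  have ts: "tens scH scH x (scH c y) = tscale c (tens scH scH x y)" for c x y
    using linvD(2)[OF tens_bilin(2)[OF vsH vsH], of y] by auto
  have "sw2 H h (\<lambda>x y. tens scH scH x (P a y)) = sw2 H h (\<lambda>x y. sw2 H y (\<lambda>y1 y2. tscale (\<delta> a y2) (tens scH scH x y1)))"
    unfolding P_right sw2_linear[OF tl] ts ..
  also have "... = sw2 H h (\<lambda>x y. sw2 H x (\<lambda>x1 x2. tscale (\<delta> a y) (tens scH scH x1 x2)))"
    by (rule sw2_coassoc[symmetric, OF vsT]) (auto intro!: lin)
  also have "... = sw2 H h (\<lambda>x y. tscale (\<delta> a y) (comul H x))"
    by (simp only: sw2_scale[OF vsT, symmetric] comul_sw2)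
  also have "... = comul H (P a h)"
    unfolding P_right sw2_linear[OF lin_comul] using lin_comul by (simp add: linear_iff_linv linv_def)
  finally show ?thesis using assms by (simp add: hdeg_P)
qed

lemma comul_P_left: 
  assumes "h \<in> Hd a" 
  shows "comul H h = sw2 H h (\<lambda>x y. tens scH scH (P a x) y)"
proof -
  have tl: "Vector_Spaces.linear scH tscale (\<lambda>x. tens scH scH x y)" for y
    by (auto simp: linear_iff_linv intro!: tens_bilin)
  have ts: "tens scH scH (scH c x) y = tscale c (tens scH scH x y)" for c x y
    using linvD(2)[OF tens_bilin(1)[OF vsH vsH], of x] by auto
  have "sw2 H h (\<lambda>x y. tens scH scH (P a x) y) = sw2 H h (\<lambda>x y. sw2 H x (\<lambda>x1 x2. tscale (\<delta> a x1) (tens scH scH x2 y)))"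
    unfolding P_def sw2_linear[OF tl] ts ..
  also have "... = sw2 H h (\<lambda>x y. sw2 H y (\<lambda>y1 y2. tscale (\<delta> a x) (tens scH scH y1 y2)))"
    by (rule sw2_coassoc[OF vsT]) (auto intro!: lin)
  also have "... = sw2 H h (\<lambda>x y. tscale (\<delta> a x) (comul H y))"
    by (simp only: sw2_scale[OF vsT, symmetric] comul_sw2)
  also have "... = comul H (P a h)"
    unfolding P_def sw2_linear[OF lin_comul] using lin_comul by (simp add: linear_iff_linv linv_def)
  finally show ?thesis using assms by (simp add: hdeg_P)
qed

lemma sw2_P:
  assumes "h \<in> Hd a" "vector_space s" "\<And>b. linv scH UNIV s (\<lambda>a. F a b)" "\<And>a. linv scH UNIV s (\<lambda>b. F a b)"
  shows "sw2 H h F = sw2 H h (\<lambda>x y. F (P a x) (P a y))"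
proof -
  have r: "sw2 H h F = sw2 H h (\<lambda>x y. F x (P a y))" if "\<And>b. linv scH UNIV s (\<lambda>a. F a b)" "\<And>a. linv scH UNIV s (\<lambda>b. F a b)" for F
  proof -
    have "sw2 H h F = lsum (map (\<lambda>(x, y). (x, P a y)) (dlist h)) F"
      by (rule sw2_eqI[OF _ assms(2) that], unfold lsum_map) (rule comul_P_right[OF assms(1), unfolded sw2_lsum])
    then show ?thesis by (simp add: lsum_map sw2_lsum)
  qed
  have l: "sw2 H h F = sw2 H h (\<lambda>x y. F (P a x) y)" if "\<And>b. linv scH UNIV s (\<lambda>a. F a b)" "\<And>a. linv scH UNIV s (\<lambda>b. F a b)" for F
  proof -
    have "sw2 H h F = lsum (map (\<lambda>(x, y). (P a x, y)) (dlist h)) F"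
      by (rule sw2_eqI[OF _ assms(2) that], unfold lsum_map) (rule comul_P_left[OF assms(1), unfolded sw2_lsum])
    then show ?thesis by (simp add: lsum_map sw2_lsum)
  qed
  have "sw2 H h F = sw2 H h (\<lambda>x y. F x (P a y))" using assms by (intro r)
  also have "... = sw2 H h (\<lambda>x y. F (P a x) (P a y))"
    by (rule l) (auto intro!: assms linv_comp[OF assms(4)] lin)
  finally show ?thesis .
qed

text \<open>Both coproduct factors of an element of degree a may be taken of degree a. Under this
  rule the zested structure maps can be replaced by their homogeneous formulas inside Sweedler
  sums.\<close>

lemma sw2_hom_cong:
  assumes "h \<in> Hd a" "vector_space s" "\<And>b. linv scH UNIV s (\<lambda>a. F a b)" "\<And>a. linv scH UNIV s (\<lambda>b. F a b)"
    "\<And>b. linv scH UNIV s (\<lambda>a. G a b)" "\<And>a. linv scH UNIV s (\<lambda>b. G a b)"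
    "\<And>x y. x \<in> Hd a ==> y \<in> Hd a ==> F x y = G x y"
  shows "sw2 H h F = sw2 H h G"
  using sw2_P[OF assms(1-4)] sw2_P[OF assms(1,2,5,6)] assms(7)[OF P_in P_in] by simp

lemma S2_hom_cong:
  assumes "h \<in> Hd a" "k \<in> Hd b" "vector_space s"
    and F: "\<And>x y z. linv scH UNIV s (\<lambda>w. F w x y z)" "\<And>x y z. linv scH UNIV s (\<lambda>w. F x w y z)"
      "\<And>x y z. linv scH UNIV s (\<lambda>w. F x y w z)" "\<And>x y z. linv scH UNIV s (\<lambda>w. F x y z w)"
    and G: "\<And>x y z. linv scH UNIV s (\<lambda>w. G w x y z)" "\<And>x y z. linv scH UNIV s (\<lambda>w. G x w y z)"
      "\<And>x y z. linv scH UNIV s (\<lambda>w. G x y w z)" "\<And>x y z. linv scH UNIV s (\<lambda>w. G x y z w)"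
    and eq: "\<And>x y z w. x \<in> Hd a ==> y \<in> Hd b ==> z \<in> Hd a ==> w \<in> Hd b ==>
       F x y z w = G x y z w"
  shows "S2 h k F = S2 h k G"
  unfolding S2_def
  by (rule sw2_hom_cong[OF assms(1,3)]; (rule sw2_hom_cong[OF assms(2,3)])?)
    (auto intro!: linv_sw2 assms(3) F G eq)

lemma S3_hom_cong:
  assumes "h \<in> Hd a" "k \<in> Hd b" "l \<in> Hd c" "vector_space s"
    and F: "\<And>x y z u v. linv scH UNIV s (\<lambda>w. F w x y z u v)" "\<And>x y z u v. linv scH UNIV s (\<lambda>w. F x w y z u v)"
      "\<And>x y z u v. linv scH UNIV s (\<lambda>w. F x y w z u v)" "\<And>x y z u v. linv scH UNIV s (\<lambda>w. F x y z w u v)"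
      "\<And>x y z u v. linv scH UNIV s (\<lambda>w. F x y z u w v)" "\<And>x y z u v. linv scH UNIV s (\<lambda>w. F x y z u v w)"
    and G: "\<And>x y z u v. linv scH UNIV s (\<lambda>w. G w x y z u v)" "\<And>x y z u v. linv scH UNIV s (\<lambda>w. G x w y z u v)"
      "\<And>x y z u v. linv scH UNIV s (\<lambda>w. G x y w z u v)" "\<And>x y z u v. linv scH UNIV s (\<lambda>w. G x y z w u v)"
      "\<And>x y z u v. linv scH UNIV s (\<lambda>w. G x y z u w v)" "\<And>x y z u v. linv scH UNIV s (\<lambda>w. G x y z u v w)"
    and eq: "\<And>x y z x' y' z'. x \<in> Hd a ==> y \<in> Hd b ==> z \<in> Hd c ==>
       x' \<in> Hd a ==> y' \<in> Hd b ==> z' \<in> Hd c ==> F x y z x' y' z' = G x y z x' y' z'"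
  shows "S3 h k l F = S3 h k l G"
  unfolding S3_def
  by (rule sw2_hom_cong[OF assms(1,4)]; (rule sw2_hom_cong[OF assms(2,4)]; (rule sw2_hom_cong[OF assms(3,4)])?)?)
    (auto intro!: linv_sw2 assms(4) F G eq)

lemma conv3_hom:
  assumes "h \<in> Hd a" "k \<in> Hd b" "l \<in> Hd c"
    and t: "tform p" "tform q" "tform p'" "tform q'"
    and eq: "\<And>h k l. h \<in> Hd a ==> k \<in> Hd b ==> l \<in> Hd c ==> p h k l = p' h k l"
      "\<And>h k l. h \<in> Hd a ==> k \<in> Hd b ==> l \<in> Hd c ==> q h k l = q' h k l"
  shows "conv3 H p q h k l = conv3 H p' q' h k l"
  unfolding conv3_S3
  by (rule S3_hom_cong[OF assms(1-3) vsF])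
    (auto simp: eq intro!: lin lin_app3[OF t(1)] lin_app3[OF t(2)] lin_app3[OF t(3)] lin_app3[OF t(4)])

lemma conv2_hom:
  assumes "h \<in> Hd a" "k \<in> Hd b"
    and t: "bform p" "bform q" "bform p'" "bform q'"
    and eq: "\<And>h k. h \<in> Hd a ==> k \<in> Hd b ==> p h k = p' h k"
      "\<And>h k. h \<in> Hd a ==> k \<in> Hd b ==> q h k = q' h k"
  shows "conv2 H p q h k = conv2 H p' q' h k"
  unfolding conv2_S2
  by (rule S2_hom_cong[OF assms(1-2) vsF])
    (auto simp: eq intro!: lin lin_app2[OF t(1)] lin_app2[OF t(2)] lin_app2[OF t(3)] lin_app2[OF t(4)])

text \<open>Assembles a family of linear maps, \<open>F a\<close> being used in degree a, into one
  map on \<open>H\<close>; the sum is finite by \<open>P_finite\<close>. It supplies the witnesses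
  for the definite descriptions of the zested structure.\<close>

definition glue where
  "glue F h = (\<Sum>a | P a h \<noteq> 0. F a (P a h))"

lemma glue_super:
  assumes "\<And>a. linv scH UNIV s (F a)" "vector_space s" "finite A" "\<And>a. a \<notin> A ==> P a h = 0"
  shows "glue F h = (\<Sum>a\<in>A. F a (P a h))"
  unfolding glue_def
  by (rule sum.mono_neutral_left) (use assms linv_0[OF assms(1) vsH assms(2)] in auto)

lemma linv_glue:
  assumes "\<And>a. linv scH UNIV s (F a)" "vector_space s"
  shows "linv scH UNIV s (glue F)"
  unfolding linv_def
proof (intro conjI ballI allI)
  have P: "P a (x + y) = P a x + P a y" "P a (scH c x) = scH c (P a x)" for a x y c
    using lin_P[OF linv_id, of UNIV a] by (auto simp: linv_def)
  fix x y :: 'h and c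
  obtain A where A: "finite A" "\<And>a. a \<notin> A ==> P a x = 0" using P_finite by metis
  obtain B where B: "finite B" "\<And>a. a \<notin> B ==> P a y = 0" using P_finite by metis
  have F: "F a (u + v) = F a u + F a v" "F a (scH c u) = s c (F a u)" for a u v c
    using assms(1)[of a] by (auto simp: linv_def)
  have g: "glue F z = (\<Sum>a\<in>A \<union> B. F a (P a z))" if "\<And>a. a \<notin> A \<union> B ==> P a z = 0" for z
    using A(1) B(1) that by (intro glue_super[OF assms]) auto
  show "glue F (x + y) = glue F x + glue F y"
  proof -
    have "P a (x + y) = 0" if "a \<notin> A \<union> B" for a using that A(2) B(2) by (simp add: P)
    then have "glue F (x + y) = (\<Sum>a\<in>A \<union> B. F a (P a (x + y)))" by (rule g)
    moreover have "glue F x = (\<Sum>a\<in>A \<union> B. F a (P a x))" "glue F y = (\<Sum>a\<in>A \<union> B. F a (P a y))"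
      using A(2) B(2) by (intro g; simp)+
    ultimately show ?thesis by (simp add: P F sum.distrib)
  qed
  show "glue F (scH c x) = s c (glue F x)"
    using A linv_sum[OF linv_const_scale[OF linv_id assms(2)] assms(2,2), of c "\<lambda>a. F a (P a x)" A]
    by (simp add: glue_super[OF assms, of A] P F vs_rules(5)[OF vsH])
qed

lemma glue_hdeg:
  assumes "\<And>a. linv scH UNIV s (F a)" "vector_space s" "h \<in> Hd a"
  shows "glue F h = F a h"
  using glue_super[OF assms(1,2), of "{a}" h] P_hdeg[OF assms(3)] by simp

lemma linv_glue_param:
  assumes "\<And>a x. linv s1 V s2 (\<lambda>v. F v a x)" "vector_space s2"
  shows "linv s1 V s2 (\<lambda>v. glue (F v) h)"
proof -
  have "linv s1 V s2 (\<lambda>v. \<Sum>a\<in>A. F v a (P a h))" for A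
    by (induction A rule: infinite_finite_induct)
      (use assms in \<open>auto simp: linv_def vs_rules\<close>)
  then show ?thesis by (simp add: glue_def)
qed

section \<open>Products, antipode and extensionality in the grading\<close>

lemma hdeg_mult:
  assumes "h \<in> Hd a" "k \<in> Hd b"
  shows "h * k \<in> Hd (a + b)"
proof -
  have l: "linv s V pscale f ==> linv s V pscale (\<lambda>x. f x * q)" "linv s V pscale f ==> linv s V pscale (\<lambda>x. q * f x)"
    for s V q and f :: "'h => 'g \<Rightarrow>\<^sub>0 'k"
    by (auto simp: linv_def pscale_mult algebra_simps)
  have l': "linv pscale UNIV pscale (\<lambda>x. x * q)" "linv pscale UNIV pscale (\<lambda>x. q * x)" for q :: "'g \<Rightarrow>\<^sub>0 'k"
    by (auto simp: linv_def pscale_mult algebra_simps)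
  have "sw2 H (h * k) (\<lambda>x y. tens pscale scH (\<pi> x) y) =
    sw2 H h (\<lambda>h1 h2. sw2 H k (\<lambda>k1 k2. tens pscale scH (\<pi> h1 * \<pi> k1) (h2 * k2)))"
    by (subst sw2_m[OF vsT]) (auto simp: S2_def \<pi>_mult intro!: lin)
  also have "... = sw2 H h (\<lambda>h1 h2. tens pscale scH (\<pi> h1 * gbas b) (h2 * k))"
  proof (rule sw2_cong)
    fix h1 h2
    show "sw2 H k (\<lambda>k1 k2. tens pscale scH (\<pi> h1 * \<pi> k1) (h2 * k2)) = tens pscale scH (\<pi> h1 * gbas b) (h2 * k)"
      by (rule hdeg_sw[OF assms(2), where F = "\<lambda>p x. tens pscale scH (\<pi> h1 * p) (h2 * x)" and s = tscale])
        (rule bilinI; auto intro!: lin l')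
  qed
  also have "... = tens pscale scH (gbas a * gbas b) (h * k)"
    by (rule hdeg_sw[OF assms(1), where F = "\<lambda>p x. tens pscale scH (p * gbas b) (x * k)" and s = tscale])
      (rule bilinI; auto intro!: lin l')
  finally show ?thesis by (simp add: hdeg_def gbas_mult)
qed

lemma hdeg_1: "1 \<in> Hd 0"
  by (simp add: hdeg_def sw2_grouplike[OF grouplike_1 vsT] lin \<pi>_1 gbas_def)

lemma hdeg_scale: "h \<in> Hd a ==> scH c h \<in> Hd a"
  using subspaceD(3)[OF vsH hdeg_subspace] .

lemma scH_mult: "scH c x * y = scH c (x * y)" "x * scH c y = scH c (x * y)"
  using lin_m[OF linv_id, of UNIV] by (auto simp: linv_def)

lemma P_mult_right:
  assumes "y \<in> Hd a"
  shows "P b (x * y) = P (b - a) x * y"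
  by (rule hdeg_ext[where f = "\<lambda>x. P b (x * y)" and g = "\<lambda>x. P (b - a) x * y", OF _ _ vsH])
    (auto intro!: lin simp: P_hdeg[OF hdeg_mult[OF _ assms]] P_hdeg algebra_simps)

lemma P_mult_left:
  assumes "x \<in> Hd a"
  shows "P b (x * y) = x * P (b - a) y"
  by (rule hdeg_ext[where f = "\<lambda>y. P b (x * y)" and g = "\<lambda>y. x * P (b - a) y", OF _ _ vsH])
    (auto intro!: lin simp: P_hdeg[OF hdeg_mult[OF assms]] P_hdeg algebra_simps)

text \<open>The antipode axiom takes values in degree 0. Applying \<open>P 0\<close> to it, where
  the other factor has degree a, keeps exactly the component of degree -a of the antipode.\<close>

lemma antipode_hom:
  assumes "h \<in> Hd a"
  shows "sw2 H h (\<lambda>h1 h2. P (- a) (S h1) * h2) = scH (eps h) 1" "sw2 H h (\<lambda>h1 h2. h1 * P (- a) (S h2)) = scH (eps h) 1"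
proof -
  have P1: "P 0 (scH (eps h) 1) = scH (eps h) 1"
    using hdeg_scale[OF hdeg_1] by (simp add: hdeg_P)
  have "sw2 H h (\<lambda>h1 h2. P (- a) (S h1) * h2) = sw2 H h (\<lambda>h1 h2. P 0 (S h1 * h2))"
    by (rule sw2_hom_cong[OF assms vsH]) (auto intro!: lin simp: P_mult_right)
  also have "... = scH (eps h) 1"
    unfolding sw2_linear[OF linear_P, symmetric] antipode P1 ..
  finally show "sw2 H h (\<lambda>h1 h2. P (- a) (S h1) * h2) = scH (eps h) 1" .
  have "sw2 H h (\<lambda>h1 h2. h1 * P (- a) (S h2)) = sw2 H h (\<lambda>h1 h2. P 0 (h1 * S h2))"
    by (rule sw2_hom_cong[OF assms vsH]) (auto intro!: lin simp: P_mult_left)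
  also have "... = scH (eps h) 1"
    unfolding sw2_linear[OF linear_P, symmetric] antipode P1 ..
  finally show "sw2 H h (\<lambda>h1 h2. h1 * P (- a) (S h2)) = scH (eps h) 1" .
qed

lemma tform_hom_ext:
  assumes "tform p" "tform q" "\<And>a b c h k l. h \<in> Hd a ==> k \<in> Hd b ==> l \<in> Hd c ==> p h k l = q h k l"
  shows "p = q"
proof (intro ext)
  fix h k l
  note l = lin_app3[OF assms(1) linv_id] lin_app3[OF assms(2) linv_id]
  have 1: "p h k l = q h k l" if "h \<in> Hd a" "k \<in> Hd b" for a b h k l
    by (rule hdeg_ext[OF l(3,6) vsF]) (rule assms(3)[OF that])
  have 2: "p h k l = q h k l" if "h \<in> Hd a" for a h k l
    by (rule hdeg_ext[OF l(2,5) vsF]) (rule 1[OF that])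
  show "p h k l = q h k l"
    by (rule hdeg_ext[OF l(1,4) vsF]) (rule 2)
qed

lemma bilin_hom_ext:
  assumes "bilin scH scH s p" "bilin scH scH s q"
    "\<And>a b h k. h \<in> Hd a ==> k \<in> Hd b ==> p h k = q h k"
  shows "p = q"
proof (intro ext)
  fix h k
  have vs: "vector_space s" using assms(1) by (simp add: bilin_iff_linv)
  note l = lin_app2[OF assms(1) linv_id] lin_app2[OF assms(2) linv_id]
  have 2: "p h k = q h k" if "h \<in> Hd a" for a h k
    by (rule hdeg_ext[OF l(2,4) vs]) (rule assms(3)[OF that])
  show "p h k = q h k"
    by (rule hdeg_ext[OF l(1,3) vs]) (rule 2)
qed

lemma glue2:
  assumes "\<And>a b. bilin scH scH s (F a b)" "vector_space s"
  defines "G \<equiv> \<lambda>h k. glue (\<lambda>a h. glue (\<lambda>b k. F a b h k) k) h"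
  shows "bilin scH scH s G" "\<And>a b h k. h \<in> Hd a ==> k \<in> Hd b ==> G h k = F a b h k"
proof -
  note F = lin_app2[OF assms(1) linv_id]
  show "bilin scH scH s G" unfolding G_def
    by (rule bilinI) (auto intro!: linv_glue linv_glue_param F assms(2))
  show "G h k = F a b h k" if "h \<in> Hd a" "k \<in> Hd b" for a b h k
    unfolding G_def
    by (subst glue_hdeg[OF _ assms(2) that(1)], intro linv_glue_param F assms(2))
      (rule glue_hdeg[OF _ assms(2) that(2)], rule F)
qed

lemma glue3:
  assumes "\<And>a b c. tform (F a b c)"
  defines "G \<equiv> \<lambda>h k l. glue (\<lambda>a h. glue (\<lambda>b k. glue (\<lambda>c l. F a b c h k l) l) k) h"
  shows "tform G"
    "\<And>a b c h k l. h \<in> Hd a ==> k \<in> Hd b ==> l \<in> Hd c ==> G h k l = F a b c h k l"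
proof -
  note F = lin_app3[OF assms(1) linv_id]
  show "tform G" unfolding G_def
    by (rule trilinI) (auto intro!: linv_glue linv_glue_param F)
  show "G h k l = F a b c h k l" if "h \<in> Hd a" "k \<in> Hd b" "l \<in> Hd c" for a b c h k l
    unfolding G_def
    by (subst glue_hdeg[OF _ vsF that(1)], intro linv_glue_param F vsF,
        subst glue_hdeg[OF _ vsF that(2)], intro linv_glue_param F vsF)
      (rule glue_hdeg[OF _ vsF that(3)], rule F)
qed

end

section \<open>Forms concentrated in single variables\<close>

context coalg begin

lemma conv3_prod12: "conv3 H (\<lambda>h k l. b h k * f l) (\<lambda>h k l. b' h k * f' l) = (\<lambda>h k l. conv2 H b b' h k * conv1 f f' l)"
  unfolding conv3_def conv2_def conv1_def
  by (intro ext, simp only: sw2_mult_right, simp only: sw2_mult_left, simp only: mult_ac)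

lemma conv3_prod13: "conv3 H (\<lambda>h k l. b h l * f k) (\<lambda>h k l. b' h l * f' k) = (\<lambda>h k l. conv2 H b b' h l * conv1 f f' k)"
proof (intro ext)
  fix h k l
  show "conv3 H (\<lambda>h k l. b h l * f k) (\<lambda>h k l. b' h l * f' k) h k l = conv2 H b b' h l * conv1 f f' k"
    unfolding conv3_def conv2_def conv1_def
    by (subst sw2_swap[of k], simp only: sw2_mult_right, simp only: sw2_mult_left, simp only: mult_ac)
qed

lemma conv3_scale: "conv3 H (\<lambda>h k l. c * p h k l) q = (\<lambda>h k l. c * conv3 H p q h k l)"
  "conv3 H p (\<lambda>h k l. c * q h k l) = (\<lambda>h k l. c * conv3 H p q h k l)"
  unfolding conv3_def by (simp_all add: sw2_mult_left mult_ac)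

lemma lform_linv: "lform H f \<longleftrightarrow> linv scH UNIV (*) f"
  by (simp add: lform_def linear_iff_linv)

lemma conv1_eps: "lform H f ==> conv1 eps f = f" "lform H f ==> conv1 f eps = f"
  unfolding conv1_def lform_linv by (auto intro!: ext sw2_eps_left sw2_eps_right)

lemma conv1_assoc: "lform H f ==> lform H g ==> lform H p ==> conv1 (conv1 f g) p = conv1 f (conv1 g p)"
  unfolding conv1_def sw2_mult_left sw2_mult_right mult.assoc lform_linv
  by (intro ext sw2_coassoc vsF) (auto intro!: lin)

text \<open>A linear form placed in the second, respectively third, of three variables. Up to
  scalars the zested associator is \<open>G3 (\<gamma> g)\<close> in each triple of degrees;
  \<open>G2\<close> appears when the hexagons permute its arguments.\<close>

definition G2 where "G2 f = (\<lambda>h k l. e2 h l * f k)"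
definition G3 where "G3 f = (\<lambda>h k l. e2 h k * f l)"

lemma tform_G: "lform H f ==> tform (G2 f)" "lform H f ==> tform (G3 f)"
  unfolding G2_def G3_def lform_linv by (auto intro!: trilinI lin lin_app2[OF bform_e2])

lemma G3_G3: "conv3 H (G3 f) (G3 g) = G3 (conv1 f g)"
  unfolding G3_def conv3_prod12 by (simp add: bform_e2)

lemma G3_eps: "G3 eps = e3"
  by (simp add: G3_def e2_def e3_def)

text \<open>The two forms live in different variables. In the first hexagon this brings
  \<gamma>(\<lambda>(a, b)) next to its convolution inverse.\<close>

lemma G3_comm:
  assumes "bform b" "lform H f"
  shows "conv3 H (\<lambda>h k l. b h k * eps l) (G3 f) = conv3 H (G3 f) (\<lambda>h k l. b h k * eps l)"
  using assms by (simp add: G3_def conv3_prod12 conv1_eps)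

lemma G2_comm:
  assumes "bform b" "lform H f"
  shows "conv3 H (\<lambda>h k l. b h l * eps k) (G2 f) = conv3 H (G2 f) (\<lambda>h k l. b h l * eps k)"
  using assms by (simp add: G2_def conv3_prod13 conv1_eps)

text \<open>In given degrees every factor of the zested pentagon is a multiple of such a product of
  one-variable forms, and these convolve variable by variable.\<close>

definition Q4 where "Q4 f g p q = (\<lambda>h k l t. f h * (g k * (p l * q t)))" for f g p q :: "'h => 'k"

lemma Q4_Q4: "conv4 (Q4 f g p q) (Q4 f' g' p' q') = Q4 (conv1 f f') (conv1 g g') (conv1 p p') (conv1 q q')"
  unfolding Q4_def conv4_def[abs_def] S4_def conv1_def
  by (intro ext, simp only: sw2_mult_right, simp only: sw2_mult_left, simp only: mult_ac)

lemma qform_Q4: "lform H f ==> lform H g ==> lform H p ==> lform H q ==> qform (Q4 f g p q)"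
  unfolding Q4_def qform_def quadlin_on_def lform_linv by (auto intro!: lin)

lemma conv4_scale: "conv4 (\<lambda>h k l t. c * p h k l t) q h' k' l' t' = c * conv4 p q h' k' l' t'"
  "conv4 p (\<lambda>h k l t. c * q h k l t) h' k' l' t' = c * conv4 p q h' k' l' t'"
  unfolding conv4_def S4_def by (simp_all add: sw2_mult_left mult_ac)

end

context graded begin

lemma conv1_hom:
  assumes "h \<in> Hd a" "lform H p" "lform H q" "lform H p'" "lform H q'"
    "\<And>h. h \<in> Hd a ==> p h = p' h" "\<And>h. h \<in> Hd a ==> q h = q' h"
  shows "conv1 p q h = conv1 p' q' h"
  unfolding conv1_def using assms
  by (intro sw2_hom_cong[OF assms(1) vsF]) (auto simp: lform_linv intro!: lin)

lemma conv4_hom: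
  assumes "h \<in> Hd a" "k \<in> Hd b" "l \<in> Hd c" "x \<in> Hd d"
    and t: "qform p" "qform q" "qform p'" "qform q'"
    and eq: "\<And>h k l x. h \<in> Hd a ==> k \<in> Hd b ==> l \<in> Hd c ==> x \<in> Hd d ==> p h k l x = p' h k l x"
      "\<And>h k l x. h \<in> Hd a ==> k \<in> Hd b ==> l \<in> Hd c ==> x \<in> Hd d ==> q h k l x = q' h k l x"
  shows "conv4 p q h k l x = conv4 p' q' h k l x"
proof -
  note L = lin_app4[OF t(1)] lin_app4[OF t(2)] lin_app4[OF t(3)] lin_app4[OF t(4)]
  show ?thesis
    unfolding conv4_def S4_def
    by (rule sw2_hom_cong[OF assms(1) vsF]; (rule sw2_hom_cong[OF assms(2) vsF];
        (rule sw2_hom_cong[OF assms(3) vsF]; (rule sw2_hom_cong[OF assms(4) vsF])?)?)?)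
      (auto simp: eq intro!: lin L)
qed

text \<open>The integrands of the zig-zag identities split, in a fixed degree, into a product of
  one-variable forms; the fivefold coproduct then is a convolution product of linear forms.\<close>

lemma sw5_hom:
  assumes "h \<in> Hd a"
    and F: "\<And>x y z w. linv scH UNIV (*) (\<lambda>v. F v x y z w)" "\<And>x y z w. linv scH UNIV (*) (\<lambda>v. F x v y z w)"
      "\<And>x y z w. linv scH UNIV (*) (\<lambda>v. F x y v z w)" "\<And>x y z w. linv scH UNIV (*) (\<lambda>v. F x y z v w)"
      "\<And>x y z w. linv scH UNIV (*) (\<lambda>v. F x y z w v)"
    and f: "lform H f1" "lform H f2" "lform H f3" "lform H f4" "lform H f5"
    and eq: "\<And>x y z v w. x \<in> Hd a ==> y \<in> Hd a ==> z \<in> Hd a ==> v \<in> Hd a ==> w \<in> Hd a ==>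
      F x y z v w = f1 x * (f2 y * (f3 z * (f4 v * f5 w)))"
  shows "sw5 H h F = conv1 f1 (conv1 f2 (conv1 f3 (conv1 f4 f5))) h"
proof -
  note L = f[unfolded lform_linv]
  have "sw5 H h F = sw2 H h (\<lambda>x h. sw2 H h (\<lambda>y h. sw2 H h (\<lambda>z h. sw2 H h (\<lambda>v w. f1 x * (f2 y * (f3 z * (f4 v * f5 w)))))))"
    unfolding sw5_def sw4_def sw3_def
    by (rule sw2_hom_cong[OF assms(1) vsF]; (rule sw2_hom_cong[OF _ vsF];
        (rule sw2_hom_cong[OF _ vsF]; (rule sw2_hom_cong[OF _ vsF])?)?)?)
      (auto simp: eq intro!: lin F L)
  then show ?thesis by (simp add: conv1_def sw2_mult_left)
qed

text \<open>The algebra map \<phi> is applied to \<open>antipode_hom\<close>: its composite with the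
  antipode is its convolution inverse.\<close>

lemma eps_antipode:
  assumes "alg_map H \<phi>" "h \<in> Hd a"
  shows "sw2 H h (\<lambda>h1 h2. \<phi> h1 * \<phi> (P (- a) (S h2))) = eps h"
    "sw2 H h (\<lambda>h1 h2. \<phi> (P (- a) (S h1)) * \<phi> h2) = eps h"
proof -
  have \<phi>: "Vector_Spaces.linear scH (*) \<phi>" "\<phi> (x * y) = \<phi> x * \<phi> y" "\<phi> 1 = 1" for x y
    using assms(1) by (auto simp: alg_map_def)
  have "\<phi> (scH (eps h) 1) = eps h" using \<phi> by (auto simp: linear_iff_linv linv_def)
  then show "sw2 H h (\<lambda>h1 h2. \<phi> h1 * \<phi> (P (- a) (S h2))) = eps h"
    "sw2 H h (\<lambda>h1 h2. \<phi> (P (- a) (S h1)) * \<phi> h2) = eps h"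
    using antipode_hom[OF assms(2), THEN arg_cong, of \<phi>] by (simp_all add: sw2_linear[OF \<phi>(1)] \<phi>)
qed

lemma alg_map_eps: "alg_map H eps"
  using grouplike_1 eps_m lin_eps by (simp add: alg_map_def grouplike_def)

lemma eps_P_S: "h \<in> Hd a ==> eps (P (- a) (S h)) = eps h"
  using eps_antipode(2)[OF alg_map_eps, of h a]
  by (subst (asm) sw2_eps_right) (auto intro!: lin)

end

section \<open>The zested coquasi-Hopf algebra\<close>

locale zest = graded H S \<pi>
  for H :: "('k::field, 'h::ring_1) coalg" and S :: "'h => 'h" and \<pi> :: "'h => ('g::ab_group_add \<Rightarrow>\<^sub>0 'k)" +
  fixes r :: "'h => 'h => 'k" and \<Gamma>0 :: "'h set" and \<gamma> :: "'h => 'h => 'k" and lam :: "'g => 'g => 'h"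
    and \<omega> :: "'g => 'g => 'g => 'k" and t :: "'g => 'g => 'k"
  assumes cqh: "coquasitriangular_hopf H S r" and datum: "braided_zesting_datum H S r \<pi> \<Gamma>0 \<gamma> lam \<omega> t"
begin

lemma assoc_datum: "assoc_zesting_datum H S \<pi> \<Gamma>0 \<gamma> lam \<omega>"
  using datum by (simp add: braided_zesting_datum_def)

lemma \<Gamma>0: "g \<in> \<Gamma>0 ==> g \<in> Hd 0" "g \<in> \<Gamma>0 ==> grouplike H g" "1 \<in> \<Gamma>0"
  "g \<in> \<Gamma>0 ==> g' \<in> \<Gamma>0 ==> g * g' \<in> \<Gamma>0" "g \<in> \<Gamma>0 ==> S g \<in> \<Gamma>0" "lam a b \<in> \<Gamma>0"
  using assoc_datum by (auto simp: assoc_zesting_datum_def)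

lemma \<gamma>: "g \<in> \<Gamma>0 ==> alg_map H (\<gamma> g)"
  "g \<in> \<Gamma>0 ==> g' \<in> \<Gamma>0 ==> \<gamma> (g * g') = conv1 (\<gamma> g) (\<gamma> g')"
  "g \<in> \<Gamma>0 ==> sw2 H h (\<lambda>h1 h2. scH (\<gamma> g h2) (g * h1 * S g)) = sw2 H h (\<lambda>h1 h2. scH (\<gamma> g h1) h2)"
proof -
  show "g \<in> \<Gamma>0 ==> alg_map H (\<gamma> g)"
    "g \<in> \<Gamma>0 ==> sw2 H h (\<lambda>h1 h2. scH (\<gamma> g h2) (g * h1 * S g)) = sw2 H h (\<lambda>h1 h2. scH (\<gamma> g h1) h2)"
    using assoc_datum unfolding assoc_zesting_datum_def by meson+
  show "g \<in> \<Gamma>0 ==> g' \<in> \<Gamma>0 ==> \<gamma> (g * g') = conv1 (\<gamma> g) (\<gamma> g')"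
    using assoc_datum unfolding assoc_zesting_datum_def conv1_def by (intro ext) blast
qed

lemma lam [simp]: "lam 0 a = 1" "lam a 0 = 1"
  and lam_cocycle: "lam a b * lam (a + b) c = lam b c * lam a (b + c)"
  using assoc_datum unfolding assoc_zesting_datum_def by blast+

lemma lam_sym: "lam a b = lam b a"
  using datum unfolding braided_zesting_datum_def by blast

lemma \<omega> [simp]: "\<omega> a b c \<noteq> 0" "\<omega> 0 a b = 1" "\<omega> a 0 b = 1" "\<omega> a b 0 = 1"
  and \<omega>_cond: "\<gamma> (lam a b) (lam c d) * (\<omega> (a + b) c d * \<omega> a b (c + d)) = \<omega> a b c * \<omega> a (b + c) d * \<omega> b c d"
proof -
  show nz: "\<omega> a b c \<noteq> 0" "\<omega> 0 a b = 1" "\<omega> a 0 b = 1" "\<omega> a b 0 = 1" for a b c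
    using assoc_datum unfolding assoc_zesting_datum_def by blast+
  have "\<gamma> (lam a b) (lam c d) = (\<omega> a b c * \<omega> a (b + c) d * \<omega> b c d) / (\<omega> (a + b) c d * \<omega> a b (c + d))"
    using assoc_datum unfolding assoc_zesting_datum_def by blast
  then show "\<gamma> (lam a b) (lam c d) * (\<omega> (a + b) c d * \<omega> a b (c + d)) = \<omega> a b c * \<omega> a (b + c) d * \<omega> b c d"
    using nz(1) by simp
qed

lemma t: "t a b \<noteq> 0" "\<omega> a b c * \<omega> b c a * t a (b + c) = t a b * t a c * \<omega> b a c"
proof -
  show nz: "t a b \<noteq> 0" for a b using datum by (simp add: braided_zesting_datum_def)
  have "\<omega> a b c * \<omega> b c a / \<omega> b a c = t a b * t a c / t a (b + c)"
    using datum unfolding braided_zesting_datum_def by blast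
  then show "\<omega> a b c * \<omega> b c a * t a (b + c) = t a b * t a c * \<omega> b a c"
    using nz \<omega>(1) by (simp add: field_simps)
qed

lemma eps_\<Gamma>0: "g \<in> \<Gamma>0 ==> eps g = 1"
  using \<Gamma>0(2) by (simp add: grouplike_def)

lemma S_\<Gamma>0: "g \<in> \<Gamma>0 ==> S g * g = 1" "g \<in> \<Gamma>0 ==> g * S g = 1"
  using antipode[of g] sw2_grouplike[OF \<Gamma>0(2) vsH, of g "\<lambda>x y. S x * y"] sw2_grouplike[OF \<Gamma>0(2) vsH, of g "\<lambda>x y. x * S y"]
  by (auto simp: lin eps_\<Gamma>0 vs_rules(4)[OF vsH])

lemma \<gamma>_alg: 
  assumes "g \<in> \<Gamma>0"
  shows "lform H (\<gamma> g)" "\<gamma> g (h * k) = \<gamma> g h * \<gamma> g k" "\<gamma> g 1 = 1"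
  using \<gamma>(1)[OF assms] by (auto simp: alg_map_def lform_def)

lemma lin_\<gamma> [lin]: "linv s V scH f ==> g \<in> \<Gamma>0 ==> linv s V (*) (\<lambda>x. \<gamma> g (f x))"
  using lin_form \<gamma>_alg(1) by blast

declare \<Gamma>0(3-6) [simp]

text \<open>The compatibility of \<gamma> with conjugation, multiplied by \<open>g\<close> on the
  right or by \<open>S g\<close> on the left, so that only one group-like factor remains on each
  side.\<close>

lemma \<gamma>_comm:
  assumes "g \<in> \<Gamma>0"
  shows "sw2 H h (\<lambda>h1 h2. scH (\<gamma> g h2) (g * h1)) = sw2 H h (\<lambda>h1 h2. scH (\<gamma> g h1) (h2 * g))"
    "sw2 H h (\<lambda>h1 h2. scH (\<gamma> g h2) (h1 * S g)) = sw2 H h (\<lambda>h1 h2. scH (\<gamma> g h1) (S g * h2))"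
proof -
  have l: "Vector_Spaces.linear scH scH (\<lambda>x. x * k)" "Vector_Spaces.linear scH scH (\<lambda>x. k * x)" for k
    by (auto simp: linear_iff_linv intro!: lin)
  show "sw2 H h (\<lambda>h1 h2. scH (\<gamma> g h2) (g * h1)) = sw2 H h (\<lambda>h1 h2. scH (\<gamma> g h1) (h2 * g))"
    using \<gamma>(3)[OF assms, of h, THEN arg_cong, of "\<lambda>x. x * g"] 
    by (simp add: sw2_linear[OF l(1)] scH_mult mult.assoc S_\<Gamma>0 assms)
  show "sw2 H h (\<lambda>h1 h2. scH (\<gamma> g h2) (h1 * S g)) = sw2 H h (\<lambda>h1 h2. scH (\<gamma> g h1) (S g * h2))"
    using \<gamma>(3)[OF assms, of h, THEN arg_cong, of "\<lambda>x. S g * x"] 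
    by (simp add: sw2_linear[OF l(2)] scH_mult S_\<Gamma>0 assms flip: mult.assoc)
qed

lemma \<gamma>_S: "g \<in> \<Gamma>0 ==> g' \<in> \<Gamma>0 ==> \<gamma> g g' * \<gamma> g (S g') = 1"
  by (simp add: S_\<Gamma>0 \<gamma>_alg flip: \<gamma>_alg(2))

text \<open>At a group-like element \<open>g'\<close> the compatibility of \<gamma> with conjugation
  compares the two products up to the common scalar \<open>\<gamma> g g'\<close>, which is
  invertible.\<close>

lemma \<Gamma>0_comm:
  assumes "g \<in> \<Gamma>0" "g' \<in> \<Gamma>0"
  shows "g * g' = g' * g"
proof -
  have "scH (\<gamma> g g') (g * g') = scH (\<gamma> g g') (g' * g)"
    using \<gamma>_comm(1)[OF assms(1), of g'] assms
    by (subst (asm) (1 2) sw2_grouplike[OF \<Gamma>0(2) vsH]) (auto intro!: lin)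
  from arg_cong[OF this, of "scH (\<gamma> g (S g'))"] show ?thesis
    using \<gamma>_S[OF assms] by (simp add: vs_rules(3,4)[OF vsH] mult.commute)
qed

lemma r: "bform r" "r h (k * l) = sw2 H h (\<lambda>h1 h2. r h1 k * r h2 l)" "r h 1 = eps h" "r 1 l = eps l"
  "r (h * k) l = sw2 H l (\<lambda>l1 l2. r h l2 * r k l1)"
  "sw2 H h (\<lambda>h1 h2. sw2 H k (\<lambda>k1 k2. scH (r h1 k1) (k2 * h2))) =
   sw2 H h (\<lambda>h1 h2. sw2 H k (\<lambda>k1 k2. scH (r h2 k2) (h1 * k1)))"
  using cqh unfolding coquasitriangular_hopf_def by blast+

definition ri where "ri = cinv2 H r"

lemma ri: "bform ri" "conv2 H r ri = e2" "conv2 H ri r = e2"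
proof -
  obtain q where q: "is_cinv2 H r q" using cqh unfolding coquasitriangular_hopf_def by blast
  then have "ri = q" unfolding ri_def by (rule cinv2_eq[OF r(1)])
  with q show "bform ri" "conv2 H r ri = e2" "conv2 H ri r = e2" by (auto simp: is_cinv2_e2)
qed

lemmas lin_r [lin] = lin_app2[OF r(1)] and lin_ri [lin] = lin_app2[OF ri(1)]

lemma \<gamma>_ri: "g \<in> \<Gamma>0 ==> \<gamma> g h = ri h g"
  using datum unfolding braided_zesting_datum_def ri_def by blast

text \<open>Fixing the second argument of bilinear forms at a group-like element respects
  convolution. It is applied to \<open>r\<close> and its inverse, the latter giving
  \<open>\<gamma> g\<close> by the datum.\<close>

lemma \<gamma>_r:
  assumes "g \<in> \<Gamma>0"
  shows "conv1 (\<lambda>h. r h g) (\<gamma> g) = eps" "conv1 (\<gamma> g) (\<lambda>h. r h g) = eps"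
proof -
  have "conv1 (\<lambda>h. p h g) (\<lambda>h. q h g) h = conv2 H p q h g" if "bform p" "bform q" for p q h
    unfolding conv1_def conv2_def
    by (intro sw2_cong sw2_grouplike[OF \<Gamma>0(2)[OF assms] vsF, symmetric])
      (auto intro!: lin lin_app2[OF that(1)] lin_app2[OF that(2)])
  from this[OF r(1) ri(1)] this[OF ri(1) r(1)]
  show "conv1 (\<lambda>h. r h g) (\<gamma> g) = eps" "conv1 (\<gamma> g) (\<lambda>h. r h g) = eps"
    unfolding ext[of "\<gamma> g", OF \<gamma>_ri[OF assms]] using assms by (auto simp: ri e2_def eps_\<Gamma>0)
qed

lemma \<gamma>_1: "\<gamma> 1 = eps"
  using \<gamma>_r(1)[of 1] \<gamma>_alg(1)[of 1] by (simp add: r(3) conv1_eps)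

lemma \<gamma>_inv:
  assumes "g \<in> \<Gamma>0"
  shows "conv1 (\<gamma> g) (\<gamma> (S g)) = eps" "conv1 (\<gamma> (S g)) (\<gamma> g) = eps"
  using assms by (simp_all add: S_\<Gamma>0 \<gamma>_1 flip: \<gamma>(2))

section \<open>The structure maps of the zesting on homogeneous elements\<close>

definition mz where "mz = zest_mult H \<pi> lam"
definition Oz where "Oz = zest_assoc H \<pi> \<gamma> lam \<omega>"
definition rz where "rz = zest_rform H \<pi> r t"
definition Ozi where "Ozi h k l = glue (\<lambda>a h. glue (\<lambda>b k. glue (\<lambda>c l. inverse (\<omega> a b c) * G3 (\<gamma> (S (lam a b))) h k l) l) k) h"
text \<open>The zested product of degrees -a and a contributes the group-like \<lambda>(-a, a); its
  inverse \<open>S (lam (- a) a)\<close> compensates for it.\<close>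

definition Sz where "Sz = glue (\<lambda>a h. S (lam (- a) a) * P (- a) (S h))"
text \<open>With the counit as the other form \<alpha>, the first zig-zag identity fixes this value:
  it has to cancel \<open>Ozi\<close> in degrees a, -a, a.\<close>

definition \<beta>z where "\<beta>z = glue (\<lambda>a h. \<omega> a (- a) a * \<gamma> (lam (- a) a) h)"

text \<open>Gluing gives the witness for the definite description, and bilinear maps that agree on
  homogeneous elements are equal. The forms \<open>rz\<close> and \<open>Oz\<close> are treated
  alike.\<close>

lemma mz: "bilin scH scH scH mz" "h \<in> Hd a ==> k \<in> Hd b ==> mz h k = h * k * lam a b"
proof -
  have F: "\<And>a b. bilin scH scH scH (\<lambda>h k. h * k * lam a b)"
    by (rule bilinI) (auto intro!: lin)
  note g = glue2[where F = "\<lambda>a b h k. h * k * lam a b", OF F vsH]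
  let ?Q = "\<lambda>m. bilin scH scH scH m \<and> (\<forall>a b. \<forall>h\<in>Hd a. \<forall>k\<in>Hd b. m h k = h * k * lam a b)"
  have "?Q mz"
    unfolding mz_def zest_mult_def
  proof (rule theI[of ?Q])
    show "bilin scH scH scH (\<lambda>h k. glue (\<lambda>a h. glue (\<lambda>b k. h * k * lam a b) k) h) \<and>
      (\<forall>a b. \<forall>h\<in>Hd a. \<forall>k\<in>Hd b. glue (\<lambda>a h. glue (\<lambda>b k. h * k * lam a b) k) h = h * k * lam a b)"
      using g by auto
  qed (rule bilin_hom_ext; auto intro: g(1) simp: g(2))
  then show "bilin scH scH scH mz" "h \<in> Hd a ==> k \<in> Hd b ==> mz h k = h * k * lam a b" by auto
qed

lemma rz: "bform rz" "h \<in> Hd a ==> k \<in> Hd b ==> rz h k = t a b * r h k"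
proof -
  have F: "\<And>a b. bform (\<lambda>h k. t a b * r h k)"
    by (rule bilinI) (auto intro!: lin)
  note g = glue2[where F = "\<lambda>a b h k. t a b * r h k", OF F vsF]
  let ?Q = "\<lambda>p. bform p \<and> (\<forall>a b. \<forall>h\<in>Hd a. \<forall>k\<in>Hd b. p h k = t a b * r h k)"
  have "?Q rz"
    unfolding rz_def zest_rform_def
  proof (rule theI[of ?Q])
    show "bform (\<lambda>h k. glue (\<lambda>a h. glue (\<lambda>b k. t a b * r h k) k) h) \<and>
      (\<forall>a b. \<forall>h\<in>Hd a. \<forall>k\<in>Hd b. glue (\<lambda>a h. glue (\<lambda>b k. t a b * r h k) k) h = t a b * r h k)"
      using g by auto
  qed (rule bilin_hom_ext; auto intro: g(1) simp: g(2))
  then show "bform rz" "h \<in> Hd a ==> k \<in> Hd b ==> rz h k = t a b * r h k" by auto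
qed

lemma tform_scale: "tform p ==> tform (\<lambda>h k l. c * p h k l)"
  unfolding trilin_form_def linear_iff_linv by (auto intro!: lin)

lemma Oz: "tform Oz"
  "h \<in> Hd a ==> k \<in> Hd b ==> l \<in> Hd c ==> Oz h k l = \<omega> a b c * G3 (\<gamma> (lam a b)) h k l"
proof -
  have F: "\<And>a b c. tform (\<lambda>h k l. \<omega> a b c * G3 (\<gamma> (lam a b)) h k l)"
    by (intro tform_scale tform_G \<gamma>_alg) simp
  note g = glue3[where F = "\<lambda>a b c h k l. \<omega> a b c * G3 (\<gamma> (lam a b)) h k l", OF F]
  let ?Q = "\<lambda>p. tform p \<and> (\<forall>a b c. \<forall>h\<in>Hd a. \<forall>k\<in>Hd b. \<forall>l\<in>Hd c. p h k l = eps (h * k) * \<omega> a b c * \<gamma> (lam a b) l)"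
  have "?Q Oz"
    unfolding Oz_def zest_assoc_def
  proof (rule theI[of ?Q])
    show "tform (\<lambda>h k l. glue (\<lambda>a h. glue (\<lambda>b k. glue (\<lambda>c l. \<omega> a b c * G3 (\<gamma> (lam a b)) h k l) l) k) h) \<and>
      (\<forall>a b c. \<forall>h\<in>Hd a. \<forall>k\<in>Hd b. \<forall>l\<in>Hd c.
        glue (\<lambda>a h. glue (\<lambda>b k. glue (\<lambda>c l. \<omega> a b c * G3 (\<gamma> (lam a b)) h k l) l) k) h = eps (h * k) * \<omega> a b c * \<gamma> (lam a b) l)"
      using g by (simp add: G3_def e2_def eps_m)
  qed (rule tform_hom_ext; auto intro: g(1) simp: g(2); simp add: G3_def e2_def eps_m)
  then show "tform Oz"
    "h \<in> Hd a ==> k \<in> Hd b ==> l \<in> Hd c ==> Oz h k l = \<omega> a b c * G3 (\<gamma> (lam a b)) h k l"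
    by (auto simp: G3_def e2_def eps_m)
qed

lemma Ozi: "tform Ozi"
  "h \<in> Hd a ==> k \<in> Hd b ==> l \<in> Hd c ==> Ozi h k l = inverse (\<omega> a b c) * G3 (\<gamma> (S (lam a b))) h k l"
proof -
  have F: "\<And>a b c. tform (\<lambda>h k l. inverse (\<omega> a b c) * G3 (\<gamma> (S (lam a b))) h k l)"
    by (intro tform_scale tform_G \<gamma>_alg) simp
  note g = glue3[where F = "\<lambda>a b c h k l. inverse (\<omega> a b c) * G3 (\<gamma> (S (lam a b))) h k l", OF F]
  show "tform Ozi"
    "h \<in> Hd a ==> k \<in> Hd b ==> l \<in> Hd c ==> Ozi h k l = inverse (\<omega> a b c) * G3 (\<gamma> (S (lam a b))) h k l"
    unfolding Ozi_def[abs_def] by (rule g, rule g)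
qed

lemma Sz: "Vector_Spaces.linear scH scH Sz" "h \<in> Hd a ==> Sz h = S (lam (- a) a) * P (- a) (S h)"
  unfolding Sz_def linear_iff_linv by (auto intro!: linv_glue lin glue_hdeg[where s = scH])

lemma \<beta>z: "lform H \<beta>z" "h \<in> Hd a ==> \<beta>z h = \<omega> a (- a) a * \<gamma> (lam (- a) a) h"
  unfolding \<beta>z_def lform_linv by (auto intro!: linv_glue lin glue_hdeg[where s = "(*)"])

lemmas lin_z [lin] = lin_app2[OF mz(1)] lin_app2[OF rz(1)] lin_app3[OF Oz(1)] lin_app3[OF Ozi(1)]
  lin_app[OF Sz(1)] lin_app[OF \<beta>z(1)[unfolded lform_def]]

end

context coalg begin

lemma conv3_G1R:
  assumes "tform p"
  shows "conv3 H p (\<lambda>h k l. e2 k l * f h) h k l = sw2 H h (\<lambda>h1 h2. p h1 k l * f h2)"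
proof -
  have "conv3 H p (\<lambda>h k l. e2 k l * f h) h k l = conv3 H p (\<lambda>h k l. (f h * eps l) * eps k) h k l"
    by (simp add: e2_def mult_ac)
  also have "... = sw2 H h (\<lambda>h1 h2. sw2 H l (\<lambda>l1 l2. (p h1 k l1 * f h2) * eps l2))"
    unfolding conv3_pad2[OF assms, of "\<lambda>h l. f h * eps l"] unfolding mult.assoc ..
  also have "... = sw2 H h (\<lambda>h1 h2. p h1 k l * f h2)"
    by (intro sw2_cong sw2_eps_right lin lin_app3[OF assms])
  finally show ?thesis .
qed

lemma conv3_G3L:
  assumes "tform p"
  shows "conv3 H (G3 f) p h k l = sw2 H l (\<lambda>l1 l2. f l1 * p h k l2)"
proof -
  have "conv3 H (G3 f) p h k l = conv3 H (\<lambda>h k l. eps h * (eps k * f l)) p h k l"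
    by (simp add: G3_def e2_def mult_ac)
  also have "... = sw2 H k (\<lambda>k1 k2. eps k1 * sw2 H l (\<lambda>l1 l2. f l1 * p h k2 l2))"
    by (simp add: conv3_pad1L[OF assms] mult.assoc sw2_mult_left)
  also have "... = sw2 H l (\<lambda>l1 l2. f l1 * p h k l2)"
    by (intro sw2_eps_left lin lin_app3[OF assms] vsF)
  finally show ?thesis .
qed

text \<open>The counits inside \<open>G3\<close> absorb the coproducts of \<open>h\<close> and
  \<open>k\<close>; only the coproduct of \<open>l\<close> survives.\<close>

lemma S3_G3:
  assumes "trilin scH F"
  shows "S3 h k l (\<lambda>h1 k1 l1 h2 k2 l2. scH (c * G3 f h2 k2 l2) (F h1 k1 l1)) =
      scH c (sw2 H l (\<lambda>l1 l2. scH (f l2) (F h k l1)))"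
    "S3 h k l (\<lambda>h1 k1 l1 h2 k2 l2. scH (c * G3 f h1 k1 l1) (F h2 k2 l2)) =
      scH c (sw2 H l (\<lambda>l1 l2. scH (f l1) (F h k l2)))"
proof -
  have eq: "scH (c * G3 f x y z) X = scH (eps x) (scH (eps y) (scH c (scH (f z) X)))" for x y z X
    by (simp add: G3_def e2_def vs_rules(3)[OF vsH] mult_ac)
  have l: "linv s V scH f ==> linv s V scH (\<lambda>x. F (f x) b c)" "linv s V scH f ==> linv s V scH (\<lambda>x. F a (f x) c)" for s V f a b c
    using assms linv_comp unfolding trilin_def by blast+
  show "S3 h k l (\<lambda>h1 k1 l1 h2 k2 l2. scH (c * G3 f h2 k2 l2) (F h1 k1 l1)) =
      scH c (sw2 H l (\<lambda>l1 l2. scH (f l2) (F h k l1)))"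
    unfolding S3_def eq by (simp only: sw2_scale[OF vsH, symmetric]) ((subst sw2_counit(2); (intro lin l vsH)?)+, rule refl)
  show "S3 h k l (\<lambda>h1 k1 l1 h2 k2 l2. scH (c * G3 f h1 k1 l1) (F h2 k2 l2)) =
      scH c (sw2 H l (\<lambda>l1 l2. scH (f l1) (F h k l2)))"
    unfolding S3_def eq by (simp only: sw2_scale[OF vsH, symmetric]) ((subst sw2_counit(1); (intro lin l vsH)?)+, rule refl)
qed

end

context graded begin

lemma trilin_hom_ext:
  assumes "trilin s p" "trilin s q" "vector_space s"
    "\<And>a b c h k l. h \<in> Hd a ==> k \<in> Hd b ==> l \<in> Hd c ==> p h k l = q h k l"
  shows "p h k l = q h k l"
proof -
  have 1: "p h k l = q h k l" if "h \<in> Hd a" "k \<in> Hd b" for a b h k l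
    by (rule hdeg_ext[OF _ _ assms(3)]) (use assms(1,2) assms(4)[OF that] in \<open>auto simp: trilin_def\<close>)
  have 2: "p h k l = q h k l" if "h \<in> Hd a" for a h k l
    by (rule hdeg_ext[OF _ _ assms(3)]) (use assms(1,2) 1[OF that] in \<open>auto simp: trilin_def\<close>)
  show "p h k l = q h k l"
    by (rule hdeg_ext[OF _ _ assms(3)]) (use assms(1,2) 2 in \<open>auto simp: trilin_def\<close>)
qed

lemma qform_hom_ext:
  assumes "qform p" "qform q"
    "\<And>a b c d h k l x. h \<in> Hd a ==> k \<in> Hd b ==> l \<in> Hd c ==> x \<in> Hd d ==> p h k l x = q h k l x"
  shows "p h k l x = q h k l x"
proof -
  note L = lin_app4[OF assms(1) linv_id] lin_app4[OF assms(2) linv_id]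
  have "p h k l x = q h k l x" if h: "h \<in> Hd a" for a h
  proof (rule trilin_hom_ext[of "(*)" "p h" "q h"])
    show "trilin (*) (p h)" "trilin (*) (q h)" unfolding trilin_def by (intro conjI allI L)+
  qed (use assms(3)[OF h] in auto)
  then show ?thesis
    by (rule hdeg_ext[of "(*)" "\<lambda>h. p h k l x" "\<lambda>h. q h k l x", OF L(1) L(5) vsF])
qed

end

section \<open>The zested coquasi-bialgebra\<close>

context zest begin

lemma hdeg_\<Gamma>0: "h \<in> Hd a ==> g \<in> \<Gamma>0 ==> h * g \<in> Hd a" "h \<in> Hd a ==> g \<in> \<Gamma>0 ==> g * h \<in> Hd a"
  using hdeg_mult[of h a g 0] hdeg_mult[of g 0 h a] \<Gamma>0(1) by auto

lemma mz_deg: "h \<in> Hd a ==> k \<in> Hd b ==> mz h k \<in> Hd (a + b)"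
  by (simp add: mz hdeg_\<Gamma>0 hdeg_mult)

lemma Sz_deg: "h \<in> Hd a ==> Sz h \<in> Hd (- a)"
  by (simp add: Sz hdeg_\<Gamma>0 P_in)

lemma eps_mz_hom: "h \<in> Hd a ==> k \<in> Hd b ==> eps (mz h k) = eps h * eps k"
  by (simp add: mz eps_m eps_\<Gamma>0)

lemma eps_Sz: "h \<in> Hd a ==> eps (Sz h) = eps h"
  by (simp add: Sz eps_m eps_\<Gamma>0 eps_P_S)

lemma \<gamma>_mz: "h \<in> Hd a ==> k \<in> Hd b ==> g \<in> \<Gamma>0 ==> \<gamma> g (mz h k) = \<gamma> g h * \<gamma> g k * \<gamma> g (lam a b)"
  by (simp add: mz(2) \<gamma>_alg)

lemma mz_mz:
  assumes "h \<in> Hd a" "k \<in> Hd b" "l \<in> Hd c"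
  shows "mz (mz h k) l = h * k * lam a b * l * lam (a + b) c" "mz h (mz k l) = h * (k * l * lam b c) * lam a (b + c)"
  using mz(2)[OF mz_deg[OF assms(1,2)] assms(3)] mz(2)[OF assms(1) mz_deg[OF assms(2,3)]]
  by (simp_all add: mz(2)[OF assms(1,2)] mz(2)[OF assms(2,3)])

text \<open>Multiplication by a group-like element puts that element into both coproduct factors.
  Since homogeneous components are subcoalgebras, these factors have the degrees of \<open>h\<close>
  and \<open>k\<close>, and the same \<lambda>(a, b) belongs to them.\<close>

lemma mz_coalg: "mult_coalg_map H mz"
proof -
  have c: "comul H (h * k * g) = S2 h k (\<lambda>h1 k1 h2 k2. tens2 H (h1 * k1 * g) (h2 * k2 * g))" if "g \<in> \<Gamma>0" for h k g
  proof -
    have "comul H (h * k * g) = S2 (h * k) g (\<lambda>h1 k1 h2 k2. tens scH scH (h1 * k1) (h2 * k2))"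
      using sw2_m[OF vsT, of "tens scH scH" "h * k" g] by (simp add: comul_sw2 lin)
    also have "... = sw2 H (h * k) (\<lambda>x y. tens scH scH (x * g) (y * g))"
      unfolding S2_def by (intro sw2_cong sw2_grouplike[OF \<Gamma>0(2)[OF that] vsT]) (auto intro!: lin)
    also have "... = S2 h k (\<lambda>h1 k1 h2 k2. tens2 H (h1 * k1 * g) (h2 * k2 * g))"
      unfolding tens2_def by (rule sw2_m[OF vsT]) (auto intro!: lin)
    finally show ?thesis .
  qed
  have lc: "linv s V scH f ==> linv s V tscale (\<lambda>x. comul H (f x))" for s V f
    by (rule lin_app[OF lin_comul])
  have "(\<lambda>h k. comul H (mz h k)) = (\<lambda>h k. S2 h k (\<lambda>h1 k1 h2 k2. tens2 H (mz h1 k1) (mz h2 k2)))"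
  proof (rule bilin_hom_ext[where s = tscale])
    fix a b h k assume hk: "h \<in> Hd a" "k \<in> Hd b"
    show "comul H (mz h k) = S2 h k (\<lambda>h1 k1 h2 k2. tens2 H (mz h1 k1) (mz h2 k2))"
      unfolding mz(2)[OF hk] c[OF \<Gamma>0(6)]
      by (rule S2_hom_cong[OF hk vsT]) (auto simp: tens2_def mz intro!: lin)
  qed (rule bilinI; auto simp: S2_def tens2_def intro!: lin lc)+
  moreover have "(\<lambda>h k. eps (mz h k)) = (\<lambda>h k. eps h * eps k)"
    by (rule bilin_hom_ext[where s = "(*)"]) ((rule bilinI; auto intro!: lin)+, rule eps_mz_hom)
  ultimately show ?thesis
    by (auto simp: mult_coalg_map_def mz(1) S2_def fun_eq_iff)
qed

lemma mz_unit: "mz 1 h = h" "mz h 1 = h"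
  by (rule hdeg_ext[OF _ _ vsH]; auto intro!: lin simp: mz(2)[OF hdeg_1] mz(2)[OF _ hdeg_1])+

lemma Oz_cinv: "is_cinv3 H Oz Ozi"
proof -
  have e: "tform (\<lambda>h k l. c * G3 (\<gamma> g) h k l)" if "g \<in> \<Gamma>0" for c g
    using that by (intro tform_scale tform_G \<gamma>_alg)
  have "conv3 H Oz Ozi = e3"
  proof (rule tform_hom_ext)
    fix a b c h k l assume d: "h \<in> Hd a" "k \<in> Hd b" "l \<in> Hd c"
    have "conv3 H Oz Ozi h k l = conv3 H (\<lambda>h k l. \<omega> a b c * G3 (\<gamma> (lam a b)) h k l)
      (\<lambda>h k l. inverse (\<omega> a b c) * G3 (\<gamma> (S (lam a b))) h k l) h k l"
      by (rule conv3_hom[OF d]) (simp_all add: e Oz Ozi)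
    then show "conv3 H Oz Ozi h k l = e3 h k l"
      by (simp add: conv3_scale G3_G3 \<gamma>_inv G3_eps)
  qed (intro tform_conv3 Oz Ozi tform_e3)+
  moreover have "conv3 H Ozi Oz = e3"
  proof (rule tform_hom_ext)
    fix a b c h k l assume d: "h \<in> Hd a" "k \<in> Hd b" "l \<in> Hd c"
    have "conv3 H Ozi Oz h k l = conv3 H (\<lambda>h k l. inverse (\<omega> a b c) * G3 (\<gamma> (S (lam a b))) h k l)
      (\<lambda>h k l. \<omega> a b c * G3 (\<gamma> (lam a b)) h k l) h k l"
      by (rule conv3_hom[OF d]) (simp_all add: e Oz Ozi)
    then show "conv3 H Ozi Oz h k l = e3 h k l"
      by (simp add: conv3_scale G3_G3 \<gamma>_inv G3_eps)
  qed (intro tform_conv3 Oz Ozi tform_e3)+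
  ultimately show ?thesis by (simp add: is_cinv3_e3 Ozi)
qed

lemma Ozi_eq: "cinv3 H Oz = Ozi"
  by (rule cinv3_eq[OF Oz(1) Oz_cinv])

text \<open>In the left-bracketed product the group-like \<lambda>(a, b) stands before
  \<open>l\<close>. By \<open>\<gamma>_comm\<close> it moves past \<open>l\<close> while
  \<gamma>(\<lambda>(a, b)) changes from the second to the first coproduct factor of
  \<open>l\<close>; the cocycle condition on \<lambda> then rebrackets.\<close>

lemma Oz_mult:
  "S3 h k l (\<lambda>h1 k1 l1 h2 k2 l2. scH (Oz h2 k2 l2) (mz (mz h1 k1) l1)) =
   S3 h k l (\<lambda>h1 k1 l1 h2 k2 l2. scH (Oz h1 k1 l1) (mz h2 (mz k2 l2)))"
proof (rule trilin_hom_ext[where s = scH and p = "\<lambda>h k l. S3 h k l _"])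
  fix a b c h k l assume d: "h \<in> Hd a" "k \<in> Hd b" "l \<in> Hd c"
  let ?g = "lam a b" and ?g' = "lam (a + b) c"
  have lm: "Vector_Spaces.linear scH scH (\<lambda>x. h * k * x * ?g')"
    by (auto simp: linear_iff_linv intro!: lin)
  have lG [lin]: "linv s V scH f ==> linv s V (*) (\<lambda>x. G3 (\<gamma> ?g) (f x) y z)" "linv s V scH f ==> linv s V (*) (\<lambda>x. G3 (\<gamma> ?g) y (f x) z)"
    "linv s V scH f ==> linv s V (*) (\<lambda>x. G3 (\<gamma> ?g) y z (f x))" for s V f y z
    by (erule lin_app3[OF tform_G(2)[OF \<gamma>_alg(1)[OF \<Gamma>0(6)]]])+
  have "S3 h k l (\<lambda>h1 k1 l1 h2 k2 l2. scH (Oz h2 k2 l2) (mz (mz h1 k1) l1)) =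
    S3 h k l (\<lambda>h1 k1 l1 h2 k2 l2. scH (\<omega> a b c * G3 (\<gamma> ?g) h2 k2 l2) (h1 * k1 * ?g * l1 * ?g'))"
    by (rule S3_hom_cong[OF d vsH]) (auto simp: mz_mz Oz(2) intro!: lin lG)
  also have "... = scH (\<omega> a b c) (sw2 H l (\<lambda>l1 l2. h * k * scH (\<gamma> ?g l2) (?g * l1) * ?g'))"
    by (subst S3_G3(1)) (auto simp: trilin_def scH_mult mult.assoc intro!: lin)
  also have "... = scH (\<omega> a b c) (sw2 H l (\<lambda>l1 l2. h * k * scH (\<gamma> ?g l1) (l2 * ?g) * ?g'))"
    unfolding sw2_linear[OF lm, symmetric] \<gamma>_comm(1)[OF \<Gamma>0(6)] ..
  also have "... = scH (\<omega> a b c) (sw2 H l (\<lambda>l1 l2. scH (\<gamma> ?g l1) (h * (k * l2 * lam b c) * lam a (b + c))))"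
    by (simp add: scH_mult mult.assoc lam_cocycle)
  also have "... = S3 h k l (\<lambda>h1 k1 l1 h2 k2 l2. scH (\<omega> a b c * G3 (\<gamma> ?g) h1 k1 l1) (h2 * (k2 * l2 * lam b c) * lam a (b + c)))"
    by (subst S3_G3(2)) (auto simp: trilin_def intro!: lin)
  also have "... = S3 h k l (\<lambda>h1 k1 l1 h2 k2 l2. scH (Oz h1 k1 l1) (mz h2 (mz k2 l2)))"
    by (rule S3_hom_cong[OF d vsH]) (auto simp: mz_mz Oz(2) intro!: lin lG)
  finally show "S3 h k l (\<lambda>h1 k1 l1 h2 k2 l2. scH (Oz h2 k2 l2) (mz (mz h1 k1) l1)) =
    S3 h k l (\<lambda>h1 k1 l1 h2 k2 l2. scH (Oz h1 k1 l1) (mz h2 (mz k2 l2)))" .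
qed (auto simp: trilin_def S3_def intro!: lin)

lemma Oz_unit: "Oz h 1 k = eps h * eps k"
proof -
  have "(\<lambda>h k. Oz h 1 k) = (\<lambda>h k. eps h * eps k)"
    by (rule bilin_hom_ext[where s = "(*)"])
      ((rule bilinI; auto intro!: lin)+, simp add: Oz(2)[OF _ hdeg_1] G3_def e2_def \<gamma>_1 grouplike_1[unfolded grouplike_def])
  then show ?thesis by meson
qed

text \<open>In the variable \<open>x\<close> the \<gamma>-parts agree by the cocycle condition on
  \<lambda> and commutativity in \<open>\<Gamma>0\<close>. The product of \<open>l\<close> and
  \<open>x\<close> contains \<lambda>(c, d), on which \<gamma>(\<lambda>(a, b)) takes the scalar
  appearing in the condition on \<omega>.\<close>

lemma Oz_pentagon:
  "conv4 (\<lambda>h k l x. Oz (mz h k) l x) (\<lambda>h k l x. Oz h k (mz l x)) h k l x =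
   conv4 (\<lambda>h k l x. Oz h k l * eps x) (conv4 (\<lambda>h k l x. Oz h (mz k l) x) (\<lambda>h k l x. eps h * Oz k l x)) h k l x"
proof (rule qform_hom_ext[of "conv4 _ _"])
  have Q: "qform (\<lambda>h k l x. Oz (mz h k) l x)" "qform (\<lambda>h k l x. Oz h k (mz l x))" "qform (\<lambda>h k l x. Oz h k l * eps x)"
    "qform (\<lambda>h k l x. Oz h (mz k l) x)" "qform (\<lambda>h k l x. eps h * Oz k l x)"
    by (auto simp: qform_def quadlin_on_def intro!: lin)
  then show "qform (conv4 (\<lambda>h k l x. Oz (mz h k) l x) (\<lambda>h k l x. Oz h k (mz l x)))"
    "qform (conv4 (\<lambda>h k l x. Oz h k l * eps x) (conv4 (\<lambda>h k l x. Oz h (mz k l) x) (\<lambda>h k l x. eps h * Oz k l x)))"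
    by (intro qform_conv4 Q)+
  fix a b c d h k l x assume d: "h \<in> Hd a" "k \<in> Hd b" "l \<in> Hd c" "x \<in> Hd d"
  let ?g = "lam a b"
  have E: "qform (\<lambda>h k l x. z * Q4 eps eps p q h k l x)" if "lform H p" "lform H q" for p q z
    using qform_Q4[OF lform_eps lform_eps that] unfolding qform_def quadlin_on_def by (auto intro!: lin)
  note F = E[OF lform_eps \<gamma>_alg(1)[OF \<Gamma>0(6)]] E[OF \<gamma>_alg(1)[OF \<Gamma>0(6)] \<gamma>_alg(1)[OF \<Gamma>0(6)]] E[OF \<gamma>_alg(1)[OF \<Gamma>0(6)] lform_eps]
  have L: "conv4 (\<lambda>h k l x. Oz (mz h k) l x) (\<lambda>h k l x. Oz h k (mz l x)) h k l x =
    conv4 (\<lambda>h k l x. \<omega> (a + b) c d * Q4 eps eps eps (\<gamma> (lam (a + b) c)) h k l x)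
     (\<lambda>h k l x. (\<omega> a b (c + d) * \<gamma> ?g (lam c d)) * Q4 eps eps (\<gamma> ?g) (\<gamma> ?g) h k l x) h k l x"
    by (rule conv4_hom[OF d Q(1,2) F(1,2)])
      (simp_all add: Oz(2)[OF mz_deg] Oz(2)[OF _ _ mz_deg] G3_def e2_def eps_mz_hom Q4_def \<gamma>_mz mult_ac)
  have R1: "conv4 (\<lambda>h k l x. Oz h (mz k l) x) (\<lambda>h k l x. eps h * Oz k l x) h k l x =
    (\<omega> a (b + c) d * \<omega> b c d) * Q4 eps eps eps (\<gamma> (lam a (b + c) * lam b c)) h k l x"
    if "h \<in> Hd a" "k \<in> Hd b" "l \<in> Hd c" "x \<in> Hd d" for h k l x
  proof -
    have "conv4 (\<lambda>h k l x. Oz h (mz k l) x) (\<lambda>h k l x. eps h * Oz k l x) h k l x =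
      conv4 (\<lambda>h k l x. \<omega> a (b + c) d * Q4 eps eps eps (\<gamma> (lam a (b + c))) h k l x)
       (\<lambda>h k l x. \<omega> b c d * Q4 eps eps eps (\<gamma> (lam b c)) h k l x) h k l x"
      by (rule conv4_hom[OF that Q(4,5) F(1,1)])
        (simp_all add: Oz(2)[OF _ mz_deg] Oz(2) G3_def e2_def eps_mz_hom Q4_def mult_ac)
    then show ?thesis by (simp add: conv4_scale Q4_Q4 conv1_eps lform_eps \<gamma>(2) mult_ac)
  qed
  have R: "conv4 (\<lambda>h k l x. Oz h k l * eps x) (conv4 (\<lambda>h k l x. Oz h (mz k l) x) (\<lambda>h k l x. eps h * Oz k l x)) h k l x =
    conv4 (\<lambda>h k l x. \<omega> a b c * Q4 eps eps (\<gamma> ?g) eps h k l x)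
     (\<lambda>h k l x. (\<omega> a (b + c) d * \<omega> b c d) * Q4 eps eps eps (\<gamma> (lam a (b + c) * lam b c)) h k l x) h k l x"
    by (rule conv4_hom[OF d Q(3) qform_conv4[OF Q(4,5)] F(3) E[OF lform_eps \<gamma>_alg(1)[OF \<Gamma>0(4)[OF \<Gamma>0(6,6)]]]])
      (simp_all add: R1, simp_all add: Oz(2) G3_def e2_def Q4_def mult_ac)
  have g: "lam (a + b) c * ?g = lam a (b + c) * lam b c"
    using lam_cocycle[of a b c] \<Gamma>0_comm by (metis \<Gamma>0(6))
  show "conv4 (\<lambda>h k l x. Oz (mz h k) l x) (\<lambda>h k l x. Oz h k (mz l x)) h k l x =
   conv4 (\<lambda>h k l x. Oz h k l * eps x) (conv4 (\<lambda>h k l x. Oz h (mz k l) x) (\<lambda>h k l x. eps h * Oz k l x)) h k l x"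
    unfolding L R conv4_scale Q4_Q4
    using \<omega>_cond[of a b c d] by (simp add: conv1_eps lform_eps \<gamma>_alg g flip: \<gamma>(2)) (simp add: Q4_def mult_ac)
qed

lemma coquasi_bialgebra_z: "coquasi_bialgebra H mz 1 Oz"
  unfolding coquasi_bialgebra_def
proof (intro conjI allI)
  show "\<exists>\<Omega>'. is_cinv3 H Oz \<Omega>'" using Oz_cinv by blast
  fix h k l x
  show "sw2 H h (\<lambda>h1 h2. sw2 H k (\<lambda>k1 k2. sw2 H l (\<lambda>l1 l2. scH (Oz h2 k2 l2) (mz (mz h1 k1) l1)))) =
    sw2 H h (\<lambda>h1 h2. sw2 H k (\<lambda>k1 k2. sw2 H l (\<lambda>l1 l2. scH (Oz h1 k1 l1) (mz h2 (mz k2 l2)))))"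
    using Oz_mult[of h k l] by (simp add: S3_def)
  have q: "qform (\<lambda>h k l t. Oz h (mz k l) t)" by (auto simp: qform_def quadlin_on_def intro!: lin)
  show "sw2 H h (\<lambda>h1 h2. sw2 H k (\<lambda>k1 k2. sw2 H l (\<lambda>l1 l2. sw2 H x (\<lambda>t1 t2.
         Oz (mz h1 k1) l1 t1 * Oz h2 k2 (mz l2 t2))))) =
       sw2 H h (\<lambda>h1 h2. sw3 H k (\<lambda>k1 k2 k3. sw3 H l (\<lambda>l1 l2 l3. sw2 H x (\<lambda>t1 t2.
         Oz h1 k1 l1 * Oz h2 (mz k2 l2) t1 * Oz k3 l3 t2))))"
    using Oz_pentagon[of h k l x] unfolding pentagon_rhs[OF Oz(1) q Oz(1)] by (simp add: conv4_def S4_def)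
qed (simp_all add: coalgebra mz_coalg grouplike_1 Oz(1) mz_unit Oz_unit)

section \<open>The zested r-form and its hexagons\<close>

lemma lform_r: "lform H (r g)"
  by (simp add: lform_linv lin)

lemma tform_c: "g \<in> \<Gamma>0 ==> tform (\<lambda>h k l. c * G3 (\<gamma> g) h k l)" "g \<in> \<Gamma>0 ==> tform (\<lambda>h k l. c * G2 (\<gamma> g) h k l)"
  by (intro tform_scale tform_G \<gamma>_alg, assumption)+

text \<open>Multiplicativity of \<open>r\<close> in its second argument as a convolution identity of
  padded forms, the shape in which the side of the hexagon with two braidings presents
  itself.\<close>

lemma r_mult12: "conv3 H (\<lambda>h k l. r h k * eps l) (\<lambda>h k l. r h l * eps k) = (\<lambda>h k l. r h (k * l))"
proof (intro ext)
  fix h k l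
  have "conv3 H (\<lambda>h k l. r h k * eps l) (\<lambda>h k l. r h l * eps k) h k l = sw2 H h (\<lambda>h1 h2. sw2 H l (\<lambda>l1 l2. eps l1 * (r h1 k * r h2 l2)))"
    unfolding conv3_pad2[OF tform_pads(1)[OF r(1)]] by (simp add: mult_ac)
  also have "... = sw2 H h (\<lambda>h1 h2. r h1 k * r h2 l)"
    by (intro sw2_cong sw2_eps_left lin)
  finally show "conv3 H (\<lambda>h k l. r h k * eps l) (\<lambda>h k l. r h l * eps k) h k l = r h (k * l)"
    by (simp add: r(2))
qed

lemma r_mult23: "conv3 H (\<lambda>h k l. eps h * r k l) (\<lambda>h k l. r h l * eps k) = (\<lambda>h k l. r (h * k) l)"
proof (intro ext)
  fix h k l
  have "conv3 H (\<lambda>h k l. eps h * r k l) (\<lambda>h k l. r h l * eps k) h k l = sw2 H h (\<lambda>h1 h2. eps h1 * sw2 H l (\<lambda>l1 l2. r h2 l2 * r k l1))"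
    unfolding conv3_pad2[OF tform_pads(3)[OF r(1)]] by (simp add: mult_ac sw2_mult_left)
  also have "... = sw2 H l (\<lambda>l1 l2. r h l2 * r k l1)"
    by (intro sw2_eps_left lin vsF)
  finally show "conv3 H (\<lambda>h k l. eps h * r k l) (\<lambda>h k l. r h l * eps k) h k l = r (h * k) l"
    by (simp add: r(5))
qed

text \<open>In fixed degrees both sides carry the scalar \<open>t a b\<close> and a right factor
  \<lambda>. The opposite product contributes \<lambda>(b, a), and here the symmetry of \<lambda> is
  essential.\<close>

lemma r_comm_z:
  "S2 h k (\<lambda>h1 k1 h2 k2. scH (rz h1 k1) (mz k2 h2)) = S2 h k (\<lambda>h1 k1 h2 k2. scH (rz h2 k2) (mz h1 k1))"
proof -
  have "(\<lambda>h k. S2 h k (\<lambda>h1 k1 h2 k2. scH (rz h1 k1) (mz k2 h2))) = (\<lambda>h k. S2 h k (\<lambda>h1 k1 h2 k2. scH (rz h2 k2) (mz h1 k1)))"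
  proof (rule bilin_hom_ext[where s = scH])
    fix a b h k assume d: "h \<in> Hd a" "k \<in> Hd b"
    have lm: "Vector_Spaces.linear scH scH (\<lambda>x. scH (t a b) x * lam a b)"
      by (auto simp: linear_iff_linv intro!: lin)
    have "S2 h k (\<lambda>h1 k1 h2 k2. scH (rz h1 k1) (mz k2 h2)) = S2 h k (\<lambda>h1 k1 h2 k2. scH (t a b) (scH (r h1 k1) (k2 * h2)) * lam a b)"
      by (rule S2_hom_cong[OF d vsH]) (auto simp: rz(2) mz(2) scH_mult vs_rules(3)[OF vsH] lam_sym[of b a] intro!: lin)
    also have "... = S2 h k (\<lambda>h1 k1 h2 k2. scH (t a b) (scH (r h2 k2) (h1 * k1)) * lam a b)"
      unfolding S2_def sw2_linear[OF lm, symmetric] r(6) ..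
    also have "... = S2 h k (\<lambda>h1 k1 h2 k2. scH (rz h2 k2) (mz h1 k1))"
      by (rule S2_hom_cong[OF d vsH]) (auto simp: rz(2) mz(2) scH_mult vs_rules(3)[OF vsH] intro!: lin)
    finally show "S2 h k (\<lambda>h1 k1 h2 k2. scH (rz h1 k1) (mz k2 h2)) = S2 h k (\<lambda>h1 k1 h2 k2. scH (rz h2 k2) (mz h1 k1))" .
  qed (rule bilinI; auto simp: S2_def intro!: lin)+
  then show ?thesis by meson
qed

lemma rz_cinv: "\<exists>q. is_cinv2 H rz q"
proof -
  define q where "q h k = glue (\<lambda>a h. glue (\<lambda>b k. inverse (t a b) * ri h k) k) h" for h k
  have F: "\<And>a b. bform (\<lambda>h k. inverse (t a b) * ri h k)" "\<And>a b. bform (\<lambda>h k. t a b * r h k)"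
    by (rule bilinI; auto intro!: lin)+
  note g = glue2[where F = "\<lambda>a b h k. inverse (t a b) * ri h k", OF F(1) vsF]
  have q: "bform q" "\<And>a b h k. h \<in> Hd a ==> k \<in> Hd b ==> q h k = inverse (t a b) * ri h k"
    unfolding q_def[abs_def] by (rule g, rule g)
  have sc: "conv2 H (\<lambda>h k. c * p h k) (\<lambda>h k. d * q h k) h k = (c * d) * conv2 H p q h k" for c d p q h k
    unfolding conv2_def by (simp add: sw2_mult_left mult_ac)
  have "conv2 H rz q = e2"
  proof (rule bilin_hom_ext[where s = "(*)"])
    fix a b h k assume d: "h \<in> Hd a" "k \<in> Hd b"
    have "conv2 H rz q h k = conv2 H (\<lambda>h k. t a b * r h k) (\<lambda>h k. inverse (t a b) * ri h k) h k"
      by (rule conv2_hom[OF d rz(1) q(1) F(2,1)]) (simp_all add: rz(2) q(2))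
    then show "conv2 H rz q h k = e2 h k" by (simp add: sc ri t)
  qed (intro bform_conv2 rz q bform_e2)+
  moreover have "conv2 H q rz = e2"
  proof (rule bilin_hom_ext[where s = "(*)"])
    fix a b h k assume d: "h \<in> Hd a" "k \<in> Hd b"
    have "conv2 H q rz h k = conv2 H (\<lambda>h k. inverse (t a b) * ri h k) (\<lambda>h k. t a b * r h k) h k"
      by (rule conv2_hom[OF d q(1) rz(1) F(1,2)]) (simp_all add: rz(2) q(2))
    then show "conv2 H q rz h k = e2 h k" by (simp add: sc ri t)
  qed (intro bform_conv2 rz q bform_e2)+
  ultimately show ?thesis using q(1) by (auto simp: is_cinv2_e2)
qed

lemma rz_mz:
  assumes "h \<in> Hd a" "k \<in> Hd b" "l \<in> Hd c"
  shows "rz h (mz k l) = t a (b + c) * r h (k * l * lam b c)" "rz (mz h k) l = t (a + b) c * r (h * k * lam a b) l"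
  using rz(2)[OF assms(1) mz_deg[OF assms(2,3)]] rz(2)[OF mz_deg[OF assms(1,2)] assms(3)]
  by (simp_all add: mz(2)[OF assms(1,2)] mz(2)[OF assms(2,3)])

lemma mz_Sz:
  assumes "h \<in> Hd a" "k \<in> Hd a"
  shows "mz (Sz h) k = S (lam (- a) a) * P (- a) (S h) * k * lam (- a) a"
    "mz h (Sz k) = h * (S (lam (- a) a) * P (- a) (S k)) * lam a (- a)"
  using mz(2)[OF Sz_deg[OF assms(1)] assms(2)] mz(2)[OF assms(1) Sz_deg[OF assms(2)]]
  by (simp_all add: Sz(2)[OF assms(1)] Sz(2)[OF assms(2)])

lemma \<gamma>_Sz: "g \<in> \<Gamma>0 ==> h \<in> Hd a ==> \<gamma> g (Sz h) = \<gamma> g (S (lam (- a) a)) * \<gamma> g (P (- a) (S h))"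
  by (simp add: Sz(2) \<gamma>_alg)

text \<open>On the left, \<open>r\<close> at \<open>k * l * lam b c\<close> splits off
  \<open>r\<close> at \<lambda>(b, c), which cancels against the \<gamma>(\<lambda>(b, c)) of the
  associator. On the right, \<gamma>(\<lambda>(a, b)) commutes past \<open>r\<close> in the other
  variables and cancels against its inverse in \<open>Ozi\<close>. Both sides are multiples of
  \<open>r h (k * l)\<close>, with equal scalars by the first equation for \<open>t\<close>.\<close>

lemma hexagon1_z:
  "conv3 H (\<lambda>h k l. rz h (mz k l)) (\<lambda>h k l. Oz k l h) h k l =
   conv3 H Ozi (conv3 H (\<lambda>h k l. rz h k * eps l) (conv3 H (\<lambda>h k l. Oz k h l) (\<lambda>h k l. rz h l * eps k))) h k l"
proof -
  have T: "tform (\<lambda>h k l. rz h (mz k l))" "tform (\<lambda>h k l. Oz k l h)" "tform (\<lambda>h k l. rz h k * eps l)"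
    "tform (\<lambda>h k l. Oz k h l)" "tform (\<lambda>h k l. rz h l * eps k)" "tform (\<lambda>h k l. r h k * eps l)"
    "tform (\<lambda>h k l. r h l * eps k)" "\<And>g. tform (\<lambda>h k l. r h (k * l * g))" "tform (\<lambda>h k l. r h (k * l))"
    by (auto intro!: trilinI lin)
  have "conv3 H (\<lambda>h k l. rz h (mz k l)) (\<lambda>h k l. Oz k l h) =
    conv3 H Ozi (conv3 H (\<lambda>h k l. rz h k * eps l) (conv3 H (\<lambda>h k l. Oz k h l) (\<lambda>h k l. rz h l * eps k)))"
  proof (rule tform_hom_ext)
    fix a b c h k l assume d: "h \<in> Hd a" "k \<in> Hd b" "l \<in> Hd c"
    let ?g = "lam a b" and ?g' = "lam b c"
    have TG: "tform (\<lambda>h k l. c * (e2 k l * \<gamma> ?g' h))" for c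
      by (rule trilinI) (auto simp: e2_def intro!: lin)
    have "conv3 H (\<lambda>h k l. rz h (mz k l)) (\<lambda>h k l. Oz k l h) h k l =
      conv3 H (\<lambda>h k l. t a (b + c) * r h (k * l * ?g')) (\<lambda>h k l. \<omega> b c a * (e2 k l * \<gamma> ?g' h)) h k l"
      by (rule conv3_hom[OF d T(1,2) tform_scale[OF T(8)] TG])
        (simp_all add: rz_mz Oz(2) G3_def)
    also have "... = (t a (b + c) * \<omega> b c a) * sw2 H h (\<lambda>h1 h2. r h1 (k * l * ?g') * \<gamma> ?g' h2)"
      unfolding conv3_scale conv3_G1R[OF T(8)] by (simp add: mult_ac)
    also have "sw2 H h (\<lambda>h1 h2. r h1 (k * l * ?g') * \<gamma> ?g' h2) = sw2 H h (\<lambda>u v. sw2 H u (\<lambda>u1 u2. r u1 (k * l) * r u2 ?g' * \<gamma> ?g' v))"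
      unfolding r(2)[of _ "k * l" ?g'] sw2_mult_right ..
    also have "... = sw2 H h (\<lambda>u v. sw2 H v (\<lambda>v1 v2. r u (k * l) * r v1 ?g' * \<gamma> ?g' v2))"
      by (rule sw2_coassoc[OF vsF]) (auto intro!: lin)
    also have "... = sw2 H h (\<lambda>u v. r u (k * l) * conv1 (\<lambda>h. r h ?g') (\<gamma> ?g') v)"
      by (simp add: conv1_def sw2_mult_left mult.assoc)
    also have "... = r h (k * l)"
      unfolding \<gamma>_r(1)[OF \<Gamma>0(6)] by (intro sw2_eps_right lin)
    finally have L: "conv3 H (\<lambda>h k l. rz h (mz k l)) (\<lambda>h k l. Oz k l h) h k l = t a (b + c) * \<omega> b c a * r h (k * l)" .
    let ?c = "inverse (\<omega> a b c) * (t a b * (\<omega> b a c * t a c))"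
    have c: "t a (b + c) * \<omega> b c a = ?c" using t(2)[of a b c] by (simp add: field_simps)
    have R1: "conv3 H (\<lambda>h k l. Oz k h l) (\<lambda>h k l. rz h l * eps k) h k l =
      \<omega> b a c * t a c * conv3 H (G3 (\<gamma> ?g)) (\<lambda>h k l. r h l * eps k) h k l"
      if "h \<in> Hd a" "k \<in> Hd b" "l \<in> Hd c" for h k l
    proof -
      have "conv3 H (\<lambda>h k l. Oz k h l) (\<lambda>h k l. rz h l * eps k) h k l =
        conv3 H (\<lambda>h k l. \<omega> b a c * G3 (\<gamma> ?g) h k l) (\<lambda>h k l. t a c * (r h l * eps k)) h k l"
        by (rule conv3_hom[OF that T(4,5) tform_c(1)[OF \<Gamma>0(6)] tform_scale[OF T(7)]])
          (simp_all add: Oz(2) rz(2) G3_def e2_def lam_sym[of b a] mult_ac)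
      then show ?thesis unfolding conv3_scale by (simp add: mult.assoc)
    qed
    have TR1: "tform (conv3 H (G3 (\<gamma> ?g)) (\<lambda>h k l. r h l * eps k))"
      by (intro tform_conv3 tform_G \<gamma>_alg T \<Gamma>0(6))
    have R2: "conv3 H (\<lambda>h k l. rz h k * eps l) (conv3 H (\<lambda>h k l. Oz k h l) (\<lambda>h k l. rz h l * eps k)) h k l =
      t a b * (\<omega> b a c * t a c) * conv3 H (\<lambda>h k l. r h k * eps l) (conv3 H (G3 (\<gamma> ?g)) (\<lambda>h k l. r h l * eps k)) h k l"
      if "h \<in> Hd a" "k \<in> Hd b" "l \<in> Hd c" for h k l
    proof -
      have "conv3 H (\<lambda>h k l. rz h k * eps l) (conv3 H (\<lambda>h k l. Oz k h l) (\<lambda>h k l. rz h l * eps k)) h k l =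
        conv3 H (\<lambda>h k l. t a b * (r h k * eps l)) (\<lambda>h k l. \<omega> b a c * t a c * conv3 H (G3 (\<gamma> ?g)) (\<lambda>h k l. r h l * eps k) h k l) h k l"
        by (rule conv3_hom[OF that T(3) tform_conv3[OF T(4,5)] tform_scale[OF T(6)] tform_scale[OF TR1]])
          (simp_all add: R1 rz(2))
      then show ?thesis unfolding conv3_scale by (simp add: mult_ac)
    qed
    have "conv3 H Ozi (conv3 H (\<lambda>h k l. rz h k * eps l) (conv3 H (\<lambda>h k l. Oz k h l) (\<lambda>h k l. rz h l * eps k))) h k l =
      conv3 H (\<lambda>h k l. inverse (\<omega> a b c) * G3 (\<gamma> (S ?g)) h k l)
       (\<lambda>h k l. t a b * (\<omega> b a c * t a c) * conv3 H (\<lambda>h k l. r h k * eps l) (conv3 H (G3 (\<gamma> ?g)) (\<lambda>h k l. r h l * eps k)) h k l) h k l"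
      by (rule conv3_hom[OF d Ozi(1) tform_conv3[OF T(3) tform_conv3[OF T(4,5)]] tform_c(1) tform_scale[OF tform_conv3[OF T(6) TR1]]])
        (simp_all add: R2 Ozi(2))
    also have "... = ?c * conv3 H (G3 (\<gamma> (S ?g))) (conv3 H (\<lambda>h k l. r h k * eps l) (conv3 H (G3 (\<gamma> ?g)) (\<lambda>h k l. r h l * eps k))) h k l"
      unfolding conv3_scale by (simp add: mult_ac)
    also have "conv3 H (G3 (\<gamma> (S ?g))) (conv3 H (\<lambda>h k l. r h k * eps l) (conv3 H (G3 (\<gamma> ?g)) (\<lambda>h k l. r h l * eps k))) =
      conv3 H (G3 (\<gamma> (S ?g))) (conv3 H (conv3 H (\<lambda>h k l. r h k * eps l) (G3 (\<gamma> ?g))) (\<lambda>h k l. r h l * eps k))"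
      by (simp add: conv3_assoc tform_G \<gamma>_alg T)
    also have "... = conv3 H (conv3 H (G3 (\<gamma> (S ?g))) (G3 (\<gamma> ?g))) (conv3 H (\<lambda>h k l. r h k * eps l) (\<lambda>h k l. r h l * eps k))"
      unfolding G3_comm[OF r(1) \<gamma>_alg(1)[OF \<Gamma>0(6)]] by (simp add: conv3_assoc tform_G \<gamma>_alg T tform_conv3)
    also have "... = (\<lambda>h k l. r h (k * l))"
      by (simp add: G3_G3 \<gamma>_inv G3_eps r_mult12 T)
    finally show "conv3 H (\<lambda>h k l. rz h (mz k l)) (\<lambda>h k l. Oz k l h) h k l =
      conv3 H Ozi (conv3 H (\<lambda>h k l. rz h k * eps l) (conv3 H (\<lambda>h k l. Oz k h l) (\<lambda>h k l. rz h l * eps k))) h k l"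
      unfolding L c by simp
  qed (intro tform_conv3 T Ozi)+
  from this[THEN fun_cong, THEN fun_cong, THEN fun_cong] show ?thesis .
qed

text \<open>The character condition on \<open>g\<close> is convolved on the left with
  \<open>\<gamma> g\<close>, the inverse of \<open>r\<close> with second argument
  \<open>g\<close>.\<close>

lemma r_character:
  assumes "induces_character H r \<pi> g \<chi>" "g \<in> \<Gamma>0" "l \<in> Hd c"
  shows "r g l = \<chi> c * \<gamma> g l"
proof -
  have l: "lform H (\<lambda>h. r h g)" "lform H (\<lambda>h. \<chi> c * eps h)" by (auto simp: lform_linv intro!: lin)
  have "r g l = conv1 (conv1 (\<gamma> g) (\<lambda>h. r h g)) (r g) l"
    by (simp add: \<gamma>_r[OF assms(2)] conv1_eps lform_r)
  also have "... = conv1 (\<gamma> g) (conv1 (\<lambda>h. r h g) (r g)) l"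
    by (simp add: conv1_assoc \<gamma>_alg assms l lform_r)
  also have "... = conv1 (\<gamma> g) (\<lambda>h. \<chi> c * eps h) l"
    by (rule conv1_hom[OF assms(3)])
      (use assms(1,2) in \<open>auto simp: \<gamma>_alg l lform_conv1 lform_r conv1_def induces_character_def\<close>)
  also have "... = \<chi> c * conv1 (\<gamma> g) eps l"
    by (simp add: conv1_def sw2_mult_left mult_ac)
  finally show ?thesis by (simp add: conv1_eps \<gamma>_alg assms)
qed

lemma r_lam_left:
  assumes "l \<in> Hd c"
  shows "r (lam a b) l * (\<omega> a c b * t (a + b) c) = \<omega> a b c * \<omega> c a b * (t a c * t b c) * \<gamma> (lam a b) l"
proof -
  obtain \<chi> where \<chi>: "induces_character H r \<pi> (lam a b) \<chi>"
    using datum unfolding braided_zesting_datum_def by meson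
  then have "\<chi> c = (\<omega> a b c * \<omega> c a b / \<omega> a c b) * (t a c * t b c / t (a + b) c)"
    using datum unfolding braided_zesting_datum_def by meson
  with r_character[OF \<chi> _ assms] show ?thesis by (simp add: t field_simps)
qed

text \<open>Here \<lambda>(a, b) enters the first argument of \<open>r\<close> and produces
  \<open>r (lam a b)\<close> on the first coproduct factor of \<open>l\<close>. By
  \<open>r_lam_left\<close> it is a multiple of \<gamma>(\<lambda>(a, b)), which is the contribution
  of \<open>Oz\<close> on the other side. The factor in the variable \<open>k\<close> coming from
  \<open>Ozi\<close> commutes with \<open>r\<close> in \<open>h\<close> and
  \<open>l\<close>.\<close>

lemma hexagon2_z:
  "conv3 H (\<lambda>h k l. rz (mz h k) l) (\<lambda>h k l. Ozi l h k) h k l =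
   conv3 H Oz (conv3 H (\<lambda>h k l. eps h * rz k l) (conv3 H (\<lambda>h k l. Ozi h l k) (\<lambda>h k l. rz h l * eps k))) h k l"
proof -
  have T: "tform (\<lambda>h k l. rz (mz h k) l)" "tform (\<lambda>h k l. Ozi l h k)" "tform (\<lambda>h k l. eps h * rz k l)"
    "tform (\<lambda>h k l. Ozi h l k)" "tform (\<lambda>h k l. rz h l * eps k)" "tform (\<lambda>h k l. eps h * r k l)"
    "tform (\<lambda>h k l. r h l * eps k)" "\<And>g. tform (\<lambda>h k l. r (h * k * g) l)" "tform (\<lambda>h k l. r (h * k) l)"
    by (auto intro!: trilinI lin)
  have "conv3 H (\<lambda>h k l. rz (mz h k) l) (\<lambda>h k l. Ozi l h k) =
    conv3 H Oz (conv3 H (\<lambda>h k l. eps h * rz k l) (conv3 H (\<lambda>h k l. Ozi h l k) (\<lambda>h k l. rz h l * eps k)))"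
  proof (rule tform_hom_ext)
    fix a b c h k l assume d: "h \<in> Hd a" "k \<in> Hd b" "l \<in> Hd c"
    let ?g = "lam a b" and ?g' = "lam c a"
    let ?X = "conv3 H (G3 (\<gamma> ?g)) (conv3 H (\<lambda>h k l. r (h * k) l) (G2 (\<gamma> (S ?g'))))"
    have TG: "tform (G2 (\<gamma> (S ?g')))" by (simp add: tform_G \<gamma>_alg)
    have "conv3 H (\<lambda>h k l. rz (mz h k) l) (\<lambda>h k l. Ozi l h k) h k l =
      conv3 H (\<lambda>h k l. t (a + b) c * r (h * k * ?g) l) (\<lambda>h k l. inverse (\<omega> c a b) * G2 (\<gamma> (S ?g')) h k l) h k l"
      by (rule conv3_hom[OF d T(1,2) tform_scale[OF T(8)] tform_c(2)])
        (simp_all add: rz_mz Ozi(2) G2_def G3_def e2_def mult_ac)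
    also have "... = t (a + b) c * inverse (\<omega> c a b) * conv3 H (conv3 H (G3 (r ?g)) (\<lambda>h k l. r (h * k) l)) (G2 (\<gamma> (S ?g'))) h k l"
      unfolding conv3_scale conv3_G3L[OF T(9), abs_def] r(5)[of _ ?g] by (simp add: mult_ac)
    also have "conv3 H (conv3 H (G3 (r ?g)) (\<lambda>h k l. r (h * k) l)) (G2 (\<gamma> (S ?g'))) =
      conv3 H (G3 (r ?g)) (conv3 H (\<lambda>h k l. r (h * k) l) (G2 (\<gamma> (S ?g'))))"
      by (simp add: conv3_assoc tform_G lform_r TG T)
    also have "t (a + b) c * inverse (\<omega> c a b) * conv3 H (G3 (r ?g)) (conv3 H (\<lambda>h k l. r (h * k) l) (G2 (\<gamma> (S ?g')))) h k l =
      \<omega> a b c * (t b c * (inverse (\<omega> a c b) * t a c)) * ?X h k l"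
    proof -
      have "conv3 H (G3 (r ?g)) (conv3 H (\<lambda>h k l. r (h * k) l) (G2 (\<gamma> (S ?g')))) h k l =
        conv3 H (\<lambda>h k l. (\<omega> a b c * \<omega> c a b * (t a c * t b c) / (\<omega> a c b * t (a + b) c)) * G3 (\<gamma> ?g) h k l)
          (conv3 H (\<lambda>h k l. r (h * k) l) (G2 (\<gamma> (S ?g')))) h k l"
        using r_lam_left[of _ c a b]
        by (intro conv3_hom[OF d tform_G(2)[OF lform_r] tform_conv3[OF T(9) TG] tform_c(1)[OF \<Gamma>0(6)] tform_conv3[OF T(9) TG]])
          (auto simp: G3_def t field_simps)
      then show ?thesis unfolding conv3_scale by (simp add: t field_simps)
    qed
    finally have L: "conv3 H (\<lambda>h k l. rz (mz h k) l) (\<lambda>h k l. Ozi l h k) h k l =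
      \<omega> a b c * (t b c * (inverse (\<omega> a c b) * t a c)) * ?X h k l" .
    have R1: "conv3 H (\<lambda>h k l. Ozi h l k) (\<lambda>h k l. rz h l * eps k) h k l =
      inverse (\<omega> a c b) * t a c * conv3 H (\<lambda>h k l. r h l * eps k) (G2 (\<gamma> (S ?g'))) h k l"
      if "h \<in> Hd a" "k \<in> Hd b" "l \<in> Hd c" for h k l
    proof -
      have "conv3 H (\<lambda>h k l. Ozi h l k) (\<lambda>h k l. rz h l * eps k) h k l =
        conv3 H (\<lambda>h k l. inverse (\<omega> a c b) * G2 (\<gamma> (S ?g')) h k l) (\<lambda>h k l. t a c * (r h l * eps k)) h k l"
        by (rule conv3_hom[OF that T(4,5) tform_c(2) tform_scale[OF T(7)]])
          (simp_all add: Ozi(2) rz(2) G2_def G3_def e2_def lam_sym[of c a] mult_ac)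
      then show ?thesis unfolding conv3_scale by (simp add: G2_comm r(1) \<gamma>_alg mult.assoc)
    qed
    have TR1: "tform (conv3 H (\<lambda>h k l. r h l * eps k) (G2 (\<gamma> (S ?g'))))"
      by (intro tform_conv3 TG T)
    have R2: "conv3 H (\<lambda>h k l. eps h * rz k l) (conv3 H (\<lambda>h k l. Ozi h l k) (\<lambda>h k l. rz h l * eps k)) h k l =
      t b c * (inverse (\<omega> a c b) * t a c) * conv3 H (\<lambda>h k l. r (h * k) l) (G2 (\<gamma> (S ?g'))) h k l"
      if "h \<in> Hd a" "k \<in> Hd b" "l \<in> Hd c" for h k l
    proof -
      have "conv3 H (\<lambda>h k l. eps h * rz k l) (conv3 H (\<lambda>h k l. Ozi h l k) (\<lambda>h k l. rz h l * eps k)) h k l =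
        conv3 H (\<lambda>h k l. t b c * (eps h * r k l)) (\<lambda>h k l. inverse (\<omega> a c b) * t a c * conv3 H (\<lambda>h k l. r h l * eps k) (G2 (\<gamma> (S ?g'))) h k l) h k l"
        by (rule conv3_hom[OF that T(3) tform_conv3[OF T(4,5)] tform_scale[OF T(6)] tform_scale[OF TR1]])
          (simp_all add: R1 rz(2))
      then show ?thesis
        unfolding conv3_scale conv3_assoc[OF T(6,7) TG, symmetric] r_mult23 by (simp add: mult_ac)
    qed
    have "conv3 H Oz (conv3 H (\<lambda>h k l. eps h * rz k l) (conv3 H (\<lambda>h k l. Ozi h l k) (\<lambda>h k l. rz h l * eps k))) h k l =
      conv3 H (\<lambda>h k l. \<omega> a b c * G3 (\<gamma> ?g) h k l)
       (\<lambda>h k l. t b c * (inverse (\<omega> a c b) * t a c) * conv3 H (\<lambda>h k l. r (h * k) l) (G2 (\<gamma> (S ?g'))) h k l) h k l"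
      by (rule conv3_hom[OF d Oz(1) tform_conv3[OF T(3) tform_conv3[OF T(4,5)]] tform_c(1) tform_scale[OF tform_conv3[OF T(9) TG]]])
        (simp_all add: R2 Oz(2))
    also have "... = \<omega> a b c * (t b c * (inverse (\<omega> a c b) * t a c)) * ?X h k l"
      unfolding conv3_scale by (simp add: mult_ac)
    finally show "conv3 H (\<lambda>h k l. rz (mz h k) l) (\<lambda>h k l. Ozi l h k) h k l =
      conv3 H Oz (conv3 H (\<lambda>h k l. eps h * rz k l) (conv3 H (\<lambda>h k l. Ozi h l k) (\<lambda>h k l. rz h l * eps k))) h k l"
      unfolding L ..
  qed (intro tform_conv3 T Oz)+
  from this[THEN fun_cong, THEN fun_cong, THEN fun_cong] show ?thesis .
qed

lemma coquasitriangular_z: "coquasitriangular H mz 1 Oz rz"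
  unfolding coquasitriangular_def Ozi_eq
proof (intro conjI allI)
  fix h k l
  have T: "tform (\<lambda>h k l. Oz k h l)" "tform (\<lambda>h k l. Ozi h l k)" by (auto intro!: trilinI lin)
  show "sw2 H h (\<lambda>h1 h2. sw2 H k (\<lambda>k1 k2. scH (rz h1 k1) (mz k2 h2))) =
       sw2 H h (\<lambda>h1 h2. sw2 H k (\<lambda>k1 k2. scH (rz h2 k2) (mz h1 k1)))"
    using r_comm_z[of h k] by (simp add: S2_def)
  show "sw2 H h (\<lambda>h1 h2. sw2 H k (\<lambda>k1 k2. sw2 H l (\<lambda>l1 l2. rz h1 (mz k1 l1) * Oz k2 l2 h2))) =
       sw4 H h (\<lambda>h1 h2 h3 h4. sw3 H k (\<lambda>k1 k2 k3. sw3 H l (\<lambda>l1 l2 l3.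
         Ozi h1 k1 l1 * rz h2 k2 * Oz k3 h3 l2 * rz h4 l3)))"
    using hexagon1_z[of h k l] unfolding hexagon1_rhs[OF Ozi(1) T(1) rz(1) rz(1)] by (simp add: conv3_def)
  show "sw2 H h (\<lambda>h1 h2. sw2 H k (\<lambda>k1 k2. sw2 H l (\<lambda>l1 l2. rz (mz h1 k1) l1 * Ozi l2 h2 k2))) =
       sw3 H h (\<lambda>h1 h2 h3. sw3 H k (\<lambda>k1 k2 k3. sw4 H l (\<lambda>l1 l2 l3 l4.
         Oz h1 k1 l1 * rz k2 l2 * Ozi h2 l3 k3 * rz h3 l4)))"
    using hexagon2_z[of h k l] unfolding hexagon2_rhs[OF Oz(1) T(2) rz(1) rz(1)] by (simp add: conv3_def)
qed (use rz_cinv in \<open>simp_all add: coquasi_bialgebra_z rz(1)\<close>)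

section \<open>The antipode of the zesting and the zig-zag identities\<close>

lemma antipode_z: "sw2 H h (\<lambda>h1 h2. mz (Sz h1) h2) = scH (eps h) 1"
proof (rule hdeg_ext[OF _ _ vsH, where f = "\<lambda>h. sw2 H h (\<lambda>h1 h2. mz (Sz h1) h2)" and g = "\<lambda>h. scH (eps h) 1"])
  fix a h assume d: "h \<in> Hd a"
  let ?g = "lam (- a) a"
  have lm: "Vector_Spaces.linear scH scH (\<lambda>x. S ?g * x * ?g)" by (auto simp: linear_iff_linv intro!: lin)
  have "sw2 H h (\<lambda>h1 h2. mz (Sz h1) h2) = sw2 H h (\<lambda>h1 h2. S ?g * (P (- a) (S h1) * h2) * ?g)"
    by (rule sw2_hom_cong[OF d vsH]) (auto simp: mz_Sz mult.assoc intro!: lin)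
  also have "... = scH (eps h) 1"
    unfolding sw2_linear[OF lm, symmetric] antipode_hom[OF d] by (simp add: scH_mult S_\<Gamma>0)
  finally show "sw2 H h (\<lambda>h1 h2. mz (Sz h1) h2) = scH (eps h) 1" .
qed (auto intro!: lin)

text \<open>The inverse of \<lambda>(-a, a) stands between \<open>h1\<close> and the antipode of
  \<open>h3\<close>. The form \<gamma>(\<lambda>(-a, a)) inside \<open>\<beta>z\<close> allows
  \<open>\<gamma>_comm\<close> to move it to the left end; then \<open>antipode_hom\<close> applies
  and the outer group-like factors cancel.\<close>

lemma antipode_\<beta>z: "sw3 H h (\<lambda>h1 h2 h3. scH (\<beta>z h2) (mz h1 (Sz h3))) = scH (\<beta>z h) 1"
proof (rule hdeg_ext[OF _ _ vsH, where f = "\<lambda>h. sw3 H h (\<lambda>h1 h2 h3. scH (\<beta>z h2) (mz h1 (Sz h3)))" and g = "\<lambda>h. scH (\<beta>z h) 1"])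
  fix a h assume d: "h \<in> Hd a"
  let ?g = "lam (- a) a" and ?w = "\<omega> a (- a) a"
  have "sw3 H h (\<lambda>h1 h2 h3. scH (\<beta>z h2) (mz h1 (Sz h3))) =
    sw2 H h (\<lambda>h1 h'. sw2 H h' (\<lambda>h2 h3. scH ?w (scH (\<gamma> ?g h2) (h1 * S ?g) * P (- a) (S h3) * ?g)))"
    unfolding sw3_def
    by (rule sw2_hom_cong[OF d vsH]; (rule sw2_hom_cong[OF _ vsH])?)
      (auto simp: mz_Sz \<beta>z(2) scH_mult vs_rules(3)[OF vsH] lam_sym[of a "- a"] mult.assoc intro!: lin)
  also have "... = sw2 H h (\<lambda>h' h3. sw2 H h' (\<lambda>h1 h2. scH ?w (scH (\<gamma> ?g h2) (h1 * S ?g) * P (- a) (S h3) * ?g)))"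
    by (rule sw2_coassoc[OF vsH, symmetric]) (auto intro!: lin)
  also have "... = sw2 H h (\<lambda>h' h3. sw2 H h' (\<lambda>h1 h2. scH ?w (scH (\<gamma> ?g h1) (S ?g * h2) * P (- a) (S h3) * ?g)))"
  proof (rule sw2_cong)
    fix h' h3
    have lm: "Vector_Spaces.linear scH scH (\<lambda>x. scH ?w (x * P (- a) (S h3) * ?g))" by (auto simp: linear_iff_linv intro!: lin)
    show "sw2 H h' (\<lambda>h1 h2. scH ?w (scH (\<gamma> ?g h2) (h1 * S ?g) * P (- a) (S h3) * ?g)) =
      sw2 H h' (\<lambda>h1 h2. scH ?w (scH (\<gamma> ?g h1) (S ?g * h2) * P (- a) (S h3) * ?g))"
      unfolding sw2_linear[OF lm, symmetric] \<gamma>_comm(2)[OF \<Gamma>0(6)] ..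
  qed
  also have "... = sw2 H h (\<lambda>h1 h'. sw2 H h' (\<lambda>h2 h3. scH ?w (scH (\<gamma> ?g h1) (S ?g * h2) * P (- a) (S h3) * ?g)))"
    by (rule sw2_coassoc[OF vsH]) (auto intro!: lin)
  also have "... = sw2 H h (\<lambda>h1 h'. scH (?w * \<gamma> ?g h1) (scH (eps h') 1))"
  proof (rule sw2_hom_cong[OF d vsH])
    fix x y assume y: "y \<in> Hd a"
    have lm: "Vector_Spaces.linear scH scH (\<lambda>z. scH (?w * \<gamma> ?g x) (S ?g * z * ?g))" by (auto simp: linear_iff_linv intro!: lin)
    have "sw2 H y (\<lambda>h2 h3. scH ?w (scH (\<gamma> ?g x) (S ?g * h2) * P (- a) (S h3) * ?g)) =
      sw2 H y (\<lambda>h2 h3. scH (?w * \<gamma> ?g x) (S ?g * (h2 * P (- a) (S h3)) * ?g))"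
      by (simp add: scH_mult vs_rules(3)[OF vsH] mult.assoc)
    then show "sw2 H y (\<lambda>h2 h3. scH ?w (scH (\<gamma> ?g x) (S ?g * h2) * P (- a) (S h3) * ?g)) = scH (?w * \<gamma> ?g x) (scH (eps y) 1)"
      unfolding sw2_linear[OF lm, symmetric] antipode_hom[OF y] by (simp add: scH_mult S_\<Gamma>0)
  qed (auto intro!: lin)
  also have "... = sw2 H h (\<lambda>h1 h'. scH (eps h') (scH (?w * \<gamma> ?g h1) 1))"
    by (simp add: vs_rules(3)[OF vsH] mult_ac)
  also have "... = scH (\<beta>z h) 1"
    unfolding \<beta>z(2)[OF d] by (intro sw2_counit(2) vsH) (auto intro!: lin)
  finally show "sw3 H h (\<lambda>h1 h2 h3. scH (\<beta>z h2) (mz h1 (Sz h3))) = scH (\<beta>z h) 1" .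
qed (auto simp: sw3_def intro!: lin)

lemma zigzag1: "sw5 H h (\<lambda>h1 h2 h3 h4 h5. \<beta>z h2 * eps h4 * Ozi h1 (Sz h3) h5) = eps h"
proof (rule hdeg_ext[where s = "(*)"])
  fix a h assume d: "h \<in> Hd a"
  let ?g = "lam (- a) a"
  have "sw5 H h (\<lambda>h1 h2 h3 h4 h5. \<beta>z h2 * eps h4 * Ozi h1 (Sz h3) h5) =
    conv1 eps (conv1 (\<gamma> ?g) (conv1 eps (conv1 eps (\<gamma> (S ?g))))) h"
    by (rule sw5_hom[OF d])
      (auto simp: lform_eps \<gamma>_alg \<beta>z(2) Ozi(2)[OF _ Sz_deg] eps_Sz G3_def e2_def lam_sym[of a "- a"] intro!: lin)
  then show "sw5 H h (\<lambda>h1 h2 h3 h4 h5. \<beta>z h2 * eps h4 * Ozi h1 (Sz h3) h5) = eps h"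
    by (simp add: conv1_eps \<gamma>_alg \<gamma>_inv lform_eps)
qed (auto simp: sw5_def sw4_def sw3_def intro!: lin)

text \<open>Three scalars multiply to 1: those of \<open>\<beta>z\<close> and of \<open>Oz\<close>
  in degrees -a, a, -a, and the value of \<gamma>(\<lambda>(-a, a)) at the group-like factor of
  \<open>Sz\<close>. What remains is \<gamma>(\<lambda>(-a, a)) convolved with its composite with
  the antipode.\<close>

lemma zigzag2: "sw5 H h (\<lambda>h1 h2 h3 h4 h5. eps h2 * \<beta>z h4 * Oz (Sz h1) h3 (Sz h5)) = eps h"
proof (rule hdeg_ext[where s = "(*)"])
  fix a h assume d: "h \<in> Hd a"
  let ?g = "lam (- a) a"
  have l: "lform H (\<lambda>h. \<gamma> ?g (P (- a) (S h)))" by (auto simp: lform_linv intro!: lin)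
  \<comment> \<open>The condition on \<omega> at (a, -a, a, -a); the three values with a zero
    argument are 1 by normalisation.\<close>
  have "\<omega> a (- a) a * \<omega> (- a) a (- a) = \<gamma> ?g ?g"
    using \<omega>_cond[of a "- a" a "- a"] by (simp add: lam_sym[of a "- a"])
  then have c: "\<omega> a (- a) a * \<omega> (- a) a (- a) * \<gamma> ?g (S ?g) = 1"
    using \<gamma>_S[of ?g ?g] by simp
  have l': "lform H (\<lambda>h. \<omega> a (- a) a * \<omega> (- a) a (- a) * \<gamma> ?g (S ?g) * \<gamma> ?g h)" by (auto simp: lform_linv intro!: lin)
  have "sw5 H h (\<lambda>h1 h2 h3 h4 h5. eps h2 * \<beta>z h4 * Oz (Sz h1) h3 (Sz h5)) =
    conv1 eps (conv1 eps (conv1 eps (conv1 (\<lambda>h. \<omega> a (- a) a * \<omega> (- a) a (- a) * \<gamma> ?g (S ?g) * \<gamma> ?g h) (\<lambda>h. \<gamma> ?g (P (- a) (S h)))))) h"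
    by (rule sw5_hom[OF d _ _ _ _ _ lform_eps lform_eps lform_eps l' l])
      (auto simp: lform_eps \<gamma>_alg \<beta>z(2) Oz(2)[OF Sz_deg _ Sz_deg] eps_Sz G3_def e2_def \<gamma>_Sz intro!: lin)
  also have "... = conv1 (\<gamma> ?g) (\<lambda>h. \<gamma> ?g (P (- a) (S h))) h"
    unfolding c by (simp add: conv1_eps lform_conv1 \<gamma>_alg l)
  also have "... = eps h"
    unfolding conv1_def by (rule eps_antipode[OF \<gamma>(1)[OF \<Gamma>0(6)] d])
  finally show "sw5 H h (\<lambda>h1 h2 h3 h4 h5. eps h2 * \<beta>z h4 * Oz (Sz h1) h3 (Sz h5)) = eps h" .
qed (auto simp: sw5_def sw4_def sw3_def intro!: lin)

theorem coquasi_hopf_z: "coquasi_hopf_algebra H mz 1 Oz"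
proof -
  \<comment> \<open>The form \<alpha> is chosen to be the counit, which the inner coproduct
    absorbs.\<close>
  have "sw3 H h (\<lambda>h1 h2 h3. scH (eps h2) (mz (Sz h1) h3)) = scH (eps h) 1" for h
  proof -
    have "sw3 H h (\<lambda>h1 h2 h3. scH (eps h2) (mz (Sz h1) h3)) = sw2 H h (\<lambda>h1 h2. mz (Sz h1) h2)"
      unfolding sw3_def by (intro sw2_cong sw2_counit(1) vsH lin)
    then show ?thesis by (simp add: antipode_z)
  qed
  then show ?thesis
    unfolding coquasi_hopf_algebra_def Ozi_eq
    using coquasi_bialgebra_z Sz(1) lin_eps \<beta>z(1)[unfolded lform_def] antipode_\<beta>z zigzag1 zigzag2 by blast
qed

end

section \<open>The zested category\<close>

lemma linv_scale_coeff:
  assumes "linv s1 V (*) f" "vector_space s"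
  shows "linv s1 V s (\<lambda>x. s (f x) v)"
  using assms by (auto simp: linv_def vs_rules)

context graded begin

lemma lform_\<delta>: "lform H (\<delta> a)"
  by (auto simp: lform_linv intro!: lin)

text \<open>The projection of a comodule onto its part of degree \<open>a\<close>; the counterpart
  of \<open>P\<close> for coactions.\<close>

definition Q :: "'g => ('k, 'h, 'u) comod => ('k, 'u) vec => ('k, 'u) vec" where
  "Q a X x = act1 X (\<delta> a) (\<lambda>y. y) x"

lemma Q_csw: "Q a X x = csw H X x (\<lambda>h y. pscale (\<delta> a h) y)"
  by (simp add: Q_def act1_def)

lemma lmap_Q: "precomod X ==> lmap X (Q a X)"
  unfolding Q_def[abs_def] by (rule lmap_act1[OF _ lform_\<delta> lmap_id])

lemma Q_carr: "precomod X ==> Q a X x \<in> carr X"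
  unfolding Q_csw using subspaceD[OF vsP precomod_subspace]
  by (intro csw_in[OF _ vsP precomod_subspace]) auto

lemma Q_Q:
  fixes X :: "('k, 'h, 'u) comod"
  assumes X: "lcomod X"
  shows "Q a X (Q b X x) = (if a = b then Q a X x else 0)"
proof -
  have "Q a X (Q b X x) = act1 X (\<delta> b) (Q a X) x"
    unfolding Q_def[of b] by (rule act1_linear[OF lmap_Q precomod_subspace]) (use comod_precomod[OF X] in auto)
  also have "... = act1 X (conv1 (\<delta> b) (\<delta> a)) (\<lambda>y. y) x"
    unfolding Q_def[abs_def] by (rule act1_act1[OF X lform_\<delta> lform_\<delta> lmap_id])
  also have "conv1 (\<delta> b) (\<delta> a) = (if a = b then \<delta> a else (\<lambda>h. 0))"
    by (auto simp: conv1_def \<delta>_comul)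
  moreover have "act1 X (\<lambda>h. 0) f x = 0" for f :: "('k, 'u) vec => ('k, 'u) vec"
    by (simp add: act1_def csw_lsum vs_rules(6)[OF vsP])
  ultimately show ?thesis by (simp add: Q_def)
qed

text \<open>Projecting the vector or its coaction component amounts to projecting the coefficient in
  \<open>H\<close>. Coassociativity reduces the two cases to \<open>P_def\<close> and
  \<open>P_right\<close>, so their agreement is again cocentrality.\<close>

lemma csw_Q:
  assumes X: "lcomod X" and vs: "vector_space s"
    and F: "\<And>y. y \<in> carr X ==> linv scH UNIV s (\<lambda>h. F h y)" "\<And>h. linv pscale (carr X) s (F h)"
  shows "csw H X (Q a X x) F = csw H X x (\<lambda>h y. F (P a h) y)" (is "?A = ?C")
    "csw H X x (\<lambda>h y. F h (Q a X y)) = csw H X x (\<lambda>h y. F (P a h) y)" (is "?B = ?C")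
proof -
  note p = comod_precomod[OF X] and sub = precomod_subspace[OF comod_precomod[OF X]]
  have l: "linv pscale (carr X) s (\<lambda>v. csw H X v F)"
    using p vs F by (auto intro!: lin)
  have lF: "Vector_Spaces.linear scH s (\<lambda>h. F h y)" if "y \<in> carr X" for y
    using F(1)[OF that] vs by (simp add: linear_iff_linv)
  have sF: "F (scH c h) y = s c (F h y)" if "y \<in> carr X" for c h y
    using F(1)[OF that] by (simp add: linv_def)
  have "?A = csw H X x (\<lambda>h y. csw H X (pscale (\<delta> a h) y) F)"
    unfolding Q_csw using subspaceD[OF vsP sub]
    by (intro csw_linv[OF l vsP vs sub p]) auto
  also have "... = csw H X x (\<lambda>h y. csw H X y (\<lambda>k z. s (\<delta> a h) (F k z)))"
    by (rule csw_cong[OF p]) (simp add: linvD(2)[OF l] csw_scale[OF vs])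
  also have "... = csw H X x (\<lambda>h y. sw2 H h (\<lambda>h1 h2. s (\<delta> a h1) (F h2 y)))"
    using F by (intro csw_coassoc[OF X vs]) (auto simp: mtri_def vs intro!: lin linv_scale_coeff)
  also have "... = ?C"
    by (rule csw_cong[OF p]) (simp add: P_def sw2_linear[OF lF] sF)
  finally show "?A = ?C" .
  have "?B = csw H X x (\<lambda>h y. csw H X y (\<lambda>k z. s (\<delta> a k) (F h z)))"
  proof (rule csw_cong[OF p])
    fix h y assume y: "y \<in> carr X"
    have "F h (Q a X y) = csw H X y (\<lambda>k z. F h (pscale (\<delta> a k) z))"
      unfolding Q_csw using subspaceD[OF vsP sub]
      by (intro csw_linv[OF F(2) vsP vs sub p]) auto
    also have "... = csw H X y (\<lambda>k z. s (\<delta> a k) (F h z))"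
      by (rule csw_cong[OF p]) (simp add: linvD(2)[OF F(2)])
    finally show "F h (Q a X y) = csw H X y (\<lambda>k z. s (\<delta> a k) (F h z))" .
  qed
  also have "... = csw H X x (\<lambda>h y. sw2 H h (\<lambda>h1 h2. s (\<delta> a h2) (F h1 y)))"
    using F by (intro csw_coassoc[OF X vs]) (auto simp: mtri_def vs intro!: lin linv_scale_coeff)
  also have "... = ?C"
    by (rule csw_cong[OF p]) (simp add: P_right sw2_linear[OF lF] sF)
  finally show "?B = ?C" .
qed

text \<open>The analogue of \<open>hdeg_P\<close>. Conversely, for a fixed vector the coefficients
  in \<open>H\<close> may be replaced by their parts of degree a, on which \<pi> is a multiple of
  \<open>gbas a\<close>.\<close>

lemma cdeg_Q:
  fixes X :: "('k, 'h, 'u) comod"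
  assumes X: "lcomod X"
  shows "x \<in> Cd X a \<longleftrightarrow> x \<in> carr X \<and> Q a X x = x"
proof -
  note p = comod_precomod[OF X]
  have "Q a X x = x" if "csw H X x (\<lambda>h y. tens pscale pscale (\<pi> h) y) = tens pscale pscale (gbas a) x"
  proof -
    have b: "bilin pscale pscale pscale (\<lambda>p x :: ('k, 'u) vec. pscale (Poly_Mapping.lookup p a) x)"
      by (rule bilinI) (auto intro!: lin)
    have "lsum (clist X x) (\<lambda>h y. pscale (Poly_Mapping.lookup (\<pi> h) a) y) = lsum [(x, x)] (\<lambda>h y. pscale (Poly_Mapping.lookup (gbas a) a) y)"
      by (rule linv_lsum_functional[OF vsP vsP vsP b])
        (use that in \<open>simp add: csw_lsum\<close>)
    then show ?thesis by (simp add: Q_csw csw_lsum \<delta>_def lookup_gbas vs_rules(4)[OF vsP])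
  qed
  moreover have "csw H X x (\<lambda>h y. tens pscale pscale (\<pi> h) y) = tens pscale pscale (gbas a) x" if x: "x \<in> carr X" "Q a X x = x"
  proof -
    have l: "linv s V pscale f ==> linv s V tscale (\<lambda>v. tens pscale pscale (f v) y)"
      "linv s V pscale g ==> linv s V tscale (\<lambda>v. tens pscale pscale q (g v))"
      for s V and f :: "_ => 'g \<Rightarrow>\<^sub>0 'k" and g :: "_ => ('k, 'u) vec" and y :: "('k, 'u) vec" and q :: "'g \<Rightarrow>\<^sub>0 'k"
      by (auto intro!: linv_tens1 linv_tens2)
    have ts: "tens pscale pscale (pscale c q) y = tscale c (tens pscale pscale q y)" for c and y :: "('k, 'u) vec" and q :: "'g \<Rightarrow>\<^sub>0 'k"
      using linvD(2)[OF l(1)[OF linv_id], of q UNIV] by auto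
    have *: "tens pscale pscale (\<pi> (P a h)) y = tens pscale pscale (gbas a) (pscale (\<delta> a h) y)" for h and y :: "('k, 'u) vec"
    proof -
      have "\<pi> (P a h) = sw2 H h (\<lambda>x y. pscale (\<delta> a x) (\<pi> y))"
        unfolding P_def sw2_linear[OF linear_\<pi>] using linear_\<pi> by (simp add: linear_iff_linv linv_def)
      then show ?thesis
        using linvD(2)[OF l(2)[OF linv_id], of y UNIV] by (simp add: \<delta>_\<pi> ts)
    qed
    have "csw H X (Q a X x) (\<lambda>h y. tens pscale pscale (\<pi> h) y) = csw H X x (\<lambda>h y. tens pscale pscale (\<pi> (P a h)) y)"
      by (rule csw_Q(1)[OF X vsT]) (auto intro!: lin l)
    also have "... = csw H X x (\<lambda>h y. tens pscale pscale (gbas a) (pscale (\<delta> a h) y))"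
      by (rule csw_cong[OF comod_precomod[OF X]]) (rule *)
    also have "... = tens pscale pscale (gbas a) (Q a X x)"
      unfolding Q_csw by (rule csw_linear[OF l(2)[OF linv_id], symmetric]) auto
    finally show ?thesis by (simp add: x)
  qed
  ultimately show ?thesis by (auto simp: cdeg_def)
qed

lemma Q_in: "lcomod X ==> Q a X x \<in> Cd X a"
  by (simp add: cdeg_Q Q_carr comod_precomod Q_Q)

lemma cdeg_subspace:
  assumes X: "lcomod X"
  shows "module.subspace pscale (Cd X a)"
  using subspaceD[OF vsP precomod_subspace[OF comod_precomod[OF X]]]
    linvD[OF lmap_Q[OF comod_precomod[OF X]]] linv_0[OF lmap_Q vsP vsP precomod_subspace] comod_precomod[OF X]
  by (intro subspaceI) (auto simp: cdeg_Q[OF X])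

text \<open>A representation of the coaction of \<open>x\<close> involves finitely many degrees. The
  corresponding projections sum to \<open>x\<close> by the counit axiom.\<close>

lemma vspan_cdeg:
  fixes X :: "('k, 'h, 'u) comod"
  assumes X: "lcomod X"
  shows "vspan (\<Union>a. Cd X a) = carr X"
proof
  note p = comod_precomod[OF X]
  show "vspan (\<Union>a. Cd X a) \<subseteq> carr X"
    by (rule vspan_minimal[OF _ precomod_subspace[OF p]]) (auto simp: cdeg_def)
  show "carr X \<subseteq> vspan (\<Union>a. Cd X a)"
  proof
    fix x assume x: "x \<in> carr X"
    define A where "A = (\<Union>(h, y)\<in>set (clist X x). Poly_Mapping.keys (\<pi> h))"
    have fin: "finite A" by (auto simp: A_def)
    have ls: "(\<Sum>a\<in>A. lsum L (F a)) = lsum L (\<lambda>h y. \<Sum>a\<in>A. F a h y)" for L and F :: "'g => 'h => ('k, 'u) vec => ('k, 'u) vec"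
      by (induction L) (auto simp: sum.distrib)
    have sc: "(\<Sum>a\<in>A. pscale (f a) y) = pscale (\<Sum>a\<in>A. f a) y" for f and y :: "('k, 'u) vec"
      using fin by (induction A) (auto simp: vs_rules(2,6))
    have "(\<Sum>a\<in>A. Q a X x) = lsum (clist X x) (\<lambda>h y. pscale (eps h) y)"
      unfolding Q_csw csw_lsum ls sc
      by (rule lsum_cong) (auto simp: A_def intro!: \<delta>_counit arg_cong2[of _ _ _ _ pscale])
    also have "... = x"
      using csw_counit[OF X vsP linv_id x] by (simp add: csw_lsum)
    finally have x: "(\<Sum>a\<in>A. Q a X x) = x" .
    have q: "Q a X x \<in> vspan (\<Union>a. Cd X a)" for a
      by (rule vspan_base) (use Q_in[OF X] in blast)
    have "(\<Sum>a\<in>B. Q a X x) \<in> vspan (\<Union>a. Cd X a)" if "finite B" for B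
      using that subspaceD[OF vsP vspan_subspace[of "\<Union>a. Cd X a"]] q
      by (induction B) auto
    then show "x \<in> vspan (\<Union>a. Cd X a)" using fin x by metis
  qed
qed

lemma cdeg_ext:
  assumes X: "lcomod X" and "linv pscale (carr X) s f" "linv pscale (carr X) s g" "vector_space s"
    "\<And>a x. x \<in> Cd X a ==> f x = g x" "x \<in> carr X"
  shows "f x = g x"
  using linv_eq_vspan[of "\<Union>a. Cd X a" s f g x] assms by (auto simp: vspan_cdeg)

lemma cdeg_carr: "x \<in> Cd X a ==> x \<in> carr X"
  by (simp add: cdeg_def)

lemma csw_PQ:
  assumes X: "lcomod X" and vs: "vector_space s" and x: "x \<in> Cd X a"
    and F: "\<And>y. y \<in> carr X ==> linv scH UNIV s (\<lambda>h. F h y)" "\<And>h. linv pscale (carr X) s (F h)"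
  shows "csw H X x F = csw H X x (\<lambda>h y. F (P a h) (Q a X y))"
proof -
  have "csw H X x (\<lambda>h y. F (P a h) (Q a X y)) = csw H X x (\<lambda>h y. F (P a (P a h)) y)"
    using F by (intro csw_Q(2)[OF X vs, of "\<lambda>h y. F (P a h) y"]) (auto intro!: linv_comp[OF F(1)] lin)
  also have "... = csw H X (Q a X x) F"
    by (simp add: P_P csw_Q(1)[OF X vs F])
  finally show ?thesis using x by (simp add: cdeg_Q[OF X])
qed

text \<open>Coaction sums of a vector of degree a may be compared for coefficients and vectors of
  degree a only, as with \<open>sw2_hom_cong\<close> for coproducts.\<close>

lemma csw_hom_cong:
  assumes X: "lcomod X" and vs: "vector_space s" and x: "x \<in> Cd X a"
    and F: "\<And>y. y \<in> carr X ==> linv scH UNIV s (\<lambda>h. F h y)" "\<And>h. linv pscale (carr X) s (F h)"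
    and G: "\<And>y. y \<in> carr X ==> linv scH UNIV s (\<lambda>h. G h y)" "\<And>h. linv pscale (carr X) s (G h)"
    and eq: "\<And>h y. h \<in> Hd a ==> y \<in> Cd X a ==> F h y = G h y"
  shows "csw H X x F = csw H X x G"
  using csw_PQ[OF X vs x F] csw_PQ[OF X vs x G] eq[OF P_in Q_in[OF X]] by simp

lemma A2_hom_cong:
  assumes X: "lcomod X" and Y: "lcomod Y" and vs: "vector_space s"
    and x: "x \<in> Cd X a" and y: "y \<in> Cd Y b"
    and F: "\<And>k u v. u \<in> carr X ==> v \<in> carr Y ==> linv scH UNIV s (\<lambda>h. F h k u v)"
      "\<And>k u v. u \<in> carr X ==> v \<in> carr Y ==> linv scH UNIV s (\<lambda>h. F k h u v)"
      "\<And>h k v. v \<in> carr Y ==> linv pscale (carr X) s (\<lambda>u. F h k u v)"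
      "\<And>h k u. u \<in> carr X ==> linv pscale (carr Y) s (\<lambda>v. F h k u v)"
    and G: "\<And>k u v. u \<in> carr X ==> v \<in> carr Y ==> linv scH UNIV s (\<lambda>h. G h k u v)"
      "\<And>k u v. u \<in> carr X ==> v \<in> carr Y ==> linv scH UNIV s (\<lambda>h. G k h u v)"
      "\<And>h k v. v \<in> carr Y ==> linv pscale (carr X) s (\<lambda>u. G h k u v)"
      "\<And>h k u. u \<in> carr X ==> linv pscale (carr Y) s (\<lambda>v. G h k u v)"
    and eq: "\<And>h k u v. h \<in> Hd a ==> k \<in> Hd b ==> u \<in> Cd X a ==> v \<in> Cd Y b ==> F h k u v = G h k u v"
  shows "A2 X Y x y F = A2 X Y x y G"
  unfolding A2_def
  by (rule csw_hom_cong[OF X vs x]; (rule csw_hom_cong[OF Y vs y])?)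
    (use comod_precomod[OF Y] in \<open>auto intro!: linv_csw vs F G eq cdeg_carr\<close>)

lemma act2_hom:
  assumes X: "lcomod X" and Y: "lcomod Y"
    and x: "x \<in> Cd X a" and y: "y \<in> Cd Y b" and p: "bform p" "bform q" and f: "bmap X Y f"
    and eq: "\<And>h k. h \<in> Hd a ==> k \<in> Hd b ==> p h k = q h k"
  shows "act2 X Y p f x y = act2 X Y q f x y"
  unfolding act2_def
  by (rule A2_hom_cong[OF X Y vsP x y])
    (use f in \<open>auto simp: eq bilin_on_def intro!: lin lin_app2[OF p(1)] lin_app2[OF p(2)]\<close>)

lemma act3_hom:
  assumes X: "lcomod X" and Y: "lcomod Y" and Z: "lcomod Z"
    and x: "x \<in> Cd X a" and y: "y \<in> Cd Y b" and z: "z \<in> Cd Z c"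
    and p: "tform p" "tform q" and f: "tmap X Y Z f"
    and eq: "\<And>h k l. h \<in> Hd a ==> k \<in> Hd b ==> l \<in> Hd c ==> p h k l = q h k l"
  shows "act3 X Y Z p f x y z = act3 X Y Z q f x y z"
proof -
  note pp = comod_precomod[OF Y] comod_precomod[OF Z]
  show ?thesis
    unfolding act3_def A3_def
    by (rule csw_hom_cong[OF X vsP x]; (rule csw_hom_cong[OF Y vsP y];
        (rule csw_hom_cong[OF Z vsP z])?)?)
      (use f pp in \<open>auto simp: eq trilin_on_def cdeg_carr intro!: lin lin_app3[OF p(1)] lin_app3[OF p(2)]\<close>)
qed

lemma carr_chomog [simp]: "carr (chomog H \<pi> X a) = Cd X a"
  by (simp add: chomog_def)

lemma coact_chomog:
  assumes X: "lcomod X" and x: "x \<in> Cd X a"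
  shows "coact X x = csw H X x (\<lambda>h y. htens H (P a h) (Q a X y))"
proof -
  have "coact X x = csw H X x (htens H)"
    using clist(2)[OF comod_precomod[OF X]] by (simp add: csw_lsum)
  also have "... = csw H X x (\<lambda>h y. htens H (P a h) (Q a X y))"
    by (rule csw_PQ[OF X vsT x]) (auto intro!: lin)
  finally show ?thesis .
qed

lemma precomod_chomog:
  assumes X: "lcomod X"
  shows "precomod (chomog H \<pi> X a)"
  unfolding precomod_def carr_chomog
proof (intro conjI ballI)
  note p = comod_precomod[OF X]
  have "linv pscale (carr X) tscale (coact X)" using p by (simp add: precomod_def lin_on_iff)
  then show "lin_on pscale tscale (Cd X a) (coact (chomog H \<pi> X a))"
    unfolding chomog_def using cdeg_subspace[OF X] linv_subset[of pscale "carr X" tscale "coact X" "Cd X a"] cdeg_carr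
    by (auto intro!: lin_on_restrict)
  fix x assume x: "x \<in> Cd X a"
  have "csw H X x (\<lambda>h y. htens H (P a h) (Q a X y)) \<in> tspace scH pscale UNIV (Cd X a)"
    by (rule csw_in[OF p vsT subspace_tspace]) (auto simp: htens_def Q_in[OF X] intro!: tens_in_tspace)
  then show "coact (chomog H \<pi> X a) x \<in> tspace scH pscale UNIV (Cd X a)"
    using x coact_chomog[OF X x] by (simp add: chomog_def)
qed (rule cdeg_subspace[OF X])

text \<open>The representation chosen in \<open>X\<close> need not consist of homogeneous vectors;
  after projecting its entries it represents the coaction of the homogeneous part and gives the same
  sum.\<close>

lemma csw_chomog:
  assumes X: "lcomod X" and vs: "vector_space s" and x: "x \<in> Cd X a"
    and F: "\<And>y. y \<in> carr X ==> linv scH UNIV s (\<lambda>h. F h y)" "\<And>h. linv pscale (carr X) s (F h)"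
  shows "csw H (chomog H \<pi> X a) x F = csw H X x F"
proof -
  have "csw H (chomog H \<pi> X a) x F = lsum (map (\<lambda>(h, y). (P a h, Q a X y)) (clist X x)) F"
  proof (rule csw_eqI[OF precomod_chomog[OF X] _ _ vs])
    show "coact (chomog H \<pi> X a) x = lsum (map (\<lambda>(h, y). (P a h, Q a X y)) (clist X x)) (htens H)"
      using x coact_chomog[OF X x] by (simp add: chomog_def csw_lsum lsum_map)
    show "linv scH UNIV s (\<lambda>h. F h y)" if "y \<in> carr (chomog H \<pi> X a)" for y
      using that by (auto intro: F cdeg_carr)
    show "linv pscale (carr (chomog H \<pi> X a)) s (F h)" for h
      using linv_subset[OF F(2), of "Cd X a" h] cdeg_carr by auto
  qed (use Q_in[OF X] in auto)
  then show ?thesis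
    using csw_PQ[OF X vs x F] by (simp add: csw_lsum lsum_map)
qed

end

text \<open>All lines spanned by a \<lambda>(a, b) have the same underlying space, so this one
  injection serves every summand of a zested tensor product.\<close>

definition kten :: "('k::field, 'u) vec => ('k, 'u) vec" where
  "kten v = v \<otimes> evec"

text \<open>The left inverse of \<open>kten\<close>: it reads the coordinates at indices
  \<open>Node i Dot\<close>, where tensoring with \<open>evec\<close> has put them.\<close>

definition unk :: "('k::field, 'u) vec => ('k, 'u) vec" where
  "unk v = Poly_Mapping.map_key (\<lambda>i. Node i Dot) v"

lemma lookup_unk: "Poly_Mapping.lookup (unk v) i = Poly_Mapping.lookup v (Node i Dot)"
  by (simp add: unk_def Poly_Mapping.map_key.rep_eq inj_def)

lemma lin_kten [lin]: "linv s V pscale f ==> linv s V pscale (\<lambda>x. kten (f x))"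
  unfolding kten_def by (rule linv_vten1)

lemma lin_unk [lin]: "linv s V pscale f ==> linv s V pscale (\<lambda>x. unk (f x))"
  by (auto simp: linv_def lookup_unk lookup_add intro!: poly_mapping_eqI)

lemma unk_kten [simp]: "unk (kten v) = v"
  by (rule poly_mapping_eqI) (simp add: lookup_unk kten_def vten_lookup evec_def)

lemma kten_subspace:
  fixes A :: "('k::field, 'u) vec set"
  assumes "module.subspace pscale A"
  shows "module.subspace pscale (kten ` A)"
proof -
  note s = subspaceD[OF vsP assms]
  have k: "kten x + kten y = kten (x + y)" "pscale c (kten x) = kten (pscale c x)" for x y :: "('k, 'u) vec" and c
    by (rule vec_eqI; simp add: kten_def vten_lookup lookup_add algebra_simps)+
  have "(0 :: ('k, 'u) vec) = kten 0" by (rule vec_eqI) (simp_all add: kten_def vten_lookup)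
  with s k show ?thesis by (intro subspaceI) auto
qed

lemma tcarr_evec:
  assumes "module.subspace pscale A"
  shows "tcarr A (vspan {evec}) = kten ` A"
proof
  show "tcarr A (vspan {evec}) \<subseteq> kten ` A"
    unfolding tcarr_def
  proof (rule vspan_minimal[OF _ kten_subspace[OF assms]], clarify)
    fix x c :: "('a, 'b) vec" assume x: "x \<in> A" and c: "c \<in> vspan {evec}"
    have "x \<otimes> c = kten (pscale (Poly_Mapping.lookup c Dot) x)"
      using c unfolding vspan_evec kten_def by (metis vten_scale)
    then show "x \<otimes> c \<in> kten ` A" using x subspaceD(3)[OF vsP assms] by simp
  qed
  show "kten ` A \<subseteq> tcarr A (vspan {evec})"
    unfolding tcarr_def kten_def by (auto intro!: vspan_base)
qed

lemma ccomp_cid: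
  assumes "module.subspace pscale (carr Y)" "h \<in> chom H X Y"
  shows "ccomp (cid Y) h = h"
proof -
  obtain f where h: "h = (X, f, Y)" "lin_on pscale pscale (carr X) f" "f ` carr X \<subseteq> carr Y"
    using assms(2) by (auto simp: chom_def)
  have "(\<lambda>x. if x \<in> carr Y then x else 0) \<circ> f = f"
    using h(2,3) by (auto simp: fun_eq_iff lin_on_def image_subset_iff)
  with h show ?thesis by (simp add: ccomp_def cid_def)
qed

section \<open>Comodules transported along tensoring with the vector \<open>evec\<close>\<close>

context coalg_mult begin

context
  fixes W W' :: "('a, 'b, 'u) comod"
  assumes W: "lcomod W" and carr': "carr W' = kten ` carr W"
    and coact': "\<And>v. v \<in> carr W ==> coact W' (kten v) = csw H W v (\<lambda>h w. htens H h (kten w))"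
    and coact0: "\<And>v. v \<notin> carr W' ==> coact W' v = 0"
begin

lemma p: "precomod W"
  using W by (rule comod_precomod)

lemma lkten: "linv pscale (kten ` carr W) s f \<longleftrightarrow> linv pscale (carr W) s (\<lambda>v. f (kten v))"
proof -
  have "kten (v + w) = kten v + kten w" "kten (pscale c v) = pscale c (kten v)" for v w :: "('a, 'u) vec" and c
    using lin_kten[OF linv_id, of UNIV] by (auto simp: linv_def)
  then show ?thesis by (simp add: linv_def)
qed

lemma precomod_kt: "precomod W'"
  unfolding precomod_def lin_on_iff carr'
proof (intro conjI ballI allI impI)
  have "linv pscale (carr W) tscale (\<lambda>v. csw H W v (\<lambda>h w. htens H h (kten w)))"
    using p by (auto intro!: lin)
  then show "linv pscale (kten ` carr W) tscale (coact W')"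
    unfolding lkten 
    by (rule linv_cong[OF vsP precomod_subspace[OF p], THEN iffD2, rotated]) (rule coact')
  fix x assume "x \<in> kten ` carr W"
  then obtain v where v: "x = kten v" "v \<in> carr W" by blast
  show "coact W' x \<in> tspace scH pscale UNIV (kten ` carr W)"
    unfolding v(1) coact'[OF v(2)]
    by (rule csw_in[OF p vsT subspace_tspace]) (auto simp: htens_def intro!: tens_in_tspace)
qed (use coact0 carr' kten_subspace precomod_subspace[OF p] in auto)

lemma csw_kt:
  assumes "vector_space s" "v \<in> carr W" "\<And>y. y \<in> kten ` carr W ==> linv scH UNIV s (\<lambda>h. F h y)"
    "\<And>h. linv pscale (kten ` carr W) s (F h)"
  shows "csw H W' (kten v) F = csw H W v (\<lambda>h w. F h (kten w))"
proof -
  have "csw H W' (kten v) F = lsum (map (\<lambda>(h, w). (h, kten w)) (clist W v)) F"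
    using clist(1)[OF p, of v] assms coact'[OF assms(2)]
    by (intro csw_eqI[OF precomod_kt]) (auto simp: carr' csw_lsum lsum_map)
  then show ?thesis by (simp add: lsum_map csw_lsum)
qed

lemma comod_kt: "lcomod W'"
  unfolding left_comodule_def
proof (intro conjI ballI)
  show "module.subspace pscale (carr W')" "lin_on pscale tscale (carr W') (coact W')"
    "x \<in> carr W' ==> coact W' x \<in> tspace scH pscale UNIV (carr W')" for x
    using precomod_kt by (auto simp: precomod_def)
  fix x assume "x \<in> carr W'"
  then obtain v where v: "x = kten v" "v \<in> carr W" by (auto simp: carr')
  have c: "csw H W' (kten w) (\<lambda>k z. tens scH tscale h (htens H k z)) = csw H W w (\<lambda>k z. tens scH tscale h (htens H k (kten z)))"
    if "w \<in> carr W" for w h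
    by (rule csw_kt[OF vsT that]) (auto intro!: lin)
  have "csw H W' x (\<lambda>h y. sw2 H h (\<lambda>h1 h2. tens scH tscale h1 (htens H h2 y))) =
    csw H W v (\<lambda>h w. sw2 H h (\<lambda>h1 h2. tens scH tscale h1 (htens H h2 (kten w))))"
    unfolding v(1) by (rule csw_kt[OF vsT v(2)]) (auto intro!: lin)
  also have "... = csw H W v (\<lambda>h w. csw H W w (\<lambda>k z. tens scH tscale h (htens H k (kten z))))"
    by (rule csw_coassoc[OF W vsT, symmetric]) (auto simp: mtri_def intro!: lin)
  also have "... = csw H W v (\<lambda>h w. csw H W' (kten w) (\<lambda>k z. tens scH tscale h (htens H k z)))"
    by (rule csw_cong[OF p]) (simp add: c)
  also have "... = csw H W' x (\<lambda>h y. csw H W' y (\<lambda>k z. tens scH tscale h (htens H k z)))"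
    unfolding v(1) using precomod_kt
    by (intro csw_kt[OF vsT v(2), symmetric]) (auto simp: carr' intro!: lin)
  finally show "csw H W' x (\<lambda>h y. sw2 H h (\<lambda>h1 h2. tens scH tscale h1 (htens H h2 y))) =
    csw H W' x (\<lambda>h y. csw H W' y (\<lambda>k z. tens scH tscale h (htens H k z)))" .
  have "csw H W' x (\<lambda>h y. pscale (eps h) y) = csw H W v (\<lambda>h w. pscale (eps h) (kten w))"
    unfolding v(1) by (rule csw_kt[OF vsP v(2)]) (auto intro!: lin)
  also have "... = x"
    unfolding v(1) by (rule csw_counit[OF W vsP _ v(2)]) (auto intro!: lin)
  finally show "csw H W' x (\<lambda>h y. pscale (eps h) y) = x" .
qed

lemma kt_iso:
  defines "J \<equiv> (W', \<lambda>v. if v \<in> carr W' then unk v else 0, W)" and "JI \<equiv> (W, \<lambda>v. if v \<in> carr W then kten v else 0, W')"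
  shows "JI \<in> chom H W W'" "J \<in> chom H W' W" "ccomp J JI = cid W" "ccomp JI J = cid W'"
proof -
  have "lin_on pscale pscale (carr W) (\<lambda>v. if v \<in> carr W then kten v else 0)"
    by (intro lin_on_restrict precomod_subspace[OF p]) (auto intro!: lin)
  moreover have "coact W' (kten v) = csw H W v (\<lambda>h w. htens H h (if w \<in> carr W then kten w else 0))" if "v \<in> carr W" for v
    unfolding coact'[OF that] by (rule csw_cong[OF p]) simp
  ultimately show h: "JI \<in> chom H W W'"
    by (auto simp: JI_def chom_def carr')
  have "lin_on pscale pscale (carr W') (\<lambda>v. if v \<in> carr W' then unk v else 0)"
    by (intro lin_on_restrict precomod_subspace[OF precomod_kt]) (auto intro!: lin)
  from chom_inverse[OF p precomod_kt h[unfolded JI_def] this]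
  have "(\<And>y. y \<in> carr W' ==> unk y \<in> carr W) ==> (\<And>y. y \<in> carr W' ==> kten (unk y) = y) ==>
    J \<in> chom H W' W \<and> ccomp J JI = cid W \<and> ccomp JI J = cid W'"
    by (simp add: J_def JI_def carr')
  moreover have "unk y \<in> carr W" "kten (unk y) = y" if "y \<in> carr W'" for y
    using that by (auto simp: carr')
  ultimately show "J \<in> chom H W' W" "ccomp J JI = cid W" "ccomp JI J = cid W'"
    by blast+
qed

end

end

section \<open>The zested tensor product and the tensor product over the zesting\<close>

context zest begin

sublocale z: cqt H mz 1 Oz rz
  by unfold_locales (rule coquasitriangular_z)

abbreviation ZT :: "('k, 'h, 'u) comod => ('k, 'h, 'u) comod => ('k, 'h, 'u) comod" where
  "ZT \<equiv> ztens H \<pi> lam"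

context
  fixes X Y :: "('k, 'h, 'u) comod"
  assumes X: "lcomod X" and Y: "lcomod Y"
begin

lemma carr_zsummand: "carr (zsummand H \<pi> lam X Y a b) = kten ` tcarr (Cd X a) (Cd Y b)"
  by (simp add: zsummand_def tcarr_evec)

text \<open>Each tensor factor is spanned by its homogeneous parts, and these are exhausted one
  factor at a time. Hence the internal sum of all summands has the underlying space of the full
  tensor product.\<close>

lemma tcarr_cdeg: "kten ` tcarr (carr X) (carr Y) = vspan (\<Union>a b. kten ` tcarr (Cd X a) (Cd Y b))"
  (is "?L = vspan ?S")
proof
  have "?S \<subseteq> ?L"
    unfolding tcarr_def
    by (intro UN_least image_mono vspan_minimal vspan_subspace) (auto intro!: vspan_base cdeg_carr)
  then show "vspan ?S \<subseteq> ?L"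
    by (intro vspan_minimal kten_subspace) (auto simp: tcarr_def)
  have h: "kten (x \<otimes> y) \<in> vspan ?S" if "x \<in> Cd X a" "y \<in> Cd Y b" for x y a b
    using that by (intro vspan_base UN_I imageI) (auto simp: tcarr_def intro!: vspan_base)
  have h1: "kten (x \<otimes> y) \<in> vspan ?S" if "x \<in> Cd X a" "y \<in> carr Y" for x y a
    by (rule linv_in_vspan[of "\<Union>b. Cd Y b" pscale "\<lambda>y. kten (x \<otimes> y)"])
      (use h[OF that(1)] that(2) in \<open>auto simp: vspan_cdeg[OF Y] intro!: lin\<close>)
  have h2: "kten (x \<otimes> y) \<in> vspan ?S" if "x \<in> carr X" "y \<in> carr Y" for x y
    by (rule linv_in_vspan[of "\<Union>a. Cd X a" pscale "\<lambda>x. kten (x \<otimes> y)"])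
      (use h1[OF _ that(2)] that(1) in \<open>auto simp: vspan_cdeg[OF X] intro!: lin\<close>)
  show "?L \<subseteq> vspan ?S"
    using tcarr_in[OF lin_kten[OF linv_id] vsP vspan_subspace h2] by blast
qed

lemma carr_ZT: "carr (ZT X Y) = kten ` tcarr (carr X) (carr Y)"
  by (simp add: ztens_def ztens_carr_def carr_zsummand tcarr_cdeg)

text \<open>The line contributes the group-like \<lambda>(a, b) to the diagonal coaction. On
  coefficients of degrees a and b the product \<open>h * k * lam a b\<close> is the zested one, and
  this is where the two tensor products meet.\<close>

lemma coact_zsummand:
  assumes "x \<in> Cd X a" "y \<in> Cd Y b"
  shows "coact (zsummand H \<pi> lam X Y a b) (kten (x \<otimes> y)) = A2 X Y x y (\<lambda>h k u v. htens H (mz h k) (kten (u \<otimes> v)))"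
proof -
  let ?X = "chomog H \<pi> X a" and ?Y = "chomog H \<pi> Y b" and ?k = "kline H (lam a b) :: ('k, 'h, 'u) comod"
  note p = precomod_chomog[OF X, of a] precomod_chomog[OF Y, of b]
  note pT = precomod_T[OF p]
  have e: "evec \<in> vspan {evec}" by (rule vspan_base) simp
  have xy: "x \<otimes> y \<in> tcarr (Cd X a) (Cd Y b)"
    using assms by (auto simp: tcarr_def intro!: vspan_base)
  have "coact (zsummand H \<pi> lam X Y a b) (kten (x \<otimes> y)) = A2 (T ?X ?Y) ?k (x \<otimes> y) evec (\<lambda>h k v w. htens H (h * k) (v \<otimes> w))"
    unfolding zsummand_def kten_def by (rule coact_T(2)[OF pT precomod_kline]) (use xy e in auto)
  also have "... = csw H (T ?X ?Y) (x \<otimes> y) (\<lambda>h v. htens H (h * lam a b) (kten v))"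
    unfolding A2_def kten_def by (intro csw_cong[OF pT] csw_kline[OF vsT]) (auto intro!: lin e)
  also have "... = A2 ?X ?Y x y (\<lambda>h k u v. htens H (h * k * lam a b) (kten (u \<otimes> v)))"
    by (rule csw_T[OF p vsT]) (use assms in \<open>auto intro!: lin\<close>)
  also have "... = csw H X x (\<lambda>h u. csw H ?Y y (\<lambda>k v. htens H (h * k * lam a b) (kten (u \<otimes> v))))"
    unfolding A2_def by (rule csw_chomog[OF X vsT assms(1)]) (use p in \<open>auto intro!: lin\<close>)
  also have "... = A2 X Y x y (\<lambda>h k u v. htens H (h * k * lam a b) (kten (u \<otimes> v)))"
    unfolding A2_def
    by (intro csw_cong[OF comod_precomod[OF X]] csw_chomog[OF Y vsT assms(2)]) (auto intro!: lin)
  also have "... = A2 X Y x y (\<lambda>h k u v. htens H (mz h k) (kten (u \<otimes> v)))"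
    by (rule A2_hom_cong[OF X Y vsT assms]) (auto simp: mz(2) intro!: lin)
  finally show ?thesis .
qed

text \<open>The coaction transported from the tensor product over \<open>H\<^sup>\<lambda>\<close>
  restricts correctly to every summand, and the summands span; it therefore is the map that the
  definite description in \<open>ztens\<close> selects.\<close>

lemma coact_ZT: "coact (ZT X Y) = (\<lambda>v. if v \<in> carr (ZT X Y) then csw H (z.T X Y) (unk v) (\<lambda>h w. htens H h (kten w)) else 0)"
  (is "_ = ?f")
proof -
  note pX = comod_precomod[OF X] and pY = comod_precomod[OF Y]
  note pT = z.precomod_T[OF pX pY]
  have ZS: "ztens_carr H \<pi> lam X Y = kten ` tcarr (carr X) (carr Y)"
    using carr_ZT by (simp add: ztens_def)
  have mem: "unk v \<in> carr (z.T X Y)" if "v \<in> kten ` tcarr (carr X) (carr Y)" for v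
    using that by auto
  have lf: "linv pscale (kten ` tcarr (carr X) (carr Y)) tscale (\<lambda>v. csw H (z.T X Y) (unk v) (\<lambda>h w. htens H h (kten w)))"
    using pT mem by (auto intro!: lin)
  have "the_lin pscale tscale (kten ` tcarr (carr X) (carr Y))
      (\<lambda>f. \<forall>a b. \<forall>v\<in>carr (zsummand H \<pi> lam X Y a b). f v = coact (zsummand H \<pi> lam X Y a b) v) = ?f"
  proof (rule the_lin_eq)
    show "lin_on pscale tscale (kten ` tcarr (carr X) (carr Y)) ?f"
      unfolding carr_ZT using lf by (intro lin_on_restrict kten_subspace) (auto simp: tcarr_def)
    show pf: "\<forall>a b. \<forall>v\<in>carr (zsummand H \<pi> lam X Y a b). ?f v = coact (zsummand H \<pi> lam X Y a b) v"
    proof (intro allI ballI)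
      fix a b v assume v: "v \<in> carr (zsummand H \<pi> lam X Y a b)"
      then obtain w where w: "v = kten w" "w \<in> tcarr (Cd X a) (Cd Y b)" by (auto simp: carr_zsummand)
      have sub: "tcarr (Cd X a) (Cd Y b) \<subseteq> tcarr (carr X) (carr Y)"
        unfolding tcarr_def by (intro vspan_minimal vspan_subspace) (auto intro!: vspan_base cdeg_carr)
      have pz: "precomod (zsummand H \<pi> lam X Y a b)"
        unfolding zsummand_def by (intro precomod_T precomod_chomog X Y precomod_kline)
      have "csw H (z.T X Y) w (\<lambda>h w. htens H h (kten w)) = coact (zsummand H \<pi> lam X Y a b) (kten w)"
      proof (rule tcarr_ext[OF _ _ vsT _ w(2)])
        show "linv pscale (tcarr (Cd X a) (Cd Y b)) tscale (\<lambda>w. csw H (z.T X Y) w (\<lambda>h w. htens H h (kten w)))"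
          using pT sub by (auto intro!: lin)
        show "linv pscale (tcarr (Cd X a) (Cd Y b)) tscale (\<lambda>w. coact (zsummand H \<pi> lam X Y a b) (kten w))"
        proof (rule linv_comp[OF _ lin_kten[OF linv_id]])
          show "linv pscale (kten ` tcarr (Cd X a) (Cd Y b)) tscale (coact (zsummand H \<pi> lam X Y a b))"
            using pz unfolding precomod_def lin_on_iff carr_zsummand by simp
        qed simp
        fix x y assume xy: "x \<in> Cd X a" "y \<in> Cd Y b"
        show "csw H (z.T X Y) (x \<otimes> y) (\<lambda>h w. htens H h (kten w)) = coact (zsummand H \<pi> lam X Y a b) (kten (x \<otimes> y))"
          unfolding coact_zsummand[OF xy]
          by (rule z.csw_T[OF pX pY vsT]) (use xy cdeg_carr in \<open>auto intro!: lin\<close>)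
      qed
      then show "?f v = coact (zsummand H \<pi> lam X Y a b) v"
        using w sub by (auto simp: carr_ZT)
    qed
    fix g v assume g: "lin_on pscale tscale (kten ` tcarr (carr X) (carr Y)) g"
      "\<forall>a b. \<forall>v\<in>carr (zsummand H \<pi> lam X Y a b). g v = coact (zsummand H \<pi> lam X Y a b) v"
      and v: "v \<in> kten ` tcarr (carr X) (carr Y)"
    show "g v = ?f v"
    proof (rule linv_eq_vspan[OF _ _ vsT _ v[unfolded tcarr_cdeg]])
      show "linv pscale (vspan (\<Union>a b. kten ` tcarr (Cd X a) (Cd Y b))) tscale g"
        using g(1) by (simp add: lin_on_iff tcarr_cdeg)
      show "linv pscale (vspan (\<Union>a b. kten ` tcarr (Cd X a) (Cd Y b))) tscale ?f"
        using lf lin_on_restrict[OF lf vsP kten_subspace] by (simp add: lin_on_iff carr_ZT flip: tcarr_cdeg)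
      show "g x = ?f x" if "x \<in> (\<Union>a b. kten ` tcarr (Cd X a) (Cd Y b))" for x
      proof -
        from that obtain a b where "x \<in> carr (zsummand H \<pi> lam X Y a b)" by (auto simp: carr_zsummand)
        from g(2)[rule_format, OF this] pf[rule_format, OF this] show ?thesis by (rule trans[OF _ sym])
      qed
    qed
  qed
  then show ?thesis by (simp add: ztens_def ZS)
qed

lemma kt_ZT: "carr (ZT X Y) = kten ` carr (z.T X Y)"
  "v \<in> carr (z.T X Y) ==> coact (ZT X Y) (kten v) = csw H (z.T X Y) v (\<lambda>h w. htens H h (kten w))"
  "v \<notin> carr (ZT X Y) ==> coact (ZT X Y) v = 0"
  by (simp_all add: coact_ZT carr_ZT)

lemmas comod_ZT = comod_kt[OF z.comod_T[OF X Y] kt_ZT]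

end

text \<open>\<open>JJ\<close> strips the factor \<open>evec\<close> and \<open>JI\<close> restores
  it. Both are set to 0 outside their sources, as arrows between comodules are.\<close>

definition JJ :: "('k, 'h, 'u) comod => ('k, 'h, 'u) comod => ('k, 'h, 'u) carrow" where
  "JJ X Y = (ZT X Y, \<lambda>v. if v \<in> carr (ZT X Y) then unk v else 0, z.T X Y)"

definition JI :: "('k, 'h, 'u) comod => ('k, 'h, 'u) comod => ('k, 'h, 'u) carrow" where
  "JI X Y = (z.T X Y, \<lambda>v. if v \<in> carr (z.T X Y) then kten v else 0, ZT X Y)"

abbreviation DD :: "(('k, 'h, 'u) comod, ('k, 'h, 'u) carrow, 'k) bmcat" where
  "DD \<equiv> zested_category H r \<pi> \<gamma> lam \<omega> t"

lemma DD_simps [simp]: "Obj DD = {X. lcomod X}" "Hom DD = chom H" "Idt DD = cid" "Cmp DD = ccomp"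
  "Add DD = cadd" "Smul DD = csmul" "Unt DD = kline H 1" "Tob DD = ZT" "Tar DD = ztens_arr H \<pi> lam"
  by (simp_all add: zested_category_def Let_def)

lemma ztens_carr: "ztens_carr H \<pi> lam X Y = carr (ZT X Y)"
  by (simp add: ztens_def)

lemma comp_chom:
  "lcomod X ==> lcomod Y ==> lcomod Z ==> a \<in> chom H X Y ==> b \<in> chom H Y Z ==> ccomp b a \<in> chom H X Z"
  by (rule chom_comp[OF comod_precomod comod_precomod comod_precomod])

text \<open>Identifies an arrow given by a definite description with an already known colinear map:
  the latter must have the prescribed values, and these must determine a linear map.\<close>

lemma arrow_eq:
  assumes "a \<in> chom H A B" "R (mp a)" "\<And>k v. lin_on pscale pscale (carr A) k ==> R k ==> v \<in> carr A ==> k v = mp a v"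
  shows "(A, the_lin pscale pscale (carr A) R, B) = a"
proof -
  have "the_lin pscale pscale (carr A) R = mp a"
    by (rule the_lin_eq[where P = R and f = "mp a"]) (use chom_mp(2)[OF assms(1)] assms(2,3) in auto)
  then show ?thesis using chom_mp(1)[OF assms(1)] by simp
qed

lemma cid_chom: "lcomod X ==> cid X \<in> chom H X X"
  by (rule chom_id[OF comod_precomod])

lemma kten_scale: "kten (pscale c v) = pscale c (kten v)"
  by (simp add: kten_def vten_scale)

context
  fixes X Y :: "('k, 'h, 'u) comod"
  assumes X: "lcomod X" and Y: "lcomod Y"
begin

lemma JJ: "JI X Y \<in> chom H (z.T X Y) (ZT X Y)" "JJ X Y \<in> chom H (ZT X Y) (z.T X Y)"
  "ccomp (JJ X Y) (JI X Y) = cid (z.T X Y)" "ccomp (JI X Y) (JJ X Y) = cid (ZT X Y)"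
  using kt_iso[OF z.comod_T[OF X Y] kt_ZT[OF X Y]] by (simp_all add: JJ_def JI_def)

lemma mp_JJ: "v \<in> tcarr (carr X) (carr Y) ==> mp (JJ X Y) (kten v) = v" "v \<in> tcarr (carr X) (carr Y) ==> mp (JI X Y) v = kten v"
  using carr_ZT[OF X Y] by (simp_all add: JJ_def JI_def)

lemma comod_T': "lcomod (z.T X Y)" and comod_ZT': "lcomod (ZT X Y)"
  by (rule z.comod_T[OF X Y], rule comod_ZT[OF X Y])

lemma JJ_JI: "h \<in> chom H W (z.T X Y) ==> ccomp (JJ X Y) (ccomp (JI X Y) h) = h"
  unfolding ccomp_assoc JJ(3) by (rule ccomp_cid[OF precomod_subspace[OF comod_precomod[OF comod_T']]])

lemma ZT_lin: "linv pscale (carr (ZT X Y)) s f \<longleftrightarrow> linv pscale (tcarr (carr X) (carr Y)) s (\<lambda>v. f (kten v))"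
  using lkten[OF z.comod_T[OF X Y] kt_ZT[OF X Y]] carr_ZT[OF X Y] by simp

lemma ZT_ext:
  assumes "linv pscale (carr (ZT X Y)) pscale f" "linv pscale (carr (ZT X Y)) pscale g"
    "\<And>x y. x \<in> carr X ==> y \<in> carr Y ==> f (kten (x \<otimes> y)) = g (kten (x \<otimes> y))" "v \<in> carr (ZT X Y)"
  shows "f v = g v"
proof -
  obtain w where w: "v = kten w" "w \<in> tcarr (carr X) (carr Y)" using assms(4) by (auto simp: carr_ZT[OF X Y])
  show ?thesis unfolding w(1)
    by (rule tcarr_ext[OF assms(1,2)[unfolded ZT_lin] vsP assms(3) w(2)])
qed

lemma ZT_hom_ext:
  assumes fg: "linv pscale (carr (ZT X Y)) pscale f" "linv pscale (carr (ZT X Y)) pscale g"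
    and eq: "\<And>a b x y. x \<in> Cd X a ==> y \<in> Cd Y b ==> f (kten (x \<otimes> y)) = g (kten (x \<otimes> y))"
    and v: "v \<in> carr (ZT X Y)"
  shows "f v = g v"
proof (rule ZT_ext[OF fg _ v])
  note l = fg[unfolded ZT_lin]
  have m: "x \<otimes> y \<in> tcarr (carr X) (carr Y)" if "x \<in> carr X" "y \<in> carr Y" for x y
    using that by simp
  have 1: "f (kten (x \<otimes> y)) = g (kten (x \<otimes> y))" if x: "x \<in> Cd X a" and y: "y \<in> carr Y" for a x y
  proof (rule cdeg_ext[OF Y _ _ vsP _ y])
    show "linv pscale (carr Y) pscale (\<lambda>y. f (kten (x \<otimes> y)))" "linv pscale (carr Y) pscale (\<lambda>y. g (kten (x \<otimes> y)))"
      by (rule linv_comp[OF l(1)] linv_comp[OF l(2)]; use m cdeg_carr[OF x] in \<open>auto intro!: lin\<close>)+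
  qed (rule eq[OF x])
  fix x y assume x: "x \<in> carr X" and y: "y \<in> carr Y"
  show "f (kten (x \<otimes> y)) = g (kten (x \<otimes> y))"
  proof (rule cdeg_ext[OF X _ _ vsP _ x])
    show "linv pscale (carr X) pscale (\<lambda>x. f (kten (x \<otimes> y)))" "linv pscale (carr X) pscale (\<lambda>x. g (kten (x \<otimes> y)))"
      by (rule linv_comp[OF l(1)] linv_comp[OF l(2)]; use m y in \<open>auto intro!: lin\<close>)+
  qed (rule 1[OF _ y])
qed

end

section \<open>The structure morphisms of the zested category as conjugates\<close>

lemma Tar_DD:
  assumes X: "lcomod X" and X': "lcomod X'" and Y: "lcomod Y" and Y': "lcomod Y'"
    and f: "f \<in> chom H X X'" and g: "g \<in> chom H Y Y'"
  defines "a \<equiv> ccomp (JI X' Y') (ccomp (z.TA f g) (JJ X Y))"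
  shows "ztens_arr H \<pi> lam f g = a" "a \<in> chom H (ZT X Y) (ZT X' Y')"
proof -
  note p = X[THEN comod_precomod] Y[THEN comod_precomod] X'[THEN comod_precomod] Y'[THEN comod_precomod]
  note T = z.T_arr[OF p f g]
  show a: "a \<in> chom H (ZT X Y) (ZT X' Y')"
    unfolding a_def by (intro comp_chom[OF _ _ _ comp_chom[OF _ _ _ JJ(2) T(1)] JJ(1)] comod_ZT' comod_T' X Y X' Y')
  have v: "mp a (kten (x \<otimes> y)) = kten (mp f x \<otimes> mp g y)" if xy: "x \<in> carr X" "y \<in> carr Y" for x y
  proof -
    have "x \<otimes> y \<in> tcarr (carr X) (carr Y)" "mp f x \<otimes> mp g y \<in> tcarr (carr X') (carr Y')"
      using chom_mp(4)[OF f xy(1)] chom_mp(4)[OF g xy(2)] xy by (auto simp: tcarr_def intro!: vspan_base)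
    then show ?thesis using T(2)[OF xy] by (simp add: a_def mp_JJ X Y X' Y')
  qed
  have "ztens_arr H \<pi> lam f g = (ZT X Y, the_lin pscale pscale (carr (ZT X Y))
      (\<lambda>F. \<forall>x\<in>carr X. \<forall>y\<in>carr Y. F (kten (x \<otimes> y)) = kten (mp f x \<otimes> mp g y)), ZT X' Y')"
    using chom_mp(1)[OF f] chom_mp(1)[OF g] unfolding kten_def
    by (cases f, cases g) (simp add: ztens_arr_def ztens_carr)
  also have "... = a"
  proof (rule arrow_eq[OF a])
    fix k w assume "lin_on pscale pscale (carr (ZT X Y)) k"
      "\<forall>x\<in>carr X. \<forall>y\<in>carr Y. k (kten (x \<otimes> y)) = kten (mp f x \<otimes> mp g y)" "w \<in> carr (ZT X Y)"
    then show "k w = mp a w"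
      using v by - (rule ZT_ext[OF X Y _ chom_mp(3)[OF a]], auto simp: lin_on_iff)
  qed (use v in blast)
  finally show "ztens_arr H \<pi> lam f g = a" .
qed

lemma JJ_nat:
  assumes X: "lcomod X" and X': "lcomod X'" and Y: "lcomod Y" and Y': "lcomod Y'"
    and f: "f \<in> chom H X X'" and g: "g \<in> chom H Y Y'"
  shows "ccomp (JJ X' Y') (ztens_arr H \<pi> lam f g) = ccomp (z.TA f g) (JJ X Y)"
  unfolding Tar_DD(1)[OF assms]
  by (rule JJ_JI[OF X' Y' comp_chom[OF _ _ _ JJ(2)[OF X Y] z.T_arr(1)[OF _ _ _ _ f g]]])
    (intro comod_ZT' comod_T' X Y X' Y' comod_precomod)+

lemma Lun_DD:
  assumes X: "lcomod X"
  shows "Lun DD X = ccomp (Lun z.CC X) (JJ (kline H 1) X)"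
proof -
  let ?K = "kline H 1 :: ('k, 'h, 'b) comod"
  have K: "lcomod ?K" by (rule comod_kline[OF grouplike_1])
  note L = z.Lun_CC[OF X]
  have a: "ccomp (Lun z.CC X) (JJ ?K X) \<in> chom H (ZT ?K X) X"
    by (intro comp_chom[OF _ _ _ JJ(2) L(1)] comod_ZT' comod_T' X K)
  have e: "evec \<in> vspan {evec :: ('k, 'b) vec}" by (rule vspan_base) simp
  have v: "mp (ccomp (Lun z.CC X) (JJ ?K X)) (kten (evec \<otimes> x)) = x" if x: "x \<in> carr X" for x
  proof -
    have "evec \<otimes> x \<in> tcarr (carr ?K) (carr X)" using e x by (auto simp: tcarr_def intro!: vspan_base)
    then show ?thesis using L(2)[OF x] by (simp add: mp_JJ X K del: carr_kline)
  qed
  have "Lun DD X = (ZT ?K X, the_lin pscale pscale (carr (ZT ?K X)) (\<lambda>f. \<forall>x\<in>carr X. f (kten (evec \<otimes> x)) = x), X)"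
    by (simp add: zested_category_def Let_def ztens_carr kten_def)
  also have "... = ccomp (Lun z.CC X) (JJ ?K X)"
  proof (rule arrow_eq[OF a])
    fix k w assume k: "lin_on pscale pscale (carr (ZT ?K X)) k" "\<forall>x\<in>carr X. k (kten (evec \<otimes> x)) = x" and w: "w \<in> carr (ZT ?K X)"
    obtain u where u: "w = kten u" "u \<in> tcarr (vspan {evec}) (carr X)" using w by (auto simp: carr_ZT[OF K X])
    have l: "linv pscale (carr (ZT ?K X)) pscale k" using k(1) by (simp add: lin_on_iff)
    show "k w = mp (ccomp (Lun z.CC X) (JJ ?K X)) w" unfolding u(1)
      by (rule tcarr_evec_ext[OF l[unfolded ZT_lin[OF K X] carr_kline] chom_mp(3)[OF a, unfolded ZT_lin[OF K X] carr_kline] vsP _ u(2)])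
        (use k(2) v in simp)
  qed (use v in blast)
  finally show ?thesis .
qed

lemma Run_DD:
  assumes X: "lcomod X"
  shows "Run DD X = ccomp (Run z.CC X) (JJ X (kline H 1))"
proof -
  let ?K = "kline H 1 :: ('k, 'h, 'b) comod"
  have K: "lcomod ?K" by (rule comod_kline[OF grouplike_1])
  note L = z.Run_CC[OF X]
  have a: "ccomp (Run z.CC X) (JJ X ?K) \<in> chom H (ZT X ?K) X"
    by (intro comp_chom[OF _ _ _ JJ(2) L(1)] comod_ZT' comod_T' X K)
  have e: "evec \<in> vspan {evec :: ('k, 'b) vec}" by (rule vspan_base) simp
  have v: "mp (ccomp (Run z.CC X) (JJ X ?K)) (kten (x \<otimes> evec)) = x" if x: "x \<in> carr X" for x
  proof -
    have "x \<otimes> evec \<in> tcarr (carr X) (carr ?K)" using e x by (auto simp: tcarr_def intro!: vspan_base)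
    then show ?thesis using L(2)[OF x] by (simp add: mp_JJ X K del: carr_kline)
  qed
  have "Run DD X = (ZT X ?K, the_lin pscale pscale (carr (ZT X ?K)) (\<lambda>f. \<forall>x\<in>carr X. f (kten (x \<otimes> evec)) = x), X)"
    by (simp add: zested_category_def Let_def ztens_carr kten_def)
  also have "... = ccomp (Run z.CC X) (JJ X ?K)"
  proof (rule arrow_eq[OF a])
    fix k w assume k: "lin_on pscale pscale (carr (ZT X ?K)) k" "\<forall>x\<in>carr X. k (kten (x \<otimes> evec)) = x" and w: "w \<in> carr (ZT X ?K)"
    obtain u where u: "w = kten u" "u \<in> tcarr (carr X) (vspan {evec})" using w by (auto simp: carr_ZT[OF X K])
    have l: "linv pscale (carr (ZT X ?K)) pscale k" using k(1) by (simp add: lin_on_iff)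
    show "k w = mp (ccomp (Run z.CC X) (JJ X ?K)) w" unfolding u(1)
      by (rule tcarr_evec_ext_right[OF l[unfolded ZT_lin[OF X K] carr_kline] chom_mp(3)[OF a, unfolded ZT_lin[OF X K] carr_kline] vsP _ u(2)])
        (use k(2) v in simp)
  qed (use v in blast)
  finally show ?thesis .
qed

text \<open>In degrees b and c the form \<open>rz\<close> is \<open>t b c\<close> times
  \<open>r\<close>, so its action on the flip is the braiding over \<open>H\<close> scaled by that
  constant, as the zested braiding prescribes.\<close>

lemma Brd_DD:
  assumes X: "lcomod X" and Y: "lcomod Y"
  defines "a \<equiv> ccomp (JI Y X) (ccomp (Brd z.CC X Y) (JJ X Y))"
  shows "Brd DD X Y = a" "a \<in> chom H (ZT X Y) (ZT Y X)"
proof -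
  note p = comod_precomod[OF X] comod_precomod[OF Y]
  note B = z.Brd_CC[OF X Y]
  let ?s = "\<lambda>x y. y \<otimes> x"
  show a: "a \<in> chom H (ZT X Y) (ZT Y X)"
    unfolding a_def by (intro comp_chom[OF _ _ _ comp_chom[OF _ _ _ JJ(2) B(1)] JJ(1)] comod_ZT' comod_T' X Y)
  have fe: "cbraid_map H r X Y = the_lin pscale pscale (tcarr (carr X) (carr Y))
     (\<lambda>f. \<forall>x\<in>carr X. \<forall>y\<in>carr Y. f (x \<otimes> y) = act2 X Y r ?s x y)"
    by (simp add: cbraid_map_def ctens_carr_tcarr act2_def A2_def)
  have cb: "cbraid_map H r X Y (x \<otimes> y) = act2 X Y r ?s x y" if "x \<in> carr X" "y \<in> carr Y" for x y
    unfolding fe by (rule the_lin_tcarr(2)[OF precomod_subspace[OF p(1)] precomod_subspace[OF p(2)] vsP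
      bmap_act2[OF p r(1) tmaps(4)] refl that])
  have v: "mp a (kten (x \<otimes> y)) = pscale (t b c) (kten (cbraid_map H r X Y (x \<otimes> y)))"
    if xy: "x \<in> Cd X b" "y \<in> Cd Y c" for x y b c
  proof -
    note xy' = cdeg_carr[OF xy(1)] cdeg_carr[OF xy(2)]
    have m: "x \<otimes> y \<in> tcarr (carr X) (carr Y)" "act2 X Y rz ?s x y \<in> tcarr (carr Y) (carr X)"
      using xy' p by (auto intro!: act2_in)
    have "bform (\<lambda>h k. t b c * r h k)" by (rule bilinI) (auto intro!: lin)
    then have "act2 X Y rz ?s x y = act2 X Y (\<lambda>h k. t b c * r h k) ?s x y"
      by (intro act2_hom[OF X Y xy rz(1) _ tmaps(4)]) (simp_all add: rz(2))
    also have "... = pscale (t b c) (act2 X Y r ?s x y)"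
      by (simp add: act2_def pscale_sums vs_rules(3)[OF vsP])
    finally show ?thesis
      using B(2)[OF xy'] m by (simp add: a_def mp_JJ X Y cb[OF xy'] kten_scale)
  qed
  have "Brd DD X Y = (ZT X Y, the_lin pscale pscale (carr (ZT X Y)) (\<lambda>f. \<forall>a b. \<forall>x\<in>Cd X a. \<forall>y\<in>Cd Y b.
      f (kten (x \<otimes> y)) = pscale (t a b) (kten (cbraid_map H r X Y (x \<otimes> y)))), ZT Y X)"
    by (simp add: zested_category_def Let_def ztens_carr kten_def)
  also have "... = a"
  proof (rule arrow_eq[OF a])
    fix k w assume "lin_on pscale pscale (carr (ZT X Y)) k" "\<forall>a b. \<forall>x\<in>Cd X a. \<forall>y\<in>Cd Y b.
      k (kten (x \<otimes> y)) = pscale (t a b) (kten (cbraid_map H r X Y (x \<otimes> y)))" "w \<in> carr (ZT X Y)"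
    then show "k w = mp a w"
      using v by - (rule ZT_hom_ext[OF X Y _ chom_mp(3)[OF a]], auto simp: lin_on_iff)
  qed (use v in blast)
  finally show "Brd DD X Y = a" .
qed

text \<open>The conjugate removes the outer and inner copies of \<open>evec\<close>, lets
  \<open>Oz\<close> act and puts both copies back. Its values are compared with the prescription on
  homogeneous vectors, first in \<open>z\<close> and then in the two factors of
  \<open>u\<close>.\<close>

lemma Asc_DD:
  assumes X: "lcomod X" and Y: "lcomod Y" and Z: "lcomod Z"
  defines "a \<equiv> ccomp (JI X (ZT Y Z)) (ccomp (z.TA (cid X) (JI Y Z))
    (ccomp (Asc z.CC X Y Z) (ccomp (z.TA (JJ X Y) (cid Z)) (JJ (ZT X Y) Z))))"
  shows "Asc DD X Y Z = a" "a \<in> chom H (ZT (ZT X Y) Z) (ZT X (ZT Y Z))"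
proof -
  note c = X Y Z comod_ZT'[OF X Y] comod_ZT'[OF Y Z] comod_T'[OF X Y] comod_T'[OF Y Z]
  note p = c[THEN comod_precomod]
  note A = z.Asc_CC[OF X Y Z]
  note T1 = z.T_arr[OF p(4,3,6,3) JJ(2)[OF X Y] cid_chom[OF Z]]
  note T2 = z.T_arr[OF p(1,7,1,5) cid_chom[OF X] JJ(1)[OF Y Z]]
  show a: "a \<in> chom H (ZT (ZT X Y) Z) (ZT X (ZT Y Z))"
    unfolding a_def
    by (intro comp_chom[OF _ _ _ comp_chom[OF _ _ _ comp_chom[OF _ _ _ comp_chom[OF _ _ _ JJ(2) T1(1)] A(1)] T2(1)] JJ(1)]
        comod_ZT' comod_T' c)
  let ?f = "\<lambda>x y z. kten (x \<otimes> kten (y \<otimes> z))"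
  have tf: "tmap X Y Z ?f" by (auto simp: trilin_on_def intro!: lin)
  have v: "mp a (kten (kten (x \<otimes> y) \<otimes> z)) = act3 X Y Z Oz ?f x y z"
    if xyz: "x \<in> carr X" "y \<in> carr Y" "z \<in> carr Z" for x y z
  proof -
    have m: "x \<otimes> y \<in> tcarr (carr X) (carr Y)" "kten (x \<otimes> y) \<in> carr (ZT X Y)"
      "kten (x \<otimes> y) \<otimes> z \<in> tcarr (carr (ZT X Y)) (carr Z)"
      using xyz by (auto simp: carr_ZT[OF X Y])
    let ?q = "\<lambda>v. mp (JI X (ZT Y Z)) (mp (z.TA (cid X) (JI Y Z)) v)"
    have lq: "linv pscale (carr (z.T X (z.T Y Z))) pscale ?q"
      by (rule linv_comp[OF chom_mp(3)[OF JJ(1)[OF c(1,5)]] chom_mp(3)[OF T2(1)] chom_mp(4)[OF T2(1)]])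
    have q: "?q (x \<otimes> (y \<otimes> z)) = ?f x y z" if xyz: "x \<in> carr X" "y \<in> carr Y" "z \<in> carr Z" for x y z
    proof -
      have m: "y \<otimes> z \<in> tcarr (carr Y) (carr Z)" using xyz by simp
      then have m2: "x \<otimes> kten (y \<otimes> z) \<in> tcarr (carr X) (carr (ZT Y Z))"
        using xyz unfolding carr_ZT[OF Y Z] by (intro vten_in_tcarr) auto
      show ?thesis using xyz m mp_JJ(2)[OF c(1,5) m2] by (simp add: T2(2) mp_JJ(2)[OF Y Z])
    qed
    have "mp a (kten (kten (x \<otimes> y) \<otimes> z)) = ?q (act3 X Y Z Oz (\<lambda>x y z. x \<otimes> (y \<otimes> z)) x y z)"
      using xyz m by (simp add: a_def mp_JJ(1)[OF c(4,3)] T1(2) mp_JJ(1)[OF X Y] A(2))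
    also have "... = act3 X Y Z Oz (\<lambda>x y z. ?q (x \<otimes> (y \<otimes> z))) x y z"
      by (rule act3_linear[OF lq _ p(1,2,3)]) (simp_all add: tcarr_def vspan_base, auto intro!: vspan_base)
    also have "... = act3 X Y Z Oz ?f x y z"
      by (intro act3_cong p) (simp add: q)
    finally show ?thesis .
  qed
  \<comment> \<open>In fixed degrees \<open>Oz\<close> is the counit in the first two variables, so
    only the coaction of \<open>z\<close> survives: the half-braiding by \<gamma>(\<lambda>(b, d))
    times \<omega>(b, d, e).\<close>
  have h: "act3 X Y Z Oz ?f x y z = csw H Z z (\<lambda>l z0. pscale (\<gamma> (lam b d) l * \<omega> b d e) (?f x y z0))"
    if xyz: "x \<in> Cd X b" "y \<in> Cd Y d" "z \<in> Cd Z e" for x y z b d e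
  proof -
    note xyz' = xyz[THEN cdeg_carr]
    have "act3 X Y Z Oz ?f x y z = act3 X Y Z (\<lambda>h k l. \<omega> b d e * G3 (\<gamma> (lam b d)) h k l) ?f x y z"
      by (rule act3_hom[OF X Y Z xyz Oz(1) tform_c(1)[OF \<Gamma>0(6)] tf]) (simp add: Oz(2))
    also have "... = act3 X Y Z (\<lambda>h k l. e2 h k * (\<gamma> (lam b d) l * \<omega> b d e)) ?f x y z"
      by (simp add: G3_def mult_ac)
    also have "... = act2 X Y e2 (\<lambda>x y. act1 Z (\<lambda>l. \<gamma> (lam b d) l * \<omega> b d e) (?f x y) z) x y"
      by (rule act3_split3)
    also have "... = act1 Z (\<lambda>l. \<gamma> (lam b d) l * \<omega> b d e) (?f x y) z"
      by (rule act2_e2[OF X Y _ xyz'(1,2)]) (auto simp: bilin_on_def act1_def intro!: lin p(3))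
    finally show ?thesis by (simp add: act1_def)
  qed
  have "Asc DD X Y Z = (ZT (ZT X Y) Z, the_lin pscale pscale (carr (ZT (ZT X Y) Z))
        (\<lambda>f. \<forall>a b c. \<forall>x\<in>Cd X a. \<forall>y\<in>Cd Y b. \<forall>z\<in>Cd Z c.
          f (kten (kten (x \<otimes> y) \<otimes> z)) = csw H Z z (\<lambda>l z0. pscale (\<gamma> (lam a b) l * \<omega> a b c) (?f x y z0))), ZT X (ZT Y Z))"
    by (simp add: zested_category_def Let_def ztens_carr kten_def)
  also have "... = a"
  proof (rule arrow_eq[OF a])
    show pa: "\<forall>b d e. \<forall>x\<in>Cd X b. \<forall>y\<in>Cd Y d. \<forall>z\<in>Cd Z e.
      mp a (kten (kten (x \<otimes> y) \<otimes> z)) = csw H Z z (\<lambda>l z0. pscale (\<gamma> (lam b d) l * \<omega> b d e) (?f x y z0))"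
      by (simp add: v cdeg_carr h)
    fix k w assume k: "lin_on pscale pscale (carr (ZT (ZT X Y) Z)) k"
      "\<forall>a b c. \<forall>x\<in>Cd X a. \<forall>y\<in>Cd Y b. \<forall>z\<in>Cd Z c.
        k (kten (kten (x \<otimes> y) \<otimes> z)) = csw H Z z (\<lambda>l z0. pscale (\<gamma> (lam a b) l * \<omega> a b c) (?f x y z0))"
      and w: "w \<in> carr (ZT (ZT X Y) Z)"
    have lk: "linv pscale (carr (ZT (ZT X Y) Z)) pscale k" using k(1) by (simp add: lin_on_iff)
    note l = lk[unfolded ZT_lin[OF c(4,3)]] chom_mp(3)[OF a, unfolded ZT_lin[OF c(4,3)]]
    show "k w = mp a w"
    proof (rule ZT_ext[OF c(4,3) lk chom_mp(3)[OF a] _ w])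
      fix u z assume u: "u \<in> carr (ZT X Y)" and z: "z \<in> carr Z"
      have m: "u \<otimes> z \<in> tcarr (carr (ZT X Y)) (carr Z)" if "u \<in> carr (ZT X Y)" "z \<in> carr Z" for u z
        using that by (auto simp: tcarr_def intro!: vspan_base)
      have 1: "k (kten (u \<otimes> z)) = mp a (kten (u \<otimes> z))" if z: "z \<in> Cd Z e" for z e
      proof (rule ZT_hom_ext[OF X Y _ _ _ u])
        show "linv pscale (carr (ZT X Y)) pscale (\<lambda>u. k (kten (u \<otimes> z)))" "linv pscale (carr (ZT X Y)) pscale (\<lambda>u. mp a (kten (u \<otimes> z)))"
          by (rule linv_comp[OF l(1)] linv_comp[OF l(2)]; use m cdeg_carr[OF z] in \<open>auto intro!: lin\<close>)+
        show "k (kten (kten (x \<otimes> y) \<otimes> z)) = mp a (kten (kten (x \<otimes> y) \<otimes> z))"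
          if "x \<in> Cd X b" "y \<in> Cd Y d" for b d x y
          using k(2)[rule_format, OF that z] pa[rule_format, OF that z] by simp
      qed
      show "k (kten (u \<otimes> z)) = mp a (kten (u \<otimes> z))"
      proof (rule cdeg_ext[OF Z _ _ vsP _ z])
        show "linv pscale (carr Z) pscale (\<lambda>z. k (kten (u \<otimes> z)))" "linv pscale (carr Z) pscale (\<lambda>z. mp a (kten (u \<otimes> z)))"
          by (rule linv_comp[OF l(1)] linv_comp[OF l(2)]; use m u in \<open>auto intro!: lin\<close>)+
      qed (rule 1)
    qed
  qed
  finally show "Asc DD X Y Z = a" .
qed

text \<open>After inserting \<open>Asc_DD\<close>, naturality of \<open>JJ\<close> brings it next to
  the outer \<open>JI\<close>; then the inner pair cancels by functoriality of the tensor
  product.\<close>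

lemma J_Asc_DD:
  assumes X: "lcomod X" and Y: "lcomod Y" and Z: "lcomod Z"
  shows "ccomp (Asc z.CC X Y Z) (ccomp (JJ (z.T X Y) Z) (ztens_arr H \<pi> lam (JJ X Y) (cid Z))) =
    ccomp (JJ X (z.T Y Z)) (ccomp (ztens_arr H \<pi> lam (cid X) (JJ Y Z)) (Asc DD X Y Z))"
  (is "_ = ?R")
proof -
  note c = X Y Z comod_ZT'[OF X Y] comod_ZT'[OF Y Z] comod_T'[OF X Y] comod_T'[OF Y Z]
  note p = c[THEN comod_precomod]
  note A = z.Asc_CC[OF X Y Z]
  note T1 = z.T_arr[OF p(4,3,6,3) JJ(2)[OF X Y] cid_chom[OF Z]]
  note T2 = z.T_arr[OF p(1,7,1,5) cid_chom[OF X] JJ(1)[OF Y Z]]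
  note T3 = z.T_arr[OF p(1,5,1,7) cid_chom[OF X] JJ(2)[OF Y Z]]
  let ?B = "ccomp (Asc z.CC X Y Z) (ccomp (z.TA (JJ X Y) (cid Z)) (JJ (ZT X Y) Z))"
  have B: "?B \<in> chom H (ZT (ZT X Y) Z) (z.T X (z.T Y Z))"
    by (intro comp_chom[OF _ _ _ comp_chom[OF _ _ _ JJ(2) T1(1)] A(1)] comod_ZT' comod_T' c)
  have TB: "ccomp (z.TA (cid X) (JI Y Z)) ?B \<in> chom H (ZT (ZT X Y) Z) (z.T X (ZT Y Z))"
    by (intro comp_chom[OF _ _ _ B T2(1)] comod_ZT' comod_T' c)
  have i: "ccomp (z.TA (cid X) (JJ Y Z)) (z.TA (cid X) (JI Y Z)) = cid (z.T X (z.T Y Z))"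
    unfolding z.T_functor[OF cid_chom[OF X] cid_chom[OF X] JJ(1)[OF Y Z] JJ(2)[OF Y Z] X X X c(7,5,7), symmetric]
      JJ(3)[OF Y Z] ccomp_cid[OF precomod_subspace[OF p(1)] cid_chom[OF X]] by (rule z.T_id[OF X c(7)])
  have "?R =
    ccomp (ccomp (z.TA (cid X) (JJ Y Z)) (JJ X (ZT Y Z)))
      (ccomp (JI X (ZT Y Z)) (ccomp (z.TA (cid X) (JI Y Z)) ?B))"
    unfolding Asc_DD(1)[OF X Y Z] JJ_nat[OF c(1,1,5,7) cid_chom[OF X] JJ(2)[OF Y Z], symmetric] ccomp_assoc ..
  also have "... = ccomp (z.TA (cid X) (JJ Y Z)) (ccomp (z.TA (cid X) (JI Y Z)) ?B)"
    unfolding ccomp_assoc[symmetric] JJ_JI[OF c(1,5) TB[unfolded ccomp_assoc[symmetric]]] ..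
  also have "... = ?B"
    unfolding ccomp_assoc[of "z.TA (cid X) (JJ Y Z)"] i
    by (rule ccomp_cid[OF precomod_subspace[OF comod_precomod[OF comod_T'[OF c(1,7)]]] B])
  also have "... = ccomp (Asc z.CC X Y Z) (ccomp (JJ (z.T X Y) Z) (ztens_arr H \<pi> lam (JJ X Y) (cid Z)))"
    unfolding JJ_nat[OF c(4,6,3,3) JJ(2)[OF X Y] cid_chom[OF Z]] ..
  finally show ?thesis ..
qed

theorem equivalent_DD: "braided_tensor_equivalent (z.CC :: (('k, 'h, 'u) comod, ('k, 'h, 'u) carrow, 'k) bmcat) (DD :: (('k, 'h, 'u) comod, ('k, 'h, 'u) carrow, 'k) bmcat)"
proof -
  interpret J: transported_category z.CC "DD :: (('k, 'h, 'u) comod, ('k, 'h, 'u) carrow, 'k) bmcat" JJ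
  proof unfold_locales
    show "Cmp z.CC (Cmp z.CC h g) f = Cmp z.CC h (Cmp z.CC g f)" for f g h :: "('k, 'h, 'u) carrow"
      by (simp add: ccomp_assoc)
    show "iso_in z.CC (Tob DD X Y) (Tob z.CC X Y) (JJ X Y)" if "X \<in> Obj z.CC" "Y \<in> Obj z.CC" for X Y :: "('k, 'h, 'u) comod"
      using that by (auto simp: iso_in_def JJ intro!: bexI[of _ "JI X Y"])
    show "Cmp z.CC (Brd z.CC X Y) (JJ X Y) = Cmp z.CC (JJ Y X) (Brd DD X Y)"
      if "X \<in> Obj z.CC" "Y \<in> Obj z.CC" for X Y :: "('k, 'h, 'u) comod"
    proof -
      have c: "lcomod X" "lcomod Y" using that by auto
      from JJ_JI[OF c(2,1) comp_chom[OF comod_ZT' comod_T' comod_T' JJ(2) z.Brd_CC(1)]] c show ?thesis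
        by (simp add: Brd_DD(1))
    qed
    show "Tar DD f g \<in> Hom z.CC (Tob DD X Y) (Tob DD X' Y')"
      if "X \<in> Obj z.CC" "X' \<in> Obj z.CC" "Y \<in> Obj z.CC" "Y' \<in> Obj z.CC" "f \<in> Hom z.CC X X'" "g \<in> Hom z.CC Y Y'"
      for X X' Y Y' :: "('k, 'h, 'u) comod" and f g
      using that Tar_DD[of X X' Y Y' f g] by simp
    show "Asc DD X Y Z \<in> Hom z.CC (Tob DD (Tob DD X Y) Z) (Tob DD X (Tob DD Y Z))"
      if "X \<in> Obj z.CC" "Y \<in> Obj z.CC" "Z \<in> Obj z.CC" for X Y Z :: "('k, 'h, 'u) comod"
      using that Asc_DD[of X Y Z] by simp
  qed (auto simp: comod_ZT' JJ_nat Lun_DD Run_DD Brd_DD J_Asc_DD z.braided_CC)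
  show ?thesis by (rule J.equivalent)
qed

end

theorem corollary3p10:
  fixes H :: "('k::field, 'h::ring_1) coalg"
    and S :: "'h \<Rightarrow> 'h" and r :: "'h \<Rightarrow> 'h \<Rightarrow> 'k"
    and \<pi> :: "'h \<Rightarrow> ('g::ab_group_add \<Rightarrow>\<^sub>0 'k)"
    and \<Gamma>0 :: "'h set" and \<gamma> :: "'h \<Rightarrow> 'h \<Rightarrow> 'k" and lam :: "'g \<Rightarrow> 'g \<Rightarrow> 'h"
    and \<omega> :: "'g \<Rightarrow> 'g \<Rightarrow> 'g \<Rightarrow> 'k" and t :: "'g \<Rightarrow> 'g \<Rightarrow> 'k"
  assumes "coquasitriangular_hopf H S r"
    and "hopf_map_to_galg H \<pi>" and "surj \<pi>" and "cocentral H \<pi>"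
    and "braided_zesting_datum H S r \<pi> \<Gamma>0 \<gamma> lam \<omega> t"
  shows "coquasi_hopf_algebra H (zest_mult H \<pi> lam) 1 (zest_assoc H \<pi> \<gamma> lam \<omega>) \<and>
    coquasitriangular H (zest_mult H \<pi> lam) 1 (zest_assoc H \<pi> \<gamma> lam \<omega>) (zest_rform H \<pi> r t) \<and>
    (\<forall>a b. \<forall>x\<in>hdeg H \<pi> a. \<forall>y\<in>hdeg H \<pi> b. zest_rform H \<pi> r t x y = t a b * r x y) \<and>
    braided_tensor_equivalent
      (comod_category H (zest_mult H \<pi> lam) 1 (zest_assoc H \<pi> \<gamma> lam \<omega>) (zest_rform H \<pi> r t)
        :: (('k, 'h, 'u) comod, ('k, 'h, 'u) carrow, 'k) bmcat)
      (zested_category H r \<pi> \<gamma> lam \<omega> t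
        :: (('k, 'h, 'u) comod, ('k, 'h, 'u) carrow, 'k) bmcat)"
proof -
  interpret zest H S \<pi> r \<Gamma>0 \<gamma> lam \<omega> t
    using assms by unfold_locales (auto simp: coquasitriangular_hopf_def)
  show ?thesis
    using coquasi_hopf_z coquasitriangular_z rz(2) equivalent_DD
    unfolding mz_def Oz_def rz_def by blast
qed

end
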